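(* Let $n\ge 0$. Convergence in distribution, denoted $\Rightarrow$, is as $N\to\infty$. 1. (Independent resampling coupled particle filter.) For any bounded measurable $\varphi:\mathsf{X}\to\mathbb{R}$, $$\sqrt N[\check\eta_n^{N,I}-\check\eta_n^I](\varphi\otimes 1-1\otimes\varphi)\Rightarrow\mathcal{N}(0,\sigma_n^{2,I}(\varphi)),\qquad \sigma_n^{2,I}(\varphi)=\sum_{p=0}^n\check\eta_p^I\big(\{D_{p,n}^f(\varphi)\otimes1-1\otimes D_{p,n}^c(\varphi)\}^2\big).$$ 2. (Maximally coupled resampling particle filter.) Assume that $G_n$ is bounded and continuous for every $n\geq 0$, that $\check M_n$ is Feller for every $n\ge1$, and that $\mathsf{X}\times\mathsf{X}$ is a locally compact and separable metric space. Then for any bounded continuous $\varphi:\mathsf{X}\to\mathbb{R}$, $$\sqrt N[\check\eta_n^{N,M}-\check\eta_n^M](\varphi\otimes 1-1\otimes\varphi)\Rightarrow\mathcal{N}(0,\sigma_n^{2,M}(\varphi)),\qquad \sigma_n^{2,M}(\varphi)=\sum_{p=0}^n\check\eta_p^M\big(\{D_{p,n}^f(\varphi)\otimes1-1\otimes D_{p,n}^c(\varphi)\}^2\big).$$ 3. (Maximal coupling particle filter.) Suppose that for $s\in\{f,c\}$ and every $n\ge1$ the density $M_n^s$ is a bounded measurable function on $\mathsf{X}\times\mathsf{X}$. Then for any bounded measurable $\varphi:\mathsf{X}\to\mathbb{R}$, $$\sqrt N[\check\eta_n^{N,C}-\check\eta_n^C](\varphi\otimes 1-1\otimes\varphi)\Rightarrow\mathcal{N}(0,\sigma_n^{2,C}(\varphi)),\qquad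 \sigma_n^{2,C}(\varphi)=\sum_{p=0}^n\check\eta_p^C\big(\{D_{p,n}^f(\varphi)\otimes1-1\otimes D_{p,n}^c(\varphi)\}^2\big).$$
   Context: **Model.** $(\mathsf{X},\mathcal{X})$ is a measurable space (Borel when topology is used; products carry product structures). For $n\ge0$, $G_n:\mathsf{X}\to\mathbb{R}_+$ is bounded and measurable. For $s\in\{f,c\}$, $\eta_0^s$ is a probability measure on $\mathsf{X}$ and $M_n^s$ ($n\ge1$) are Markov kernels on $\mathsf{X}$. Notation: $\mu(\varphi)=\int\varphi\,d\mu$, $K(\varphi)(x)=\int\varphi(y)K(x,dy)$, $(\varphi\otimes\psi)(x,y)=\varphi(x)\psi(y)$, $\wedge$ is minimum. Define $$\gamma_n^s(\varphi)=\int_{\mathsf{X}^{n+1}}\varphi(x_n)\Big(\prod_{p=0}^{n-1}G_p(x_p)\Big)\eta_0^s(dx_0)\prod_{p=1}^nM_p^s(x_{p-1},dx_p),\qquad\eta_n^s=\gamma_n^s/\gamma_n^s(1).$$ $\check\eta_0$ is a probability measure on $\mathsf{X}\times\mathsf{X}$ with marginals $\eta_0^f,\eta_0^c$; $\check M_n$ is a Markov kernel on $\mathsf{X}\times\mathsf{X}$ such that $\check M_n((x,x'),\cdot)$ has marginals $M_n^f(x,\cdot)$, $M_n^c(x',\cdot)$. Feller means mapping bounded continuous functions to bounded continuous functions. All normalizing constants occurring below are assumed (almost surely) strictly positive. **Semigroups.** $Q_n^s(x,dy)=G_{n-1}(x)M_n^s(x,dy)$, $Q_{p,n}^s=Q_{p+1}^s\cdots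 Q_n^s$ for $p<n$, $Q_{n,n}^s$ the identity. For $0\le p<n$, $D_{p,n}^s(\varphi)=\dfrac{Q_{p,n}^s(\varphi-\eta_n^s(\varphi))}{\eta_p^s(Q_{p,n}^s(1))}$, and $D_{n,n}^s(\varphi)=\varphi-\eta_n^s(\varphi)$. In all algorithms below, particles are $u_p^i=(x_p^{i,f},x_p^{i,c})\in\mathsf{X}\times\mathsf{X}$, $1\le i\le N$; $\eta_p^{N,s}=\frac1N\sum_i\delta_{x_p^{i,s}}$, and $\check\eta_p^{N,t}=\frac1N\sum_i\delta_{u_p^i}$ for algorithm $t\in\{I,M,C\}$. **(I) Independent resampling.** $\check\Phi_n^I(\mu)(B)=\mu([G_{n-1}\otimes G_{n-1}]\check M_n(B))/\mu(G_{n-1}\otimes G_{n-1})$. Limit: $\check\eta_0^I=\check\eta_0$, $\check\eta_n^I=\check\Phi_n^I(\eta_{n-1}^f\otimes\eta_{n-1}^c)$. Particles: $u_0^i$ i.i.d. from $\check\eta_0$; given the past, $u_p^i$ i.i.d. from $\check\Phi_p^I(\eta_{p-1}^{N,f}\otimes\eta_{p-1}^{N,c})$. **(M) Maximally coupled resampling.** For $\mu$ a probability on $\mathsf{X}\times\mathsf{X}$: $F_{n-1,\mu,f}(x,y)=G_{n-1}(x)/\mu(G_{n-1}\otimes1)$, $F_{n-1,\mu,c}(x,y)=G_{n-1}(y)/\mu(1\otimes G_{n-1})$, $\overline F_{n-1,\mu,s}=\frac{F_{n-1,\mu,s}-F_{n-1,\mu,f}\wedge F_{n-1,\mu,c}}{\mu(F_{n-1,\mu,s}-F_{n-1,\mu,f}\wedge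 F_{n-1,\mu,c})}$, $\bar M_n(B)((x,y),(u,w))=\check M_n(B)(x,w)$, $$\check\Phi_n^M(\mu)(B)=\mu(\{F_{n-1,\mu,f}\wedge F_{n-1,\mu,c}\}\check M_n(B))+(1-\mu(F_{n-1,\mu,f}\wedge F_{n-1,\mu,c}))(\mu\otimes\mu)(\{\overline F_{n-1,\mu,f}\otimes\overline F_{n-1,\mu,c}\}\bar M_n(B)),$$ the last summand being $0$ if $\mu(F_{n-1,\mu,f}\wedge F_{n-1,\mu,c})=1$. Limit: $\check\eta_0^M=\check\eta_0$, $\check\eta_n^M=\check\Phi_n^M(\check\eta_{n-1}^M)$. Particles: $u_0^i$ i.i.d. from $\check\eta_0$; given the past, $u_p^i$ i.i.d. from $\check\Phi_p^M(\check\eta_{p-1}^{N,M})$. **(C) Maximal coupling.** Here $M_n^s$ and $\eta_0^s$ have densities w.r.t. a $\sigma$-finite measure $dx$, denoted by the same symbols. For probabilities $\mu,\nu$ on $\mathsf{X}$: $F_{n-1,\mu,f}(x)=\mu(G_{n-1}M_n^f(\cdot,x))/\mu(G_{n-1})$, $F_{n-1,\nu,c}(x)=\nu(G_{n-1}M_n^c(\cdot,x))/\nu(G_{n-1})$, and $\check\Phi_n^C(\mu,\nu)$ is the maximal coupling of these two densities: $$\check\Phi_n^C(\mu,\nu)(B)=\int\mathbb{I}_B(u,u)m(u)du+\frac{1}{1-\int m(u)du}\int\mathbb{I}_B(x,y)(F_{n-1,\mu,f}(x)-m(x))(F_{n-1,\nu,c}(y)-m(y))dxdy,$$ $m=F_{n-1,\mu,f}\wedge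 F_{n-1,\nu,c}$ (second term $0$ if $\int m=1$). Limit: $\check\eta_0^C$ is the maximal coupling of $(\eta_0^f,\eta_0^c)$ (same formula), $\check\eta_n^C=\check\Phi_n^C(\eta_{n-1}^f,\eta_{n-1}^c)$. Particles: $u_0^i$ i.i.d. from $\check\eta_0^C$; given the past, $u_p^i$ i.i.d. from $\check\Phi_p^C(\eta_{p-1}^{N,f},\eta_{p-1}^{N,c})$. *)

theory Defs
  imports "HOL-Probability.Probability"
begin

datatype level = Fine | Coarse

primrec proj :: "level \<Rightarrow> 'a \<times> 'a \<Rightarrow> 'a" where
  "proj Fine = fst"
| "proj Coarse = snd"

text \<open>Potentials \<open>G n\<close> are indexed from 0, kernels \<open>M s n\<close> and \<open>Mc n\<close> from 1;
  the values at kernel index 0 are irrelevant.\<close>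

locale coupled_feynman_kac =
  fixes X :: "'a measure"
    and G :: "nat \<Rightarrow> 'a \<Rightarrow> real"
    and eta0 :: "level \<Rightarrow> 'a measure"
    and M :: "level \<Rightarrow> nat \<Rightarrow> 'a \<Rightarrow> 'a measure"
    and etac0 :: "('a \<times> 'a) measure"
    and Mc :: "nat \<Rightarrow> 'a \<times> 'a \<Rightarrow> ('a \<times> 'a) measure"
  assumes G_measurable: "\<And>n. G n \<in> borel_measurable X"
    and G_nonneg: "\<And>n x. x \<in> space X \<Longrightarrow> 0 \<le> G n x"
    and G_bounded: "\<And>n. bounded (G n ` space X)"
    and eta0_prob: "\<And>s. eta0 s \<in> space (prob_algebra X)"
    and M_kernel: "\<And>s n. n \<ge> 1 \<Longrightarrow> M s n \<in> X \<rightarrow>\<^sub>M prob_algebra X"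
    and etac0_prob: "etac0 \<in> space (prob_algebra (X \<Otimes>\<^sub>M X))"
    and etac0_marginal: "\<And>s. distr etac0 X (proj s) = eta0 s"
    and Mc_kernel: "\<And>n. n \<ge> 1 \<Longrightarrow> Mc n \<in> X \<Otimes>\<^sub>M X \<rightarrow>\<^sub>M prob_algebra (X \<Otimes>\<^sub>M X)"
    and Mc_marginal: "\<And>s n z. n \<ge> 1 \<Longrightarrow> z \<in> space (X \<Otimes>\<^sub>M X) \<Longrightarrow>
      distr (Mc n z) X (proj s) = M s n (proj s z)"

text \<open>\<open>path_law X eta0 M s n\<close> is the law of the Markov chain
  \<open>eta0 s (dx\<^sub>0) M s 1 (x\<^sub>0, dx\<^sub>1) \<dots> M s n (x\<^sub>n\<^sub>-\<^sub>1, dx\<^sub>n)\<close> on paths indexed by \<open>{..n}\<close>.\<close>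

primrec path_law ::
  "'a measure \<Rightarrow> (level \<Rightarrow> 'a measure) \<Rightarrow> (level \<Rightarrow> nat \<Rightarrow> 'a \<Rightarrow> 'a measure)
    \<Rightarrow> level \<Rightarrow> nat \<Rightarrow> (nat \<Rightarrow> 'a) measure" where
  "path_law X eta0 M s 0 = distr (eta0 s) (PiM {..0} (\<lambda>_. X)) (\<lambda>x. \<lambda>i\<in>{..0}. x)"
| "path_law X eta0 M s (Suc n) =
    path_law X eta0 M s n \<bind>
      (\<lambda>x. distr (M s (Suc n) (x n)) (PiM {..Suc n} (\<lambda>_. X)) (\<lambda>y. x(Suc n := y)))"

definition gamma ::
  "'a measure \<Rightarrow> (nat \<Rightarrow> 'a \<Rightarrow> real) \<Rightarrow> (level \<Rightarrow> 'a measure)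
    \<Rightarrow> (level \<Rightarrow> nat \<Rightarrow> 'a \<Rightarrow> 'a measure) \<Rightarrow> level \<Rightarrow> nat \<Rightarrow> 'a measure" where
  "gamma X G eta0 M s n =
    distr (density (path_law X eta0 M s n) (\<lambda>x. ennreal (\<Prod>p<n. G p (x p)))) X (\<lambda>x. x n)"

definition eta ::
  "'a measure \<Rightarrow> (nat \<Rightarrow> 'a \<Rightarrow> real) \<Rightarrow> (level \<Rightarrow> 'a measure)
    \<Rightarrow> (level \<Rightarrow> nat \<Rightarrow> 'a \<Rightarrow> 'a measure) \<Rightarrow> level \<Rightarrow> nat \<Rightarrow> 'a measure" where
  "eta X G eta0 M s n =
    scale_measure (1 / emeasure (gamma X G eta0 M s n) (space X)) (gamma X G eta0 M s n)"

definition Qop ::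
  "(nat \<Rightarrow> 'a \<Rightarrow> real) \<Rightarrow> (level \<Rightarrow> nat \<Rightarrow> 'a \<Rightarrow> 'a measure)
    \<Rightarrow> level \<Rightarrow> nat \<Rightarrow> ('a \<Rightarrow> real) \<Rightarrow> 'a \<Rightarrow> real" where
  "Qop G M s n \<phi> x = G (n - 1) x * (\<integral>y. \<phi> y \<partial>(M s n x))"

text \<open>The right fold is \<open>Q\<^sub>p\<^sub>+\<^sub>1 (\<dots> (Q\<^sub>n \<phi>))\<close>, and the identity for \<open>p = n\<close>.\<close>

definition Qsg ::
  "(nat \<Rightarrow> 'a \<Rightarrow> real) \<Rightarrow> (level \<Rightarrow> nat \<Rightarrow> 'a \<Rightarrow> 'a measure)
    \<Rightarrow> level \<Rightarrow> nat \<Rightarrow> nat \<Rightarrow> ('a \<Rightarrow> real) \<Rightarrow> 'a \<Rightarrow> real" where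
  "Qsg G M s p n \<phi> = foldr (Qop G M s) [Suc p..<Suc n] \<phi>"

definition Dop ::
  "'a measure \<Rightarrow> (nat \<Rightarrow> 'a \<Rightarrow> real) \<Rightarrow> (level \<Rightarrow> 'a measure)
    \<Rightarrow> (level \<Rightarrow> nat \<Rightarrow> 'a \<Rightarrow> 'a measure)
    \<Rightarrow> level \<Rightarrow> nat \<Rightarrow> nat \<Rightarrow> ('a \<Rightarrow> real) \<Rightarrow> 'a \<Rightarrow> real" where
  "Dop X G eta0 M s p n \<phi> x =
    (let \<psi> = (\<lambda>y. \<phi> y - (\<integral>u. \<phi> u \<partial>(eta X G eta0 M s n))) in
     if p = n then \<psi> x
     else Qsg G M s p n \<psi> x / (\<integral>u. Qsg G M s p n (\<lambda>_. 1) u \<partial>(eta X G eta0 M s p)))"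

text \<open>In the maps below \<open>g\<close> stands for the potential at time \<open>n - 1\<close> and \<open>K\<close> for the coupled
  kernel at time \<open>n\<close>.\<close>

definition Phi_I ::
  "'a measure \<Rightarrow> ('a \<Rightarrow> real) \<Rightarrow> ('a \<times> 'a \<Rightarrow> ('a \<times> 'a) measure)
    \<Rightarrow> ('a \<times> 'a) measure \<Rightarrow> ('a \<times> 'a) measure" where
  "Phi_I X g K \<mu> =
    measure_of (space (X \<Otimes>\<^sub>M X)) (sets (X \<Otimes>\<^sub>M X))
      (\<lambda>B. (\<integral>\<^sup>+z. ennreal (g (fst z) * g (snd z)) * emeasure (K z) B \<partial>\<mu>)
           / (\<integral>\<^sup>+z. ennreal (g (fst z) * g (snd z)) \<partial>\<mu>))"

definition FM :: "('a \<Rightarrow> real) \<Rightarrow> ('a \<times> 'a) measure \<Rightarrow> level \<Rightarrow> 'a \<times> 'a \<Rightarrow> real" where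
  "FM g \<mu> s z = g (proj s z) / (\<integral>w. g (proj s w) \<partial>\<mu>)"

definition FM_min :: "('a \<Rightarrow> real) \<Rightarrow> ('a \<times> 'a) measure \<Rightarrow> 'a \<times> 'a \<Rightarrow> real" where
  "FM_min g \<mu> z = min (FM g \<mu> Fine z) (FM g \<mu> Coarse z)"

definition FM_bar :: "('a \<Rightarrow> real) \<Rightarrow> ('a \<times> 'a) measure \<Rightarrow> level \<Rightarrow> 'a \<times> 'a \<Rightarrow> real" where
  "FM_bar g \<mu> s z = (FM g \<mu> s z - FM_min g \<mu> z) / (\<integral>w. FM g \<mu> s w - FM_min g \<mu> w \<partial>\<mu>)"

definition Phi_M ::
  "'a measure \<Rightarrow> ('a \<Rightarrow> real) \<Rightarrow> ('a \<times> 'a \<Rightarrow> ('a \<times> 'a) measure)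
    \<Rightarrow> ('a \<times> 'a) measure \<Rightarrow> ('a \<times> 'a) measure" where
  "Phi_M X g K \<mu> =
    measure_of (space (X \<Otimes>\<^sub>M X)) (sets (X \<Otimes>\<^sub>M X))
      (\<lambda>B. (\<integral>\<^sup>+z. ennreal (FM_min g \<mu> z) * emeasure (K z) B \<partial>\<mu>)
         + (if (\<integral>z. FM_min g \<mu> z \<partial>\<mu>) = 1 then 0
            else ennreal (1 - (\<integral>z. FM_min g \<mu> z \<partial>\<mu>)) *
              (\<integral>\<^sup>+(z, w). ennreal (FM_bar g \<mu> Fine z * FM_bar g \<mu> Coarse w)
                 * emeasure (K (fst z, snd w)) B \<partial>(\<mu> \<Otimes>\<^sub>M \<mu>))))"

text \<open>Maximal coupling of the probability densities \<open>f\<close> and \<open>h\<close> with respect to \<open>L\<close>.\<close>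

definition max_coupling :: "'a measure \<Rightarrow> ('a \<Rightarrow> real) \<Rightarrow> ('a \<Rightarrow> real) \<Rightarrow> ('a \<times> 'a) measure" where
  "max_coupling L f h =
    (let m = (\<lambda>u. min (f u) (h u)); c = (\<integral>u. m u \<partial>L) in
     measure_of (space (L \<Otimes>\<^sub>M L)) (sets (L \<Otimes>\<^sub>M L))
      (\<lambda>B. (\<integral>\<^sup>+u. indicator B (u, u) * ennreal (m u) \<partial>L)
         + (if c = 1 then 0
            else ennreal (1 / (1 - c)) *
              (\<integral>\<^sup>+(x, y). indicator B (x, y) * ennreal ((f x - m x) * (h y - m y))
                 \<partial>(L \<Otimes>\<^sub>M L)))))"

definition FC :: "('a \<Rightarrow> real) \<Rightarrow> ('a \<Rightarrow> 'a \<Rightarrow> real) \<Rightarrow> 'a measure \<Rightarrow> 'a \<Rightarrow> real" where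
  "FC g d \<mu> x = (\<integral>y. g y * d y x \<partial>\<mu>) / (\<integral>y. g y \<partial>\<mu>)"

definition Phi_C ::
  "'a measure \<Rightarrow> ('a \<Rightarrow> real) \<Rightarrow> (level \<Rightarrow> 'a \<Rightarrow> 'a \<Rightarrow> real)
    \<Rightarrow> (level \<Rightarrow> 'a measure) \<Rightarrow> ('a \<times> 'a) measure" where
  "Phi_C L g d \<mu> = max_coupling L (FC g (d Fine) (\<mu> Fine)) (FC g (d Coarse) (\<mu> Coarse))"

primrec limit_I ::
  "'a measure \<Rightarrow> (nat \<Rightarrow> 'a \<Rightarrow> real) \<Rightarrow> (level \<Rightarrow> 'a measure)
    \<Rightarrow> (level \<Rightarrow> nat \<Rightarrow> 'a \<Rightarrow> 'a measure) \<Rightarrow> ('a \<times> 'a) measure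
    \<Rightarrow> (nat \<Rightarrow> 'a \<times> 'a \<Rightarrow> ('a \<times> 'a) measure) \<Rightarrow> nat \<Rightarrow> ('a \<times> 'a) measure" where
  "limit_I X G eta0 M etac0 Mc 0 = etac0"
| "limit_I X G eta0 M etac0 Mc (Suc p) =
    Phi_I X (G p) (Mc (Suc p)) (eta X G eta0 M Fine p \<Otimes>\<^sub>M eta X G eta0 M Coarse p)"

primrec limit_M ::
  "'a measure \<Rightarrow> (nat \<Rightarrow> 'a \<Rightarrow> real) \<Rightarrow> ('a \<times> 'a) measure
    \<Rightarrow> (nat \<Rightarrow> 'a \<times> 'a \<Rightarrow> ('a \<times> 'a) measure) \<Rightarrow> nat \<Rightarrow> ('a \<times> 'a) measure" where
  "limit_M X G etac0 Mc 0 = etac0"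
| "limit_M X G etac0 Mc (Suc p) = Phi_M X (G p) (Mc (Suc p)) (limit_M X G etac0 Mc p)"

primrec limit_C ::
  "'a measure \<Rightarrow> (nat \<Rightarrow> 'a \<Rightarrow> real) \<Rightarrow> (level \<Rightarrow> 'a measure)
    \<Rightarrow> (level \<Rightarrow> nat \<Rightarrow> 'a \<Rightarrow> 'a measure) \<Rightarrow> 'a measure \<Rightarrow> (level \<Rightarrow> 'a \<Rightarrow> real)
    \<Rightarrow> (level \<Rightarrow> nat \<Rightarrow> 'a \<Rightarrow> 'a \<Rightarrow> real) \<Rightarrow> nat \<Rightarrow> ('a \<times> 'a) measure" where
  "limit_C X G eta0 M L d0 d 0 = max_coupling L (d0 Fine) (d0 Coarse)"
| "limit_C X G eta0 M L d0 d (Suc p) =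
    Phi_C L (G p) (\<lambda>s. d s (Suc p)) (\<lambda>s. eta X G eta0 M s p)"

text \<open>\<open>(1/N) \<Sum>\<^sub>1\<^sub>\<le>\<^sub>i\<^sub>\<le>\<^sub>N \<delta>\<^bsub>u i\<^esub>\<close> as a measure on the measurable space \<open>Y\<close>.\<close>

definition empirical :: "'b measure \<Rightarrow> nat \<Rightarrow> (nat \<Rightarrow> 'b) \<Rightarrow> 'b measure" where
  "empirical Y N u = distr (uniform_count_measure {1..N}) Y u"

definition past :: "'b measure \<Rightarrow> 'w measure \<Rightarrow> nat \<Rightarrow> (nat \<Rightarrow> nat \<Rightarrow> 'w \<Rightarrow> 'b) \<Rightarrow> nat \<Rightarrow> 'w measure"
  where
  "past Y \<Omega> N U p =
    sigma (space \<Omega>) {U q i -` A \<inter> space \<Omega> | q i A. q \<le> p \<and> i \<in> {1..N} \<and> A \<in> sets Y}"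

text \<open>A system of \<open>N\<close> particles \<open>U p i\<close> (time \<open>p\<close>, label \<open>i \<in> {1..N}\<close>): i.i.d. from \<open>init\<close> at
  time 0; given the particles up to time \<open>p\<close>, i.i.d. at time \<open>p + 1\<close> from \<open>step p u\<close>, where \<open>u\<close>
  is the configuration at time \<open>p\<close>.\<close>

definition particle_system ::
  "'b measure \<Rightarrow> 'b measure \<Rightarrow> (nat \<Rightarrow> (nat \<Rightarrow> 'b) \<Rightarrow> 'b measure)
    \<Rightarrow> 'w measure \<Rightarrow> nat \<Rightarrow> (nat \<Rightarrow> nat \<Rightarrow> 'w \<Rightarrow> 'b) \<Rightarrow> bool" where
  "particle_system Y init step \<Omega> N U \<longleftrightarrow>
    prob_space \<Omega> \<and>
    (\<forall>p. \<forall>i\<in>{1..N}. U p i \<in> \<Omega> \<rightarrow>\<^sub>M Y) \<and>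
    prob_space.indep_vars \<Omega> (\<lambda>_. Y) (U 0) {1..N} \<and>
    (\<forall>i\<in>{1..N}. distr \<Omega> Y (U 0 i) = init) \<and>
    (\<forall>p A. (\<forall>i\<in>{1..N}. A i \<in> sets Y) \<longrightarrow>
      (AE \<omega> in \<Omega>.
        real_cond_exp \<Omega> (past Y \<Omega> N U p)
          (\<lambda>\<omega>'. \<Prod>i\<in>{1..N}. indicator (A i) (U (Suc p) i \<omega>')) \<omega>
        = (\<Prod>i\<in>{1..N}. measure (step p (\<lambda>i. U p i \<omega>)) (A i))))"

definition particles_I ::
  "'a measure \<Rightarrow> (nat \<Rightarrow> 'a \<Rightarrow> real) \<Rightarrow> ('a \<times> 'a) measure
    \<Rightarrow> (nat \<Rightarrow> 'a \<times> 'a \<Rightarrow> ('a \<times> 'a) measure)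
    \<Rightarrow> 'w measure \<Rightarrow> nat \<Rightarrow> (nat \<Rightarrow> nat \<Rightarrow> 'w \<Rightarrow> 'a \<times> 'a) \<Rightarrow> bool" where
  "particles_I X G etac0 Mc \<Omega> N U \<longleftrightarrow>
    particle_system (X \<Otimes>\<^sub>M X) etac0
      (\<lambda>p u. Phi_I X (G p) (Mc (Suc p))
        (empirical X N (\<lambda>i. fst (u i)) \<Otimes>\<^sub>M empirical X N (\<lambda>i. snd (u i)))) \<Omega> N U"

definition particles_M ::
  "'a measure \<Rightarrow> (nat \<Rightarrow> 'a \<Rightarrow> real) \<Rightarrow> ('a \<times> 'a) measure
    \<Rightarrow> (nat \<Rightarrow> 'a \<times> 'a \<Rightarrow> ('a \<times> 'a) measure)
    \<Rightarrow> 'w measure \<Rightarrow> nat \<Rightarrow> (nat \<Rightarrow> nat \<Rightarrow> 'w \<Rightarrow> 'a \<times> 'a) \<Rightarrow> bool" where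
  "particles_M X G etac0 Mc \<Omega> N U \<longleftrightarrow>
    particle_system (X \<Otimes>\<^sub>M X) etac0
      (\<lambda>p u. Phi_M X (G p) (Mc (Suc p)) (empirical (X \<Otimes>\<^sub>M X) N u)) \<Omega> N U"

definition particles_C ::
  "'a measure \<Rightarrow> (nat \<Rightarrow> 'a \<Rightarrow> real) \<Rightarrow> 'a measure \<Rightarrow> (level \<Rightarrow> 'a \<Rightarrow> real)
    \<Rightarrow> (level \<Rightarrow> nat \<Rightarrow> 'a \<Rightarrow> 'a \<Rightarrow> real)
    \<Rightarrow> 'w measure \<Rightarrow> nat \<Rightarrow> (nat \<Rightarrow> nat \<Rightarrow> 'w \<Rightarrow> 'a \<times> 'a) \<Rightarrow> bool" where
  "particles_C X G L d0 d \<Omega> N U \<longleftrightarrow>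
    particle_system (X \<Otimes>\<^sub>M X) (max_coupling L (d0 Fine) (d0 Coarse))
      (\<lambda>p u. Phi_C L (G p) (\<lambda>s. d s (Suc p)) (\<lambda>s. empirical X N (\<lambda>i. proj s (u i)))) \<Omega> N U"

text \<open>Almost sure positivity of the normalising constants of the particle approximations:
  in all three algorithms they are the integrals below or products of them.\<close>

definition positive_weights ::
  "'a measure \<Rightarrow> (nat \<Rightarrow> 'a \<Rightarrow> real) \<Rightarrow> 'w measure \<Rightarrow> nat
    \<Rightarrow> (nat \<Rightarrow> nat \<Rightarrow> 'w \<Rightarrow> 'a \<times> 'a) \<Rightarrow> bool" where
  "positive_weights X G \<Omega> N U \<longleftrightarrow>
    (\<forall>s p. AE \<omega> in \<Omega>. 0 < (\<integral>x. G p x \<partial>(empirical X N (\<lambda>i. proj s (U p i \<omega>)))))"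

definition densities ::
  "'a measure \<Rightarrow> (level \<Rightarrow> 'a measure) \<Rightarrow> (level \<Rightarrow> nat \<Rightarrow> 'a \<Rightarrow> 'a measure) \<Rightarrow> 'a measure
    \<Rightarrow> (level \<Rightarrow> 'a \<Rightarrow> real) \<Rightarrow> (level \<Rightarrow> nat \<Rightarrow> 'a \<Rightarrow> 'a \<Rightarrow> real) \<Rightarrow> bool" where
  "densities X eta0 M L d0 d \<longleftrightarrow>
    sigma_finite_measure L \<and> sets L = sets X \<and>
    (\<forall>s. d0 s \<in> borel_measurable X \<and> (\<forall>x\<in>space X. 0 \<le> d0 s x) \<and>
      eta0 s = density L (\<lambda>x. ennreal (d0 s x))) \<and>
    (\<forall>s. \<forall>n\<ge>1. \<forall>x\<in>space X.
      d s n x \<in> borel_measurable X \<and> (\<forall>y\<in>space X. 0 \<le> d s n x y) \<and>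
      M s n x = density L (\<lambda>y. ennreal (d s n x y)))"

definition feller :: "'b topology \<Rightarrow> ('b \<Rightarrow> 'b measure) \<Rightarrow> bool" where
  "feller S K \<longleftrightarrow>
    (\<forall>\<psi>. continuous_map S euclideanreal \<psi> \<and> bounded (\<psi> ` topspace S) \<longrightarrow>
      continuous_map S euclideanreal (\<lambda>z. \<integral>w. \<psi> w \<partial>(K z)) \<and>
      bounded ((\<lambda>z. \<integral>w. \<psi> w \<partial>(K z)) ` topspace S))"

text \<open>Centred normal law with variance \<open>v \<ge> 0\<close>; for \<open>v = 0\<close> it is the point mass at 0.\<close>

definition centred_normal :: "real \<Rightarrow> real measure" where
  "centred_normal v = (if v = 0 then return borel 0 else density lborel (normal_density 0 (sqrt v)))"

definition asymp_variance ::
  "'a measure \<Rightarrow> (nat \<Rightarrow> 'a \<Rightarrow> real) \<Rightarrow> (level \<Rightarrow> 'a measure)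
    \<Rightarrow> (level \<Rightarrow> nat \<Rightarrow> 'a \<Rightarrow> 'a measure) \<Rightarrow> (nat \<Rightarrow> ('a \<times> 'a) measure)
    \<Rightarrow> nat \<Rightarrow> ('a \<Rightarrow> real) \<Rightarrow> real" where
  "asymp_variance X G eta0 M etac n \<phi> =
    (\<Sum>p=0..n. \<integral>z. (Dop X G eta0 M Fine p n \<phi> (fst z)
                    - Dop X G eta0 M Coarse p n \<phi> (snd z))\<^sup>2 \<partial>(etac p))"

definition scaled_error ::
  "'a measure \<Rightarrow> (nat \<Rightarrow> ('a \<times> 'a) measure) \<Rightarrow> nat \<Rightarrow> (nat \<Rightarrow> nat \<Rightarrow> 'w \<Rightarrow> 'a \<times> 'a)
    \<Rightarrow> nat \<Rightarrow> ('a \<Rightarrow> real) \<Rightarrow> 'w \<Rightarrow> real" where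
  "scaled_error X etac N U n \<phi> \<omega> =
    sqrt (real N) *
      ((\<integral>z. \<phi> (fst z) - \<phi> (snd z) \<partial>(empirical (X \<Otimes>\<^sub>M X) N (\<lambda>i. U n i \<omega>)))
       - (\<integral>z. \<phi> (fst z) - \<phi> (snd z) \<partial>(etac n)))"

end

theory Submission imports Defs begin

text \<open>
  In all three algorithms the configuration of the \<open>N\<close> particles is a Markov chain: given the
  configuration \<open>u\<close> at time \<open>p\<close>, the next one consists of \<open>N\<close> independent draws from a law
  \<open>K N p u\<close> on pairs. Its two marginals are the Boltzmann--Gibbs updates of the two empirical
  marginals of \<open>u\<close>, whatever the coupling. The central limit theorem is proved once for such chains,
  and an algorithm only has to supply one convergence statement about its coupling.

  The general theorem runs by induction on time through characteristic functions. Let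
  \<open>Z\<^sub>p(\<phi>, \<psi>)\<close> be \<open>sqrt N\<close> times the difference between the average of \<open>\<phi>(x) - \<psi>(y)\<close> over the
  particles \<open>(x, y)\<close> at time \<open>p\<close> and its limit. Given time \<open>p\<close>, the particles at time \<open>p + 1\<close> are
  i.i.d., so the conditional characteristic function of \<open>Z\<^sub>p\<^sub>+\<^sub>1(\<phi>, \<psi>)\<close> is Gaussian up to
  \<open>O(N\<^sup>-\<^sup>1\<^sup>/\<^sup>2)\<close> (\<open>iid_char_expansion\<close>), with a random mean and a random variance. The mean is a ratio
  of two empirical averages; both fluctuate by \<open>O(N\<^sup>-\<^sup>1\<^sup>/\<^sup>2)\<close>, so that replacing the random normalising
  constant by its limit costs only \<open>O(1/N)\<close> in mean (\<open>linearisation_error\<close>). Hence the mean equals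
  \<open>Z\<^sub>p(Q\<phi>, Q\<psi>)\<close> up to a negligible term, where \<open>Q\<close> is the linearised one-step operator \<open>Qt\<close>. The
  variance converges in mean to a constant (\<open>variance_L1\<close>). This gives
  \<open>E exp(i Z\<^sub>p\<^sub>+\<^sub>1(\<phi>, \<psi>)) = exp(-V/2) E exp(i Z\<^sub>p(Q\<phi>, Q\<psi>)) + o(1)\<close> (\<open>char_step\<close>). Iterating adds up the
  variances \<open>V\<close>, and the identity \<open>D\<^bsub>p,n+1\<^esub>(\<phi>) = D\<^bsub>p,n\<^esub>(Q\<phi>)\<close> (\<open>Dop_Suc\<close>) identifies the sum as the
  asserted asymptotic variance. Levy's continuity theorem concludes.

  The squares \<open>\<phi>\<^sup>2\<close>, \<open>\<psi>\<^sup>2\<close> in the conditional variance only see the marginals, for which the mean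
  square error is \<open>O(1/N)\<close> in every algorithm (\<open>avg_rate\<close>). The coupling enters through the mixed
  term alone, so what each algorithm must supply is that \<open>\<integral>\<phi> \<otimes> \<psi> dK\<close> converges in mean for
  bounded measurable \<open>\<phi>\<close>, \<open>\<psi>\<close> (assumption \<open>cross_conv\<close>).

  For independent resampling the integral is a ratio of averages of a function \<open>H\<close> over all pairs made
  of the fine coordinate of one particle and the coarse coordinate of another. On rectangles such an
  average factorises; rectangles are dense in \<open>L\<^sup>1\<close>, and the error of the approximation is controlled by
  a first moment bound, since two different particles are conditionally independent and the \<open>N\<close> diagonal
  pairs contribute \<open>O(1/N)\<close> (\<open>product_L1\<close>).

  For maximally coupled resampling the whole empirical measure on pairs converges, by induction on time
  (\<open>joint_L1\<close>): the random weights differ from the limiting ones by \<open>o(1)\<close> on average over the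
  particles, and with the limiting weights only averages over particles and over pairs of particles
  remain.

  For the maximal coupling of densities, the law of large numbers gives convergence of the random
  densities at each point, and Scheffe's lemma turns this into convergence in \<open>L\<^sup>1\<close> (\<open>ldist_L1\<close>), in
  which the maximal coupling is continuous. In the last two cases the part of the coupling off the
  diagonal carries a factor \<open>1/(1 - c)\<close>, with \<open>c\<close> the mass of the common part; it does not blow up as
  \<open>c\<close> tends to 1 because its numerator is \<open>O((1 - c)\<^sup>2)\<close> (\<open>remainder_quotient\<close>, \<open>L1_conv_remainder\<close>).
\<close>

section \<open>Bounded measurable functions and kernels\<close>

text \<open>Membership does not restrict the values of a function outside the space of the measure.\<close>

definition bm :: "'b measure \<Rightarrow> ('b \<Rightarrow> real) set" where
  "bm Y = {f \<in> borel_measurable Y. bounded (f ` space Y)}"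

lemma bm_iff: "f \<in> bm Y \<longleftrightarrow> f \<in> borel_measurable Y \<and> (\<exists>B. \<forall>x\<in>space Y. \<bar>f x\<bar> \<le> B)"
  by (auto simp: bm_def bounded_iff)

lemma bmI: "f \<in> borel_measurable Y \<Longrightarrow> (\<And>x. x \<in> space Y \<Longrightarrow> \<bar>f x\<bar> \<le> B) \<Longrightarrow> f \<in> bm Y"
  by (auto simp: bm_iff)

lemma bm_measurable[measurable_dest]: "f \<in> bm Y \<Longrightarrow> f \<in> borel_measurable Y"
  by (simp add: bm_iff)

lemma bmE:
  assumes "f \<in> bm Y"
  obtains B where "0 \<le> B" "\<And>x. x \<in> space Y \<Longrightarrow> \<bar>f x\<bar> \<le> B"
proof -
  from assms obtain B where "\<forall>x\<in>space Y. \<bar>f x\<bar> \<le> B" by (auto simp: bm_iff)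
  then show ?thesis by (intro that[of "max 0 B"]) force+
qed

lemma bm_const[simp, intro]: "(\<lambda>_. c) \<in> bm Y"
  by (rule bmI[where B="\<bar>c\<bar>"]) auto

lemma bm_add[intro]: assumes "f \<in> bm Y" "g \<in> bm Y" shows "(\<lambda>x. f x + g x) \<in> bm Y"
proof -
  note assms[measurable]
  obtain A where A: "\<And>x. x \<in> space Y \<Longrightarrow> \<bar>f x\<bar> \<le> A" using bmE[OF assms(1)] by blast
  obtain B where B: "\<And>x. x \<in> space Y \<Longrightarrow> \<bar>g x\<bar> \<le> B" using bmE[OF assms(2)] by blast
  show ?thesis by (rule bmI[where B="A + B"]) (measurable, use A B in force)
qed

lemma bm_mult[intro]: assumes "f \<in> bm Y" "g \<in> bm Y" shows "(\<lambda>x. f x * g x) \<in> bm Y"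
proof -
  note assms[measurable]
  obtain A where A: "0 \<le> A" "\<And>x. x \<in> space Y \<Longrightarrow> \<bar>f x\<bar> \<le> A" using bmE[OF assms(1)] by blast
  obtain B where B: "\<And>x. x \<in> space Y \<Longrightarrow> \<bar>g x\<bar> \<le> B" using bmE[OF assms(2)] by blast
  show ?thesis by (rule bmI[where B="A * B"]) (measurable, use A B in \<open>auto simp: abs_mult intro!: mult_mono\<close>)
qed

lemma bm_uminus[intro]: "f \<in> bm Y \<Longrightarrow> (\<lambda>x. - f x) \<in> bm Y"
  using bm_mult[of "\<lambda>_. -1" Y f] by simp

lemma bm_diff[intro]: "f \<in> bm Y \<Longrightarrow> g \<in> bm Y \<Longrightarrow> (\<lambda>x. f x - g x) \<in> bm Y"
  using bm_add[of f Y "\<lambda>x. - g x"] by auto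

lemma bm_divide[intro]: "f \<in> bm Y \<Longrightarrow> (\<lambda>x. f x / c) \<in> bm Y"
  using bm_mult[of f Y "\<lambda>_. 1 / c"] by simp

lemma bm_power[intro]: "f \<in> bm Y \<Longrightarrow> (\<lambda>x. (f x) ^ k) \<in> bm Y"
  by (induction k) auto

lemma bm_abs[intro]: assumes "f \<in> bm Y" shows "(\<lambda>x. \<bar>f x\<bar>) \<in> bm Y"
proof -
  note assms[measurable]
  obtain A where A: "0 \<le> A" "\<And>x. x \<in> space Y \<Longrightarrow> \<bar>f x\<bar> \<le> A" using bmE[OF assms(1)] by blast
  show ?thesis by (rule bmI[where B=A]) (measurable, use A in auto)
qed

lemma bm_min[intro]: "f \<in> bm Y \<Longrightarrow> g \<in> bm Y \<Longrightarrow> (\<lambda>x. min (f x) (g x)) \<in> bm Y"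
proof -
  assume a: "f \<in> bm Y" "g \<in> bm Y"
  then have "(\<lambda>x. (f x + g x - \<bar>f x - g x\<bar>) / 2) \<in> bm Y" by (intro bm_divide bm_diff bm_add bm_abs)
  moreover have "(\<lambda>x. (f x + g x - \<bar>f x - g x\<bar>) / 2) = (\<lambda>x. min (f x) (g x))"
    by (auto simp: min_def)
  ultimately show ?thesis by simp
qed

lemma bm_sum[intro]: "(\<And>i. i \<in> I \<Longrightarrow> f i \<in> bm Y) \<Longrightarrow> (\<lambda>x. \<Sum>i\<in>I. f i x) \<in> bm Y"
  by (induction I rule: infinite_finite_induct) auto

lemma bm_indicator[intro]: "A \<in> sets Y \<Longrightarrow> indicator A \<in> bm Y"
  by (rule bmI[where B=1]) (auto split: split_indicator)

lemma bm_compose: "g \<in> Z \<rightarrow>\<^sub>M Y \<Longrightarrow> f \<in> bm Y \<Longrightarrow> (\<lambda>x. f (g x)) \<in> bm Z"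
  using measurable_compose[of g Z Y f borel] measurable_space[of g Z Y] unfolding bm_iff by blast

lemma bm_cong_sets:
  assumes "sets Y = sets Z" shows "bm Y = bm Z"
  unfolding bm_def using measurable_cong_sets[OF assms refl, of "borel :: real measure"] sets_eq_imp_space_eq[OF assms] by simp

lemma prob_algebraD:
  assumes "\<mu> \<in> space (prob_algebra Y)"
  shows "prob_space \<mu>" "sets \<mu> = sets Y" "space \<mu> = space Y"
  using assms by (auto simp: space_prob_algebra dest: sets_eq_imp_space_eq)

lemma kernelD:
  assumes "k \<in> Z \<rightarrow>\<^sub>M prob_algebra Y" "z \<in> space Z"
  shows "prob_space (k z)" "sets (k z) = sets Y" "space (k z) = space Y"
  using prob_algebraD[OF measurable_space[OF assms]] by auto

lemma bm_integrable_finite: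
  assumes "finite_measure \<mu>" "sets \<mu> = sets Y" "f \<in> bm Y"
  shows "integrable \<mu> f"
proof -
  interpret finite_measure \<mu> by fact
  obtain B where "\<And>x. x \<in> space Y \<Longrightarrow> \<bar>f x\<bar> \<le> B" using bmE[OF assms(3)] by blast
  moreover have "f \<in> borel_measurable \<mu>" using assms by (simp add: bm_iff cong: measurable_cong_sets)
  ultimately show ?thesis
    using sets_eq_imp_space_eq[OF assms(2)] by (intro integrable_const_bound[where B=B]) auto
qed

lemma bm_integrable: "\<mu> \<in> space (prob_algebra Y) \<Longrightarrow> f \<in> bm Y \<Longrightarrow> integrable \<mu> f"
  using prob_algebraD[of \<mu> Y] by (intro bm_integrable_finite[where Y=Y] prob_space.axioms(1)) auto

lemma (in prob_space) abs_integral_le: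
  fixes f :: "'a \<Rightarrow> real"
  assumes "\<And>x. x \<in> space M \<Longrightarrow> \<bar>f x\<bar> \<le> B"
  shows "\<bar>\<integral>x. f x \<partial>M\<bar> \<le> B"
proof -
  have "0 \<le> B" using assms not_empty by (force intro: order_trans[OF abs_ge_zero])
  show ?thesis
  proof (cases "integrable M f")
    case True
    have "\<bar>\<integral>x. f x \<partial>M\<bar> \<le> (\<integral>x. \<bar>f x\<bar> \<partial>M)" by (rule integral_abs_bound)
    also have "\<dots> \<le> (\<integral>x. B \<partial>M)" using True assms by (intro integral_mono) auto
    finally show ?thesis by (simp add: prob_space)
  qed (use \<open>0 \<le> B\<close> in \<open>simp add: not_integrable_integral_eq\<close>)
qed

lemma bm_kernel:
  assumes k: "k \<in> Z \<rightarrow>\<^sub>M prob_algebra Y" and f: "f \<in> bm Y"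
  shows "(\<lambda>z. \<integral>y. f y \<partial>k z) \<in> bm Z"
proof -
  obtain B where B: "\<And>x. x \<in> space Y \<Longrightarrow> \<bar>f x\<bar> \<le> B" using bmE[OF f] by blast
  have "(\<lambda>z. \<integral>y. f y \<partial>k z) \<in> borel_measurable Z"
    using measurable_compose[OF measurable_prob_algebraD[OF k] integral_measurable_subprob_algebra[OF bm_measurable[OF f]]] .
  moreover have "\<bar>\<integral>y. f y \<partial>k z\<bar> \<le> B" if "z \<in> space Z" for z
    using kernelD[OF k that] B by (intro prob_space.abs_integral_le) auto
  ultimately show ?thesis by (intro bmI[where B=B]) auto
qed

lemma integral_bind_bm:
  assumes \<mu>: "\<mu> \<in> space (prob_algebra Z)" and k: "k \<in> Z \<rightarrow>\<^sub>M prob_algebra Y" and f: "f \<in> bm Y"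
  shows "(\<integral>y. f y \<partial>(\<mu> \<bind> k)) = (\<integral>z. \<integral>y. f y \<partial>k z \<partial>\<mu>)"
proof -
  obtain B where B: "\<And>x. x \<in> space Y \<Longrightarrow> \<bar>f x\<bar> \<le> B" using bmE[OF f] by blast
  have k': "k \<in> \<mu> \<rightarrow>\<^sub>M subprob_algebra Y"
    using measurable_prob_algebraD[OF k] measurable_cong_sets[OF prob_algebraD(2)[OF \<mu>] refl] by blast
  show ?thesis
  proof (rule integral_bind[OF _ _ k'])
    show "f \<in> borel_measurable Y" using f by (simp add: bm_iff)
    show "\<And>x. x \<in> space Y \<Longrightarrow> \<bar>f x\<bar> \<le> B" using B by simp
    show "finite_measure \<mu>" using prob_algebraD[OF \<mu>] by (auto intro: prob_space.axioms)
    show "AE x in \<mu>. emeasure (k x) (space (k x)) \<le> ennreal 1"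
      using prob_algebraD[OF \<mu>] prob_space.emeasure_space_1[OF kernelD(1)[OF k]] by (intro AE_I2) simp
  qed
qed

section \<open>Convergence in mean\<close>

text \<open>The bound is uniform in \<open>N\<close>, which makes the notion stable under products. The index \<open>0\<close> is left
  out, because averages over zero particles are quotients by zero.\<close>

definition L1_conv :: "(nat \<Rightarrow> 'u measure) \<Rightarrow> (nat \<Rightarrow> 'u \<Rightarrow> real) \<Rightarrow> real \<Rightarrow> bool" where
  "L1_conv P F c \<longleftrightarrow>
    (\<exists>B. \<forall>N\<ge>1. F N \<in> borel_measurable (P N) \<and> (\<forall>u\<in>space (P N). \<bar>F N u\<bar> \<le> B)) \<and>
    (\<lambda>N. \<integral>u. \<bar>F N u - c\<bar> \<partial>P N) \<longlonglongrightarrow> 0"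

lemma L1_convD:
  assumes "L1_conv P F c"
  shows L1_conv_bm: "N \<ge> 1 \<Longrightarrow> F N \<in> bm (P N)"
    and L1_conv_LIMSEQ: "(\<lambda>N. \<integral>u. \<bar>F N u - c\<bar> \<partial>P N) \<longlonglongrightarrow> 0"
    and L1_conv_bounded: "\<exists>B\<ge>0. \<forall>N\<ge>1. F N \<in> borel_measurable (P N) \<and> (\<forall>u\<in>space (P N). \<bar>F N u\<bar> \<le> B)"
proof -
  obtain B where B: "\<forall>N\<ge>1. F N \<in> borel_measurable (P N) \<and> (\<forall>u\<in>space (P N). \<bar>F N u\<bar> \<le> B)"
    using assms by (auto simp: L1_conv_def)
  then show "\<exists>B\<ge>0. \<forall>N\<ge>1. F N \<in> borel_measurable (P N) \<and> (\<forall>u\<in>space (P N). \<bar>F N u\<bar> \<le> B)"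
    by (intro exI[of _ "max 0 B"]) force
  show "N \<ge> 1 \<Longrightarrow> F N \<in> bm (P N)" using B by (auto simp: bm_iff)
  show "(\<lambda>N. \<integral>u. \<bar>F N u - c\<bar> \<partial>P N) \<longlonglongrightarrow> 0" using assms by (simp add: L1_conv_def)
qed

text \<open>Tested against a function bounded by \<open>B\<close>, the part of a maximal coupling off the diagonal gives
  \<open>v / (1 - c)\<close>, where \<open>v\<close> is an integral against the product of two weights of mass \<open>1 - c\<close> each; hence the
  square in the hypothesis.\<close>

lemma remainder_quotient:
  fixes c v B :: real
  assumes c: "c \<le> 1" and v: "\<bar>v\<bar> \<le> B * (1 - c)\<^sup>2"
  shows "(if c = 1 then 0 else v / (1 - c)) * (1 - c) = v \<and> \<bar>if c = 1 then 0 else v / (1 - c)\<bar> \<le> B * \<bar>1 - c\<bar>"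
proof (cases "c = 1")
  case True
  then show ?thesis using v by simp
next
  case False
  then have "0 < 1 - c" using c by simp
  then show ?thesis using False v by (simp add: divide_le_eq power2_eq_square mult.assoc)
qed

locale law_sequence =
  fixes P :: "nat \<Rightarrow> 'u measure"
  assumes prob: "N \<ge> 1 \<Longrightarrow> prob_space (P N)"
begin

lemma in_pa: "N \<ge> 1 \<Longrightarrow> P N \<in> space (prob_algebra (P N))"
  using prob by (simp add: space_prob_algebra)

lemma bm_int: "N \<ge> 1 \<Longrightarrow> f \<in> bm (P N) \<Longrightarrow> integrable (P N) f"
  using bm_integrable[OF in_pa] .

lemma L1_convI:
  assumes F: "\<And>N. N \<ge> 1 \<Longrightarrow> F N \<in> borel_measurable (P N)" "\<And>N u. N \<ge> 1 \<Longrightarrow> u \<in> space (P N) \<Longrightarrow> \<bar>F N u\<bar> \<le> B"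
    and e: "\<And>N. N \<ge> 1 \<Longrightarrow> (\<integral>u. \<bar>F N u - c\<bar> \<partial>P N) \<le> e N" "e \<longlonglongrightarrow> 0"
  shows "L1_conv P F c"
  unfolding L1_conv_def
proof
  show "\<exists>B. \<forall>N\<ge>1. F N \<in> borel_measurable (P N) \<and> (\<forall>u\<in>space (P N). \<bar>F N u\<bar> \<le> B)"
    using F by blast
  show "(\<lambda>N. \<integral>u. \<bar>F N u - c\<bar> \<partial>P N) \<longlonglongrightarrow> 0"
    by (rule tendsto_sandwich[OF _ _ tendsto_const e(2)])
       (use e(1) in \<open>auto intro!: eventually_sequentiallyI[of 1]\<close>)
qed

lemma L1_conv_const: "L1_conv P (\<lambda>N u. c) c"
  by (rule L1_convI[where B="\<bar>c\<bar>" and e="\<lambda>_. 0"]) auto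

lemma L1_conv_dominated:
  assumes F: "\<And>N. N \<ge> 1 \<Longrightarrow> F N \<in> borel_measurable (P N)" "\<And>N u. N \<ge> 1 \<Longrightarrow> u \<in> space (P N) \<Longrightarrow> \<bar>F N u\<bar> \<le> B"
    and H: "L1_conv P H 0"
    and le: "\<And>N. N \<ge> 1 \<Longrightarrow> AE u in P N. \<bar>F N u - c\<bar> \<le> H N u"
  shows "L1_conv P F c"
proof (rule L1_convI[OF F])
  show "(\<lambda>N. \<integral>u. \<bar>H N u - 0\<bar> \<partial>P N) \<longlonglongrightarrow> 0" using L1_conv_LIMSEQ[OF H] .
  fix N :: nat assume N: "N \<ge> 1"
  have F': "F N \<in> bm (P N)" using F N by (auto simp: bm_iff)
  show "(\<integral>u. \<bar>F N u - c\<bar> \<partial>P N) \<le> (\<integral>u. \<bar>H N u - 0\<bar> \<partial>P N)"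
    using le[OF N]
    by (intro integral_mono_AE bm_int[OF N] bm_abs bm_diff bm_const F' L1_conv_bm[OF H N]) auto
qed auto

lemma L1_conv_add:
  assumes F: "L1_conv P F a" and G: "L1_conv P G b"
  shows "L1_conv P (\<lambda>N u. F N u + G N u) (a + b)"
proof -
  obtain A where A: "\<forall>N\<ge>1. F N \<in> borel_measurable (P N) \<and> (\<forall>u\<in>space (P N). \<bar>F N u\<bar> \<le> A)"
    using L1_conv_bounded[OF F] by blast
  obtain B where B: "\<forall>N\<ge>1. G N \<in> borel_measurable (P N) \<and> (\<forall>u\<in>space (P N). \<bar>G N u\<bar> \<le> B)"
    using L1_conv_bounded[OF G] by blast
  show ?thesis
  proof (rule L1_convI)
    show "(\<lambda>N. (\<integral>u. \<bar>F N u - a\<bar> \<partial>P N) + (\<integral>u. \<bar>G N u - b\<bar> \<partial>P N)) \<longlonglongrightarrow> 0"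
      using tendsto_add[OF L1_conv_LIMSEQ[OF F] L1_conv_LIMSEQ[OF G]] by simp
    fix N :: nat assume N: "N \<ge> 1"
    show "(\<lambda>u. F N u + G N u) \<in> borel_measurable (P N)"
      by (intro bm_measurable bm_add L1_conv_bm[OF F N] L1_conv_bm[OF G N])
    show "\<bar>F N u + G N u\<bar> \<le> A + B" if "u \<in> space (P N)" for u
    proof -
      have "\<bar>F N u\<bar> \<le> A" "\<bar>G N u\<bar> \<le> B" using A B N that by blast+
      then show ?thesis by linarith
    qed
    have I: "integrable (P N) (\<lambda>u. \<bar>F N u - a\<bar>)" "integrable (P N) (\<lambda>u. \<bar>G N u - b\<bar>)"
      by (intro bm_int[OF N] bm_abs bm_diff bm_const L1_conv_bm[OF F N] L1_conv_bm[OF G N])+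
    have J: "integrable (P N) (\<lambda>u. \<bar>F N u + G N u - (a + b)\<bar>)"
      by (intro bm_int[OF N] bm_abs bm_diff bm_add bm_const L1_conv_bm[OF F N] L1_conv_bm[OF G N])
    have "(\<integral>u. \<bar>F N u + G N u - (a + b)\<bar> \<partial>P N) \<le> (\<integral>u. \<bar>F N u - a\<bar> + \<bar>G N u - b\<bar> \<partial>P N)"
      using I J by (intro integral_mono) auto
    then show "(\<integral>u. \<bar>F N u + G N u - (a + b)\<bar> \<partial>P N) \<le> (\<integral>u. \<bar>F N u - a\<bar> \<partial>P N) + (\<integral>u. \<bar>G N u - b\<bar> \<partial>P N)"
      using I by simp
  qed
qed

lemma L1_conv_abs0:
  assumes F: "L1_conv P F a" shows "L1_conv P (\<lambda>N u. \<bar>F N u - a\<bar>) 0"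
proof -
  obtain A where A: "\<forall>N\<ge>1. F N \<in> borel_measurable (P N) \<and> (\<forall>u\<in>space (P N). \<bar>F N u\<bar> \<le> A)"
    using L1_conv_bounded[OF F] by blast
  show ?thesis
  proof (rule L1_convI[where B="A + \<bar>a\<bar>", OF _ _ _ L1_conv_LIMSEQ[OF F]])
    fix N :: nat assume N: "N \<ge> 1"
    show "(\<lambda>u. \<bar>F N u - a\<bar>) \<in> borel_measurable (P N)" using A N by auto
    show "\<bar>\<bar>F N u - a\<bar>\<bar> \<le> A + \<bar>a\<bar>" if "u \<in> space (P N)" for u
    proof -
      have "\<bar>F N u\<bar> \<le> A" using A N that by blast
      then show ?thesis by linarith
    qed
  qed auto
qed

lemma L1_conv_cmult:
  assumes F: "L1_conv P F a"
  shows "L1_conv P (\<lambda>N u. k * F N u) (k * a)"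
proof -
  obtain A where A: "\<forall>N\<ge>1. F N \<in> borel_measurable (P N) \<and> (\<forall>u\<in>space (P N). \<bar>F N u\<bar> \<le> A)"
    using L1_conv_bounded[OF F] by blast
  show ?thesis
  proof (rule L1_convI[where B="\<bar>k\<bar> * A"])
    show "(\<lambda>N. \<bar>k\<bar> * (\<integral>u. \<bar>F N u - a\<bar> \<partial>P N)) \<longlonglongrightarrow> 0"
      using tendsto_mult_right[OF L1_conv_LIMSEQ[OF F], of "\<bar>k\<bar>"] by (simp add: tendsto_mult_right_zero L1_conv_LIMSEQ[OF F])
    fix N :: nat assume N: "N \<ge> 1"
    show "(\<lambda>u. k * F N u) \<in> borel_measurable (P N)" using A N by auto
    show "\<bar>k * F N u\<bar> \<le> \<bar>k\<bar> * A" if "u \<in> space (P N)" for u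
      using A N that by (auto simp: abs_mult intro!: mult_left_mono)
    show "(\<integral>u. \<bar>k * F N u - k * a\<bar> \<partial>P N) \<le> \<bar>k\<bar> * (\<integral>u. \<bar>F N u - a\<bar> \<partial>P N)"
      by (simp add: right_diff_distrib[symmetric] abs_mult)
  qed
qed

lemma L1_conv_diff:
  assumes F: "L1_conv P F a" and G: "L1_conv P G b"
  shows "L1_conv P (\<lambda>N u. F N u - G N u) (a - b)"
  using L1_conv_add[OF F L1_conv_cmult[OF G, of "-1"]] by simp

lemma L1_conv_abs_cmult0:
  assumes F: "L1_conv P F a"
  shows "L1_conv P (\<lambda>N u. k * \<bar>F N u - a\<bar>) 0"
  using L1_conv_cmult[OF L1_conv_abs0[OF F], of k] by simp

lemma L1_conv_abs_cmult0_add: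
  assumes F: "L1_conv P F a" and G: "L1_conv P G b"
  shows "L1_conv P (\<lambda>N u. k * \<bar>F N u - a\<bar> + l * \<bar>G N u - b\<bar>) 0"
  using L1_conv_add[OF L1_conv_abs_cmult0[OF F, of k] L1_conv_abs_cmult0[OF G, of l]] by simp

lemma L1_conv_mult:
  assumes F: "L1_conv P F a" and G: "L1_conv P G b"
  shows "L1_conv P (\<lambda>N u. F N u * G N u) (a * b)"
proof -
  obtain A where A: "0 \<le> A" "\<forall>N\<ge>1. F N \<in> borel_measurable (P N) \<and> (\<forall>u\<in>space (P N). \<bar>F N u\<bar> \<le> A)"
    using L1_conv_bounded[OF F] by blast
  obtain B where B: "0 \<le> B" "\<forall>N\<ge>1. G N \<in> borel_measurable (P N) \<and> (\<forall>u\<in>space (P N). \<bar>G N u\<bar> \<le> B)"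
    using L1_conv_bounded[OF G] by blast
  show ?thesis
  proof (rule L1_conv_dominated[where B="A * B", OF _ _ L1_conv_abs_cmult0_add[OF F G, of B "\<bar>a\<bar>"]])
    fix N :: nat assume N: "N \<ge> 1"
    show "(\<lambda>u. F N u * G N u) \<in> borel_measurable (P N)"
      by (intro bm_measurable bm_mult L1_conv_bm[OF F N] L1_conv_bm[OF G N])
    show "\<bar>F N u * G N u\<bar> \<le> A * B" if "u \<in> space (P N)" for u
      using A B N that by (auto simp: abs_mult intro!: mult_mono)
    show "AE u in P N. \<bar>F N u * G N u - a * b\<bar> \<le> B * \<bar>F N u - a\<bar> + \<bar>a\<bar> * \<bar>G N u - b\<bar>"
    proof (rule AE_I2)
      fix u assume u: "u \<in> space (P N)"
      have "F N u * G N u - a * b = G N u * (F N u - a) + a * (G N u - b)" by (simp add: algebra_simps)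
      then have "\<bar>F N u * G N u - a * b\<bar> \<le> \<bar>G N u\<bar> * \<bar>F N u - a\<bar> + \<bar>a\<bar> * \<bar>G N u - b\<bar>"
        by (metis abs_mult abs_triangle_ineq)
      also have "\<bar>G N u\<bar> * \<bar>F N u - a\<bar> \<le> B * \<bar>F N u - a\<bar>"
        using B N u by (intro mult_right_mono) auto
      finally show "\<bar>F N u * G N u - a * b\<bar> \<le> B * \<bar>F N u - a\<bar> + \<bar>a\<bar> * \<bar>G N u - b\<bar>" by simp
    qed
  qed
qed

text \<open>From \<open>(R - a/d) d = (A - a) - R (D - d)\<close>: it is enough that the ratio \<open>R\<close> itself is bounded, and the
  random denominator \<open>D\<close> need not stay away from zero.\<close>

lemma L1_conv_ratio:
  assumes A: "L1_conv P A a" and D: "L1_conv P D d" and d: "d \<noteq> 0"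
    and R: "\<And>N. N \<ge> 1 \<Longrightarrow> R N \<in> borel_measurable (P N)"
      "\<And>N u. N \<ge> 1 \<Longrightarrow> u \<in> space (P N) \<Longrightarrow> \<bar>R N u\<bar> \<le> B"
    and eq: "\<And>N. N \<ge> 1 \<Longrightarrow> AE u in P N. R N u * D N u = A N u"
  shows "L1_conv P R (a / d)"
proof (rule L1_conv_dominated[OF R L1_conv_abs_cmult0_add[OF A D, of "1 / \<bar>d\<bar>" "B / \<bar>d\<bar>"]])
  fix N :: nat assume N: "N \<ge> 1"
  show "AE u in P N. \<bar>R N u - a / d\<bar> \<le> 1 / \<bar>d\<bar> * \<bar>A N u - a\<bar> + B / \<bar>d\<bar> * \<bar>D N u - d\<bar>"
    using eq[OF N] AE_space
  proof eventually_elim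
    case (elim u)
    have "(R N u - a / d) * d = (A N u - a) - R N u * (D N u - d)"
      using elim d by (simp add: field_simps)
    then have "\<bar>R N u - a / d\<bar> * \<bar>d\<bar> \<le> \<bar>A N u - a\<bar> + \<bar>R N u\<bar> * \<bar>D N u - d\<bar>"
      by (metis abs_mult abs_triangle_ineq4)
    also have "\<dots> \<le> \<bar>A N u - a\<bar> + B * \<bar>D N u - d\<bar>"
      using R(2)[OF N elim(2)] by (intro add_mono mult_right_mono) auto
    finally show ?case using d by (simp add: field_simps)
  qed
qed auto

text \<open>For \<open>c = 1\<close> the quotient carries no information, and the bound by a multiple of \<open>1 - C\<close> forces the
  limit \<open>0\<close>; this is the convention for the second term of a maximal coupling.\<close>

lemma L1_conv_remainder:
  assumes A: "L1_conv P A a" and C: "L1_conv P C c"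
    and R: "\<And>N. N \<ge> 1 \<Longrightarrow> R N \<in> borel_measurable (P N)"
      "\<And>N u. N \<ge> 1 \<Longrightarrow> u \<in> space (P N) \<Longrightarrow> \<bar>R N u\<bar> \<le> B"
    and eq: "\<And>N. N \<ge> 1 \<Longrightarrow> AE u in P N. R N u * (1 - C N u) = A N u \<and> \<bar>R N u\<bar> \<le> B' * \<bar>1 - C N u\<bar>"
  shows "L1_conv P R (if c = 1 then 0 else a / (1 - c))"
proof (cases "c = 1")
  case True
  have "L1_conv P (\<lambda>N u. B' * \<bar>C N u - 1\<bar>) 0" using L1_conv_abs_cmult0[OF C] True by simp
  moreover have "AE u in P N. \<bar>R N u - 0\<bar> \<le> B' * \<bar>C N u - 1\<bar>" if "1 \<le> N" for N
    using eq[OF that] by eventually_elim (simp add: abs_minus_commute)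
  ultimately have "L1_conv P R 0"
    using R by (intro L1_conv_dominated[where H="\<lambda>N u. B' * \<bar>C N u - 1\<bar>" and F=R and B=B]) auto
  with True show ?thesis by simp
next
  case False
  have "L1_conv P R (a / (1 - c))"
  proof (rule L1_conv_ratio[OF A L1_conv_diff[OF L1_conv_const C] _ R])
    show "AE u in P N. R N u * (1 - C N u) = A N u" if "1 \<le> N" for N
      using eq[OF that] by eventually_elim simp
  qed (use False in auto)
  with False show ?thesis by simp
qed

lemma L1_conv_expectation:
  assumes "L1_conv P F c" shows "(\<lambda>N. \<integral>u. F N u \<partial>P N) \<longlonglongrightarrow> c"
proof -
  have "(\<lambda>N. (\<integral>u. F N u \<partial>P N) - c) \<longlonglongrightarrow> 0"
  proof (rule Lim_null_comparison[OF _ L1_conv_LIMSEQ[OF assms]])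
    show "\<forall>\<^sub>F N in sequentially. norm ((\<integral>u. F N u \<partial>P N) - c) \<le> (\<integral>u. \<bar>F N u - c\<bar> \<partial>P N)"
    proof (rule eventually_sequentiallyI[of 1])
      fix N :: nat assume N: "1 \<le> N"
      interpret prob_space "P N" using prob N .
      have "(\<integral>u. F N u \<partial>P N) - c = (\<integral>u. F N u - c \<partial>P N)"
        using bm_int[OF N L1_conv_bm[OF assms N]] by (simp add: prob_space)
      then show "norm ((\<integral>u. F N u \<partial>P N) - c) \<le> (\<integral>u. \<bar>F N u - c\<bar> \<partial>P N)"
        using integral_abs_bound[of "P N" "\<lambda>u. F N u - c"] by simp
    qed
  qed
  then show ?thesis by (simp add: LIM_zero_iff)
qed

text \<open>The approximating sequence only has to be close in first moment and asymptotically. The majorant \<open>H\<close> of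
  the error may depend on \<open>N\<close> and need not converge; an upper bound for its mean suffices.\<close>

lemma L1_conv_approx:
  assumes F: "\<And>N. N \<ge> 1 \<Longrightarrow> F N \<in> borel_measurable (P N)" "\<And>N u. N \<ge> 1 \<Longrightarrow> u \<in> space (P N) \<Longrightarrow> \<bar>F N u\<bar> \<le> B"
    and ap: "\<And>e. e > 0 \<Longrightarrow> \<exists>F' c' H E h. L1_conv P F' c' \<and> \<bar>c' - c\<bar> \<le> e \<and>
       (\<forall>N\<ge>1. H N \<in> bm (P N) \<and> (\<integral>u. H N u \<partial>P N) \<le> E N \<and> (\<forall>u\<in>space (P N). \<bar>F N u - F' N u\<bar> \<le> H N u))
       \<and> E \<longlonglongrightarrow> h \<and> h \<le> e"
  shows "L1_conv P F c"
proof (rule L1_convI[OF F order_refl])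
  show "(\<lambda>N. \<integral>u. \<bar>F N u - c\<bar> \<partial>P N) \<longlonglongrightarrow> 0"
  proof (rule LIMSEQ_I)
    fix r :: real assume r: "0 < r"
    (* Four terms of at most r/5 each: the approximating sequence against its limit, this limit against c, the bound E N against h, and h itself. *)
    then have "r / 5 > 0" by simp
    from ap[OF this] obtain F' c' H E h where *: "L1_conv P F' c'" "\<bar>c' - c\<bar> \<le> r/5"
       "\<forall>N\<ge>1. H N \<in> bm (P N) \<and> (\<integral>u. H N u \<partial>P N) \<le> E N \<and> (\<forall>u\<in>space (P N). \<bar>F N u - F' N u\<bar> \<le> H N u)"
       "E \<longlonglongrightarrow> h" "h \<le> r/5"
      by (elim exE conjE) (rule that)
    from LIMSEQ_D[OF L1_conv_LIMSEQ[OF *(1)], of "r/5"] r obtain n1 where n1: "\<And>N. N \<ge> n1 \<Longrightarrow> (\<integral>u. \<bar>F' N u - c'\<bar> \<partial>P N) < r/5"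
      by auto
    from LIMSEQ_D[OF *(4), of "r/5"] r obtain n2 where n2: "\<And>N. N \<ge> n2 \<Longrightarrow> \<bar>E N - h\<bar> < r/5"
      by auto
    show "\<exists>no. \<forall>N\<ge>no. norm ((\<integral>u. \<bar>F N u - c\<bar> \<partial>P N) - 0) < r"
    proof (intro exI allI impI)
      fix N assume "N \<ge> max 1 (max n1 n2)"
      then have N: "N \<ge> 1" "N \<ge> n1" "N \<ge> n2" by auto
      interpret prob_space "P N" using prob N by simp
      have F': "F N \<in> bm (P N)" using F N by (auto simp: bm_iff)
      have HN: "H N \<in> bm (P N)" "(\<integral>u. H N u \<partial>P N) \<le> E N" using *(3) N by auto
      have I: "integrable (P N) (\<lambda>u. \<bar>F N u - c\<bar>)" "integrable (P N) (\<lambda>u. \<bar>F' N u - c'\<bar>)" "integrable (P N) (H N)"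
        by (intro bm_int[OF N(1)] bm_abs bm_diff bm_const L1_conv_bm[OF *(1) N(1)] HN(1) F')+
      have "(\<integral>u. \<bar>F N u - c\<bar> \<partial>P N) \<le> (\<integral>u. (\<bar>F' N u - c'\<bar> + H N u) + r/5 \<partial>P N)"
      proof (rule integral_mono[OF I(1)])
        show "integrable (P N) (\<lambda>u. \<bar>F' N u - c'\<bar> + H N u + r / 5)" using I by auto
        fix u assume "u \<in> space (P N)"
        then have "\<bar>F N u - F' N u\<bar> \<le> H N u" using * N by auto
        then show "\<bar>F N u - c\<bar> \<le> \<bar>F' N u - c'\<bar> + H N u + r / 5" using * by linarith
      qed
      also have "\<dots> = (\<integral>u. \<bar>F' N u - c'\<bar> \<partial>P N) + (\<integral>u. H N u \<partial>P N) + r/5"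
        using I by (simp add: prob_space)
      also have "\<dots> < r" using n1[OF N(2)] n2[OF N(3)] HN(2) *(5) r by linarith
      finally show "norm ((\<integral>u. \<bar>F N u - c\<bar> \<partial>P N) - 0) < r" by simp
    qed
  qed
qed auto

lemma L1_conv_cong:
  assumes "\<And>N u. N \<ge> 1 \<Longrightarrow> u \<in> space (P N) \<Longrightarrow> F N u = G N u"
  shows "L1_conv P F c \<longleftrightarrow> L1_conv P G c"
proof -
  have *: "L1_conv P F c" if G: "L1_conv P G c" and eq: "\<And>N u. N \<ge> 1 \<Longrightarrow> u \<in> space (P N) \<Longrightarrow> F N u = G N u" for F G
  proof -
    obtain B where B: "\<forall>N\<ge>1. G N \<in> borel_measurable (P N) \<and> (\<forall>u\<in>space (P N). \<bar>G N u\<bar> \<le> B)"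
      using L1_conv_bounded[OF G] by blast
    show ?thesis
      by (rule L1_conv_dominated[where B=B, OF _ _ L1_conv_abs0[OF G]])
         (use B eq in \<open>auto simp: measurable_cong[OF eq]\<close>)
  qed
  from *[of G F] *[of F G] assms show ?thesis by auto
qed

lemma L1_conv_L2:
  assumes F: "\<And>N. N \<ge> 1 \<Longrightarrow> F N \<in> borel_measurable (P N)" "\<And>N u. N \<ge> 1 \<Longrightarrow> u \<in> space (P N) \<Longrightarrow> \<bar>F N u\<bar> \<le> B"
    and sq: "\<And>N. N \<ge> 1 \<Longrightarrow> (\<integral>u. (F N u - c)\<^sup>2 \<partial>P N) \<le> e N" and e: "e \<longlonglongrightarrow> 0"
  shows "L1_conv P F c"
proof (rule L1_convI[OF F, where e="\<lambda>N. sqrt (e N)"])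
  show "(\<lambda>N. sqrt (e N)) \<longlonglongrightarrow> 0"
    using tendsto_real_sqrt[OF e] by simp
  fix N :: nat assume N: "N \<ge> 1"
  interpret prob_space "P N" using prob N by simp
  have F': "F N \<in> bm (P N)" using F N by (auto simp: bm_iff)
  have I: "integrable (P N) (\<lambda>u. \<bar>F N u - c\<bar>)" "integrable (P N) (\<lambda>u. (F N u - c)\<^sup>2)"
    by (intro bm_int[OF N] bm_abs bm_diff bm_power bm_const F')+
  have "(\<integral>u. \<bar>F N u - c\<bar> \<partial>P N)\<^sup>2 \<le> (\<integral>u. (F N u - c)\<^sup>2 \<partial>P N)"
    using variance_eq[of "\<lambda>u. \<bar>F N u - c\<bar>"] I variance_positive[of "\<lambda>u. \<bar>F N u - c\<bar>"] by auto
  also have "\<dots> \<le> e N" by (rule sq[OF N])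
  finally show "(\<integral>u. \<bar>F N u - c\<bar> \<partial>P N) \<le> sqrt (e N)" by (rule real_le_rsqrt)
qed auto

end

section \<open>Empirical averages\<close>

definition conf :: "nat \<Rightarrow> 'b measure \<Rightarrow> (nat \<Rightarrow> 'b) measure" where
  "conf N Y = PiM {1..N} (\<lambda>_. Y)"

definition avg :: "nat \<Rightarrow> ('b \<Rightarrow> real) \<Rightarrow> (nat \<Rightarrow> 'b) \<Rightarrow> real" where
  "avg N h u = (\<Sum>i\<in>{1..N}. h (u i)) / real N"

text \<open>The average over all ordered pairs of particles, the diagonal included.\<close>

definition avg2 :: "nat \<Rightarrow> ('b \<times> 'b \<Rightarrow> real) \<Rightarrow> (nat \<Rightarrow> 'b) \<Rightarrow> real" where
  "avg2 N H u = avg N (\<lambda>z. avg N (\<lambda>w. H (z, w)) u) u"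

lemma conf_component: "i \<in> {1..N} \<Longrightarrow> (\<lambda>u. u i) \<in> conf N Y \<rightarrow>\<^sub>M Y"
  unfolding conf_def by (rule measurable_component_singleton)

lemma conf_space: "u \<in> space (conf N Y) \<Longrightarrow> i \<in> {1..N} \<Longrightarrow> u i \<in> space Y"
  using measurable_space[OF conf_component] .

lemma avg_abs_le:
  assumes "u \<in> space (conf N Y)" "\<And>x. x \<in> space Y \<Longrightarrow> \<bar>h x\<bar> \<le> B" "0 \<le> B"
  shows "\<bar>avg N h u\<bar> \<le> B"
proof (cases "N = 0")
  case False
  have "\<bar>\<Sum>i\<in>{1..N}. h (u i)\<bar> \<le> (\<Sum>i\<in>{1..N}. B)"
    using assms conf_space[OF assms(1)] by (intro order_trans[OF sum_abs] sum_mono) auto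
  then show ?thesis using False by (simp add: avg_def field_simps)
qed (use assms in \<open>simp add: avg_def\<close>)

lemma avg_mono:
  assumes "u \<in> space (conf N Y)" "\<And>x. x \<in> space Y \<Longrightarrow> h x \<le> h' x"
  shows "avg N h u \<le> avg N h' u"
  unfolding avg_def using assms conf_space[OF assms(1)] by (intro divide_right_mono sum_mono) auto

lemma avg_nonneg:
  assumes "u \<in> space (conf N Y)" "\<And>x. x \<in> space Y \<Longrightarrow> 0 \<le> h x"
  shows "0 \<le> avg N h u"
  unfolding avg_def using assms conf_space[OF assms(1)] by (intro divide_nonneg_nonneg sum_nonneg) auto

lemma avg_cong:
  assumes "u \<in> space (conf N Y)" "\<And>x. x \<in> space Y \<Longrightarrow> h x = h' x"
  shows "avg N h u = avg N h' u"
  unfolding avg_def using assms conf_space[OF assms(1)] by (intro arg_cong2[where f="(/)"] sum.cong) auto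

lemma avg_add: "avg N (\<lambda>x. h x + h' x) u = avg N h u + avg N h' u"
  by (simp add: avg_def sum.distrib add_divide_distrib)

lemma avg_diff: "avg N (\<lambda>x. h x - h' x) u = avg N h u - avg N h' u"
  by (simp add: avg_def sum_subtractf diff_divide_distrib)

lemma avg_cmult: "avg N (\<lambda>x. c * h x) u = c * avg N h u"
  by (simp add: avg_def sum_distrib_left)

lemma avg_multc: "avg N (\<lambda>x. h x * c) u = avg N h u * c"
  by (simp add: avg_def sum_distrib_right)

lemma avg_divc: "avg N (\<lambda>x. h x / c) u = avg N h u / c"
  by (simp add: avg_def sum_divide_distrib mult.commute)

lemma avg_const: "N \<ge> 1 \<Longrightarrow> avg N (\<lambda>_. c) u = c"
  by (simp add: avg_def)

lemma avg_abs: "\<bar>avg N h u\<bar> \<le> avg N (\<lambda>x. \<bar>h x\<bar>) u"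
  unfolding avg_def by (simp add: abs_divide divide_right_mono)

lemma avg_bm:
  assumes "h \<in> bm Y" shows "avg N h \<in> bm (conf N Y)"
proof -
  have "(\<lambda>u. h (u i)) \<in> bm (conf N Y)" if "i \<in> {1..N}" for i
    using conf_component[OF that] assms by (rule bm_compose)
  then show ?thesis unfolding avg_def[abs_def] by (intro bm_divide bm_sum) auto
qed

lemma avg2_bm:
  assumes "H \<in> bm (Y \<Otimes>\<^sub>M Y)" shows "avg2 N H \<in> bm (conf N Y)"
proof -
  have "(\<lambda>u. H (u i, u j)) \<in> bm (conf N Y)" if "i \<in> {1..N}" "j \<in> {1..N}" for i j
    using conf_component[OF that(1)] conf_component[OF that(2)] by (intro bm_compose[OF _ assms]) measurable
  then show ?thesis unfolding avg2_def[abs_def] avg_def[abs_def] by (intro bm_divide bm_sum) auto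
qed

lemma avg2_mono:
  assumes "u \<in> space (conf N Y)" "\<And>x. x \<in> space (Y \<Otimes>\<^sub>M Y) \<Longrightarrow> H x \<le> H' x"
  shows "avg2 N H u \<le> avg2 N H' u"
  unfolding avg2_def using assms by (intro avg_mono[OF assms(1)]) (auto simp: space_pair_measure)

lemma avg2_abs_le:
  assumes "u \<in> space (conf N Y)" "\<And>x. x \<in> space (Y \<Otimes>\<^sub>M Y) \<Longrightarrow> \<bar>H x\<bar> \<le> B" "0 \<le> B"
  shows "\<bar>avg2 N H u\<bar> \<le> B"
  unfolding avg2_def using assms by (intro avg_abs_le[OF assms(1)]) (auto simp: space_pair_measure)

lemma avg2_add: "avg2 N (\<lambda>x. H x + H' x) u = avg2 N H u + avg2 N H' u"
  by (simp add: avg2_def avg_add)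

lemma avg2_diff: "avg2 N (\<lambda>x. H x - H' x) u = avg2 N H u - avg2 N H' u"
  by (simp add: avg2_def avg_diff)

lemma avg2_cmult: "avg2 N (\<lambda>x. c * H x) u = c * avg2 N H u"
  by (simp add: avg2_def avg_cmult)

lemma avg2_abs: "\<bar>avg2 N H u\<bar> \<le> avg2 N (\<lambda>x. \<bar>H x\<bar>) u"
proof -
  have "\<bar>avg2 N H u\<bar> \<le> avg N (\<lambda>z. \<bar>avg N (\<lambda>w. H (z, w)) u\<bar>) u" unfolding avg2_def by (rule avg_abs)
  also have "\<dots> \<le> avg2 N (\<lambda>x. \<bar>H x\<bar>) u"
    unfolding avg2_def avg_def by (intro divide_right_mono sum_mono) (simp_all add: abs_divide divide_right_mono)
  finally show ?thesis .
qed

lemma avg2_tensor: "avg2 N (\<lambda>x. a (fst x) * b (snd x)) u = avg N a u * avg N b u"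
  by (simp add: avg2_def avg_cmult avg_multc)

lemma empirical_prob:
  assumes N: "N \<ge> 1" and u: "\<And>i. i \<in> {1..N} \<Longrightarrow> u i \<in> space Y"
  shows "empirical Y N u \<in> space (prob_algebra Y)"
proof -
  interpret prob_space "uniform_count_measure {1..N}"
    using N by (intro prob_space_uniform_count_measure) auto
  have "u \<in> uniform_count_measure {1..N} \<rightarrow>\<^sub>M Y"
    using u by (auto simp: uniform_count_measure_def measurable_def space_point_measure sets_point_measure)
  then have "prob_space (empirical Y N u)" unfolding empirical_def by (rule prob_space_distr)
  then show ?thesis by (simp add: space_prob_algebra empirical_def)
qed

lemma integral_empirical:
  assumes u: "\<And>i. i \<in> {1..N} \<Longrightarrow> u i \<in> space Y" and f: "f \<in> borel_measurable Y"
  shows "(\<integral>x. f x \<partial>empirical Y N u) = avg N f u"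
proof -
  have "u \<in> uniform_count_measure {1..N} \<rightarrow>\<^sub>M Y"
    using u by (auto simp: uniform_count_measure_def measurable_def space_point_measure sets_point_measure)
  then have "(\<integral>x. f x \<partial>empirical Y N u) = (\<integral>i. f (u i) \<partial>uniform_count_measure {1..N})"
    unfolding empirical_def using f by (rule integral_distr)
  also have "\<dots> = avg N f u"
    by (simp add: integral_uniform_count_measure avg_def)
  finally show ?thesis .
qed

section \<open>Independent samples\<close>

lemma PiM_prob_algebra:
  assumes "\<nu> \<in> space (prob_algebra Y)"
  shows "PiM {1..N} (\<lambda>_. \<nu>) \<in> space (prob_algebra (conf N Y))"
  unfolding conf_def space_prob_algebra using prob_algebraD[OF assms]
  by (auto intro!: prob_space_PiM sets_PiM_cong)

lemma PiM_kernel: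
  assumes k: "k \<in> Z \<rightarrow>\<^sub>M prob_algebra Y"
  shows "(\<lambda>z. PiM {1..N} (\<lambda>_. k z)) \<in> Z \<rightarrow>\<^sub>M prob_algebra (conf N Y)"
proof (rule measurable_prob_algebra_generated[OF _ Int_stable_prod_algebra prod_algebra_sets_into_space])
  show "sets (conf N Y) = sigma_sets (\<Pi>\<^sub>E i\<in>{1..N}. space Y) (prod_algebra {1..N} (\<lambda>_. Y))"
    unfolding conf_def by (rule sets_PiM)
  show "prob_space (PiM {1..N} (\<lambda>_. k z))" "sets (PiM {1..N} (\<lambda>_. k z)) = sets (conf N Y)" if "z \<in> space Z" for z
    using PiM_prob_algebra[OF measurable_space[OF k that], of N] by (auto simp: space_prob_algebra)
  fix A assume "A \<in> prod_algebra {1..N} (\<lambda>_. Y)"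
  then obtain E where A: "A = Pi\<^sub>E {1..N} E" "\<And>i. i \<in> {1..N} \<Longrightarrow> E i \<in> sets Y"
    using that by (auto simp: prod_algebra_eq_finite Pi_iff)
  have "emeasure (PiM {1..N} (\<lambda>_. k z)) A = (\<Prod>i\<in>{1..N}. emeasure (k z) (E i))" if "z \<in> space Z" for z
  proof -
    interpret kz: prob_space "k z" using kernelD[OF k that] by simp
    interpret product_sigma_finite "\<lambda>_. k z" ..
    show ?thesis using A kernelD[OF k that] by (subst A(1), intro emeasure_PiM) auto
  qed
  moreover have "(\<lambda>z. \<Prod>i\<in>{1..N}. emeasure (k z) (E i)) \<in> borel_measurable Z"
    using A measurable_compose[OF measurable_prob_algebraD[OF k] measurable_emeasure_subprob_algebra]
    by (intro borel_measurable_prod_ennreal) auto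
  ultimately show "(\<lambda>z. emeasure (PiM {1..N} (\<lambda>_. k z)) A) \<in> borel_measurable Z"
    by (simp cong: measurable_cong)
qed

context
  fixes \<nu> :: "'b measure" and Y and N :: nat
  assumes \<nu>: "\<nu> \<in> space (prob_algebra Y)" and N: "N \<ge> 1"
begin

interpretation nu: prob_space \<nu> using prob_algebraD[OF \<nu>] by simp
interpretation PP: product_prob_space "\<lambda>_. \<nu>" "{1..N}" ..
interpretation NN: pair_prob_space \<nu> \<nu> ..

lemma iid_pair_law:
  assumes ij: "i \<in> {1..N}" "j \<in> {1..N}" "i \<noteq> j"
  shows "distr (PiM {1..N} (\<lambda>_. \<nu>)) (\<nu> \<Otimes>\<^sub>M \<nu>) (\<lambda>v. (v i, v j)) = \<nu> \<Otimes>\<^sub>M \<nu>"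
proof (rule pair_measure_eqI[symmetric])
  have m: "(\<lambda>v. (v i, v j)) \<in> PiM {1..N} (\<lambda>_. \<nu>) \<rightarrow>\<^sub>M \<nu> \<Otimes>\<^sub>M \<nu>"
    using ij by measurable
  fix A B assume AB: "A \<in> sets \<nu>" "B \<in> sets \<nu>"
  let ?C = "\<lambda>k. if k = i then A else B"
  have "emeasure (distr (PiM {1..N} (\<lambda>_. \<nu>)) (\<nu> \<Otimes>\<^sub>M \<nu>) (\<lambda>v. (v i, v j))) (A \<times> B)
      = emeasure (PiM {1..N} (\<lambda>_. \<nu>)) {v \<in> space (PiM {1..N} (\<lambda>_. \<nu>)). \<forall>k\<in>{i, j}. v k \<in> ?C k}"
    using AB ij by (subst emeasure_distr[OF m]) (auto intro!: arg_cong[where f="emeasure _"])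
  also have "\<dots> = (\<Prod>k\<in>{i, j}. emeasure \<nu> (?C k))"
    using ij AB by (intro PP.emeasure_PiM_Collect) auto
  also have "\<dots> = emeasure \<nu> A * emeasure \<nu> B"
    using ij by simp
  finally show "emeasure \<nu> A * emeasure \<nu> B =
      emeasure (distr (PiM {1..N} (\<lambda>_. \<nu>)) (\<nu> \<Otimes>\<^sub>M \<nu>) (\<lambda>v. (v i, v j))) (A \<times> B)" by simp
qed (auto intro: nu.sigma_finite_measure_axioms)

lemma sets_nn: "sets (\<nu> \<Otimes>\<^sub>M \<nu>) = sets (Y \<Otimes>\<^sub>M Y)"
  using prob_algebraD[OF \<nu>] by (intro sets_pair_measure_cong) auto

lemma nn_prob: "\<nu> \<Otimes>\<^sub>M \<nu> \<in> space (prob_algebra (Y \<Otimes>\<^sub>M Y))"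
  using sets_nn NN.prob_space_axioms by (simp add: space_prob_algebra)

lemma iid_pair:
  assumes ij: "i \<in> {1..N}" "j \<in> {1..N}" "i \<noteq> j" and H: "H \<in> bm (Y \<Otimes>\<^sub>M Y)"
  shows "(\<integral>v. H (v i, v j) \<partial>PiM {1..N} (\<lambda>_. \<nu>)) = (\<integral>z. H z \<partial>(\<nu> \<Otimes>\<^sub>M \<nu>))"
proof -
  have "(\<lambda>v. (v i, v j)) \<in> PiM {1..N} (\<lambda>_. \<nu>) \<rightarrow>\<^sub>M \<nu> \<Otimes>\<^sub>M \<nu>"
    using ij by measurable
  moreover have "H \<in> borel_measurable (\<nu> \<Otimes>\<^sub>M \<nu>)"
    using H measurable_cong_sets[OF sets_nn refl, of "borel::real measure"] by (simp add: bm_iff)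
  ultimately show ?thesis
    using integral_distr[of "\<lambda>v. (v i, v j)" "PiM {1..N} (\<lambda>_. \<nu>)" "\<nu> \<Otimes>\<^sub>M \<nu>" H]
    unfolding iid_pair_law[OF ij] by simp
qed

lemma iid_single:
  assumes i: "i \<in> {1..N}" and h: "h \<in> bm Y"
  shows "(\<integral>v. h (v i) \<partial>PiM {1..N} (\<lambda>_. \<nu>)) = (\<integral>z. h z \<partial>\<nu>)"
proof -
  have "h \<in> borel_measurable \<nu>"
    using h measurable_cong_sets[OF prob_algebraD(2)[OF \<nu>] refl, of "borel::real measure"] by (simp add: bm_iff)
  then show ?thesis
    using integral_distr[OF measurable_component_singleton[OF i, of "\<lambda>_. \<nu>"], of h]
    unfolding PP.PiM_component[OF i] by simp
qed

lemma iid_integrable: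
  "F \<in> bm (conf N Y) \<Longrightarrow> integrable (PiM {1..N} (\<lambda>_. \<nu>)) F"
  using bm_integrable[OF PiM_prob_algebra[OF \<nu>]] .

lemma iid_avg:
  assumes h: "h \<in> bm Y"
  shows "(\<integral>v. avg N h v \<partial>PiM {1..N} (\<lambda>_. \<nu>)) = (\<integral>z. h z \<partial>\<nu>)"
proof -
  have "integrable (PiM {1..N} (\<lambda>_. \<nu>)) (\<lambda>v. h (v i))" if "i \<in> {1..N}" for i
    using that by (intro iid_integrable bm_compose[OF conf_component h])
  then show ?thesis using N h by (simp add: avg_def iid_single del: One_nat_def)
qed

lemma PiM_total: "measure (PiM {1..N} (\<lambda>_. \<nu>)) (space (PiM {1..N} (\<lambda>_. \<nu>))) = 1"
  using prob_space.prob_space[OF prob_algebraD(1)[OF PiM_prob_algebra[OF \<nu>]]] .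

lemma integral_double_sum:
  fixes f :: "nat \<Rightarrow> nat \<Rightarrow> (nat \<Rightarrow> 'b) \<Rightarrow> real"
  assumes "\<And>i j. i \<in> {1..N} \<Longrightarrow> j \<in> {1..N} \<Longrightarrow> integrable (PiM {1..N} (\<lambda>_. \<nu>)) (f i j)"
  shows "(\<integral>v. (\<Sum>i\<in>{1..N}. \<Sum>j\<in>{1..N}. f i j v) \<partial>PiM {1..N} (\<lambda>_. \<nu>))
    = (\<Sum>i\<in>{1..N}. \<Sum>j\<in>{1..N}. \<integral>v. f i j v \<partial>PiM {1..N} (\<lambda>_. \<nu>))"
proof -
  have "(\<integral>v. (\<Sum>i\<in>{1..N}. \<Sum>j\<in>{1..N}. f i j v) \<partial>PiM {1..N} (\<lambda>_. \<nu>))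
    = (\<Sum>i\<in>{1..N}. \<integral>v. (\<Sum>j\<in>{1..N}. f i j v) \<partial>PiM {1..N} (\<lambda>_. \<nu>))"
    using assms by (intro Bochner_Integration.integral_sum Bochner_Integration.integrable_sum)
  also have "\<dots> = (\<Sum>i\<in>{1..N}. \<Sum>j\<in>{1..N}. \<integral>v. f i j v \<partial>PiM {1..N} (\<lambda>_. \<nu>))"
    using assms by (intro sum.cong refl Bochner_Integration.integral_sum)
  finally show ?thesis .
qed

text \<open>Bias and variance: the variance of the average of \<open>N\<close> independent terms bounded by \<open>B\<close> is at most
  \<open>B\<^sup>2/N\<close>.\<close>

lemma iid_square:
  assumes h: "h \<in> bm Y" and B: "\<And>x. x \<in> space Y \<Longrightarrow> \<bar>h x\<bar> \<le> B"
  shows "(\<integral>v. (avg N h v - a)\<^sup>2 \<partial>PiM {1..N} (\<lambda>_. \<nu>)) \<le> B\<^sup>2 / N + ((\<integral>z. h z \<partial>\<nu>) - a)\<^sup>2"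
proof -
  let ?P = "PiM {1..N} (\<lambda>_. \<nu>)"
  define m where "m = (\<integral>z. h z \<partial>\<nu>)"
  define g where "g z = h z - m" for z
  have g: "g \<in> bm Y" unfolding g_def[abs_def] using h by auto
  have int_h: "integrable \<nu> h" using bm_integrable[OF \<nu> h] .
  have int_h2: "integrable \<nu> (\<lambda>z. (h z)\<^sup>2)" using h by (intro bm_integrable[OF \<nu>] bm_power)
  have g0: "(\<integral>z. g z \<partial>\<nu>) = 0" using int_h by (simp add: g_def m_def nu.prob_space)
  have B0: "0 \<le> B" using nu.not_empty prob_algebraD(3)[OF \<nu>] B by (force intro: order_trans[OF abs_ge_zero])
  have g2: "(\<integral>z. (g z)\<^sup>2 \<partial>\<nu>) \<le> B\<^sup>2"
  proof -
    have "(\<integral>z. (g z)\<^sup>2 \<partial>\<nu>) = (\<integral>z. (h z)\<^sup>2 \<partial>\<nu>) - m\<^sup>2"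
      unfolding g_def m_def by (rule nu.variance_eq[OF int_h int_h2])
    also have "\<dots> \<le> (\<integral>z. (h z)\<^sup>2 \<partial>\<nu>)" by simp
    also have "\<dots> \<le> B\<^sup>2"
      using nu.abs_integral_le[of "\<lambda>z. (h z)\<^sup>2" "B\<^sup>2"] B prob_algebraD(3)[OF \<nu>] B0
      by (force simp: power2_le_iff_abs_le)
    finally show ?thesis .
  qed
  have gg: "(\<lambda>z. g (fst z) * g (snd z)) \<in> bm (Y \<Otimes>\<^sub>M Y)"
    by (intro bm_mult bm_compose[OF measurable_fst g] bm_compose[OF measurable_snd g])
  have "(\<integral>z. g (fst z) * g (snd z) \<partial>(\<nu> \<Otimes>\<^sub>M \<nu>)) = (\<integral>x. \<integral>y. g x * g y \<partial>\<nu> \<partial>\<nu>)"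
    using NN.integral_fst'[OF bm_integrable[OF nn_prob gg]] by simp
  also have "\<dots> = 0" by (simp add: g0)
  finally have gg0: "(\<integral>z. g (fst z) * g (snd z) \<partial>(\<nu> \<Otimes>\<^sub>M \<nu>)) = 0" .
  have int_ij: "integrable ?P (\<lambda>v. g (v i) * g (v j))" if "i \<in> {1..N}" "j \<in> {1..N}" for i j
    using that by (intro iid_integrable bm_mult bm_compose[OF conf_component g])
  have E_ij: "(\<integral>v. g (v i) * g (v j) \<partial>?P) = (if i = j then (\<integral>z. (g z)\<^sup>2 \<partial>\<nu>) else 0)"
    if "i \<in> {1..N}" "j \<in> {1..N}" for i j
  proof (cases "i = j")
    case True
    have "(\<lambda>z. (g z)\<^sup>2) \<in> bm Y" using g by auto
    from iid_single[OF that(1) this] True show ?thesis by (simp add: power2_eq_square)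
  next
    case False
    from iid_pair[OF that False gg] False gg0 show ?thesis by simp
  qed
  have avg_g: "avg N g v = avg N h v - m" for v
    unfolding g_def using N by (simp add: avg_diff avg_const)
  have "(\<integral>v. (avg N g v)\<^sup>2 \<partial>?P) = (\<integral>v. (\<Sum>i\<in>{1..N}. \<Sum>j\<in>{1..N}. g (v i) * g (v j)) / (real N)\<^sup>2 \<partial>?P)"
    by (simp add: avg_def power2_eq_square sum_product)
  also have "\<dots> = (\<Sum>i\<in>{1..N}. \<Sum>j\<in>{1..N}. (\<integral>v. g (v i) * g (v j) \<partial>?P)) / (real N)\<^sup>2"
    using integral_double_sum[of "\<lambda>i j v. g (v i) * g (v j)"] int_ij by (simp del: One_nat_def)
  also have "\<dots> = (\<Sum>i\<in>{1..N}. \<Sum>j\<in>{1..N}. (if i = j then (\<integral>z. (g z)\<^sup>2 \<partial>\<nu>) else 0)) / (real N)\<^sup>2"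
    using E_ij by (intro arg_cong2[where f="(/)"] sum.cong) auto
  also have "\<dots> = (real N * (\<integral>z. (g z)\<^sup>2 \<partial>\<nu>)) / (real N)\<^sup>2"
    by simp
  also have "\<dots> \<le> B\<^sup>2 / N" using N g2 by (simp add: field_simps power2_eq_square)
  finally have var: "(\<integral>v. (avg N g v)\<^sup>2 \<partial>?P) \<le> B\<^sup>2 / N" .
  have i1: "integrable ?P (\<lambda>v. (avg N g v)\<^sup>2)" using g by (intro iid_integrable bm_power avg_bm)
  have i2: "integrable ?P (avg N g)" using g by (intro iid_integrable avg_bm)
  have "(\<integral>v. (avg N h v - a)\<^sup>2 \<partial>?P) = (\<integral>v. (avg N g v)\<^sup>2 + (2 * (m - a)) * avg N g v + (m - a)\<^sup>2 \<partial>?P)"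
    unfolding avg_g by (intro arg_cong[where f="integral\<^sup>L _"] ext) (simp add: power2_eq_square algebra_simps)
  also have "\<dots> = (\<integral>v. (avg N g v)\<^sup>2 \<partial>?P) + (2 * (m - a)) * (\<integral>v. avg N g v \<partial>?P) + (m - a)\<^sup>2"
    using i1 i2 by (simp add: PiM_total del: One_nat_def)
  also have "\<dots> \<le> B\<^sup>2 / N + (m - a)\<^sup>2"
    using var iid_avg[OF g] g0 by (simp del: One_nat_def)
  finally show ?thesis by (simp add: m_def)
qed

text \<open>The pairs of distinct particles have the exact mean, and the \<open>N\<close> diagonal pairs among \<open>N\<^sup>2\<close> contribute
  at most \<open>B/N\<close>.\<close>

lemma iid_avg2_le:
  assumes H: "H \<in> bm (Y \<Otimes>\<^sub>M Y)" and B: "\<And>x. x \<in> space (Y \<Otimes>\<^sub>M Y) \<Longrightarrow> 0 \<le> H x \<and> H x \<le> B"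
  shows "(\<integral>v. avg2 N H v \<partial>PiM {1..N} (\<lambda>_. \<nu>)) \<le> (\<integral>z. H z \<partial>(\<nu> \<Otimes>\<^sub>M \<nu>)) + B / N"
proof -
  let ?P = "PiM {1..N} (\<lambda>_. \<nu>)"
  define \<theta> where "\<theta> = (\<integral>z. H z \<partial>(\<nu> \<Otimes>\<^sub>M \<nu>))"
  have \<theta>: "0 \<le> \<theta>" unfolding \<theta>_def using B sets_eq_imp_space_eq[OF sets_nn] by (intro integral_nonneg_AE AE_I2) auto
  have bH: "(\<lambda>u. H (u i, u j)) \<in> bm (conf N Y)" if "i \<in> {1..N}" "j \<in> {1..N}" for i j
    using conf_component[OF that(1)] conf_component[OF that(2)] by (intro bm_compose[OF _ H]) measurable
  have I: "integrable ?P (\<lambda>v. H (v i, v j))" if "i \<in> {1..N}" "j \<in> {1..N}" for i j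
    using bH[OF that] by (rule iid_integrable)
  have sp: "space ?P = space (conf N Y)" using prob_algebraD[OF PiM_prob_algebra[OF \<nu>]] by simp
  have E: "(\<integral>v. H (v i, v j) \<partial>?P) \<le> \<theta> + (if i = j then B else 0)" if "i \<in> {1..N}" "j \<in> {1..N}" for i j
  proof (cases "i = j")
    case True
    have "(\<integral>v. H (v i, v j) \<partial>?P) \<le> (\<integral>v. B \<partial>?P)"
      using conf_space[of _ N Y] that sp B
      by (intro integral_mono I iid_integrable[OF bm_const]) (auto simp: space_pair_measure)
    then show ?thesis using True \<theta> by (simp add: PiM_total del: One_nat_def)
  next
    case False
    then show ?thesis using iid_pair[OF that False H] by (simp add: \<theta>_def)
  qed
  have "(\<integral>v. avg2 N H v \<partial>?P) = (\<Sum>i\<in>{1..N}. \<Sum>j\<in>{1..N}. (\<integral>v. H (v i, v j) \<partial>?P)) / (real N)\<^sup>2"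
    using integral_double_sum[of "\<lambda>i j v. H (v i, v j)"] I
    by (simp add: avg2_def avg_def power2_eq_square sum_divide_distrib[symmetric] del: One_nat_def)
  also have "\<dots> \<le> (\<Sum>i\<in>{1..N}. \<Sum>j\<in>{1..N}. \<theta> + (if i = j then B else 0)) / (real N)\<^sup>2"
    using E by (intro divide_right_mono sum_mono) auto
  also have "\<dots> = (real N * (real N * \<theta>) + real N * B) / (real N)\<^sup>2"
    by (simp add: sum.distrib distrib_left)
  also have "\<dots> = \<theta> + B / N" using N by (simp add: field_simps power2_eq_square)
  finally show ?thesis by (simp add: \<theta>_def)
qed

lemma iid_char:
  assumes h: "h \<in> bm Y"
  shows "(CLINT v|PiM {1..N} (\<lambda>_. \<nu>). iexp (\<Sum>i\<in>{1..N}. h (v i))) = (CLINT z|\<nu>. iexp (h z)) ^ N"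
proof -
  have hm: "h \<in> borel_measurable \<nu>"
    using h measurable_cong_sets[OF prob_algebraD(2)[OF \<nu>] refl, of "borel::real measure"] by (simp add: bm_iff)
  then have "integrable \<nu> (\<lambda>z. iexp (h z))" by (intro nu.integrable_iexp) auto
  then have "(CLINT v|PiM {1..N} (\<lambda>_. \<nu>). (\<Prod>i\<in>{1..N}. iexp (h (v i)))) = (\<Prod>i\<in>{1..N}. CLINT z|\<nu>. iexp (h z))"
    by (intro PP.product_integral_prod) auto
  then show ?thesis by (simp add: exp_sum[symmetric] sum_distrib_left del: exp_sum)
qed

end

section \<open>Approximation by rectangles\<close>

inductive_set rect_span :: "'a measure \<Rightarrow> ('a \<times> 'a \<Rightarrow> real) set" for X where
  rect: "A \<in> sets X \<Longrightarrow> B \<in> sets X \<Longrightarrow> (\<lambda>z. c * (indicator A (fst z) * indicator B (snd z))) \<in> rect_span X"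
| add: "S \<in> rect_span X \<Longrightarrow> T \<in> rect_span X \<Longrightarrow> (\<lambda>z. S z + T z) \<in> rect_span X"

lemma rect_span_bm: "T \<in> rect_span X \<Longrightarrow> T \<in> bm (X \<Otimes>\<^sub>M X)"
proof (induction rule: rect_span.induct)
  case (rect A B c)
  then show ?case
    by (intro bm_mult bm_const bm_compose[OF measurable_fst bm_indicator] bm_compose[OF measurable_snd bm_indicator])
qed auto

lemma rect_span_scale: "T \<in> rect_span X \<Longrightarrow> (\<lambda>z. k * T z) \<in> rect_span X"
proof (induction rule: rect_span.induct)
  case (rect A B c)
  from rect_span.rect[OF this, of "k * c"] show ?case by (simp add: mult.assoc)
next
  case (add S T)
  from rect_span.add[OF add.IH] show ?case by (simp add: algebra_simps)
qed

definition approximable :: "'a measure \<Rightarrow> ('a \<times> 'a) measure \<Rightarrow> ('a \<times> 'a \<Rightarrow> real) \<Rightarrow> bool" where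
  "approximable X \<tau> H \<longleftrightarrow> (\<forall>e>0. \<exists>T\<in>rect_span X. (\<integral>z. \<bar>H z - T z\<bar> \<partial>\<tau>) < e)"

context
  fixes \<tau> :: "('a \<times> 'a) measure" and X
  assumes fin: "finite_measure \<tau>" and st: "sets \<tau> = sets (X \<Otimes>\<^sub>M X)"
begin

interpretation finite_measure \<tau> by (rule fin)

lemma rect_span_int: "T \<in> rect_span X \<Longrightarrow> integrable \<tau> T"
  using bm_integrable_finite[OF fin st rect_span_bm] .

lemma approximable_close:
  assumes H: "integrable \<tau> H" and c: "\<And>e. e > 0 \<Longrightarrow> \<exists>H'. integrable \<tau> H' \<and> approximable X \<tau> H' \<and> (\<integral>z. \<bar>H z - H' z\<bar> \<partial>\<tau>) < e"
  shows "approximable X \<tau> H"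
  unfolding approximable_def
proof (intro allI impI)
  fix e :: real assume "e > 0"
  then have e: "e / 2 > 0" by simp
  from c[OF e] obtain H' where H': "integrable \<tau> H'" "approximable X \<tau> H'" "(\<integral>z. \<bar>H z - H' z\<bar> \<partial>\<tau>) < e/2" by blast
  then obtain T where T: "T \<in> rect_span X" "(\<integral>z. \<bar>H' z - T z\<bar> \<partial>\<tau>) < e/2"
    using e unfolding approximable_def by blast
  have "(\<integral>z. \<bar>H z - T z\<bar> \<partial>\<tau>) \<le> (\<integral>z. \<bar>H z - H' z\<bar> + \<bar>H' z - T z\<bar> \<partial>\<tau>)"
    using H H'(1) rect_span_int[OF T(1)] by (intro integral_mono) auto
  also have "\<dots> < e" using H H' rect_span_int[OF T(1)] T by simp
  finally show "\<exists>T\<in>rect_span X. (\<integral>z. \<bar>H z - T z\<bar> \<partial>\<tau>) < e" using T by blast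
qed

lemma approximable_add:
  assumes "integrable \<tau> H" "integrable \<tau> H'" "approximable X \<tau> H" "approximable X \<tau> H'"
  shows "approximable X \<tau> (\<lambda>z. H z + H' z)"
  unfolding approximable_def
proof (intro allI impI)
  fix e :: real assume "e > 0"
  then have e: "e / 2 > 0" by simp
  obtain T where T: "T \<in> rect_span X" "(\<integral>z. \<bar>H z - T z\<bar> \<partial>\<tau>) < e/2"
    using e assms unfolding approximable_def by blast
  obtain T' where T': "T' \<in> rect_span X" "(\<integral>z. \<bar>H' z - T' z\<bar> \<partial>\<tau>) < e/2"
    using e assms unfolding approximable_def by blast
  have "(\<integral>z. \<bar>H z + H' z - (T z + T' z)\<bar> \<partial>\<tau>) \<le> (\<integral>z. \<bar>H z - T z\<bar> + \<bar>H' z - T' z\<bar> \<partial>\<tau>)"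
    using assms rect_span_int[OF T(1)] rect_span_int[OF T'(1)] by (intro integral_mono) auto
  also have "\<dots> < e" using assms rect_span_int[OF T(1)] rect_span_int[OF T'(1)] T T' by simp
  finally show "\<exists>T\<in>rect_span X. (\<integral>z. \<bar>H z + H' z - T z\<bar> \<partial>\<tau>) < e"
    using rect_span.add[OF T(1) T'(1)] by (intro bexI[of _ "\<lambda>z. T z + T' z"])
qed

lemma approximable_scale:
  assumes "integrable \<tau> H" "approximable X \<tau> H"
  shows "approximable X \<tau> (\<lambda>z. k * H z)"
  unfolding approximable_def
proof (intro allI impI)
  fix e :: real assume e: "e > 0"
  then have "e / (\<bar>k\<bar> + 1) > 0" by simp
  then obtain T where T: "T \<in> rect_span X" "(\<integral>z. \<bar>H z - T z\<bar> \<partial>\<tau>) < e / (\<bar>k\<bar> + 1)"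
    using assms unfolding approximable_def by blast
  have "(\<integral>z. \<bar>k * H z - k * T z\<bar> \<partial>\<tau>) = \<bar>k\<bar> * (\<integral>z. \<bar>H z - T z\<bar> \<partial>\<tau>)"
    by (simp add: right_diff_distrib[symmetric] abs_mult)
  also have "\<dots> \<le> (\<bar>k\<bar> + 1) * (\<integral>z. \<bar>H z - T z\<bar> \<partial>\<tau>)"
    by (intro mult_right_mono) auto
  also have "\<dots> < e" using T by (simp add: field_simps)
  finally show "\<exists>T\<in>rect_span X. (\<integral>z. \<bar>k * H z - T z\<bar> \<partial>\<tau>) < e"
    using rect_span_scale[OF T(1)] by (intro bexI[of _ "\<lambda>z. k * T z"])
qed

lemma approximable_span: "T \<in> rect_span X \<Longrightarrow> approximable X \<tau> T"
  unfolding approximable_def by (auto intro!: bexI[of _ T])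

lemma approximable_sum:
  assumes "\<And>i. integrable \<tau> (H i)" "\<And>i. approximable X \<tau> (H i)"
  shows "approximable X \<tau> (\<lambda>z. \<Sum>i<k::nat. H i z)"
proof (induction k)
  case 0
  have "(\<lambda>z. 0 * (indicator {} (fst z) * indicator {} (snd z))) \<in> rect_span X" by (rule rect_span.rect) auto
  from approximable_span[OF this] show ?case by simp
next
  case (Suc k)
  then show ?case using assms by (simp add: approximable_add)
qed

lemma approximable_lim:
  assumes s: "\<And>i. integrable \<tau> (s i)" "\<And>i. approximable X \<tau> (s i)"
    and lim: "\<And>x. x \<in> space \<tau> \<Longrightarrow> (\<lambda>i. s i x) \<longlonglongrightarrow> H x"
    (* The factor 2 is the one with which simple functions approximate an integrable function in the induction rule for integrable functions. *)
    and pair_bound: "\<And>i x. x \<in> space \<tau> \<Longrightarrow> \<bar>s i x\<bar> \<le> 2 * \<bar>H x\<bar>" and H: "integrable \<tau> H"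
  shows "approximable X \<tau> H"
proof (rule approximable_close[OF H])
  fix e :: real assume e: "e > 0"
  have "(\<lambda>i. \<integral>z. \<bar>H z - s i z\<bar> \<partial>\<tau>) \<longlonglongrightarrow> (\<integral>z. 0 \<partial>\<tau>)"
  proof (rule integral_dominated_convergence[where w="\<lambda>z. 3 * \<bar>H z\<bar>"])
    show "AE x in \<tau>. (\<lambda>i. \<bar>H x - s i x\<bar>) \<longlonglongrightarrow> 0"
    proof (rule AE_I2)
      fix x assume "x \<in> space \<tau>"
      from tendsto_diff[OF tendsto_const[of "H x"] lim[OF this]]
      show "(\<lambda>i. \<bar>H x - s i x\<bar>) \<longlonglongrightarrow> 0" by (intro tendsto_rabs_zero) simp
    qed
    show "AE x in \<tau>. norm \<bar>H x - s i x\<bar> \<le> 3 * \<bar>H x\<bar>" for i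
    proof (rule AE_I2)
      fix x assume "x \<in> space \<tau>"
      from pair_bound[OF this, of i] show "norm \<bar>H x - s i x\<bar> \<le> 3 * \<bar>H x\<bar>" by simp
    qed
  qed (use H s in auto)
  then have "(\<lambda>i. \<integral>z. \<bar>H z - s i z\<bar> \<partial>\<tau>) \<longlonglongrightarrow> 0" by simp
  from LIMSEQ_D[OF this e] obtain i where "norm ((\<integral>z. \<bar>H z - s i z\<bar> \<partial>\<tau>) - 0) < e" by blast
  then show "\<exists>H'. integrable \<tau> H' \<and> approximable X \<tau> H' \<and> (\<integral>z. \<bar>H z - H' z\<bar> \<partial>\<tau>) < e"
    using s by (intro exI[of _ "s i"]) auto
qed

text \<open>Rectangles are stable under intersection and generate the product \<open>\<sigma>\<close>-algebra, and the sets with an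
  approximable indicator form a Dynkin system.\<close>

lemma approximable_indicator:
  assumes "S \<in> sets (X \<Otimes>\<^sub>M X)"
  shows "approximable X \<tau> (indicator S)"
proof -
  have int: "integrable \<tau> (indicator S :: _ \<Rightarrow> real)" if "S \<in> sets (X \<Otimes>\<^sub>M X)" for S
    using bm_integrable_finite[OF fin st bm_indicator[OF that]] .
  have rc: "indicator (A \<times> B) \<in> rect_span X" if "A \<in> sets X" "B \<in> sets X" for A B
  proof -
    have "(\<lambda>z. 1 * (indicator A (fst z) * indicator B (snd z))) = (indicator (A \<times> B) :: _ \<Rightarrow> real)"
      by (auto split: split_indicator)
    then show ?thesis using rect_span.rect[OF that, of 1] by simp
  qed
  have "S \<in> sigma_sets (space X \<times> space X) {a \<times> b | a b. a \<in> sets X \<and> b \<in> sets X}"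
    using assms by (simp add: sets_pair_measure)
  then show ?thesis
  proof (induction rule: sigma_sets_induct_disjoint[OF Int_stable_pair_measure_generator pair_measure_closed, consumes 1, case_names basic empty compl union])
    case (basic A)
    then show ?case by (auto intro!: approximable_span rc)
  next
    case empty
    have "approximable X \<tau> (indicator ({} \<times> {}))" by (intro approximable_span rc) auto
    then show ?case by (simp only: Sigma_empty1)
  next
    case (compl A)
    then have A: "A \<in> sets (X \<Otimes>\<^sub>M X)" by (simp add: sets_pair_measure)
    have "approximable X \<tau> (\<lambda>z. indicator (space X \<times> space X) z + (-1) * indicator A z)"
      using compl A int[OF A]
      by (intro approximable_add approximable_scale approximable_span[OF rc] int[OF A] int integrable_mult_right) auto
    also have "(\<lambda>z. indicator (space X \<times> space X) z + (-1) * indicator A z) = (indicator (space X \<times> space X - A) :: _ \<Rightarrow> real)"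
      using sets.sets_into_space[OF A] by (auto split: split_indicator simp: space_pair_measure fun_eq_iff)
    finally show ?case .
  next
    case (union F)
    then have F: "\<And>i. F i \<in> sets (X \<Otimes>\<^sub>M X)" by (auto simp: sets_pair_measure)
    have sum_eq: "(\<Sum>i<k. indicator (F i) z) = (indicator (\<Union>i<k. F i) z :: real)" for k z
      using union(1) by (subst indicator_UN_disjoint) (auto simp: disjoint_family_on_def)
    have a: "approximable X \<tau> (indicator (\<Union>i<k. F i))" for k
      using approximable_sum[of "\<lambda>i. indicator (F i)" k] union int[OF F] by (simp add: sum_eq)
    show ?case
    proof (rule approximable_lim[OF _ a])
      show "integrable \<tau> (indicator (\<Union>i<k. F i) :: _ \<Rightarrow> real)" for k using F by (intro int) auto
      show "integrable \<tau> (indicator (\<Union>i. F i) :: _ \<Rightarrow> real)" using F by (intro int) auto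
      show "\<bar>indicator (\<Union>i<k. F i) x :: real\<bar> \<le> 2 * \<bar>indicator (\<Union>i. F i) x\<bar>" for k x
        by (auto split: split_indicator)
      show "(\<lambda>k. indicator (\<Union>i<k. F i) x :: real) \<longlonglongrightarrow> indicator (\<Union>i. F i) x" for x
        by (rule LIMSEQ_indicator_UN)
    qed
  qed
qed

lemma rect_span_dense:
  assumes H: "integrable \<tau> H" and e: "0 < e"
  obtains T where "T \<in> rect_span X" "(\<integral>z. \<bar>H z - T z\<bar> \<partial>\<tau>) < e"
proof -
  from H have "approximable X \<tau> H"
  proof (induction rule: integrable_induct)
    case (base A c)
    then have A: "A \<in> sets (X \<Otimes>\<^sub>M X)" by (simp add: st)
    from approximable_scale[OF _ approximable_indicator[OF A], of c] bm_integrable_finite[OF fin st bm_indicator[OF A]]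
    show ?case by (simp add: mult.commute)
  next
    case (add f g)
    then show ?case by (intro approximable_add)
  next
    case (lim f s)
    then show ?case by (intro approximable_lim[of s f]) auto
  qed
  with e that show ?thesis unfolding approximable_def by blast
qed

end

section \<open>Mixtures of kernels\<close>

text \<open>The maps on measures defined by \<open>measure_of\<close> take the given set function as their value only if it is
  countably additive. Here it is a sum of two measures.\<close>

lemma sum_measure:
  assumes A: "sets A = sets Y" and B: "sets B = sets Y"
    and \<nu>: "\<nu> = measure_of (space Y) (sets Y) (\<lambda>S. emeasure A S + emeasure B S)"
  shows sum_measure_sets: "sets \<nu> = sets Y"
    and sum_measure_emeasure: "S \<in> sets Y \<Longrightarrow> emeasure \<nu> S = emeasure A S + emeasure B S"
    and sum_measure_nn_integral: "f \<in> borel_measurable Y \<Longrightarrow> (\<integral>\<^sup>+x. f x \<partial>\<nu>) = (\<integral>\<^sup>+x. f x \<partial>A) + (\<integral>\<^sup>+x. f x \<partial>B)"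
proof -
  show s: "sets \<nu> = sets Y" by (simp add: \<nu>)
  have e: "emeasure \<nu> S = emeasure A S + emeasure B S" if "S \<in> sets Y" for S
  proof (rule emeasure_measure_of[OF \<nu>])
    show "positive (sets \<nu>) (\<lambda>S. emeasure A S + emeasure B S)" by (simp add: positive_def)
    show "countably_additive (sets \<nu>) (\<lambda>S. emeasure A S + emeasure B S)"
    proof (rule countably_additiveI)
      fix F :: "nat \<Rightarrow> 'a set" assume F: "range F \<subseteq> sets \<nu>" "disjoint_family F"
      then have FA: "range F \<subseteq> sets A" and FB: "range F \<subseteq> sets B" using s A B by auto
      have "(\<Sum>i. emeasure A (F i) + emeasure B (F i)) = (\<Sum>i. emeasure A (F i)) + (\<Sum>i. emeasure B (F i))"
        by (intro suminf_add[symmetric]) auto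
      then show "(\<Sum>i. emeasure A (F i) + emeasure B (F i)) = emeasure A (\<Union>i. F i) + emeasure B (\<Union>i. F i)"
        using suminf_emeasure[OF FA F(2)] suminf_emeasure[OF FB F(2)] by simp
    qed
  qed (use that s sets.space_closed in auto)
  then show "S \<in> sets Y \<Longrightarrow> emeasure \<nu> S = emeasure A S + emeasure B S" .
  have sp: "space \<nu> = space Y" "space A = space Y" "space B = space Y"
    using s A B by (auto dest: sets_eq_imp_space_eq)
  have m: "borel_measurable \<nu> = (borel_measurable Y :: ('a \<Rightarrow> ennreal) set)"
    "borel_measurable A = (borel_measurable Y :: ('a \<Rightarrow> ennreal) set)"
    "borel_measurable B = (borel_measurable Y :: ('a \<Rightarrow> ennreal) set)"
    using s A B by (auto cong: measurable_cong_sets)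
  show "(\<integral>\<^sup>+x. f x \<partial>\<nu>) = (\<integral>\<^sup>+x. f x \<partial>A) + (\<integral>\<^sup>+x. f x \<partial>B)" if "f \<in> borel_measurable Y"
    using that
  proof (induction rule: borel_measurable_induct)
    case (cong f g)
    then have "(\<integral>\<^sup>+x. f x \<partial>M) = (\<integral>\<^sup>+x. g x \<partial>M)" if "space M = space Y" for M
      using that by (intro nn_integral_cong) auto
    then show ?case using cong sp by simp
  next
    case (set S)
    then show ?case using e s A B by simp
  next
    case (mult u c)
    then show ?case using m by (simp add: nn_integral_cmult distrib_left)
  next
    case (add u v)
    then show ?case using m by (simp add: nn_integral_add ac_simps)
  next
    case (seq U)
    have "(\<integral>\<^sup>+x. (SUP i. U i) x \<partial>M) = (SUP i. \<integral>\<^sup>+x. U i x \<partial>M)"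
      if "borel_measurable M = (borel_measurable Y :: ('a \<Rightarrow> ennreal) set)" for M
      using seq that nn_integral_monotone_convergence_SUP[of U M] by (simp add: image_comp)
    then have "(\<integral>\<^sup>+x. (SUP i. U i) x \<partial>A) + (\<integral>\<^sup>+x. (SUP i. U i) x \<partial>B) = (SUP i. \<integral>\<^sup>+x. U i x \<partial>A) + (SUP i. \<integral>\<^sup>+x. U i x \<partial>B)"
      "(\<integral>\<^sup>+x. (SUP i. U i) x \<partial>\<nu>) = (SUP i. \<integral>\<^sup>+x. U i x \<partial>\<nu>)"
      using m by auto
    moreover have "(SUP i. \<integral>\<^sup>+x. U i x \<partial>A) + (SUP i. \<integral>\<^sup>+x. U i x \<partial>B) = (SUP i. (\<integral>\<^sup>+x. U i x \<partial>A) + (\<integral>\<^sup>+x. U i x \<partial>B))"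
      using seq by (intro ennreal_SUP_add[symmetric]) (auto simp: incseq_def le_fun_def intro!: nn_integral_mono)
    ultimately show ?case using seq by simp
  qed
qed

text \<open>This recognises a set function \<open>B \<mapsto> \<integral> w(z) k(z, B) \<mu>(dz)\<close> as a measure.\<close>

lemma weighted_bind:
  assumes w[measurable]: "w \<in> borel_measurable \<mu>" and k: "k \<in> \<mu> \<rightarrow>\<^sub>M prob_algebra Y" and ne: "space \<mu> \<noteq> {}"
  shows "sets (density \<mu> w \<bind> k) = sets Y"
    and "S \<in> sets Y \<Longrightarrow> emeasure (density \<mu> w \<bind> k) S = (\<integral>\<^sup>+z. w z * emeasure (k z) S \<partial>\<mu>)"
    and "f \<in> borel_measurable Y \<Longrightarrow> (\<integral>\<^sup>+x. f x \<partial>(density \<mu> w \<bind> k)) = (\<integral>\<^sup>+z. w z * (\<integral>\<^sup>+x. f x \<partial>k z) \<partial>\<mu>)"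
proof -
  have k': "k \<in> density \<mu> w \<rightarrow>\<^sub>M subprob_algebra Y" using measurable_prob_algebraD[OF k] by simp
  note k'' = measurable_prob_algebraD[OF k, measurable]
  show "sets (density \<mu> w \<bind> k) = sets Y" using ne kernelD(2)[OF k] by (intro sets_bind) auto
  show "S \<in> sets Y \<Longrightarrow> emeasure (density \<mu> w \<bind> k) S = (\<integral>\<^sup>+z. w z * emeasure (k z) S \<partial>\<mu>)"
    using emeasure_bind[OF _ k'] ne measurable_compose[OF k'' measurable_emeasure_subprob_algebra]
    by (simp add: nn_integral_density)
  show "f \<in> borel_measurable Y \<Longrightarrow> (\<integral>\<^sup>+x. f x \<partial>(density \<mu> w \<bind> k)) = (\<integral>\<^sup>+z. w z * (\<integral>\<^sup>+x. f x \<partial>k z) \<partial>\<mu>)"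
    using nn_integral_bind[OF _ k'] measurable_compose[OF k'' nn_integral_measurable_subprob_algebra]
    by (simp add: nn_integral_density)
qed

lemma integrable_mult_bm:
  assumes w: "integrable \<mu> w" and f: "f \<in> bm \<mu>"
  shows "integrable \<mu> (\<lambda>z. w z * f z :: real)"
proof -
  obtain B where B: "0 \<le> B" "\<And>x. x \<in> space \<mu> \<Longrightarrow> \<bar>f x\<bar> \<le> B" using bmE[OF f] by blast
  note f[measurable]
  show ?thesis
  proof (rule Bochner_Integration.integrable_bound[where f="\<lambda>z. B * w z"])
    show "AE x in \<mu>. norm (w x * f x) \<le> norm (B * w x)"
    proof (rule AE_I2)
      fix x assume "x \<in> space \<mu>"
      from mult_left_mono[OF B(2)[OF this], of "\<bar>w x\<bar>"] B(1)
      show "norm (w x * f x) \<le> norm (B * w x)" by (simp add: abs_mult ac_simps)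
    qed
  qed (use w in auto)
qed

text \<open>The common form of the resampling maps: with a weight \<open>w1\<close> draw from one kernel, with a weight \<open>w2\<close>
  from another, the two weights having total mass one.\<close>

lemma mixture:
  fixes w1 :: "'a \<Rightarrow> real" and w2 :: "'b \<Rightarrow> real"
  assumes w1: "integrable \<mu>1 w1" "\<And>z. z \<in> space \<mu>1 \<Longrightarrow> 0 \<le> w1 z" and k1: "k1 \<in> \<mu>1 \<rightarrow>\<^sub>M prob_algebra Y"
    and w2: "integrable \<mu>2 w2" "\<And>z. z \<in> space \<mu>2 \<Longrightarrow> 0 \<le> w2 z" and k2: "k2 \<in> \<mu>2 \<rightarrow>\<^sub>M prob_algebra Y"
    and one: "(\<integral>z. w1 z \<partial>\<mu>1) + (\<integral>z. w2 z \<partial>\<mu>2) = 1"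
    and ne: "space \<mu>1 \<noteq> {}" "space \<mu>2 \<noteq> {}"
    and \<nu>: "\<nu> = measure_of (space Y) (sets Y) E"
    and E: "\<And>S. S \<in> sets Y \<Longrightarrow> E S = (\<integral>\<^sup>+z. ennreal (w1 z) * emeasure (k1 z) S \<partial>\<mu>1) + (\<integral>\<^sup>+z. ennreal (w2 z) * emeasure (k2 z) S \<partial>\<mu>2)"
  shows mixture_prob: "\<nu> \<in> space (prob_algebra Y)"
    and mixture_integral: "f \<in> bm Y \<Longrightarrow>
      (\<integral>x. f x \<partial>\<nu>) = (\<integral>z. w1 z * (\<integral>x. f x \<partial>k1 z) \<partial>\<mu>1) + (\<integral>z. w2 z * (\<integral>x. f x \<partial>k2 z) \<partial>\<mu>2)"
proof -
  have wm: "(\<lambda>z. ennreal (w1 z)) \<in> borel_measurable \<mu>1" "(\<lambda>z. ennreal (w2 z)) \<in> borel_measurable \<mu>2"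
    using w1 w2 by auto
  let ?A = "density \<mu>1 (\<lambda>z. ennreal (w1 z)) \<bind> k1" and ?B = "density \<mu>2 (\<lambda>z. ennreal (w2 z)) \<bind> k2"
  note A = weighted_bind[OF wm(1) k1 ne(1)] and B = weighted_bind[OF wm(2) k2 ne(2)]
  have \<nu>': "\<nu> = measure_of (space Y) (sets Y) (\<lambda>S. emeasure ?A S + emeasure ?B S)"
    unfolding \<nu> using E A(2) B(2) by (intro measure_of_eq) (auto simp: sets.space_closed sets.sigma_sets_eq)
  note s = sum_measure[OF A(1) B(1) \<nu>']
  have nn: "(\<integral>\<^sup>+x. f x \<partial>\<nu>) = (\<integral>\<^sup>+z. ennreal (w1 z) * (\<integral>\<^sup>+x. f x \<partial>k1 z) \<partial>\<mu>1) + (\<integral>\<^sup>+z. ennreal (w2 z) * (\<integral>\<^sup>+x. f x \<partial>k2 z) \<partial>\<mu>2)"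
    if "f \<in> borel_measurable Y" for f
    using s(3)[OF that] A(3)[OF that] B(3)[OF that] by simp
  have em: "emeasure (k1 z) (space Y) = 1" if "z \<in> space \<mu>1" for z
    using prob_space.emeasure_space_1[OF kernelD(1)[OF k1 that]] kernelD(3)[OF k1 that] by simp
  have em2: "emeasure (k2 z) (space Y) = 1" if "z \<in> space \<mu>2" for z
    using prob_space.emeasure_space_1[OF kernelD(1)[OF k2 that]] kernelD(3)[OF k2 that] by simp
  have pos: "0 \<le> (\<integral>z. w1 z \<partial>\<mu>1)" "0 \<le> (\<integral>z. w2 z \<partial>\<mu>2)" using w1 w2 by (auto intro!: integral_nonneg_AE)
  have "emeasure \<nu> (space \<nu>) = (\<integral>\<^sup>+z. ennreal (w1 z) \<partial>\<mu>1) + (\<integral>\<^sup>+z. ennreal (w2 z) \<partial>\<mu>2)"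
    using s(2)[of "space Y"] A(2)[of "space Y"] B(2)[of "space Y"] sets_eq_imp_space_eq[OF s(1)]
    by (simp add: em em2 cong: nn_integral_cong)
  also have "\<dots> = ennreal ((\<integral>z. w1 z \<partial>\<mu>1) + (\<integral>z. w2 z \<partial>\<mu>2))"
    using w1 w2 pos by (simp add: nn_integral_eq_integral)
  finally have e1: "emeasure \<nu> (space \<nu>) = 1" by (simp add: one)
  then interpret prob_space \<nu> by (rule prob_spaceI)
  show pa: "\<nu> \<in> space (prob_algebra Y)" using s(1) prob_space_axioms by (simp add: space_prob_algebra)
  assume f: "f \<in> bm Y"
  then obtain B where B: "0 \<le> B" "\<And>x. x \<in> space Y \<Longrightarrow> \<bar>f x\<bar> \<le> B" using bmE by blast
  (* The formula is obtained for the nonnegative function g from the nonnegative integral; both sides change by B when f is replaced by g because the weights have total mass one. *)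
  define g where "g x = f x + B" for x
  have g: "g \<in> bm Y" unfolding g_def[abs_def] using f by auto
  have g0: "0 \<le> g x" if "x \<in> space Y" for x using B(2)[OF that] by (simp add: g_def)
  have kf: "(\<lambda>z. \<integral>x. f x \<partial>k1 z) \<in> bm \<mu>1" "(\<lambda>z. \<integral>x. f x \<partial>k2 z) \<in> bm \<mu>2" using bm_kernel k1 k2 f by auto
  have kg: "(\<lambda>z. \<integral>x. g x \<partial>k1 z) \<in> bm \<mu>1" "(\<lambda>z. \<integral>x. g x \<partial>k2 z) \<in> bm \<mu>2" using bm_kernel k1 k2 g by auto
  have kgf: "(\<integral>x. g x \<partial>k1 z) = (\<integral>x. f x \<partial>k1 z) + B" if "z \<in> space \<mu>1" for z
  proof -
    interpret kz: prob_space "k1 z" using kernelD(1)[OF k1 that] .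
    show ?thesis using bm_integrable[OF measurable_space[OF k1 that] f] by (simp add: g_def kz.prob_space)
  qed
  have kgf2: "(\<integral>x. g x \<partial>k2 z) = (\<integral>x. f x \<partial>k2 z) + B" if "z \<in> space \<mu>2" for z
  proof -
    interpret kz: prob_space "k2 z" using kernelD(1)[OF k2 that] .
    show ?thesis using bm_integrable[OF measurable_space[OF k2 that] f] by (simp add: g_def kz.prob_space)
  qed
  have nk: "(\<integral>\<^sup>+x. ennreal (g x) \<partial>k z) = ennreal (\<integral>x. g x \<partial>k z)" "0 \<le> (\<integral>x. g x \<partial>k z)"
    if "k z \<in> space (prob_algebra Y)" for k :: "'d \<Rightarrow> 'c measure" and z
    using bm_integrable[OF that g] g0 prob_algebraD(3)[OF that]
    by (auto intro!: nn_integral_eq_integral integral_nonneg_AE)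
  have I: "integrable \<mu>1 (\<lambda>z. w1 z * (\<integral>x. g x \<partial>k1 z))" "integrable \<mu>2 (\<lambda>z. w2 z * (\<integral>x. g x \<partial>k2 z))"
    "integrable \<mu>1 (\<lambda>z. w1 z * (\<integral>x. f x \<partial>k1 z))" "integrable \<mu>2 (\<lambda>z. w2 z * (\<integral>x. f x \<partial>k2 z))"
    using integrable_mult_bm w1 w2 kg kf by auto
  have P: "0 \<le> (\<integral>z. w1 z * (\<integral>x. g x \<partial>k1 z) \<partial>\<mu>1)" "0 \<le> (\<integral>z. w2 z * (\<integral>x. g x \<partial>k2 z) \<partial>\<mu>2)"
    using w1 w2 nk(2)[of k1] nk(2)[of k2] measurable_space[OF k1] measurable_space[OF k2]
    by (auto intro!: integral_nonneg_AE AE_I2 mult_nonneg_nonneg)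
  have "ennreal (\<integral>x. g x \<partial>\<nu>) = (\<integral>\<^sup>+x. ennreal (g x) \<partial>\<nu>)"
    using bm_integrable[OF pa g] g0 sets_eq_imp_space_eq[OF s(1)] by (intro nn_integral_eq_integral[symmetric]) auto
  also have "\<dots> = (\<integral>\<^sup>+z. ennreal (w1 z) * (\<integral>\<^sup>+x. ennreal (g x) \<partial>k1 z) \<partial>\<mu>1) + (\<integral>\<^sup>+z. ennreal (w2 z) * (\<integral>\<^sup>+x. ennreal (g x) \<partial>k2 z) \<partial>\<mu>2)"
    using g by (intro nn) auto
  also have "(\<integral>\<^sup>+z. ennreal (w1 z) * (\<integral>\<^sup>+x. ennreal (g x) \<partial>k1 z) \<partial>\<mu>1) = (\<integral>\<^sup>+z. ennreal (w1 z * (\<integral>x. g x \<partial>k1 z)) \<partial>\<mu>1)"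
    using nk[of k1] measurable_space[OF k1] w1 by (intro nn_integral_cong) (simp add: ennreal_mult)
  also have "(\<integral>\<^sup>+z. ennreal (w2 z) * (\<integral>\<^sup>+x. ennreal (g x) \<partial>k2 z) \<partial>\<mu>2) = (\<integral>\<^sup>+z. ennreal (w2 z * (\<integral>x. g x \<partial>k2 z)) \<partial>\<mu>2)"
    using nk[of k2] measurable_space[OF k2] w2 by (intro nn_integral_cong) (simp add: ennreal_mult)
  also have "(\<integral>\<^sup>+z. ennreal (w1 z * (\<integral>x. g x \<partial>k1 z)) \<partial>\<mu>1) = ennreal (\<integral>z. w1 z * (\<integral>x. g x \<partial>k1 z) \<partial>\<mu>1)"
    using I(1) w1 nk(2)[of k1] measurable_space[OF k1] by (intro nn_integral_eq_integral AE_I2 mult_nonneg_nonneg) auto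
  also have "(\<integral>\<^sup>+z. ennreal (w2 z * (\<integral>x. g x \<partial>k2 z)) \<partial>\<mu>2) = ennreal (\<integral>z. w2 z * (\<integral>x. g x \<partial>k2 z) \<partial>\<mu>2)"
    using I(2) w2 nk(2)[of k2] measurable_space[OF k2] by (intro nn_integral_eq_integral AE_I2 mult_nonneg_nonneg) auto
  also have "ennreal (\<integral>z. w1 z * (\<integral>x. g x \<partial>k1 z) \<partial>\<mu>1) + ennreal (\<integral>z. w2 z * (\<integral>x. g x \<partial>k2 z) \<partial>\<mu>2)
    = ennreal ((\<integral>z. w1 z * (\<integral>x. g x \<partial>k1 z) \<partial>\<mu>1) + (\<integral>z. w2 z * (\<integral>x. g x \<partial>k2 z) \<partial>\<mu>2))" using P by simp
  finally have "(\<integral>x. g x \<partial>\<nu>) = (\<integral>z. w1 z * (\<integral>x. g x \<partial>k1 z) \<partial>\<mu>1) + (\<integral>z. w2 z * (\<integral>x. g x \<partial>k2 z) \<partial>\<mu>2)"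
    using P nk(2)[of "\<lambda>_. \<nu>"] pa by (subst (asm) ennreal_inj) auto
  moreover have "(\<integral>x. g x \<partial>\<nu>) = (\<integral>x. f x \<partial>\<nu>) + B"
    using bm_integrable[OF pa f] by (simp add: g_def prob_space)
  moreover have "(\<integral>z. w1 z * (\<integral>x. g x \<partial>k1 z) \<partial>\<mu>1) = (\<integral>z. w1 z * (\<integral>x. f x \<partial>k1 z) + B * w1 z \<partial>\<mu>1)"
    using kgf by (intro Bochner_Integration.integral_cong) (auto simp: algebra_simps)
  moreover have "(\<integral>z. w2 z * (\<integral>x. g x \<partial>k2 z) \<partial>\<mu>2) = (\<integral>z. w2 z * (\<integral>x. f x \<partial>k2 z) + B * w2 z \<partial>\<mu>2)"
    using kgf2 by (intro Bochner_Integration.integral_cong) (auto simp: algebra_simps)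
  moreover have "B * (\<integral>z. w1 z \<partial>\<mu>1) + B * (\<integral>z. w2 z \<partial>\<mu>2) = B"
    using one by (metis distrib_left mult.right_neutral)
  ultimately show "(\<integral>x. f x \<partial>\<nu>) = (\<integral>z. w1 z * (\<integral>x. f x \<partial>k1 z) \<partial>\<mu>1) + (\<integral>z. w2 z * (\<integral>x. f x \<partial>k2 z) \<partial>\<mu>2)"
    using I(3,4) w1 w2 by simp
qed

section \<open>Integrals against the coupled updates\<close>

lemma tensor_integral:
  fixes a :: "'a \<Rightarrow> real" and b :: "'b \<Rightarrow> real"
  assumes "sigma_finite_measure M1" "sigma_finite_measure M2" and a: "integrable M1 a" and b: "integrable M2 b"
  shows tensor_integrable: "integrable (M1 \<Otimes>\<^sub>M M2) (\<lambda>z. a (fst z) * b (snd z))"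
    and tensor_integral_eq: "(\<integral>z. a (fst z) * b (snd z) \<partial>(M1 \<Otimes>\<^sub>M M2)) = (\<integral>x. a x \<partial>M1) * (\<integral>y. b y \<partial>M2)"
proof -
  interpret M1: sigma_finite_measure M1 by fact
  interpret M2: sigma_finite_measure M2 by fact
  interpret pair_sigma_finite M1 M2 ..
  have m: "a \<in> borel_measurable M1" "b \<in> borel_measurable M2" using a b by auto
  note m[measurable]
  show i: "integrable (M1 \<Otimes>\<^sub>M M2) (\<lambda>z. a (fst z) * b (snd z))"
    by (rule Fubini_integrable) (use a b in \<open>auto simp: abs_mult\<close>)
  show "(\<integral>z. a (fst z) * b (snd z) \<partial>(M1 \<Otimes>\<^sub>M M2)) = (\<integral>x. a x \<partial>M1) * (\<integral>y. b y \<partial>M2)"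
    using integral_fst'[OF i] by simp
qed

text \<open>When the common part of two densities has mass one, the residual weights have integral zero, and the
  marginals are still correct although the second term of the coupling is dropped.\<close>

lemma integral_zero_weight:
  fixes w b :: "'a \<Rightarrow> real"
  assumes w: "integrable \<mu> w" "\<And>z. z \<in> space \<mu> \<Longrightarrow> 0 \<le> w z" "(\<integral>z. w z \<partial>\<mu>) = 0" 
  shows "(\<integral>z. w z * b z \<partial>\<mu>) = 0"
proof -
  have "AE z in \<mu>. w z = 0" using integral_nonneg_eq_0_iff_AE[of \<mu> w] w by auto
  then have "AE z in \<mu>. w z * b z = 0" by eventually_elim simp
  from integral_eq_zero_AE[OF this] show ?thesis .
qed

lemma prob_integrable_bm: "\<mu> \<in> space (prob_algebra Y) \<Longrightarrow> f \<in> bm Y \<Longrightarrow> f \<in> bm \<mu>"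
  using bm_cong_sets[of \<mu> Y] prob_algebraD[of \<mu> Y] by auto

lemma kernel_cong_space:
  assumes "\<mu> \<in> space (prob_algebra Y)" "k \<in> Y \<rightarrow>\<^sub>M Z" shows "k \<in> \<mu> \<rightarrow>\<^sub>M Z"
  using assms prob_algebraD[OF assms(1)] by (simp cong: measurable_cong_sets)

lemma pa_not_empty: "\<mu> \<in> space (prob_algebra Y) \<Longrightarrow> space \<mu> \<noteq> {}"
  using prob_algebraD(1) prob_space.not_empty by blast

lemma pa_sigma_finite: "\<mu> \<in> space (prob_algebra Y) \<Longrightarrow> sigma_finite_measure \<mu>"
  using prob_algebraD(1) prob_space_imp_sigma_finite by blast

lemma pa_pair: "\<mu> \<in> space (prob_algebra Y) \<Longrightarrow> \<nu> \<in> space (prob_algebra Z) \<Longrightarrow> \<mu> \<Otimes>\<^sub>M \<nu> \<in> space (prob_algebra (Y \<Otimes>\<^sub>M Z))"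
  using prob_space_pair[of \<mu> \<nu>] sets_pair_measure_cong[of \<mu> Y \<nu> Z] by (simp add: space_prob_algebra)

lemma Phi_I_formula:
  assumes K: "K \<in> X \<Otimes>\<^sub>M X \<rightarrow>\<^sub>M prob_algebra (X \<Otimes>\<^sub>M X)" and \<mu>: "\<mu> \<in> space (prob_algebra (X \<Otimes>\<^sub>M X))"
    and g: "g \<in> bm X" "\<And>x. x \<in> space X \<Longrightarrow> 0 \<le> g x"
    and D: "0 < (\<integral>z. g (fst z) * g (snd z) \<partial>\<mu>)"
  shows Phi_I_prob: "Phi_I X g K \<mu> \<in> space (prob_algebra (X \<Otimes>\<^sub>M X))"
    and Phi_I_integral: "f \<in> bm (X \<Otimes>\<^sub>M X) \<Longrightarrow> (\<integral>x. f x \<partial>Phi_I X g K \<mu>) =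
       (\<integral>z. g (fst z) * g (snd z) * (\<integral>x. f x \<partial>K z) \<partial>\<mu>) / (\<integral>z. g (fst z) * g (snd z) \<partial>\<mu>)"
proof -
  let ?D = "\<integral>z. g (fst z) * g (snd z) \<partial>\<mu>"
  have gg: "(\<lambda>z. g (fst z) * g (snd z)) \<in> bm (X \<Otimes>\<^sub>M X)"
    by (intro bm_mult bm_compose[OF measurable_fst g(1)] bm_compose[OF measurable_snd g(1)])
  have gg0: "0 \<le> g (fst z) * g (snd z)" if "z \<in> space \<mu>" for z
    using that prob_algebraD[OF \<mu>] g(2) by (auto simp: space_pair_measure)
  have i: "integrable \<mu> (\<lambda>z. g (fst z) * g (snd z))" using bm_integrable[OF \<mu> gg] .
  have K': "K \<in> \<mu> \<rightarrow>\<^sub>M prob_algebra (X \<Otimes>\<^sub>M X)" using kernel_cong_space[OF \<mu> K] .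
  have E: "(\<integral>\<^sup>+z. ennreal (g (fst z) * g (snd z)) * emeasure (K z) S \<partial>\<mu>) / (\<integral>\<^sup>+z. ennreal (g (fst z) * g (snd z)) \<partial>\<mu>)
     = (\<integral>\<^sup>+z. ennreal (g (fst z) * g (snd z) / ?D) * emeasure (K z) S \<partial>\<mu>) + (\<integral>\<^sup>+z. ennreal 0 * emeasure (K z) S \<partial>\<mu>)"
    if S: "S \<in> sets (X \<Otimes>\<^sub>M X)" for S
  proof -
    have m: "(\<lambda>z. ennreal (g (fst z) * g (snd z)) * emeasure (K z) S) \<in> borel_measurable \<mu>"
      using measurable_compose[OF measurable_prob_algebraD[OF K'] measurable_emeasure_subprob_algebra[OF S]] i by measurable
    have "(\<integral>\<^sup>+z. ennreal (g (fst z) * g (snd z)) \<partial>\<mu>) = ennreal ?D"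
      using i gg0 by (intro nn_integral_eq_integral) auto
    then have "(\<integral>\<^sup>+z. ennreal (g (fst z) * g (snd z)) * emeasure (K z) S \<partial>\<mu>) / (\<integral>\<^sup>+z. ennreal (g (fst z) * g (snd z)) \<partial>\<mu>)
      = (\<integral>\<^sup>+z. ennreal (g (fst z) * g (snd z)) * emeasure (K z) S / ennreal ?D \<partial>\<mu>)"
      using nn_integral_divide[OF m] by simp
    also have "\<dots> = (\<integral>\<^sup>+z. ennreal (g (fst z) * g (snd z) / ?D) * emeasure (K z) S \<partial>\<mu>)"
      using gg0 D by (intro nn_integral_cong) (simp add: divide_ennreal[symmetric] divide_ennreal_def ac_simps)
    finally show ?thesis by simp
  qed
  have "(\<integral>z. g (fst z) * g (snd z) / ?D \<partial>\<mu>) + (\<integral>z. 0 \<partial>\<mu>) = 1" using D by simp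
  note mix = mixture[where ?w1.0="\<lambda>z. g (fst z) * g (snd z) / ?D" and ?w2.0="\<lambda>_. 0" and ?k1.0=K and ?k2.0=K, OF _ _ K' _ _ K' this
      pa_not_empty[OF \<mu>] pa_not_empty[OF \<mu>] Phi_I_def E]
  show "Phi_I X g K \<mu> \<in> space (prob_algebra (X \<Otimes>\<^sub>M X))"
    by (rule mix(1)) (use i gg0 D in auto)
  assume f: "f \<in> bm (X \<Otimes>\<^sub>M X)"
  have "(\<integral>x. f x \<partial>Phi_I X g K \<mu>) = (\<integral>z. g (fst z) * g (snd z) / ?D * (\<integral>x. f x \<partial>K z) \<partial>\<mu>) + (\<integral>z. 0 * (\<integral>x. f x \<partial>K z) \<partial>\<mu>)"
    by (rule mix(2)) (use i gg0 D f in auto)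
  then show "(\<integral>x. f x \<partial>Phi_I X g K \<mu>) =
       (\<integral>z. g (fst z) * g (snd z) * (\<integral>x. f x \<partial>K z) \<partial>\<mu>) / ?D" by simp
qed

lemma proj_measurable[measurable]: "proj s \<in> X \<Otimes>\<^sub>M X \<rightarrow>\<^sub>M X"
  by (cases s) (auto simp: measurable_fst measurable_snd)

lemma proj_space: "z \<in> space (X \<Otimes>\<^sub>M X) \<Longrightarrow> proj s z \<in> space X"
  using measurable_space[OF proj_measurable] .

lemma bm_proj: "\<phi> \<in> bm X \<Longrightarrow> (\<lambda>z. \<phi> (proj s z)) \<in> bm (X \<Otimes>\<^sub>M X)"
  by (rule bm_compose[OF proj_measurable])

text \<open>\<open>FM_bar\<close> without its normalisation \<open>1 - c\<close>, which may vanish.\<close>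

definition FM_res :: "('a \<Rightarrow> real) \<Rightarrow> ('a \<times> 'a) measure \<Rightarrow> level \<Rightarrow> 'a \<times> 'a \<Rightarrow> real" where
  "FM_res g \<mu> s z = FM g \<mu> s z - FM_min g \<mu> z"

context
  fixes X :: "'a measure" and g K \<mu>
  assumes K: "K \<in> X \<Otimes>\<^sub>M X \<rightarrow>\<^sub>M prob_algebra (X \<Otimes>\<^sub>M X)" and \<mu>: "\<mu> \<in> space (prob_algebra (X \<Otimes>\<^sub>M X))"
    and g: "g \<in> bm X" "\<And>x. x \<in> space X \<Longrightarrow> 0 \<le> g x"
    and D: "\<And>s. 0 < (\<integral>z. g (proj s z) \<partial>\<mu>)"
begin

interpretation prob_space \<mu> using prob_algebraD(1)[OF \<mu>] .

lemma FM_bm: "FM g \<mu> s \<in> bm (X \<Otimes>\<^sub>M X)"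
  unfolding FM_def[abs_def] by (intro bm_divide bm_proj g)

lemma FM_min_bm: "FM_min g \<mu> \<in> bm (X \<Otimes>\<^sub>M X)"
  unfolding FM_min_def[abs_def] by (intro bm_min FM_bm)

lemma FM_res_bm: "FM_res g \<mu> s \<in> bm (X \<Otimes>\<^sub>M X)"
  unfolding FM_res_def[abs_def] by (intro bm_diff FM_bm FM_min_bm)

lemma FM_nonneg: "z \<in> space (X \<Otimes>\<^sub>M X) \<Longrightarrow> 0 \<le> FM g \<mu> s z"
  unfolding FM_def using g(2)[OF proj_space] less_imp_le[OF D] by simp

lemma FM_min_nonneg: "z \<in> space (X \<Otimes>\<^sub>M X) \<Longrightarrow> 0 \<le> FM_min g \<mu> z"
  unfolding FM_min_def using FM_nonneg by simp

lemma FM_res_nonneg: "0 \<le> FM_res g \<mu> s z"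
  unfolding FM_res_def FM_min_def by (cases s) auto

lemma FM_integral: "(\<integral>z. FM g \<mu> s z \<partial>\<mu>) = 1"
  unfolding FM_def using D[of s] by simp

lemma FM_res_integral: "(\<integral>z. FM_res g \<mu> s z \<partial>\<mu>) = 1 - (\<integral>z. FM_min g \<mu> z \<partial>\<mu>)"
  unfolding FM_res_def using bm_integrable[OF \<mu> FM_bm] bm_integrable[OF \<mu> FM_min_bm] FM_integral[of s] by simp

lemma FM_min_integral_le: "(\<integral>z. FM_min g \<mu> z \<partial>\<mu>) \<le> 1"
proof -
  have "0 \<le> (\<integral>z. FM_res g \<mu> Fine z \<partial>\<mu>)" by (intro integral_nonneg_AE) (simp add: FM_res_nonneg)
  then show ?thesis using FM_res_integral[of Fine] by simp
qed

lemma cross_measurable: "(\<lambda>p. (fst (fst p), snd (snd p))) \<in> (X \<Otimes>\<^sub>M X) \<Otimes>\<^sub>M (X \<Otimes>\<^sub>M X) \<rightarrow>\<^sub>M X \<Otimes>\<^sub>M X"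
  by measurable

lemma res_tensor:
  shows res_tensor_integrable: "integrable (\<mu> \<Otimes>\<^sub>M \<mu>) (\<lambda>p. FM_res g \<mu> Fine (fst p) * FM_res g \<mu> Coarse (snd p))"
  and res_tensor_integral: "(\<integral>p. FM_res g \<mu> Fine (fst p) * FM_res g \<mu> Coarse (snd p) \<partial>(\<mu> \<Otimes>\<^sub>M \<mu>)) = (1 - (\<integral>z. FM_min g \<mu> z \<partial>\<mu>))\<^sup>2"
  using tensor_integral[OF pa_sigma_finite[OF \<mu>] pa_sigma_finite[OF \<mu>] bm_integrable[OF \<mu> FM_res_bm[of Fine]] bm_integrable[OF \<mu> FM_res_bm[of Coarse]]]
  by (auto simp: FM_res_integral power2_eq_square)

text \<open>Both normalisations of the residual weights equal \<open>1 - c\<close>; together with the prefactor \<open>1 - c\<close> a single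
  division by \<open>1 - c\<close> is left.\<close>

lemma Phi_M_formula:
  defines "c \<equiv> (\<integral>z. FM_min g \<mu> z \<partial>\<mu>)"
  shows Phi_M_prob: "Phi_M X g K \<mu> \<in> space (prob_algebra (X \<Otimes>\<^sub>M X))"
    and Phi_M_integral: "f \<in> bm (X \<Otimes>\<^sub>M X) \<Longrightarrow> (\<integral>x. f x \<partial>Phi_M X g K \<mu>) =
      (\<integral>z. FM_min g \<mu> z * (\<integral>x. f x \<partial>K z) \<partial>\<mu>) +
      (if c = 1 then 0 else
        (\<integral>p. FM_res g \<mu> Fine (fst p) * FM_res g \<mu> Coarse (snd p) * (\<integral>x. f x \<partial>K (fst (fst p), snd (snd p))) \<partial>(\<mu> \<Otimes>\<^sub>M \<mu>)) / (1 - c))"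
proof -
  have c1: "c \<le> 1" using FM_min_integral_le by (simp add: c_def)
  define r where "r s z = FM_res g \<mu> s z" for s z
  define w2 where "w2 p = (if c = 1 then 0 else r Fine (fst p) * r Coarse (snd p) / (1 - c))" for p
  have sp: "space \<mu> = space (X \<Otimes>\<^sub>M X)" using prob_algebraD[OF \<mu>] by simp
  have \<mu>\<mu>: "\<mu> \<Otimes>\<^sub>M \<mu> \<in> space (prob_algebra ((X \<Otimes>\<^sub>M X) \<Otimes>\<^sub>M (X \<Otimes>\<^sub>M X)))" using pa_pair[OF \<mu> \<mu>] .
  have K': "K \<in> \<mu> \<rightarrow>\<^sub>M prob_algebra (X \<Otimes>\<^sub>M X)" using kernel_cong_space[OF \<mu> K] .
  have K2: "(\<lambda>p. K (fst (fst p), snd (snd p))) \<in> \<mu> \<Otimes>\<^sub>M \<mu> \<rightarrow>\<^sub>M prob_algebra (X \<Otimes>\<^sub>M X)"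
    using kernel_cong_space[OF \<mu>\<mu> measurable_compose[OF cross_measurable K]] .
  have bar: "FM_bar g \<mu> s z = r s z / (1 - c)" for s z
    using FM_res_integral[of s] unfolding FM_bar_def r_def c_def FM_res_def by simp
  have w2i: "integrable (\<mu> \<Otimes>\<^sub>M \<mu>) w2"
    using res_tensor_integrable by (cases "c = 1") (auto simp: w2_def[abs_def] r_def)
  have w20: "0 \<le> w2 p" for p using c1 by (auto simp: w2_def r_def intro!: divide_nonneg_nonneg mult_nonneg_nonneg FM_res_nonneg)
  have one: "(\<integral>z. FM_min g \<mu> z \<partial>\<mu>) + (\<integral>p. w2 p \<partial>(\<mu> \<Otimes>\<^sub>M \<mu>)) = 1"
    using res_tensor_integral by (cases "c = 1") (auto simp: w2_def[abs_def] r_def c_def power2_eq_square)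
  have E: "(\<integral>\<^sup>+z. ennreal (FM_min g \<mu> z) * emeasure (K z) S \<partial>\<mu>)
         + (if (\<integral>z. FM_min g \<mu> z \<partial>\<mu>) = 1 then 0
            else ennreal (1 - (\<integral>z. FM_min g \<mu> z \<partial>\<mu>)) *
              (\<integral>\<^sup>+(z, w). ennreal (FM_bar g \<mu> Fine z * FM_bar g \<mu> Coarse w) * emeasure (K (fst z, snd w)) S \<partial>(\<mu> \<Otimes>\<^sub>M \<mu>)))
    = (\<integral>\<^sup>+z. ennreal (FM_min g \<mu> z) * emeasure (K z) S \<partial>\<mu>)
         + (\<integral>\<^sup>+p. ennreal (w2 p) * emeasure (K (fst (fst p), snd (snd p))) S \<partial>(\<mu> \<Otimes>\<^sub>M \<mu>))"
    if S: "S \<in> sets (X \<Otimes>\<^sub>M X)" for S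
  proof (cases "c = 1")
    case True then show ?thesis by (simp add: w2_def c_def)
  next
    case False
    have rm: "r s \<in> borel_measurable \<mu>" for s
      unfolding r_def[abs_def] using prob_integrable_bm[OF \<mu> FM_res_bm] by (simp add: bm_iff)
    note rm[measurable]
    have m: "(\<lambda>p. ennreal (FM_bar g \<mu> Fine (fst p) * FM_bar g \<mu> Coarse (snd p)) * emeasure (K (fst (fst p), snd (snd p))) S) \<in> borel_measurable (\<mu> \<Otimes>\<^sub>M \<mu>)"
      using measurable_compose[OF measurable_prob_algebraD[OF K2] measurable_emeasure_subprob_algebra[OF S]]
      unfolding bar by measurable
    have "ennreal (1 - c) * (\<integral>\<^sup>+p. ennreal (FM_bar g \<mu> Fine (fst p) * FM_bar g \<mu> Coarse (snd p)) * emeasure (K (fst (fst p), snd (snd p))) S \<partial>(\<mu> \<Otimes>\<^sub>M \<mu>))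
      = (\<integral>\<^sup>+p. ennreal (1 - c) * (ennreal (FM_bar g \<mu> Fine (fst p) * FM_bar g \<mu> Coarse (snd p)) * emeasure (K (fst (fst p), snd (snd p))) S) \<partial>(\<mu> \<Otimes>\<^sub>M \<mu>))"
      by (rule nn_integral_cmult[symmetric, OF m])
    also have "\<dots> = (\<integral>\<^sup>+p. ennreal (w2 p) * emeasure (K (fst (fst p), snd (snd p))) S \<partial>(\<mu> \<Otimes>\<^sub>M \<mu>))"
    proof (rule nn_integral_cong)
      fix p
      have "ennreal (1 - c) * ennreal (FM_bar g \<mu> Fine (fst p) * FM_bar g \<mu> Coarse (snd p)) = ennreal ((1 - c) * (FM_bar g \<mu> Fine (fst p) * FM_bar g \<mu> Coarse (snd p)))"
        using c1 by (intro ennreal_mult[symmetric]) (auto simp: bar r_def intro!: mult_nonneg_nonneg divide_nonneg_nonneg FM_res_nonneg)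
      also have "(1 - c) * (FM_bar g \<mu> Fine (fst p) * FM_bar g \<mu> Coarse (snd p)) = w2 p"
        using False by (simp add: bar w2_def)
      finally show "ennreal (1 - c) * (ennreal (FM_bar g \<mu> Fine (fst p) * FM_bar g \<mu> Coarse (snd p)) * emeasure (K (fst (fst p), snd (snd p))) S)
        = ennreal (w2 p) * emeasure (K (fst (fst p), snd (snd p))) S" by (simp add: mult.assoc[symmetric])
    qed
    finally show ?thesis using False by (simp add: c_def split_beta')
  qed
  note mix = mixture[where ?w1.0="FM_min g \<mu>" and ?w2.0=w2 and ?k1.0=K, OF bm_integrable[OF \<mu> FM_min_bm] _ K' w2i w20 K2 one
      pa_not_empty[OF \<mu>] pa_not_empty[OF \<mu>\<mu>] Phi_M_def E]
  show "Phi_M X g K \<mu> \<in> space (prob_algebra (X \<Otimes>\<^sub>M X))"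
    by (rule mix(1)) (use FM_min_nonneg sp in auto)
  assume f: "f \<in> bm (X \<Otimes>\<^sub>M X)"
  have "(\<integral>x. f x \<partial>Phi_M X g K \<mu>) = (\<integral>z. FM_min g \<mu> z * (\<integral>x. f x \<partial>K z) \<partial>\<mu>) + (\<integral>p. w2 p * (\<integral>x. f x \<partial>K (fst (fst p), snd (snd p))) \<partial>(\<mu> \<Otimes>\<^sub>M \<mu>))"
    by (rule mix(2)) (use FM_min_nonneg sp f in auto)
  then show "(\<integral>x. f x \<partial>Phi_M X g K \<mu>) =
      (\<integral>z. FM_min g \<mu> z * (\<integral>x. f x \<partial>K z) \<partial>\<mu>) +
      (if c = 1 then 0 else
        (\<integral>p. FM_res g \<mu> Fine (fst p) * FM_res g \<mu> Coarse (snd p) * (\<integral>x. f x \<partial>K (fst (fst p), snd (snd p))) \<partial>(\<mu> \<Otimes>\<^sub>M \<mu>)) / (1 - c))"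
    by (simp add: w2_def r_def)
qed

end

text \<open>Integrating out the other coordinate, the residual weight adds to the common part and gives back
  \<open>FM\<close>. The normalising constant is multiplied out.\<close>

lemma Phi_M_marginal:
  assumes K: "K \<in> X \<Otimes>\<^sub>M X \<rightarrow>\<^sub>M prob_algebra (X \<Otimes>\<^sub>M X)" and \<mu>: "\<mu> \<in> space (prob_algebra (X \<Otimes>\<^sub>M X))"
    and g: "g \<in> bm X" "\<And>x. x \<in> space X \<Longrightarrow> 0 \<le> g x"
    and D: "\<And>s. 0 < (\<integral>z. g (proj s z) \<partial>\<mu>)"
    and \<phi>: "\<phi> \<in> bm X" and \<psi>: "\<psi> \<in> bm X"
    and Km: "\<And>z. z \<in> space (X \<Otimes>\<^sub>M X) \<Longrightarrow> (\<integral>x. \<phi> (proj s x) \<partial>K z) = \<psi> (proj s z)"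
  shows "(\<integral>x. \<phi> (proj s x) \<partial>Phi_M X g K \<mu>) * (\<integral>z. g (proj s z) \<partial>\<mu>) = (\<integral>z. g (proj s z) * \<psi> (proj s z) \<partial>\<mu>)"
proof -
  note A = K \<mu> g D
  let ?c = "\<integral>z. FM_min g \<mu> z \<partial>\<mu>" and ?r = "FM_res g \<mu>"
  have sp: "space \<mu> = space (X \<Otimes>\<^sub>M X)" using prob_algebraD[OF \<mu>] by simp
  have \<mu>\<mu>: "\<mu> \<Otimes>\<^sub>M \<mu> \<in> space (prob_algebra ((X \<Otimes>\<^sub>M X) \<Otimes>\<^sub>M (X \<Otimes>\<^sub>M X)))" using pa_pair[OF \<mu> \<mu>] .
  have ri: "integrable \<mu> (?r s)" for s using bm_integrable[OF \<mu> FM_res_bm[OF A]] .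
  have r\<psi>: "integrable \<mu> (\<lambda>z. ?r s z * \<psi> (proj s z))" for s
    using bm_integrable[OF \<mu> bm_mult[OF FM_res_bm[OF A] bm_proj[OF \<psi>]]] .
  have m\<psi>: "integrable \<mu> (\<lambda>z. FM_min g \<mu> z * \<psi> (proj s z))"
    using bm_integrable[OF \<mu> bm_mult[OF FM_min_bm[OF A] bm_proj[OF \<psi>]]] .
  have t: "(\<integral>p. ?r Fine (fst p) * ?r Coarse (snd p) * (\<integral>x. \<phi> (proj s x) \<partial>K (fst (fst p), snd (snd p))) \<partial>(\<mu> \<Otimes>\<^sub>M \<mu>))
    = (1 - ?c) * (\<integral>z. ?r s z * \<psi> (proj s z) \<partial>\<mu>)"
  proof (cases s)
    case Fine
    have "(\<integral>p. ?r Fine (fst p) * ?r Coarse (snd p) * (\<integral>x. \<phi> (proj s x) \<partial>K (fst (fst p), snd (snd p))) \<partial>(\<mu> \<Otimes>\<^sub>M \<mu>))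
      = (\<integral>p. (?r Fine (fst p) * \<psi> (proj Fine (fst p))) * ?r Coarse (snd p) \<partial>(\<mu> \<Otimes>\<^sub>M \<mu>))"
      using Fine Km prob_algebraD(3)[OF \<mu>\<mu>]
      by (intro Bochner_Integration.integral_cong) (auto simp: space_pair_measure)
    also have "\<dots> = (\<integral>z. ?r Fine z * \<psi> (proj Fine z) \<partial>\<mu>) * (\<integral>z. ?r Coarse z \<partial>\<mu>)"
      by (rule tensor_integral_eq[OF pa_sigma_finite[OF \<mu>] pa_sigma_finite[OF \<mu>] r\<psi> ri])
    finally show ?thesis using Fine FM_res_integral[OF A] by simp
  next
    case Coarse
    have "(\<integral>p. ?r Fine (fst p) * ?r Coarse (snd p) * (\<integral>x. \<phi> (proj s x) \<partial>K (fst (fst p), snd (snd p))) \<partial>(\<mu> \<Otimes>\<^sub>M \<mu>))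
      = (\<integral>p. ?r Fine (fst p) * (?r Coarse (snd p) * \<psi> (proj Coarse (snd p))) \<partial>(\<mu> \<Otimes>\<^sub>M \<mu>))"
      using Coarse Km prob_algebraD(3)[OF \<mu>\<mu>]
      by (intro Bochner_Integration.integral_cong) (auto simp: space_pair_measure)
    also have "\<dots> = (\<integral>z. ?r Fine z \<partial>\<mu>) * (\<integral>z. ?r Coarse z * \<psi> (proj Coarse z) \<partial>\<mu>)"
      by (rule tensor_integral_eq[OF pa_sigma_finite[OF \<mu>] pa_sigma_finite[OF \<mu>] ri r\<psi>])
    finally show ?thesis using Coarse FM_res_integral[OF A] by simp
  qed
  have z: "(\<integral>z. ?r s z * \<psi> (proj s z) \<partial>\<mu>) = 0" if "?c = 1"
    using that FM_res_integral[OF A] by (intro integral_zero_weight ri) (auto simp: FM_res_nonneg[OF A])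
  have "(\<integral>x. \<phi> (proj s x) \<partial>Phi_M X g K \<mu>) = (\<integral>z. FM_min g \<mu> z * (\<integral>x. \<phi> (proj s x) \<partial>K z) \<partial>\<mu>)
     + (\<integral>z. ?r s z * \<psi> (proj s z) \<partial>\<mu>)"
    using Phi_M_integral[OF A bm_proj[OF \<phi>], of s] unfolding t using z by auto
  also have "(\<integral>z. FM_min g \<mu> z * (\<integral>x. \<phi> (proj s x) \<partial>K z) \<partial>\<mu>) = (\<integral>z. FM_min g \<mu> z * \<psi> (proj s z) \<partial>\<mu>)"
    using Km sp by (intro Bochner_Integration.integral_cong) auto
  also have "\<dots> + (\<integral>z. ?r s z * \<psi> (proj s z) \<partial>\<mu>) = (\<integral>z. FM g \<mu> s z * \<psi> (proj s z) \<partial>\<mu>)"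
    using m\<psi> r\<psi>[of s] by (simp add: Bochner_Integration.integral_add[symmetric] FM_res_def algebra_simps)
  also have "\<dots> = (\<integral>z. g (proj s z) * \<psi> (proj s z) \<partial>\<mu>) / (\<integral>z. g (proj s z) \<partial>\<mu>)"
    by (simp add: FM_def)
  finally show ?thesis using D[of s] by simp
qed

context
  fixes L :: "'a measure" and f h :: "'a \<Rightarrow> real"
  assumes L: "sigma_finite_measure L"
    and f: "integrable L f" "\<And>x. x \<in> space L \<Longrightarrow> 0 \<le> f x" "(\<integral>x. f x \<partial>L) = 1"
    and h: "integrable L h" "\<And>x. x \<in> space L \<Longrightarrow> 0 \<le> h x" "(\<integral>x. h x \<partial>L) = 1"
begin

interpretation sigma_finite_measure L by (rule L)

lemma min_integrable: "integrable L (\<lambda>u. min (f u) (h u))"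
  using f(1) h(1) by (rule integrable_min)

lemma min_integral_le: "(\<integral>u. min (f u) (h u) \<partial>L) \<le> 1"
  using integral_mono[OF min_integrable f(1)] f(3) by simp

lemma res_integral:
  "(\<integral>u. f u - min (f u) (h u) \<partial>L) = 1 - (\<integral>u. min (f u) (h u) \<partial>L)"
  "(\<integral>u. h u - min (f u) (h u) \<partial>L) = 1 - (\<integral>u. min (f u) (h u) \<partial>L)"
  using f h min_integrable by auto

text \<open>The maximal coupling is a mixture of Dirac kernels: one on the diagonal with weight \<open>min f h\<close>, one on
  the product space with the product of the residual densities as its weight.\<close>

lemma max_coupling_formula:
  defines "c \<equiv> (\<integral>u. min (f u) (h u) \<partial>L)"
  shows max_coupling_prob: "max_coupling L f h \<in> space (prob_algebra (L \<Otimes>\<^sub>M L))"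
    and max_coupling_integral: "F \<in> bm (L \<Otimes>\<^sub>M L) \<Longrightarrow> (\<integral>x. F x \<partial>max_coupling L f h) =
      (\<integral>u. min (f u) (h u) * F (u, u) \<partial>L) +
      (if c = 1 then 0 else
        (\<integral>p. (f (fst p) - min (f (fst p)) (h (fst p))) * (h (snd p) - min (f (snd p)) (h (snd p))) * F p \<partial>(L \<Otimes>\<^sub>M L)) / (1 - c))"
proof -
  have c1: "c \<le> 1" using min_integral_le by (simp add: c_def)
  define m where "m u = min (f u) (h u)" for u
  define rf rh where "rf u = f u - m u" and "rh u = h u - m u" for u
  have ri: "integrable L rf" "integrable L rh" "integrable L m"
    using f h min_integrable by (auto simp: rf_def[abs_def] rh_def[abs_def] m_def[abs_def])
  have r0: "0 \<le> rf u" "0 \<le> rh u" for u by (auto simp: rf_def rh_def m_def)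
  have ne: "space L \<noteq> {}" using f(3) by (auto simp: Bochner_Integration.integral_empty)
  then have ne2: "space (L \<Otimes>\<^sub>M L) \<noteq> {}" by (auto simp: space_pair_measure)
  define w2 where "w2 p = (if c = 1 then 0 else rf (fst p) * rh (snd p) / (1 - c))" for p
  have w2i: "integrable (L \<Otimes>\<^sub>M L) w2"
    using tensor_integrable[OF L L ri(1,2)] by (cases "c = 1") (auto simp: w2_def[abs_def])
  have w20: "0 \<le> w2 p" for p using c1 r0 by (auto simp: w2_def intro!: divide_nonneg_nonneg mult_nonneg_nonneg)
  have one: "(\<integral>z. m z \<partial>L) + (\<integral>p. w2 p \<partial>(L \<Otimes>\<^sub>M L)) = 1"
    using tensor_integral_eq[OF L L ri(1,2)] res_integral
    by (cases "c = 1") (auto simp: w2_def[abs_def] c_def rf_def rh_def m_def)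
  have k1: "(\<lambda>u. return (L \<Otimes>\<^sub>M L) (u, u)) \<in> L \<rightarrow>\<^sub>M prob_algebra (L \<Otimes>\<^sub>M L)"
    by (rule measurable_compose[OF _ measurable_return_prob_space]) measurable
  have k2: "return (L \<Otimes>\<^sub>M L) \<in> L \<Otimes>\<^sub>M L \<rightarrow>\<^sub>M prob_algebra (L \<Otimes>\<^sub>M L)"
    by (rule measurable_return_prob_space)
  have E: "(\<integral>\<^sup>+u. indicator S (u, u) * ennreal (m u) \<partial>L)
         + (if c = 1 then 0
            else ennreal (1 / (1 - c)) *
              (\<integral>\<^sup>+(x, y). indicator S (x, y) * ennreal ((f x - m x) * (h y - m y)) \<partial>(L \<Otimes>\<^sub>M L)))
    = (\<integral>\<^sup>+z. ennreal (m z) * emeasure (return (L \<Otimes>\<^sub>M L) (z, z)) S \<partial>L)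
         + (\<integral>\<^sup>+p. ennreal (w2 p) * emeasure (return (L \<Otimes>\<^sub>M L) p) S \<partial>(L \<Otimes>\<^sub>M L))"
    if S: "S \<in> sets (L \<Otimes>\<^sub>M L)" for S
  proof -
    have 1: "(\<integral>\<^sup>+u. indicator S (u, u) * ennreal (m u) \<partial>L) = (\<integral>\<^sup>+z. ennreal (m z) * emeasure (return (L \<Otimes>\<^sub>M L) (z, z)) S \<partial>L)"
      using S by (simp add: mult.commute)
    have 2: "ennreal (1 / (1 - c)) * (\<integral>\<^sup>+p. indicator S p * ennreal (rf (fst p) * rh (snd p)) \<partial>(L \<Otimes>\<^sub>M L))
       = (\<integral>\<^sup>+p. ennreal (w2 p) * emeasure (return (L \<Otimes>\<^sub>M L) p) S \<partial>(L \<Otimes>\<^sub>M L))" if "c \<noteq> 1"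
    proof -
      have rm: "rf \<in> borel_measurable L" "rh \<in> borel_measurable L" using ri by auto
      note rm[measurable] S[measurable]
      have "ennreal (1 / (1 - c)) * (\<integral>\<^sup>+p. indicator S p * ennreal (rf (fst p) * rh (snd p)) \<partial>(L \<Otimes>\<^sub>M L))
        = (\<integral>\<^sup>+p. ennreal (1 / (1 - c)) * (indicator S p * ennreal (rf (fst p) * rh (snd p))) \<partial>(L \<Otimes>\<^sub>M L))"
        by (rule nn_integral_cmult[symmetric]) measurable
      also have "\<dots> = (\<integral>\<^sup>+p. ennreal (w2 p) * emeasure (return (L \<Otimes>\<^sub>M L) p) S \<partial>(L \<Otimes>\<^sub>M L))"
      proof (rule nn_integral_cong)
        fix p
        have "ennreal (1 / (1 - c)) * ennreal (rf (fst p) * rh (snd p)) = ennreal (w2 p)"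
          using c1 r0 that by (subst ennreal_mult[symmetric]) (auto simp: w2_def)
        then show "ennreal (1 / (1 - c)) * (indicator S p * ennreal (rf (fst p) * rh (snd p))) = ennreal (w2 p) * emeasure (return (L \<Otimes>\<^sub>M L) p) S"
          using S by (simp add: mult.commute mult.left_commute)
      qed
      finally show ?thesis .
    qed
    show ?thesis using 1 2 by (cases "c = 1") (simp_all add: w2_def split_beta' rf_def rh_def)
  qed
  have def: "max_coupling L f h = measure_of (space (L \<Otimes>\<^sub>M L)) (sets (L \<Otimes>\<^sub>M L))
      (\<lambda>B. (\<integral>\<^sup>+u. indicator B (u, u) * ennreal (m u) \<partial>L)
         + (if c = 1 then 0
            else ennreal (1 / (1 - c)) *
              (\<integral>\<^sup>+(x, y). indicator B (x, y) * ennreal ((f x - m x) * (h y - m y))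
                 \<partial>(L \<Otimes>\<^sub>M L))))"
    unfolding max_coupling_def Let_def m_def c_def ..
  have m0: "0 \<le> m z" if "z \<in> space L" for z using f h that by (auto simp: m_def)
  note mix = mixture[where ?w1.0=m and ?w2.0=w2, OF ri(3) m0 k1 w2i w20 k2 one ne ne2 def E]
  show "max_coupling L f h \<in> space (prob_algebra (L \<Otimes>\<^sub>M L))" by (rule mix(1))
  assume F: "F \<in> bm (L \<Otimes>\<^sub>M L)"
  then have Fm: "F \<in> borel_measurable (L \<Otimes>\<^sub>M L)" by (simp add: bm_iff)
  have "(\<integral>x. F x \<partial>max_coupling L f h) = (\<integral>z. m z * (\<integral>x. F x \<partial>return (L \<Otimes>\<^sub>M L) (z, z)) \<partial>L) + (\<integral>p. w2 p * (\<integral>x. F x \<partial>return (L \<Otimes>\<^sub>M L) p) \<partial>(L \<Otimes>\<^sub>M L))"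
    by (rule mix(2)[OF _ _ F])
  also have "(\<integral>z. m z * (\<integral>x. F x \<partial>return (L \<Otimes>\<^sub>M L) (z, z)) \<partial>L) = (\<integral>z. m z * F (z, z) \<partial>L)"
    using Fm by (intro Bochner_Integration.integral_cong) (auto simp: integral_return space_pair_measure)
  also have "(\<integral>p. w2 p * (\<integral>x. F x \<partial>return (L \<Otimes>\<^sub>M L) p) \<partial>(L \<Otimes>\<^sub>M L)) = (\<integral>p. w2 p * F p \<partial>(L \<Otimes>\<^sub>M L))"
    using Fm by (intro Bochner_Integration.integral_cong) (auto simp: integral_return)
  finally show "(\<integral>x. F x \<partial>max_coupling L f h) =
      (\<integral>u. min (f u) (h u) * F (u, u) \<partial>L) +
      (if c = 1 then 0 else
        (\<integral>p. (f (fst p) - min (f (fst p)) (h (fst p))) * (h (snd p) - min (f (snd p)) (h (snd p))) * F p \<partial>(L \<Otimes>\<^sub>M L)) / (1 - c))"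
    by (simp add: w2_def rf_def rh_def m_def)
qed

lemma max_coupling_tensor:
  assumes a: "a \<in> bm L" and b: "b \<in> bm L"
  shows "(\<integral>x. a (fst x) * b (snd x) \<partial>max_coupling L f h) =
      (\<integral>u. min (f u) (h u) * (a u * b u) \<partial>L) +
      (if (\<integral>u. min (f u) (h u) \<partial>L) = 1 then 0 else
        (\<integral>u. (f u - min (f u) (h u)) * a u \<partial>L) * (\<integral>u. (h u - min (f u) (h u)) * b u \<partial>L) / (1 - (\<integral>u. min (f u) (h u) \<partial>L)))"
proof -
  let ?rf = "\<lambda>u. f u - min (f u) (h u)" and ?rh = "\<lambda>u. h u - min (f u) (h u)"
  have ab: "(\<lambda>x. a (fst x) * b (snd x)) \<in> bm (L \<Otimes>\<^sub>M L)"
    by (intro bm_mult bm_compose[OF measurable_fst a] bm_compose[OF measurable_snd b])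
  have i: "integrable L (\<lambda>u. ?rf u * a u)" "integrable L (\<lambda>u. ?rh u * b u)"
    using f h min_integrable by (auto intro!: integrable_mult_bm a b)
  have "(\<integral>p. ?rf (fst p) * ?rh (snd p) * (a (fst p) * b (snd p)) \<partial>(L \<Otimes>\<^sub>M L)) =
     (\<integral>p. (?rf (fst p) * a (fst p)) * (?rh (snd p) * b (snd p)) \<partial>(L \<Otimes>\<^sub>M L))"
    by (intro Bochner_Integration.integral_cong) (auto simp: ac_simps)
  also have "\<dots> = (\<integral>u. ?rf u * a u \<partial>L) * (\<integral>u. ?rh u * b u \<partial>L)"
    by (rule tensor_integral_eq[OF L L i])
  finally show ?thesis using max_coupling_integral[OF ab] by simp
qed

lemma max_coupling_marginal:
  assumes a: "a \<in> bm L"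
  shows "(\<integral>x. a (proj s x) \<partial>max_coupling L f h) = (\<integral>u. (case s of Fine \<Rightarrow> f u | Coarse \<Rightarrow> h u) * a u \<partial>L)"
proof -
  let ?c = "\<integral>u. min (f u) (h u) \<partial>L" 
  let ?rf = "\<lambda>u. f u - min (f u) (h u)" and ?rh = "\<lambda>u. h u - min (f u) (h u)"
  have i: "integrable L ?rf" "integrable L ?rh" using f h min_integrable by auto
  have i2: "integrable L (\<lambda>u. ?rf u * a u)" "integrable L (\<lambda>u. ?rh u * a u)" "integrable L (\<lambda>u. min (f u) (h u) * a u)"
    using i min_integrable by (auto intro!: integrable_mult_bm a)
  have z: "(\<integral>u. ?rf u * a u \<partial>L) = 0" "(\<integral>u. ?rh u * a u \<partial>L) = 0" if "?c = 1"
    using that res_integral i by (auto intro!: integral_zero_weight)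
  show ?thesis
  proof (cases s)
    case Fine
    have "(\<integral>x. a (fst x) * 1 \<partial>max_coupling L f h) = (\<integral>u. min (f u) (h u) * a u \<partial>L) + (\<integral>u. ?rf u * a u \<partial>L)"
      using max_coupling_tensor[OF a bm_const[of 1]] z res_integral by (cases "?c = 1") auto
    also have "\<dots> = (\<integral>u. f u * a u \<partial>L)"
      using i2 by (simp add: Bochner_Integration.integral_add[symmetric] algebra_simps)
    finally show ?thesis using Fine by simp
  next
    case Coarse
    have "(\<integral>x. 1 * a (snd x) \<partial>max_coupling L f h) = (\<integral>u. min (f u) (h u) * a u \<partial>L) + (\<integral>u. ?rh u * a u \<partial>L)"
      using max_coupling_tensor[OF bm_const[of 1] a] z res_integral by (cases "?c = 1") auto
    also have "\<dots> = (\<integral>u. h u * a u \<partial>L)"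
      using i2 by (simp add: Bochner_Integration.integral_add[symmetric] algebra_simps)
    finally show ?thesis using Coarse by simp
  qed
qed

end

section \<open>Updates of product measures\<close>

lemma bm_cong:
  assumes "\<And>x. x \<in> space Y \<Longrightarrow> f x = g x"
  shows "f \<in> bm Y \<longleftrightarrow> g \<in> bm Y"
  using measurable_cong[of Y f g "borel :: real measure", OF assms] assms by (simp add: bm_iff)

lemma bm_kernel2:
  assumes H: "H \<in> bm (Z \<Otimes>\<^sub>M Y)" and k: "k \<in> W \<rightarrow>\<^sub>M prob_algebra Y"
  shows "(\<lambda>p. \<integral>y. H (fst p, y) \<partial>k (snd p)) \<in> bm (Z \<Otimes>\<^sub>M W)"
proof -
  note k[measurable]
  have d: "(\<lambda>p. distr (k (snd p)) (Z \<Otimes>\<^sub>M Y) (\<lambda>y. (fst p, y))) \<in> Z \<Otimes>\<^sub>M W \<rightarrow>\<^sub>M prob_algebra (Z \<Otimes>\<^sub>M Y)"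
    by (rule measurable_distr_prob_space2[where M=Y]) measurable
  have "(\<integral>y. H (fst p, y) \<partial>k (snd p)) = (\<integral>y. H y \<partial>distr (k (snd p)) (Z \<Otimes>\<^sub>M Y) (\<lambda>y. (fst p, y)))"
    if "p \<in> space (Z \<Otimes>\<^sub>M W)" for p
  proof -
    have "snd p \<in> space W" "fst p \<in> space Z" using that by (auto simp: space_pair_measure)
    note kd = kernelD[OF k this(1)]
    have "(\<lambda>y. (fst p, y)) \<in> k (snd p) \<rightarrow>\<^sub>M Z \<Otimes>\<^sub>M Y"
      using measurable_Pair1'[OF \<open>fst p \<in> space Z\<close>, of Y] measurable_cong_sets[OF kd(2) refl] by blast
    then show ?thesis using H by (simp add: integral_distr bm_iff)
  qed
  then have eq: "p \<in> space (Z \<Otimes>\<^sub>M W) \<Longrightarrow> (\<integral>y. H (fst p, y) \<partial>k (snd p)) = (\<integral>y. H y \<partial>distr (k (snd p)) (Z \<Otimes>\<^sub>M Y) (\<lambda>y. (fst p, y)))" for p .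
  have "(\<lambda>p. \<integral>y. H y \<partial>distr (k (snd p)) (Z \<Otimes>\<^sub>M Y) (\<lambda>y. (fst p, y))) \<in> bm (Z \<Otimes>\<^sub>M W)"
    by (rule bm_kernel[OF d H])
  then show ?thesis by (subst bm_cong[OF eq])
qed

lemma bm_pair_integral_fst:
  assumes \<mu>: "\<mu> \<in> space (prob_algebra Y)" and \<nu>: "\<nu> \<in> space (prob_algebra Z)" and H: "H \<in> bm (Y \<Otimes>\<^sub>M Z)"
  shows "(\<integral>x. \<integral>y. H (x, y) \<partial>\<nu> \<partial>\<mu>) = (\<integral>z. H z \<partial>(\<mu> \<Otimes>\<^sub>M \<nu>))"
    and "(\<integral>y. \<integral>x. H (x, y) \<partial>\<mu> \<partial>\<nu>) = (\<integral>z. H z \<partial>(\<mu> \<Otimes>\<^sub>M \<nu>))"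
proof -
  interpret pair_sigma_finite \<mu> \<nu> 
    using pa_sigma_finite[OF \<mu>] pa_sigma_finite[OF \<nu>] by (simp add: pair_sigma_finite_def)
  have i: "integrable (\<mu> \<Otimes>\<^sub>M \<nu>) H" using bm_integrable[OF pa_pair[OF \<mu> \<nu>] H] .
  show "(\<integral>x. \<integral>y. H (x, y) \<partial>\<nu> \<partial>\<mu>) = (\<integral>z. H z \<partial>(\<mu> \<Otimes>\<^sub>M \<nu>))" by (rule integral_fst'[OF i])
  have "integrable (\<mu> \<Otimes>\<^sub>M \<nu>) (case_prod (\<lambda>x y. H (x, y)))" using i by simp
  from integral_snd[OF this] show "(\<integral>y. \<integral>x. H (x, y) \<partial>\<mu> \<partial>\<nu>) = (\<integral>z. H z \<partial>(\<mu> \<Otimes>\<^sub>M \<nu>))" by simp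
qed

lemma bm_section:
  assumes H: "H \<in> bm (Y \<Otimes>\<^sub>M Z)"
  shows "x \<in> space Y \<Longrightarrow> (\<lambda>y. H (x, y)) \<in> bm Z" and "y \<in> space Z \<Longrightarrow> (\<lambda>x. H (x, y)) \<in> bm Y"
  using bm_compose[OF measurable_Pair1' H] bm_compose[OF measurable_Pair2' H] by auto

lemma bm_integral_snd:
  assumes \<nu>: "\<nu> \<in> space (prob_algebra Z)" and H: "H \<in> bm (Y \<Otimes>\<^sub>M Z)"
  shows "(\<lambda>x. \<integral>y. H (x, y) \<partial>\<nu>) \<in> bm Y"
proof -
  (* A fixed measure is a kernel from a one-point space. *)
  have "(\<lambda>p. \<integral>y. H (fst p, y) \<partial>\<nu>) \<in> bm (Y \<Otimes>\<^sub>M count_space (UNIV :: unit set))"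
    using bm_kernel2[OF H measurable_const[OF \<nu>, of "count_space (UNIV::unit set)"]] .
  from bm_section(2)[OF this, of "()"] show ?thesis by simp
qed

text \<open>If \<open>\<beta>1\<close>, \<open>\<beta>2\<close> are Boltzmann--Gibbs updates of \<open>\<alpha>1\<close>, \<open>\<alpha>2\<close>, then \<open>\<beta>1 \<otimes> \<beta>2\<close> is one of \<open>\<alpha>1 \<otimes> \<alpha>2\<close>. With
  the normalising constants multiplied out, the limiting flow and the particle approximation are both
  instances.\<close>

lemma product_update:
  fixes \<alpha>1 \<alpha>2 \<beta>1 \<beta>2 :: "'a measure"
  assumes a: "\<alpha>1 \<in> space (prob_algebra X)" "\<alpha>2 \<in> space (prob_algebra X)"
    and b: "\<beta>1 \<in> space (prob_algebra X)" "\<beta>2 \<in> space (prob_algebra X)"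
    and k: "k1 \<in> X \<rightarrow>\<^sub>M prob_algebra X" "k2 \<in> X \<rightarrow>\<^sub>M prob_algebra X" and g: "g \<in> bm X"
    and u1: "\<And>\<phi>. \<phi> \<in> bm X \<Longrightarrow> (\<integral>x. \<phi> x \<partial>\<beta>1) * c1 = (\<integral>x. g x * (\<integral>y. \<phi> y \<partial>k1 x) \<partial>\<alpha>1)"
    and u2: "\<And>\<phi>. \<phi> \<in> bm X \<Longrightarrow> (\<integral>x. \<phi> x \<partial>\<beta>2) * c2 = (\<integral>x. g x * (\<integral>y. \<phi> y \<partial>k2 x) \<partial>\<alpha>2)"
    and H: "H \<in> bm (X \<Otimes>\<^sub>M X)"
  shows "(\<integral>z. H z \<partial>(\<beta>1 \<Otimes>\<^sub>M \<beta>2)) * (c1 * c2) =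
    (\<integral>z. g (fst z) * g (snd z) * (\<integral>w. H w \<partial>(k1 (fst z) \<Otimes>\<^sub>M k2 (snd z))) \<partial>(\<alpha>1 \<Otimes>\<^sub>M \<alpha>2))"
proof -
  define J where "J p = g (snd p) * (\<integral>y. H (fst p, y) \<partial>k2 (snd p))" for p
  have J: "J \<in> bm (X \<Otimes>\<^sub>M X)"
    unfolding J_def[abs_def] by (intro bm_mult bm_kernel2[OF H k(2)] bm_compose[OF measurable_snd g])
  define I where "I x' = (\<integral>y. J (x', y) \<partial>\<alpha>2)" for x'
  have I: "I \<in> bm X" unfolding I_def[abs_def] by (rule bm_integral_snd[OF a(2) J])
  have "(\<integral>z. H z \<partial>(\<beta>1 \<Otimes>\<^sub>M \<beta>2)) * c2 = (\<integral>x'. \<integral>y'. H (x', y') \<partial>\<beta>2 \<partial>\<beta>1) * c2"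
    using bm_pair_integral_fst(1)[OF b H] by simp
  also have "\<dots> = (\<integral>x'. (\<integral>y'. H (x', y') \<partial>\<beta>2) * c2 \<partial>\<beta>1)" by simp
  also have "\<dots> = (\<integral>x'. I x' \<partial>\<beta>1)"
    using u2 bm_section(1)[OF H] prob_algebraD(3)[OF b(1)]
    by (intro Bochner_Integration.integral_cong) (auto simp: I_def J_def)
  finally have "(\<integral>z. H z \<partial>(\<beta>1 \<Otimes>\<^sub>M \<beta>2)) * (c1 * c2) = (\<integral>x'. I x' \<partial>\<beta>1) * c1" by (simp add: ac_simps)
  also have "\<dots> = (\<integral>x. g x * (\<integral>x'. I x' \<partial>k1 x) \<partial>\<alpha>1)" by (rule u1[OF I])
  also have "\<dots> = (\<integral>x. \<integral>y. g x * (g y * (\<integral>w. H w \<partial>(k1 x \<Otimes>\<^sub>M k2 y))) \<partial>\<alpha>2 \<partial>\<alpha>1)"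
  proof (intro Bochner_Integration.integral_cong refl)
    fix x assume "x \<in> space \<alpha>1"
    then have x: "x \<in> space X" using prob_algebraD(3)[OF a(1)] by simp
    note k1x = measurable_space[OF k(1) x]
    have "(\<integral>x'. I x' \<partial>k1 x) = (\<integral>y. \<integral>x'. J (x', y) \<partial>k1 x \<partial>\<alpha>2)"
      unfolding I_def using bm_pair_integral_fst[OF k1x a(2) J] by simp
    also have "\<dots> = (\<integral>y. g y * (\<integral>w. H w \<partial>(k1 x \<Otimes>\<^sub>M k2 y)) \<partial>\<alpha>2)"
    proof (intro Bochner_Integration.integral_cong refl)
      fix y assume "y \<in> space \<alpha>2"
      then have y: "y \<in> space X" using prob_algebraD(3)[OF a(2)] by simp
      have "(\<integral>x'. J (x', y) \<partial>k1 x) = g y * (\<integral>x'. \<integral>y'. H (x', y') \<partial>k2 y \<partial>k1 x)" by (simp add: J_def)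
      also have "(\<integral>x'. \<integral>y'. H (x', y') \<partial>k2 y \<partial>k1 x) = (\<integral>w. H w \<partial>(k1 x \<Otimes>\<^sub>M k2 y))"
        by (rule bm_pair_integral_fst(1)[OF k1x measurable_space[OF k(2) y] H])
      finally show "(\<integral>x'. J (x', y) \<partial>k1 x) = g y * (\<integral>w. H w \<partial>(k1 x \<Otimes>\<^sub>M k2 y))" .
    qed
    finally show "g x * (\<integral>x'. I x' \<partial>k1 x) = (\<integral>y. g x * (g y * (\<integral>w. H w \<partial>(k1 x \<Otimes>\<^sub>M k2 y))) \<partial>\<alpha>2)" by simp
  qed
  also have "\<dots> = (\<integral>z. g (fst z) * g (snd z) * (\<integral>w. H w \<partial>(k1 (fst z) \<Otimes>\<^sub>M k2 (snd z))) \<partial>(\<alpha>1 \<Otimes>\<^sub>M \<alpha>2))"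
  proof -
    have kk: "(\<lambda>z. k1 (fst z) \<Otimes>\<^sub>M k2 (snd z)) \<in> X \<Otimes>\<^sub>M X \<rightarrow>\<^sub>M prob_algebra (X \<Otimes>\<^sub>M X)"
      using measurable_compose[OF measurable_fst k(1)] measurable_compose[OF measurable_snd k(2)]
      by (rule measurable_pair_prob)
    have "(\<lambda>z. g (fst z) * g (snd z) * (\<integral>w. H w \<partial>(k1 (fst z) \<Otimes>\<^sub>M k2 (snd z)))) \<in> bm (X \<Otimes>\<^sub>M X)"
      by (intro bm_mult bm_kernel[OF kk H] bm_compose[OF measurable_fst g] bm_compose[OF measurable_snd g])
    from bm_pair_integral_fst(1)[OF a this] show ?thesis by (simp add: mult.assoc)
  qed
  finally show ?thesis .
qed

section \<open>The Feynman--Kac flow\<close>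

locale feynman_kac_pos = coupled_feynman_kac X G eta0 M etac0 Mc
  for X :: "'a measure" and G eta0 M etac0 Mc +
  assumes gamma_pos: "\<And>s p. 0 < measure (gamma X G eta0 M s p) (space X)"
begin

abbreviation et :: "level \<Rightarrow> nat \<Rightarrow> 'a measure" where "et \<equiv> eta X G eta0 M"
abbreviation Y :: "('a \<times> 'a) measure" where "Y \<equiv> X \<Otimes>\<^sub>M X"
abbreviation path where "path \<equiv> path_law X eta0 M"
abbreviation gam where "gam \<equiv> gamma X G eta0 M"
abbreviation Gavg where "Gavg N p s \<equiv> avg N (\<lambda>z. G p (proj s z))"

definition Mop :: "level \<Rightarrow> nat \<Rightarrow> ('a \<Rightarrow> real) \<Rightarrow> 'a \<Rightarrow> real" where
  "Mop s p \<phi> x = (\<integral>y. \<phi> y \<partial>M s (Suc p) x)"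

lemma G_bm: "G n \<in> bm X"
  using G_measurable G_bounded by (simp add: bm_def)

lemma M_k: "M s (Suc p) \<in> X \<rightarrow>\<^sub>M prob_algebra X"
  using M_kernel by simp

lemma Mc_k: "Mc (Suc p) \<in> Y \<rightarrow>\<^sub>M prob_algebra Y"
  using Mc_kernel by simp

lemma Mop_bm: "\<phi> \<in> bm X \<Longrightarrow> Mop s p \<phi> \<in> bm X"
  unfolding Mop_def[abs_def] by (rule bm_kernel[OF M_k])

lemma Mc_Mop:
  assumes z: "z \<in> space Y" and \<phi>: "\<phi> \<in> bm X"
  shows "(\<integral>w. \<phi> (proj s w) \<partial>Mc (Suc p) z) = Mop s p \<phi> (proj s z)"
proof -
  have "proj s \<in> Mc (Suc p) z \<rightarrow>\<^sub>M X"
    using proj_measurable[of s X] measurable_cong_sets[OF kernelD(2)[OF Mc_k z, of p] refl] by blast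
  then have "(\<integral>w. \<phi> w \<partial>distr (Mc (Suc p) z) X (proj s)) = (\<integral>w. \<phi> (proj s w) \<partial>Mc (Suc p) z)"
    using \<phi> by (intro integral_distr) (auto simp: bm_iff)
  then show ?thesis using Mc_marginal[OF _ z, of "Suc p" s] by (simp add: Mop_def)
qed

definition pstep :: "level \<Rightarrow> nat \<Rightarrow> (nat \<Rightarrow> 'a) \<Rightarrow> (nat \<Rightarrow> 'a) measure" where
  "pstep s n x = distr (M s (Suc n) (x n)) (PiM {..Suc n} (\<lambda>_. X)) (\<lambda>y. x(Suc n := y))"

lemma upd_measurable: "(\<lambda>(x, y). x(Suc n := y)) \<in> PiM {..n} (\<lambda>_. X) \<Otimes>\<^sub>M X \<rightarrow>\<^sub>M PiM {..Suc n} (\<lambda>_. X)"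
  using measurable_add_dim[of "Suc n" "{..n}" "\<lambda>_. X"] by (simp add: atMost_Suc)

lemma pstep_kernel: "pstep s n \<in> PiM {..n} (\<lambda>_. X) \<rightarrow>\<^sub>M prob_algebra (PiM {..Suc n} (\<lambda>_. X))"
  unfolding pstep_def[abs_def]
proof (rule measurable_distr_prob_space2[where M=X])
  show "(\<lambda>x. M s (Suc n) (x n)) \<in> PiM {..n} (\<lambda>_. X) \<rightarrow>\<^sub>M prob_algebra X"
    by (rule measurable_compose[OF _ M_k]) measurable
qed (rule upd_measurable)

lemma path_prob: "path s n \<in> space (prob_algebra (PiM {..n} (\<lambda>_. X)))"
proof (induction n)
  case 0
  have "(\<lambda>x. \<lambda>i\<in>{..0}. x) \<in> X \<rightarrow>\<^sub>M PiM {..0::nat} (\<lambda>_. X)" by measurable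
  from measurable_space[OF measurable_distr_prob_space[OF this] eta0_prob[of s]] show ?case by simp
next
  case (Suc n)
  have "path s n \<bind> pstep s n \<in> space (prob_algebra (PiM {..Suc n} (\<lambda>_. X)))"
    using measurable_space[OF measurable_bind_prob_space[OF measurable_const[OF Suc] pstep_kernel], of undefined "count_space UNIV"]
    by simp
  then show ?case by (simp add: pstep_def[abs_def])
qed

lemma path_integral_Suc:
  assumes F: "F \<in> bm (PiM {..Suc n} (\<lambda>_. X))"
  shows "(\<integral>x. F x \<partial>path s (Suc n)) = (\<integral>x. (\<integral>y. F (x(Suc n := y)) \<partial>M s (Suc n) (x n)) \<partial>path s n)"
proof -
  have "(\<integral>x. F x \<partial>path s (Suc n)) = (\<integral>x. (\<integral>y. F y \<partial>pstep s n x) \<partial>path s n)"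
    using integral_bind_bm[OF path_prob pstep_kernel F, of s s] by (simp add: pstep_def[abs_def])
  also have "\<dots> = (\<integral>x. (\<integral>y. F (x(Suc n := y)) \<partial>M s (Suc n) (x n)) \<partial>path s n)"
  proof (intro Bochner_Integration.integral_cong refl)
    fix x assume "x \<in> space (path s n)"
    then have x: "x \<in> space (PiM {..n} (\<lambda>_. X))" using prob_algebraD(3)[OF path_prob] by simp
    have xn: "x n \<in> space X" using x by (auto simp: space_PiM)
    have "(\<lambda>y. x(Suc n := y)) \<in> X \<rightarrow>\<^sub>M PiM {..Suc n} (\<lambda>_. X)"
      using measurable_compose[OF measurable_Pair1'[OF x] upd_measurable] by simp
    then have "(\<lambda>y. x(Suc n := y)) \<in> M s (Suc n) (x n) \<rightarrow>\<^sub>M PiM {..Suc n} (\<lambda>_. X)"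
      using measurable_cong_sets[OF kernelD(2)[OF M_k xn] refl] by blast
    then show "(\<integral>y. F y \<partial>pstep s n x) = (\<integral>y. F (x(Suc n := y)) \<partial>M s (Suc n) (x n))"
      unfolding pstep_def using F by (intro integral_distr) (auto simp: bm_iff)
  qed
  finally show ?thesis .
qed

definition wt :: "nat \<Rightarrow> (nat \<Rightarrow> 'a) \<Rightarrow> real" where "wt n x = (\<Prod>p<n. G p (x p))"

lemma comp_bm: "i \<in> {..n} \<Longrightarrow> f \<in> bm X \<Longrightarrow> (\<lambda>x. f (x i)) \<in> bm (PiM {..n::nat} (\<lambda>_. X))"
  by (rule bm_compose[OF measurable_component_singleton])

lemma wt_bm: "m \<le> Suc n \<Longrightarrow> wt m \<in> bm (PiM {..n} (\<lambda>_. X))"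
proof (induction m)
  case 0 then show ?case by (simp add: wt_def[abs_def])
next
  case (Suc m)
  then have "(\<lambda>x. wt m x * G m (x m)) \<in> bm (PiM {..n} (\<lambda>_. X))" by (intro bm_mult comp_bm G_bm) auto
  then show ?case by (simp add: wt_def[abs_def])
qed

lemma wt_nonneg: "m \<le> Suc n \<Longrightarrow> x \<in> space (PiM {..n} (\<lambda>_. X)) \<Longrightarrow> 0 \<le> wt m x"
  unfolding wt_def by (intro prod_nonneg ballI G_nonneg) (auto simp: space_PiM)

lemma gamma_sets: "sets (gam s n) = sets X"
  by (simp add: gamma_def)

lemma gamma_integral:
  assumes f: "f \<in> bm X"
  shows "(\<integral>x. f x \<partial>gam s n) = (\<integral>x. wt n x * f (x n) \<partial>path s n)"
    and "integrable (gam s n) f"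
proof -
  note c = prob_algebraD[OF path_prob[of s n]]
  have s: "borel_measurable (path s n) = (borel_measurable (PiM {..n} (\<lambda>_. X)) :: ((nat \<Rightarrow> 'a) \<Rightarrow> real) set)"
    using measurable_cong_sets[OF c(2) refl] .
  have w: "wt n \<in> borel_measurable (path s n)" using wt_bm[of n n] by (simp add: s bm_iff)
  have m: "(\<lambda>x. x n) \<in> density (path s n) (\<lambda>x. ennreal (wt n x)) \<rightarrow>\<^sub>M X"
    using measurable_component_singleton[of n "{..n}" "\<lambda>_. X"] measurable_cong_sets[OF c(2) refl, of X] by simp
  have fm: "(\<lambda>x. f (x n)) \<in> borel_measurable (path s n)" using comp_bm[OF _ f, of n n] by (simp add: s bm_iff)
  have pos: "AE x in path s n. 0 \<le> wt n x" using wt_nonneg[of n n] c(3) by (intro AE_I2) auto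
  have "(\<integral>x. f x \<partial>gam s n) = (\<integral>x. f (x n) \<partial>density (path s n) (\<lambda>x. ennreal (wt n x)))"
    unfolding gamma_def wt_def[symmetric] using f by (intro integral_distr m) (auto simp: bm_iff)
  also have "\<dots> = (\<integral>x. wt n x * f (x n) \<partial>path s n)"
    using integral_density[OF fm w pos] by simp
  finally show "(\<integral>x. f x \<partial>gam s n) = (\<integral>x. wt n x * f (x n) \<partial>path s n)" .
  have "integrable (path s n) (\<lambda>x. wt n x *\<^sub>R f (x n))"
    using bm_integrable[OF path_prob bm_mult[OF wt_bm[of n n] comp_bm[OF _ f, of n n]]] by simp
  then have "integrable (density (path s n) (\<lambda>x. ennreal (wt n x))) (\<lambda>x. f (x n))"
    using integrable_density[OF fm w pos] by simp
  then show "integrable (gam s n) f"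
    unfolding gamma_def wt_def[symmetric] using f m by (subst integrable_distr_eq) (auto simp: bm_iff)
qed

lemma gamma_Suc:
  assumes f: "f \<in> bm X"
  shows "(\<integral>x. f x \<partial>gam s (Suc n)) = (\<integral>x. G n x * Mop s n f x \<partial>gam s n)"
proof -
  have "(\<integral>x. f x \<partial>gam s (Suc n)) = (\<integral>x. wt (Suc n) x * f (x (Suc n)) \<partial>path s (Suc n))"
    by (rule gamma_integral(1)[OF f])
  also have "\<dots> = (\<integral>x. (\<integral>y. wt (Suc n) (x(Suc n := y)) * f ((x(Suc n := y)) (Suc n)) \<partial>M s (Suc n) (x n)) \<partial>path s n)"
    by (intro path_integral_Suc bm_mult wt_bm comp_bm f) auto
  also have "\<dots> = (\<integral>x. wt n x * (G n (x n) * Mop s n f (x n)) \<partial>path s n)"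
  proof (intro Bochner_Integration.integral_cong refl)
    fix x
    have "wt (Suc n) (x(Suc n := y)) = wt n x * G n (x n)" for y
      unfolding wt_def by (simp add: lessThan_Suc ac_simps)
    then show "(\<integral>y. wt (Suc n) (x(Suc n := y)) * f ((x(Suc n := y)) (Suc n)) \<partial>M s (Suc n) (x n)) = wt n x * (G n (x n) * Mop s n f (x n))"
      by (simp add: Mop_def mult.assoc)
  qed
  also have "\<dots> = (\<integral>x. G n x * Mop s n f x \<partial>gam s n)"
    by (rule gamma_integral(1)[symmetric]) (intro bm_mult G_bm Mop_bm f)
  finally show ?thesis .
qed

definition mass :: "level \<Rightarrow> nat \<Rightarrow> real" where "mass s n = measure (gam s n) (space X)"

lemma gamma_finite: "finite_measure (gam s n)"
proof -
  have "space (gam s n) = space X" by (simp add: gamma_def)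
  moreover have "integrable (gam s n) (\<lambda>_. 1 :: real)" using gamma_integral(2)[OF bm_const] .
  ultimately show ?thesis by (intro finite_measureI) (auto simp: integrable_iff_bounded less_top[symmetric])
qed

lemma mass_eq: "mass s n = (\<integral>x. 1 \<partial>gam s n)"
  by (simp add: mass_def gamma_def)

lemma eta_density: "et s n = density (gam s n) (\<lambda>_. ennreal (1 / mass s n))"
proof (rule measure_eqI)
  interpret finite_measure "gam s n" by (rule gamma_finite)
  have "1 / emeasure (gam s n) (space X) = ennreal (1 / mass s n)"
    using gamma_pos[of s n] by (simp add: emeasure_eq_measure mass_def divide_ennreal flip: ennreal_1)
  then show "emeasure (et s n) A = emeasure (density (gam s n) (\<lambda>_. ennreal (1 / mass s n))) A" if "A \<in> sets (et s n)" for A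
    using that by (simp add: eta_def emeasure_density_const)
qed (simp add: eta_def)

lemma eta_integral:
  assumes "f \<in> bm X"
  shows "(\<integral>x. f x \<partial>et s n) = (\<integral>x. f x \<partial>gam s n) / mass s n"
proof -
  have "f \<in> borel_measurable (gam s n)" using gamma_integral(2)[OF assms] by auto
  then show ?thesis unfolding eta_density using gamma_pos[of s n]
    by (subst integral_density) (auto simp: mass_def)
qed

lemma eta_prob: "et s n \<in> space (prob_algebra X)"
proof -
  interpret finite_measure "gam s n" by (rule gamma_finite)
  have "emeasure (et s n) (space X) = ennreal (1 / mass s n) * ennreal (mass s n)"
    unfolding eta_density using gamma_sets by (simp add: emeasure_density_const emeasure_eq_measure mass_def)
  also have "\<dots> = 1" using gamma_pos[of s n] by (simp add: mass_def flip: ennreal_mult')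
  finally have "emeasure (et s n) (space X) = 1" .
  moreover have "sets (et s n) = sets X" by (simp add: eta_def gamma_sets)
  ultimately show ?thesis
    using sets_eq_imp_space_eq[of "et s n" X] by (simp add: space_prob_algebra prob_spaceI)
qed

lemma eta_G: "(\<integral>x. G n x \<partial>et s n) = mass s (Suc n) / mass s n"
proof -
  have "Mop s n (\<lambda>_. 1) x = 1" if "x \<in> space X" for x
    using prob_space.prob_space[OF kernelD(1)[OF M_k that]] by (simp add: Mop_def)
  then have "(\<integral>x. G n x * Mop s n (\<lambda>_. 1) x \<partial>gam s n) = (\<integral>x. G n x \<partial>gam s n)"
    by (intro Bochner_Integration.integral_cong) (auto simp: gamma_def)
  then show ?thesis using gamma_Suc[OF bm_const[of 1], of s n] eta_integral[OF G_bm] by (simp add: mass_eq)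
qed

lemma eta_G_pos: "0 < (\<integral>x. G n x \<partial>et s n)"
  using gamma_pos[of s] by (simp add: eta_G mass_def)

lemma eta_Suc:
  assumes f: "f \<in> bm X"
  shows "(\<integral>x. f x \<partial>et s (Suc n)) * (\<integral>x. G n x \<partial>et s n) = (\<integral>x. G n x * Mop s n f x \<partial>et s n)"
  using gamma_pos[of s n] gamma_pos[of s "Suc n"]
  by (simp add: eta_G eta_integral[OF f] eta_integral[OF bm_mult[OF G_bm Mop_bm[OF f]]] gamma_Suc[OF f] mass_def)

lemma eta_zero:
  assumes f: "f \<in> bm X"
  shows "(\<integral>x. f x \<partial>et s 0) = (\<integral>x. f x \<partial>eta0 s)"
proof -
  have *: "(\<integral>x. f x \<partial>gam s 0) = (\<integral>x. f x \<partial>eta0 s)" if f: "f \<in> bm X" for f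
  proof -
    have "(\<lambda>x. \<lambda>i\<in>{..0::nat}. x) \<in> X \<rightarrow>\<^sub>M PiM {..0::nat} (\<lambda>_. X)" by measurable
    then have m: "(\<lambda>x. \<lambda>i\<in>{..0}. x) \<in> eta0 s \<rightarrow>\<^sub>M PiM {..0::nat} (\<lambda>_. X)"
      using kernel_cong_space[OF eta0_prob] by blast
    have "(\<integral>x. f x \<partial>gam s 0) = (\<integral>x. f (x 0) \<partial>path s 0)"
      using gamma_integral(1)[OF f, of s 0] by (simp add: wt_def)
    also have "\<dots> = (\<integral>x. f x \<partial>eta0 s)"
      using comp_bm[OF _ f, of 0 0] integral_distr[OF m, of "\<lambda>x. f (x 0)"] by (simp add: bm_iff)
    finally show ?thesis .
  qed
  have "mass s 0 = 1" using *[OF bm_const[of 1]] prob_space.prob_space[OF prob_algebraD(1)[OF eta0_prob[of s]]] by (simp add: mass_eq)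
  then show ?thesis using *[OF f] eta_integral[OF f] by simp
qed

definition ctr :: "level \<Rightarrow> nat \<Rightarrow> ('a \<Rightarrow> real) \<Rightarrow> 'a \<Rightarrow> real" where
  "ctr s p \<phi> x = \<phi> x - (\<integral>y. \<phi> y \<partial>et s p)"

lemma ctr_bm: "\<phi> \<in> bm X \<Longrightarrow> ctr s p \<phi> \<in> bm X"
  unfolding ctr_def[abs_def] by auto

lemma ctr_integral: "\<phi> \<in> bm X \<Longrightarrow> (\<integral>x. ctr s p \<phi> x \<partial>et s p) = 0"
  unfolding ctr_def using bm_integrable[OF eta_prob, of \<phi> s p] prob_space.prob_space[OF prob_algebraD(1)[OF eta_prob[of s p]]]
    prob_space.finite_measure[OF prob_algebraD(1)[OF eta_prob[of s p]]]
  by (simp add: finite_measure.integrable_const)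

definition GM :: "level \<Rightarrow> nat \<Rightarrow> ('a \<Rightarrow> real) \<Rightarrow> 'a \<Rightarrow> real" where
  "GM s p \<phi> x = G p x * Mop s p (ctr s (Suc p) \<phi>) x"

lemma GM_bm: "\<phi> \<in> bm X \<Longrightarrow> GM s p \<phi> \<in> bm X"
  unfolding GM_def[abs_def] by (intro bm_mult G_bm Mop_bm ctr_bm)

lemma GM_integral: "\<phi> \<in> bm X \<Longrightarrow> (\<integral>x. GM s p \<phi> x \<partial>et s p) = 0"
  unfolding GM_def using eta_Suc[OF ctr_bm[of \<phi> s "Suc p"], of s p] ctr_integral[of \<phi> s "Suc p"] by simp

text \<open>\<open>Q\<^bsub>p+1\<^esub>(\<phi> - \<eta>\<^bsub>p+1\<^esub>(\<phi>)) / \<eta>\<^bsub>p\<^esub>(G\<^bsub>p\<^esub>)\<close>: the derivative at \<open>\<eta>\<^bsub>p\<^esub>\<close> of the one-step map of the flow,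
  tested against \<open>\<phi>\<close>.\<close>

definition Qt :: "level \<Rightarrow> nat \<Rightarrow> ('a \<Rightarrow> real) \<Rightarrow> 'a \<Rightarrow> real" where
  "Qt s p \<phi> x = GM s p \<phi> x / (\<integral>y. G p y \<partial>et s p)"

lemma Qt_bm: "\<phi> \<in> bm X \<Longrightarrow> Qt s p \<phi> \<in> bm X"
  unfolding Qt_def[abs_def] by (intro bm_divide GM_bm)

lemma Qt_integral: "\<phi> \<in> bm X \<Longrightarrow> (\<integral>x. Qt s p \<phi> x \<partial>et s p) = 0"
  unfolding Qt_def by (simp add: GM_integral)

end

lemma measure_eq_bm:
  assumes \<mu>: "\<mu> \<in> space (prob_algebra Y)" and \<nu>: "\<nu> \<in> space (prob_algebra Y)"
    and eq: "\<And>f. f \<in> bm Y \<Longrightarrow> (\<integral>x. f x \<partial>\<mu>) = (\<integral>x. f x \<partial>\<nu>)"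
  shows "\<mu> = \<nu>"
proof (rule measure_eqI)
  show "sets \<mu> = sets \<nu>" using prob_algebraD(2)[OF \<mu>] prob_algebraD(2)[OF \<nu>] by simp
  interpret m: prob_space \<mu> using prob_algebraD(1)[OF \<mu>] .
  interpret n: prob_space \<nu> using prob_algebraD(1)[OF \<nu>] .
  fix A assume "A \<in> sets \<mu>"
  then have A: "A \<in> sets Y" using prob_algebraD(2)[OF \<mu>] by simp
  from eq[OF bm_indicator[OF A]] have "measure \<mu> A = measure \<nu> A"
    using A prob_algebraD(2)[OF \<mu>] prob_algebraD(2)[OF \<nu>] prob_algebraD(3)[OF \<mu>] prob_algebraD(3)[OF \<nu>] sets.sets_into_space[OF A]
    by (simp add: Int_absorb2)
  then show "emeasure \<mu> A = emeasure \<nu> A" by (simp add: m.emeasure_eq_measure n.emeasure_eq_measure)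
qed

text \<open>A function of the fine coordinate of one particle and the coarse coordinate of another. For two
  independent particles only the two marginals of their common law matter (\<open>cross_integral\<close>), so averages
  of such functions behave alike in all algorithms.\<close>

definition cross :: "('a \<times> 'a \<Rightarrow> real) \<Rightarrow> ('a \<times> 'a) \<times> ('a \<times> 'a) \<Rightarrow> real" where
  "cross H p = H (fst (fst p), snd (snd p))"

lemma cross_bm: "H \<in> bm (X \<Otimes>\<^sub>M X) \<Longrightarrow> cross H \<in> bm ((X \<Otimes>\<^sub>M X) \<Otimes>\<^sub>M (X \<Otimes>\<^sub>M X))"
  unfolding cross_def[abs_def] by (rule bm_compose) measurable

lemma cross_space: "p \<in> space ((X \<Otimes>\<^sub>M X) \<Otimes>\<^sub>M (X \<Otimes>\<^sub>M X)) \<Longrightarrow> (fst (fst p), snd (snd p)) \<in> space (X \<Otimes>\<^sub>M X)"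
  by (auto simp: space_pair_measure)

lemma distr_proj_prob:
  "\<nu> \<in> space (prob_algebra (X \<Otimes>\<^sub>M X)) \<Longrightarrow> distr \<nu> X (proj s) \<in> space (prob_algebra X)"
  using measurable_space[OF measurable_distr_prob_space[OF proj_measurable]] .

lemma integral_distr_proj:
  assumes \<nu>: "\<nu> \<in> space (prob_algebra (X \<Otimes>\<^sub>M X))" and \<phi>: "\<phi> \<in> bm X"
  shows "(\<integral>x. \<phi> x \<partial>distr \<nu> X (proj s)) = (\<integral>z. \<phi> (proj s z) \<partial>\<nu>)"
  by (rule integral_distr[OF kernel_cong_space[OF \<nu> proj_measurable] bm_measurable[OF \<phi>]])

lemma cross_integral:
  assumes \<nu>: "\<nu> \<in> space (prob_algebra (X \<Otimes>\<^sub>M X))" and H: "H \<in> bm (X \<Otimes>\<^sub>M X)"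
  shows "(\<integral>p. cross H p \<partial>(\<nu> \<Otimes>\<^sub>M \<nu>)) = (\<integral>z. H z \<partial>(distr \<nu> X (proj Fine) \<Otimes>\<^sub>M distr \<nu> X (proj Coarse)))"
proof -
  note d = distr_proj_prob[OF \<nu>]
  have "(\<integral>p. cross H p \<partial>(\<nu> \<Otimes>\<^sub>M \<nu>)) = (\<integral>z. \<integral>w. H (fst z, snd w) \<partial>\<nu> \<partial>\<nu>)"
    using bm_pair_integral_fst(1)[OF \<nu> \<nu> cross_bm[OF H]] by (simp add: cross_def)
  also have "\<dots> = (\<integral>z. (\<lambda>x. \<integral>y. H (x, y) \<partial>distr \<nu> X (proj Coarse)) (proj Fine z) \<partial>\<nu>)"
  proof (intro Bochner_Integration.integral_cong refl)
    fix z assume "z \<in> space \<nu>"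
    then have "fst z \<in> space X" using prob_algebraD(3)[OF \<nu>] proj_space[of z X Fine] by simp
    from integral_distr_proj[OF \<nu> bm_section(1)[OF H this], of Coarse]
    show "(\<integral>w. H (fst z, snd w) \<partial>\<nu>) = (\<lambda>x. \<integral>y. H (x, y) \<partial>distr \<nu> X (proj Coarse)) (proj Fine z)" by simp
  qed
  also have "\<dots> = (\<integral>x. \<integral>y. H (x, y) \<partial>distr \<nu> X (proj Coarse) \<partial>distr \<nu> X (proj Fine))"
    by (rule integral_distr_proj[OF \<nu>, symmetric]) (rule bm_integral_snd[OF d H])
  also have "\<dots> = (\<integral>z. H z \<partial>(distr \<nu> X (proj Fine) \<Otimes>\<^sub>M distr \<nu> X (proj Coarse)))"
    by (rule bm_pair_integral_fst(1)[OF d d H])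
  finally show ?thesis .
qed

lemma avg2_cross_empirical:
  assumes N: "N \<ge> 1" and u: "u \<in> space (conf N (X \<Otimes>\<^sub>M X))" and H: "H \<in> bm (X \<Otimes>\<^sub>M X)"
  shows "(\<integral>z. H z \<partial>(empirical X N (\<lambda>i. proj Fine (u i)) \<Otimes>\<^sub>M empirical X N (\<lambda>i. proj Coarse (u i)))) = avg2 N (cross H) u"
proof -
  have up: "i \<in> {1..N} \<Longrightarrow> proj s (u i) \<in> space X" for i s using conf_space[OF u] proj_space by blast
  have e: "empirical X N (\<lambda>i. proj s (u i)) \<in> space (prob_algebra X)" for s
    using N up by (rule empirical_prob)
  have "(\<integral>z. H z \<partial>(empirical X N (\<lambda>i. proj Fine (u i)) \<Otimes>\<^sub>M empirical X N (\<lambda>i. proj Coarse (u i))))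
    = (\<integral>x. \<integral>y. H (x, y) \<partial>empirical X N (\<lambda>i. proj Coarse (u i)) \<partial>empirical X N (\<lambda>i. proj Fine (u i)))"
    by (rule bm_pair_integral_fst(1)[OF e e H, symmetric])
  also have "\<dots> = avg N (\<lambda>x. \<integral>y. H (x, y) \<partial>empirical X N (\<lambda>i. proj Coarse (u i))) (\<lambda>i. proj Fine (u i))"
    by (rule integral_empirical[OF up bm_measurable[OF bm_integral_snd[OF e[of Coarse] H]]])
  also have "\<dots> = avg2 N (cross H) u"
    unfolding avg2_def avg_def[of N _ u] avg_def[of N _ "\<lambda>i. proj Fine (u i)"]
  proof (intro arg_cong2[where f="(/)"] sum.cong refl)
    fix i assume i: "i \<in> {1..N}"
    have "(\<integral>y. H (proj Fine (u i), y) \<partial>empirical X N (\<lambda>i. proj Coarse (u i))) = avg N (\<lambda>y. H (proj Fine (u i), y)) (\<lambda>i. proj Coarse (u i))"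
      by (rule integral_empirical[OF up bm_measurable[OF bm_section(1)[OF H up[OF i]]]])
    then show "(\<integral>y. H (proj Fine (u i), y) \<partial>empirical X N (\<lambda>i. proj Coarse (u i))) = (\<Sum>ia\<in>{1..N}. cross H (u i, u ia)) / real N"
      by (simp add: avg_def cross_def)
  qed
  finally show ?thesis .
qed

section \<open>Law of large numbers for the marginals\<close>

text \<open>\<open>\<pi> N p\<close> is the law of the configuration at time \<open>p\<close>, and \<open>ell p\<close> the limiting law of one particle.
  \<open>K N p\<close> is a kernel on all configurations, but it is tied to the potentials only where the normalising
  constants are positive, which is the case almost surely.\<close>

locale particle_scheme = feynman_kac_pos X G eta0 M etac0 Mc
  for X :: "'a measure" and G eta0 M etac0 Mc +
  fixes ell :: "nat \<Rightarrow> ('a \<times> 'a) measure"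
    and \<pi> :: "nat \<Rightarrow> nat \<Rightarrow> (nat \<Rightarrow> 'a \<times> 'a) measure"
    and K :: "nat \<Rightarrow> nat \<Rightarrow> (nat \<Rightarrow> 'a \<times> 'a) \<Rightarrow> ('a \<times> 'a) measure"
  assumes ell_prob: "ell p \<in> space (prob_algebra (X \<Otimes>\<^sub>M X))"
    and ell_marg: "\<phi> \<in> bm X \<Longrightarrow> (\<integral>z. \<phi> (proj s z) \<partial>ell p) = (\<integral>x. \<phi> x \<partial>eta X G eta0 M s p)"
    and pi_0: "N \<ge> 1 \<Longrightarrow> \<pi> N 0 = PiM {1..N} (\<lambda>_. ell 0)"
    and pi_Suc: "N \<ge> 1 \<Longrightarrow> \<pi> N (Suc p) = \<pi> N p \<bind> (\<lambda>u. PiM {1..N} (\<lambda>_. K N p u))"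
    and K_kernel: "N \<ge> 1 \<Longrightarrow> K N p \<in> conf N (X \<Otimes>\<^sub>M X) \<rightarrow>\<^sub>M prob_algebra (X \<Otimes>\<^sub>M X)"
    and pos: "N \<ge> 1 \<Longrightarrow> AE u in \<pi> N p. 0 < avg N (\<lambda>z. G p (proj s z)) u"
    and K_marg: "N \<ge> 1 \<Longrightarrow> u \<in> space (conf N (X \<Otimes>\<^sub>M X)) \<Longrightarrow> (\<And>s. 0 < avg N (\<lambda>z. G p (proj s z)) u) \<Longrightarrow> \<phi> \<in> bm X \<Longrightarrow>
      (\<integral>z. \<phi> (proj s z) \<partial>K N p u) * avg N (\<lambda>z. G p (proj s z)) u
        = avg N (\<lambda>z. G p (proj s z) * (\<integral>y. \<phi> y \<partial>M s (Suc p) (proj s z))) u"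
begin

lemma pi_prob: "N \<ge> 1 \<Longrightarrow> \<pi> N p \<in> space (prob_algebra (conf N Y))"
proof (induction p)
  case 0
  then show ?case using PiM_prob_algebra[OF ell_prob, of N] by (simp add: pi_0)
next
  case (Suc p)
  have "\<pi> N p \<bind> (\<lambda>u. PiM {1..N} (\<lambda>_. K N p u)) \<in> space (prob_algebra (conf N Y))"
    using measurable_space[OF measurable_bind_prob_space[OF measurable_const[OF Suc.IH[OF Suc.prems]] PiM_kernel[OF K_kernel[OF Suc.prems]]], of undefined "count_space UNIV"]
    by simp
  then show ?case using Suc.prems by (simp add: pi_Suc)
qed

sublocale law: law_sequence "\<lambda>N. \<pi> N p" for p
  by (rule law_sequence.intro) (rule prob_algebraD(1)[OF pi_prob])

lemma pi_space: "N \<ge> 1 \<Longrightarrow> space (\<pi> N p) = space (conf N Y)"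
  using prob_algebraD(3)[OF pi_prob] .

lemma pi_bm: "N \<ge> 1 \<Longrightarrow> f \<in> bm (conf N Y) \<Longrightarrow> f \<in> bm (\<pi> N p)"
  using prob_integrable_bm[OF pi_prob] .

lemma pi_int: "N \<ge> 1 \<Longrightarrow> f \<in> bm (conf N Y) \<Longrightarrow> integrable (\<pi> N p) f"
  using bm_integrable[OF pi_prob] .

lemma pi_meas: "N \<ge> 1 \<Longrightarrow> f \<in> bm (conf N Y) \<Longrightarrow> f \<in> borel_measurable (\<pi> N p)"
  using pi_bm by (simp add: bm_iff)

lemma pi_integral_Suc:
  assumes N: "N \<ge> 1" and F: "F \<in> bm (conf N Y)"
  shows "(\<integral>u. F u \<partial>\<pi> N (Suc p)) = (\<integral>u. (\<integral>v. F v \<partial>PiM {1..N} (\<lambda>_. K N p u)) \<partial>\<pi> N p)"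
  unfolding pi_Suc[OF N] by (rule integral_bind_bm[OF pi_prob[OF N] PiM_kernel[OF K_kernel[OF N]] F])

lemma K_prob: "N \<ge> 1 \<Longrightarrow> u \<in> space (conf N Y) \<Longrightarrow> K N p u \<in> space (prob_algebra Y)"
  using measurable_space[OF K_kernel] .

lemma PiK_prob: "N \<ge> 1 \<Longrightarrow> u \<in> space (conf N Y) \<Longrightarrow> PiM {1..N} (\<lambda>_. K N p u) \<in> space (prob_algebra (conf N Y))"
  using PiM_prob_algebra[OF K_prob] .

lemma avg_proj_bm: "\<phi> \<in> bm X \<Longrightarrow> avg N (\<lambda>z. \<phi> (proj s z)) \<in> bm (conf N Y)"
  by (rule avg_bm[OF bm_proj])

lemma K_bm: "N \<ge> 1 \<Longrightarrow> f \<in> bm Y \<Longrightarrow> (\<lambda>u. \<integral>z. f z \<partial>K N p u) \<in> bm (conf N Y)"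
  by (rule bm_kernel[OF K_kernel])

lemma K_abs_le:
  fixes f :: "'a \<times> 'a \<Rightarrow> real"
  shows "N \<ge> 1 \<Longrightarrow> u \<in> space (conf N Y) \<Longrightarrow> (\<And>z. z \<in> space Y \<Longrightarrow> \<bar>f z\<bar> \<le> B) \<Longrightarrow> \<bar>\<integral>z. f z \<partial>K N p u\<bar> \<le> B"
  by (rule prob_space.abs_integral_le[OF prob_algebraD(1)[OF K_prob]]) (simp_all add: prob_algebraD(3)[OF K_prob])

lemma pos_all: "N \<ge> 1 \<Longrightarrow> AE u in \<pi> N p. u \<in> space (conf N Y) \<and> (\<forall>s. 0 < Gavg N p s u)"
proof -
  assume N: "N \<ge> 1"
  have "AE u in \<pi> N p. 0 < Gavg N p Fine u \<and> 0 < Gavg N p Coarse u \<and> u \<in> space (conf N Y)"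
    using pos[OF N, of p Fine] pos[OF N, of p Coarse] AE_space[of "\<pi> N p"] pi_space[OF N, of p] by auto
  then show ?thesis
  proof eventually_elim
    case (elim u)
    then show ?case by (metis level.exhaust)
  qed
qed

text \<open>The error of the sampling law times the random normalising constant is the average over the particles
  of a function that is centred under the flow.\<close>

lemma kernel_err:
  assumes N: "N \<ge> 1" and \<phi>: "\<phi> \<in> bm X"
  shows "AE u in \<pi> N p. ((\<integral>z. \<phi> (proj s z) \<partial>K N p u) - (\<integral>x. \<phi> x \<partial>et s (Suc p))) * Gavg N p s u
    = avg N (\<lambda>z. GM s p \<phi> (proj s z)) u"
  using pos_all[OF N, of p]
proof eventually_elim
  case (elim u)
  then have u: "u \<in> space (conf N Y)" by simp
  interpret Ku: prob_space "K N p u" using prob_algebraD(1)[OF K_prob[OF N u]] .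
  have "(\<integral>z. ctr s (Suc p) \<phi> (proj s z) \<partial>K N p u) = (\<integral>z. \<phi> (proj s z) \<partial>K N p u) - (\<integral>x. \<phi> x \<partial>et s (Suc p))"
    unfolding ctr_def using bm_integrable[OF K_prob[OF N u] bm_proj[OF \<phi>]] by (simp add: Ku.prob_space)
  then show ?case
    using K_marg[OF N u _ ctr_bm[OF \<phi>, of s "Suc p"], of p s] elim by (simp add: GM_def Mop_def)
qed

definition rate :: "nat \<Rightarrow> (nat \<Rightarrow> (nat \<Rightarrow> 'a \<times> 'a) \<Rightarrow> real) \<Rightarrow> bool" where
  "rate p F \<longleftrightarrow> (\<exists>C\<ge>0. \<forall>N\<ge>1. (\<integral>u. (F N u)\<^sup>2 \<partial>\<pi> N p) \<le> C / N)"

text \<open>Let \<open>r\<close> be the error, \<open>d\<close> the deviation of the normalising constant from its limit \<open>gb\<close> and \<open>x\<close> the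
  centred average. Then \<open>r gb = x - r d\<close> and \<open>\<bar>r\<bar> \<le> 2B\<close>, whence \<open>r\<^sup>2 gb\<^sup>2 \<le> 2 x\<^sup>2 + 8 B\<^sup>2 d\<^sup>2\<close>. The random
  normalising constant is never bounded from below.\<close>

lemma kernel_rate:
  assumes IH: "\<And>\<phi> s. \<phi> \<in> bm X \<Longrightarrow> rate p (\<lambda>N u. avg N (\<lambda>z. \<phi> (proj s z)) u - (\<integral>x. \<phi> x \<partial>et s p))"
    and \<phi>: "\<phi> \<in> bm X"
  shows "rate p (\<lambda>N u. (\<integral>z. \<phi> (proj s z) \<partial>K N p u) - (\<integral>x. \<phi> x \<partial>et s (Suc p)))"
proof -
  define gb where "gb = (\<integral>x. G p x \<partial>et s p)"
  have gb: "0 < gb" unfolding gb_def by (rule eta_G_pos)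
  obtain B where B: "0 \<le> B" "\<And>x. x \<in> space X \<Longrightarrow> \<bar>\<phi> x\<bar> \<le> B" using bmE[OF \<phi>] by blast
  define a where "a = (\<integral>x. \<phi> x \<partial>et s (Suc p))"
  have a: "\<bar>a\<bar> \<le> B" unfolding a_def
    using prob_algebraD[OF eta_prob[of s "Suc p"]] B by (intro prob_space.abs_integral_le) auto
  obtain C1 where C1: "C1 \<ge> 0" "\<And>N. N \<ge> 1 \<Longrightarrow> (\<integral>u. (avg N (\<lambda>z. GM s p \<phi> (proj s z)) u)\<^sup>2 \<partial>\<pi> N p) \<le> C1 / N"
    using IH[OF GM_bm[OF \<phi>, of s p], of s] GM_integral[OF \<phi>, of s p] unfolding rate_def by auto
  obtain C2 where C2: "C2 \<ge> 0" "\<And>N. N \<ge> 1 \<Longrightarrow> (\<integral>u. (Gavg N p s u - gb)\<^sup>2 \<partial>\<pi> N p) \<le> C2 / N"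
    using IH[OF G_bm[of p], of s] unfolding rate_def gb_def by auto
  let ?C = "(2 * C1 + 8 * B\<^sup>2 * C2) / gb\<^sup>2"
  show ?thesis unfolding rate_def
  proof (intro exI conjI allI impI)
    show "0 \<le> ?C" using C1 C2 by simp
    fix N :: nat assume N: "N \<ge> 1"
    define r where "r u = (\<integral>z. \<phi> (proj s z) \<partial>K N p u) - a" for u
    have r_bm: "r \<in> bm (conf N Y)" unfolding r_def[abs_def] by (intro bm_diff bm_const K_bm[OF N] bm_proj \<phi>)
    have i1: "integrable (\<pi> N p) (\<lambda>u. (avg N (\<lambda>z. GM s p \<phi> (proj s z)) u)\<^sup>2)"
      by (intro pi_int[OF N] bm_power avg_proj_bm GM_bm \<phi>)
    have i2: "integrable (\<pi> N p) (\<lambda>u. (Gavg N p s u - gb)\<^sup>2)"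
      by (intro pi_int[OF N] bm_power bm_diff bm_const avg_proj_bm G_bm)
    have i3: "integrable (\<pi> N p) (\<lambda>u. (r u)\<^sup>2)" by (intro pi_int[OF N] bm_power r_bm)
    have ae: "AE u in \<pi> N p. (r u)\<^sup>2 \<le> 2 / gb\<^sup>2 * (avg N (\<lambda>z. GM s p \<phi> (proj s z)) u)\<^sup>2 + 8 * B\<^sup>2 / gb\<^sup>2 * (Gavg N p s u - gb)\<^sup>2"
      using kernel_err[OF N \<phi>, of p s] AE_space
    proof eventually_elim
      case (elim u)
      let ?x = "avg N (\<lambda>z. GM s p \<phi> (proj s z)) u" and ?d = "Gavg N p s u - gb"
      have u: "u \<in> space (conf N Y)" using elim pi_space[OF N] by simp
      have "\<bar>\<integral>z. \<phi> (proj s z) \<partial>K N p u\<bar> \<le> B" by (rule K_abs_le[OF N u]) (rule B(2)[OF proj_space])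
      then have r: "\<bar>r u\<bar> \<le> 2 * B" using a by (simp add: r_def)
      have eq: "r u * gb = ?x - r u * ?d" using elim unfolding r_def a_def by (simp add: algebra_simps)
      have r2: "(r u)\<^sup>2 \<le> (2 * B)\<^sup>2" using r B(1) by (subst power2_le_iff_abs_le) auto
      have "(r u * gb)\<^sup>2 \<le> 2 * ?x\<^sup>2 + 2 * (r u * ?d)\<^sup>2"
        unfolding eq using zero_le_power2[of "?x + r u * ?d"] by (simp add: power2_eq_square algebra_simps)
      also have "(r u * ?d)\<^sup>2 \<le> (2 * B)\<^sup>2 * ?d\<^sup>2"
        unfolding power_mult_distrib[of "r u"] by (intro mult_right_mono r2) simp
      finally have "(r u)\<^sup>2 * gb\<^sup>2 \<le> 2 * ?x\<^sup>2 + 8 * B\<^sup>2 * ?d\<^sup>2" by (simp add: power_mult_distrib)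
      then have "(r u)\<^sup>2 \<le> (2 * ?x\<^sup>2 + 8 * B\<^sup>2 * ?d\<^sup>2) / gb\<^sup>2" using gb by (simp add: pos_le_divide_eq)
      then show ?case by (simp add: add_divide_distrib)
    qed
    have "(\<integral>u. (r u)\<^sup>2 \<partial>\<pi> N p) \<le> (\<integral>u. 2 / gb\<^sup>2 * (avg N (\<lambda>z. GM s p \<phi> (proj s z)) u)\<^sup>2 + 8 * B\<^sup>2 / gb\<^sup>2 * (Gavg N p s u - gb)\<^sup>2 \<partial>\<pi> N p)"
      by (rule integral_mono_AE[OF i3 _ ae]) (use i1 i2 in auto)
    also have "\<dots> = 2 / gb\<^sup>2 * (\<integral>u. (avg N (\<lambda>z. GM s p \<phi> (proj s z)) u)\<^sup>2 \<partial>\<pi> N p) + 8 * B\<^sup>2 / gb\<^sup>2 * (\<integral>u. (Gavg N p s u - gb)\<^sup>2 \<partial>\<pi> N p)"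
      using i1 i2 by simp
    also have "\<dots> \<le> 2 / gb\<^sup>2 * (C1 / N) + 8 * B\<^sup>2 / gb\<^sup>2 * (C2 / N)"
      by (intro add_mono mult_left_mono C1 C2 N) auto
    also have "\<dots> = ?C / N" by (simp add: add_divide_distrib)
    finally show "(\<integral>u. ((\<integral>z. \<phi> (proj s z) \<partial>K N p u) - (\<integral>x. \<phi> x \<partial>et s (Suc p)))\<^sup>2 \<partial>\<pi> N p) \<le> ?C / N"
      by (simp add: r_def a_def)
  qed
qed

lemma avg_rate:
  "\<phi> \<in> bm X \<Longrightarrow> rate p (\<lambda>N u. avg N (\<lambda>z. \<phi> (proj s z)) u - (\<integral>x. \<phi> x \<partial>et s p))"
proof (induction p arbitrary: \<phi> s)
  case 0
  obtain B where B: "0 \<le> B" "\<And>x. x \<in> space X \<Longrightarrow> \<bar>\<phi> x\<bar> \<le> B" using bmE[OF 0] by blast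
  show ?case unfolding rate_def
  proof (intro exI[of _ "B\<^sup>2"] conjI allI impI)
    fix N :: nat assume N: "N \<ge> 1"
    have "(\<integral>u. (avg N (\<lambda>z. \<phi> (proj s z)) u - (\<integral>x. \<phi> x \<partial>et s 0))\<^sup>2 \<partial>\<pi> N 0) \<le> B\<^sup>2 / N + ((\<integral>z. \<phi> (proj s z) \<partial>ell 0) - (\<integral>x. \<phi> x \<partial>et s 0))\<^sup>2"
      unfolding pi_0[OF N] by (rule iid_square[OF ell_prob N bm_proj[OF 0]]) (rule B(2)[OF proj_space])
    then show "(\<integral>u. (avg N (\<lambda>z. \<phi> (proj s z)) u - (\<integral>x. \<phi> x \<partial>et s 0))\<^sup>2 \<partial>\<pi> N 0) \<le> B\<^sup>2 / N"
      by (simp add: ell_marg[OF 0])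
  qed simp
next
  case (Suc p)
  obtain B where B: "0 \<le> B" "\<And>x. x \<in> space X \<Longrightarrow> \<bar>\<phi> x\<bar> \<le> B" using bmE[OF Suc.prems] by blast
  define a where "a = (\<integral>x. \<phi> x \<partial>et s (Suc p))"
  obtain C where C: "0 \<le> C" "\<And>N. N \<ge> 1 \<Longrightarrow> (\<integral>u. ((\<integral>z. \<phi> (proj s z) \<partial>K N p u) - a)\<^sup>2 \<partial>\<pi> N p) \<le> C / N"
    using kernel_rate[OF Suc.IH Suc.prems, of s] unfolding rate_def a_def by auto
  show ?case unfolding rate_def
  proof (intro exI[of _ "B\<^sup>2 + C"] conjI allI impI)
    fix N :: nat assume N: "N \<ge> 1"
    interpret P: prob_space "\<pi> N p" using law.prob[OF N] .
    let ?F = "\<lambda>u. (avg N (\<lambda>z. \<phi> (proj s z)) u - a)\<^sup>2"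
    have F: "?F \<in> bm (conf N Y)" by (intro bm_power bm_diff bm_const avg_proj_bm Suc.prems)
    have i: "integrable (\<pi> N p) (\<lambda>u. ((\<integral>z. \<phi> (proj s z) \<partial>K N p u) - a)\<^sup>2)"
      by (intro pi_int[OF N] bm_power bm_diff bm_const K_bm[OF N] bm_proj Suc.prems)
    have "(\<integral>u. ?F u \<partial>\<pi> N (Suc p)) = (\<integral>u. (\<integral>v. ?F v \<partial>PiM {1..N} (\<lambda>_. K N p u)) \<partial>\<pi> N p)"
      by (rule pi_integral_Suc[OF N F])
    also have "\<dots> \<le> (\<integral>u. B\<^sup>2 / N + ((\<integral>z. \<phi> (proj s z) \<partial>K N p u) - a)\<^sup>2 \<partial>\<pi> N p)"
    proof (rule integral_mono)
      show "integrable (\<pi> N p) (\<lambda>u. \<integral>v. ?F v \<partial>PiM {1..N} (\<lambda>_. K N p u))"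
        by (intro pi_int[OF N] bm_kernel[OF PiM_kernel[OF K_kernel[OF N]] F])
      show "integrable (\<pi> N p) (\<lambda>u. B\<^sup>2 / N + ((\<integral>z. \<phi> (proj s z) \<partial>K N p u) - a)\<^sup>2)" using i by auto
      fix u assume "u \<in> space (\<pi> N p)"
      then have u: "u \<in> space (conf N Y)" using pi_space[OF N] by simp
      show "(\<integral>v. ?F v \<partial>PiM {1..N} (\<lambda>_. K N p u)) \<le> B\<^sup>2 / N + ((\<integral>z. \<phi> (proj s z) \<partial>K N p u) - a)\<^sup>2"
        by (rule iid_square[OF K_prob[OF N u] N bm_proj[OF Suc.prems]]) (rule B(2)[OF proj_space])
    qed
    also have "\<dots> \<le> B\<^sup>2 / N + C / N" using i C(2)[OF N] by (simp add: P.prob_space)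
    finally show "(\<integral>u. (avg N (\<lambda>z. \<phi> (proj s z)) u - (\<integral>x. \<phi> x \<partial>et s (Suc p)))\<^sup>2 \<partial>\<pi> N (Suc p)) \<le> (B\<^sup>2 + C) / N"
      by (simp add: a_def add_divide_distrib)
  qed (use C in simp)
qed

lemma K_rate: "\<phi> \<in> bm X \<Longrightarrow> rate p (\<lambda>N u. (\<integral>z. \<phi> (proj s z) \<partial>K N p u) - (\<integral>x. \<phi> x \<partial>et s (Suc p)))"
  by (rule kernel_rate[OF avg_rate])

lemma L1_conv_rate:
  assumes F: "\<And>N. N \<ge> 1 \<Longrightarrow> F N \<in> bm (conf N Y)" and B: "\<And>N u. N \<ge> 1 \<Longrightarrow> u \<in> space (conf N Y) \<Longrightarrow> \<bar>F N u\<bar> \<le> B"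
    and r: "rate p (\<lambda>N u. F N u - c)"
  shows "L1_conv (\<lambda>N. \<pi> N p) F c"
proof -
  from r obtain C where C: "\<And>N. N \<ge> 1 \<Longrightarrow> (\<integral>u. (F N u - c)\<^sup>2 \<partial>\<pi> N p) \<le> C / N" unfolding rate_def by auto
  show ?thesis by (rule law.L1_conv_L2[where B=B and e="\<lambda>N. C / real N", OF _ _ _ lim_const_over_n]) (use F B C pi_meas pi_space in auto)
qed

lemma avg_L1:
  assumes \<phi>: "\<phi> \<in> bm X"
  shows "L1_conv (\<lambda>N. \<pi> N p) (\<lambda>N. avg N (\<lambda>z. \<phi> (proj s z))) (\<integral>x. \<phi> x \<partial>et s p)"
proof -
  obtain B where B: "0 \<le> B" "\<And>x. x \<in> space X \<Longrightarrow> \<bar>\<phi> x\<bar> \<le> B" using bmE[OF \<phi>] by blast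
  show ?thesis
  proof (rule L1_conv_rate[OF avg_proj_bm[OF \<phi>] _ avg_rate[OF \<phi>]])
    show "\<bar>avg N (\<lambda>z. \<phi> (proj s z)) u\<bar> \<le> B" if "N \<ge> 1" "u \<in> space (conf N Y)" for N u
      by (rule avg_abs_le[OF that(2) _ B(1)]) (rule B(2)[OF proj_space])
  qed
qed

lemma K_L1:
  assumes \<phi>: "\<phi> \<in> bm X"
  shows "L1_conv (\<lambda>N. \<pi> N p) (\<lambda>N u. \<integral>z. \<phi> (proj s z) \<partial>K N p u) (\<integral>x. \<phi> x \<partial>et s (Suc p))"
proof -
  obtain B where B: "0 \<le> B" "\<And>x. x \<in> space X \<Longrightarrow> \<bar>\<phi> x\<bar> \<le> B" using bmE[OF \<phi>] by blast
  show ?thesis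
  proof (rule L1_conv_rate[OF K_bm[OF _ bm_proj[OF \<phi>]] _ K_rate[OF \<phi>]])
    show "\<bar>\<integral>z. \<phi> (proj s z) \<partial>K N p u\<bar> \<le> B" if "N \<ge> 1" "u \<in> space (conf N Y)" for N u
      by (rule K_abs_le[OF that]) (rule B(2)[OF proj_space])
  qed
qed

section \<open>Averages over pairs of particles\<close>

text \<open>Only an upper bound, and only on the mean: this is what \<open>L1_conv_approx\<close> asks of an error term, and it
  passes from one time to the next by conditioning.\<close>

definition pair_bound :: "nat \<Rightarrow> bool" where
  "pair_bound p \<longleftrightarrow> (\<forall>H\<in>bm Y. (\<forall>z\<in>space Y. 0 \<le> H z) \<longrightarrow>
    (\<exists>E. (\<forall>N\<ge>1. (\<integral>u. avg2 N (cross H) u \<partial>\<pi> N p) \<le> E N) \<and> E \<longlonglongrightarrow> (\<integral>z. H z \<partial>(et Fine p \<Otimes>\<^sub>M et Coarse p))))"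

lemma tau_prob: "et Fine p \<Otimes>\<^sub>M et Coarse p \<in> space (prob_algebra Y)"
  by (intro pa_pair eta_prob)

lemma avg2_cross_bm: "H \<in> bm Y \<Longrightarrow> avg2 N (cross H) \<in> bm (conf N Y)"
  by (intro avg2_bm cross_bm)

lemma avg2_cross_abs_le:
  assumes "u \<in> space (conf N Y)" "\<And>z. z \<in> space Y \<Longrightarrow> \<bar>H z\<bar> \<le> B" "0 \<le> B"
  shows "\<bar>avg2 N (cross H) u\<bar> \<le> B"
  unfolding cross_def by (rule avg2_abs_le[OF assms(1) _ assms(3)]) (rule assms(2)[OF cross_space])

text \<open>On rectangles the average over pairs is a product of two averages over particles.\<close>

lemma span_L1:
  assumes "T \<in> rect_span X"
  shows "L1_conv (\<lambda>N. \<pi> N p) (\<lambda>N. avg2 N (cross T)) (\<integral>z. T z \<partial>(et Fine p \<Otimes>\<^sub>M et Coarse p))"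
  using assms
proof (induction rule: rect_span.induct)
  case (rect A B c)
  have i: "integrable (et s p) (indicator S :: _ \<Rightarrow> real)" if "S \<in> sets X" for s S
    using bm_integrable[OF eta_prob bm_indicator[OF that]] .
  have e1: "avg2 N (cross (\<lambda>z. c * (indicator A (fst z) * indicator B (snd z)))) u
      = c * (avg N (\<lambda>z. indicator A (proj Fine z)) u * avg N (\<lambda>z. indicator B (proj Coarse z)) u)" for N u
    unfolding cross_def using avg2_tensor[of N "\<lambda>z. indicator A (fst z)" "\<lambda>z. indicator B (snd z)" u] by (simp add: avg2_cmult)
  have e2: "(\<integral>z. c * (indicator A (fst z) * indicator B (snd z)) \<partial>(et Fine p \<Otimes>\<^sub>M et Coarse p))
      = c * ((\<integral>x. indicator A x \<partial>et Fine p) * (\<integral>x. indicator B x \<partial>et Coarse p))"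
    using tensor_integral_eq[OF pa_sigma_finite[OF eta_prob] pa_sigma_finite[OF eta_prob] i[OF rect(1)] i[OF rect(2)]] by simp
  show ?case unfolding e1 e2
    by (intro law.L1_conv_cmult law.L1_conv_mult avg_L1 bm_indicator rect)
next
  case (add S T)
  have i: "integrable (et Fine p \<Otimes>\<^sub>M et Coarse p) T" if "T \<in> rect_span X" for T
    using bm_integrable[OF tau_prob rect_span_bm[OF that]] .
  from law.L1_conv_add[OF add.IH] i[OF add.hyps(1)] i[OF add.hyps(2)] show ?case
    by (simp add: cross_def avg2_add)
qed

text \<open>Approximate \<open>H\<close> by rectangles in \<open>L\<^sup>1\<close> of the limiting product; the bound, applied to the modulus of the
  difference, controls the average of the error.\<close>

lemma pair_bound_L1:
  assumes d: "pair_bound p" and H: "H \<in> bm Y"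
  shows "L1_conv (\<lambda>N. \<pi> N p) (\<lambda>N. avg2 N (cross H)) (\<integral>z. H z \<partial>(et Fine p \<Otimes>\<^sub>M et Coarse p))"
proof -
  let ?\<tau> = "et Fine p \<Otimes>\<^sub>M et Coarse p"
  obtain B where B: "0 \<le> B" "\<And>x. x \<in> space Y \<Longrightarrow> \<bar>H x\<bar> \<le> B" using bmE[OF H] by blast
  have Hi: "integrable ?\<tau> H" using bm_integrable[OF tau_prob H] .
  show ?thesis
  proof (rule law.L1_conv_approx[where B=B])
    show "avg2 N (cross H) \<in> borel_measurable (\<pi> N p)" if "N \<ge> 1" for N
      by (intro pi_meas that avg2_cross_bm H)
    show "\<bar>avg2 N (cross H) u\<bar> \<le> B" if "N \<ge> 1" "u \<in> space (\<pi> N p)" for N u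
      using avg2_cross_abs_le B that pi_space by simp
    fix e :: real assume e: "e > 0"
    obtain T where T: "T \<in> rect_span X" "(\<integral>z. \<bar>H z - T z\<bar> \<partial>?\<tau>) < e"
      using rect_span_dense[OF _ prob_algebraD(2)[OF tau_prob] Hi e] prob_algebraD(1)[OF tau_prob] prob_space.finite_measure by blast
    have Ti: "integrable ?\<tau> T" using bm_integrable[OF tau_prob rect_span_bm[OF T(1)]] .
    have HT: "(\<lambda>z. \<bar>H z - T z\<bar>) \<in> bm Y" by (intro bm_abs bm_diff H rect_span_bm T)
    obtain E where E: "\<forall>N\<ge>1. (\<integral>u. avg2 N (cross (\<lambda>z. \<bar>H z - T z\<bar>)) u \<partial>\<pi> N p) \<le> E N" "E \<longlonglongrightarrow> (\<integral>z. \<bar>H z - T z\<bar> \<partial>?\<tau>)"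
      using d HT unfolding pair_bound_def by auto
    show "\<exists>F' c' H' E h. L1_conv (\<lambda>N. \<pi> N p) F' c' \<and> \<bar>c' - (\<integral>z. H z \<partial>?\<tau>)\<bar> \<le> e \<and>
       (\<forall>N\<ge>1. H' N \<in> bm (\<pi> N p) \<and> (\<integral>u. H' N u \<partial>\<pi> N p) \<le> E N \<and> (\<forall>u\<in>space (\<pi> N p). \<bar>avg2 N (cross H) u - F' N u\<bar> \<le> H' N u))
       \<and> E \<longlonglongrightarrow> h \<and> h \<le> e"
    proof (intro exI conjI allI impI ballI)
      show "L1_conv (\<lambda>N. \<pi> N p) (\<lambda>N. avg2 N (cross T)) (\<integral>z. T z \<partial>?\<tau>)" by (rule span_L1[OF T(1)])
      show "\<bar>(\<integral>z. T z \<partial>?\<tau>) - (\<integral>z. H z \<partial>?\<tau>)\<bar> \<le> e"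
        using integral_abs_bound[of ?\<tau> "\<lambda>z. H z - T z"] Hi Ti T(2) by simp
      show "E \<longlonglongrightarrow> (\<integral>z. \<bar>H z - T z\<bar> \<partial>?\<tau>)" by fact
      show "(\<integral>z. \<bar>H z - T z\<bar> \<partial>?\<tau>) \<le> e" using T by simp
      fix N :: nat assume N: "1 \<le> N"
      show "avg2 N (cross (\<lambda>z. \<bar>H z - T z\<bar>)) \<in> bm (\<pi> N p)" by (intro pi_bm N avg2_cross_bm HT)
      show "(\<integral>u. avg2 N (cross (\<lambda>z. \<bar>H z - T z\<bar>)) u \<partial>\<pi> N p) \<le> E N" using E N by simp
      fix u
      have "avg2 N (cross H) u - avg2 N (cross T) u = avg2 N (\<lambda>z. cross H z - cross T z) u" by (simp add: avg2_diff)
      then show "\<bar>avg2 N (cross H) u - avg2 N (cross T) u\<bar> \<le> avg2 N (cross (\<lambda>z. \<bar>H z - T z\<bar>)) u"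
        using avg2_abs[of N "\<lambda>z. cross H z - cross T z" u] by (simp add: cross_def[abs_def])
    qed
  qed
qed

lemma ell_distr: "distr (ell p) X (proj s) = et s p"
  using integral_distr_proj[OF ell_prob] ell_marg by (intro measure_eq_bm[OF distr_proj_prob[OF ell_prob] eta_prob]) simp

lemma pair_bound_0: "pair_bound 0"
  unfolding pair_bound_def
proof (intro ballI impI)
  fix H assume H: "H \<in> bm Y" and nn: "\<forall>z\<in>space Y. 0 \<le> H z"
  obtain B where B: "0 \<le> B" "\<And>x. x \<in> space Y \<Longrightarrow> \<bar>H x\<bar> \<le> B" using bmE[OF H] by blast
  let ?I = "\<integral>z. H z \<partial>(et Fine 0 \<Otimes>\<^sub>M et Coarse 0)"
  show "\<exists>E. (\<forall>N\<ge>1. (\<integral>u. avg2 N (cross H) u \<partial>\<pi> N 0) \<le> E N) \<and> E \<longlonglongrightarrow> ?I"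
  proof (intro exI[of _ "\<lambda>N. ?I + B / real N"] conjI allI impI)
    show "(\<lambda>N. ?I + B / real N) \<longlonglongrightarrow> ?I" using tendsto_add[OF tendsto_const lim_const_over_n[of B], of ?I] by simp
    fix N :: nat assume N: "N \<ge> 1"
    have "0 \<le> cross H x \<and> cross H x \<le> B" if "x \<in> space (Y \<Otimes>\<^sub>M Y)" for x
      using cross_space[OF that] nn B(2) unfolding cross_def by fastforce
    from iid_avg2_le[OF ell_prob N cross_bm[OF H] this, of 0]
    show "(\<integral>u. avg2 N (cross H) u \<partial>\<pi> N 0) \<le> ?I + B / real N"
      by (simp add: pi_0[OF N] cross_integral[OF ell_prob H] ell_distr del: proj.simps)
  qed
qed

text \<open>The unnormalised one-step operator of the product flow.\<close>

definition tensor_Q :: "nat \<Rightarrow> ('a \<times> 'a \<Rightarrow> real) \<Rightarrow> 'a \<times> 'a \<Rightarrow> real" where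
  "tensor_Q p H z = G p (fst z) * G p (snd z) * (\<integral>w. H w \<partial>(M Fine (Suc p) (fst z) \<Otimes>\<^sub>M M Coarse (Suc p) (snd z)))"

lemma tensor_Q_bm: "H \<in> bm Y \<Longrightarrow> tensor_Q p H \<in> bm Y"
  unfolding tensor_Q_def[abs_def]
  by (intro bm_mult bm_compose[OF measurable_fst G_bm] bm_compose[OF measurable_snd G_bm]
      bm_kernel[OF measurable_pair_prob[OF measurable_compose[OF measurable_fst M_k] measurable_compose[OF measurable_snd M_k]]])

lemma tau_Suc:
  assumes H: "H \<in> bm Y"
  shows "(\<integral>z. H z \<partial>(et Fine (Suc p) \<Otimes>\<^sub>M et Coarse (Suc p))) * ((\<integral>x. G p x \<partial>et Fine p) * (\<integral>x. G p x \<partial>et Coarse p))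
     = (\<integral>z. tensor_Q p H z \<partial>(et Fine p \<Otimes>\<^sub>M et Coarse p))"
  unfolding tensor_Q_def
  by (rule product_update[OF eta_prob eta_prob eta_prob eta_prob M_k M_k G_bm _ _ H])
     (use eta_Suc in \<open>auto simp: Mop_def\<close>)

lemma tensor_K_update:
  assumes N: "N \<ge> 1" and u: "u \<in> space (conf N Y)" and ps: "\<And>s. 0 < Gavg N p s u" and H: "H \<in> bm Y"
  shows "(\<integral>z. cross H z \<partial>(K N p u \<Otimes>\<^sub>M K N p u)) * (Gavg N p Fine u * Gavg N p Coarse u)
    = avg2 N (cross (tensor_Q p H)) u"
proof -
  let ?e = "\<lambda>s. empirical X N (\<lambda>i. proj s (u i))" and ?b = "\<lambda>s. distr (K N p u) X (proj s)"
  have up: "i \<in> {1..N} \<Longrightarrow> proj s (u i) \<in> space X" for i s using conf_space[OF u] proj_space by blast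
  have e: "?e s \<in> space (prob_algebra X)" for s using N up by (rule empirical_prob)
  have b: "?b s \<in> space (prob_algebra X)" for s by (rule distr_proj_prob[OF K_prob[OF N u]])
  have upd: "(\<integral>x. \<phi> x \<partial>?b s) * Gavg N p s u = (\<integral>x. G p x * (\<integral>y. \<phi> y \<partial>M s (Suc p) x) \<partial>?e s)"
    if \<phi>: "\<phi> \<in> bm X" for s \<phi>
  proof -
    have "(\<integral>x. G p x * Mop s p \<phi> x \<partial>?e s) = avg N (\<lambda>x. G p x * Mop s p \<phi> x) (\<lambda>i. proj s (u i))"
      by (rule integral_empirical[OF up bm_measurable[OF bm_mult[OF G_bm[of p] Mop_bm[OF \<phi>, of s p]]]])
    then show ?thesis
      using K_marg[OF N u ps \<phi>, of s] by (simp add: integral_distr_proj[OF K_prob[OF N u] \<phi>] Mop_def avg_def)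
  qed
  have "(\<integral>z. H z \<partial>(?b Fine \<Otimes>\<^sub>M ?b Coarse)) * (Gavg N p Fine u * Gavg N p Coarse u) = (\<integral>z. tensor_Q p H z \<partial>(?e Fine \<Otimes>\<^sub>M ?e Coarse))"
    unfolding tensor_Q_def
    by (rule product_update[OF e e b b M_k M_k G_bm upd upd H])
  then show ?thesis by (simp add: cross_integral[OF K_prob[OF N u] H] avg2_cross_empirical[OF N u tensor_Q_bm[OF H]] del: proj.simps)
qed

lemma tensor_K_kernel: "N \<ge> 1 \<Longrightarrow> (\<lambda>u. K N p u \<Otimes>\<^sub>M K N p u) \<in> conf N Y \<rightarrow>\<^sub>M prob_algebra (Y \<Otimes>\<^sub>M Y)"
  using K_kernel K_kernel by (rule measurable_pair_prob)

text \<open>For two conditionally independent particles, the law of the fine coordinate of one and the coarse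
  coordinate of the other is a product of Boltzmann--Gibbs updates, hence a ratio of averages over pairs
  at the previous time.\<close>

lemma tensor_K_L1:
  assumes d: "pair_bound p" and H: "H \<in> bm Y"
  shows "L1_conv (\<lambda>N. \<pi> N p) (\<lambda>N u. \<integral>z. cross H z \<partial>(K N p u \<Otimes>\<^sub>M K N p u)) (\<integral>z. H z \<partial>(et Fine (Suc p) \<Otimes>\<^sub>M et Coarse (Suc p)))"
proof -
  let ?g = "(\<integral>x. G p x \<partial>et Fine p) * (\<integral>x. G p x \<partial>et Coarse p)"
  have g: "?g \<noteq> 0" using eta_G_pos[of Fine p] eta_G_pos[of Coarse p] by simp
  obtain B where B: "0 \<le> B" "\<And>x. x \<in> space Y \<Longrightarrow> \<bar>H x\<bar> \<le> B" using bmE[OF H] by blast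
  have "L1_conv (\<lambda>N. \<pi> N p) (\<lambda>N u. \<integral>z. cross H z \<partial>(K N p u \<Otimes>\<^sub>M K N p u)) ((\<integral>z. tensor_Q p H z \<partial>(et Fine p \<Otimes>\<^sub>M et Coarse p)) / ?g)"
  proof (rule law.L1_conv_ratio[OF pair_bound_L1[OF d tensor_Q_bm[OF H]] law.L1_conv_mult[OF avg_L1[OF G_bm] avg_L1[OF G_bm]] g, where B=B])
    fix N :: nat assume N: "N \<ge> 1"
    show "(\<lambda>u. \<integral>z. cross H z \<partial>(K N p u \<Otimes>\<^sub>M K N p u)) \<in> borel_measurable (\<pi> N p)"
      by (intro pi_meas N bm_kernel[OF tensor_K_kernel[OF N]] cross_bm H)
    show "\<bar>\<integral>z. cross H z \<partial>(K N p u \<Otimes>\<^sub>M K N p u)\<bar> \<le> B" if "u \<in> space (\<pi> N p)" for u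
    proof -
      have u: "u \<in> space (conf N Y)" using that pi_space[OF N] by simp
      show ?thesis
      proof (rule prob_space.abs_integral_le[OF kernelD(1)[OF tensor_K_kernel[OF N] u]])
        fix z assume "z \<in> space (K N p u \<Otimes>\<^sub>M K N p u)"
        then have "z \<in> space (Y \<Otimes>\<^sub>M Y)" using kernelD(3)[OF tensor_K_kernel[OF N] u] by simp
        from B(2)[OF cross_space[OF this]] show "\<bar>cross H z\<bar> \<le> B" by (simp add: cross_def)
      qed
    qed
    show "AE u in \<pi> N p. (\<integral>z. cross H z \<partial>(K N p u \<Otimes>\<^sub>M K N p u)) * (Gavg N p Fine u * Gavg N p Coarse u) = avg2 N (cross (tensor_Q p H)) u"
      using pos_all[OF N, of p] by eventually_elim (rule tensor_K_update[OF N _ _ H], auto)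
  qed
  also have "(\<integral>z. tensor_Q p H z \<partial>(et Fine p \<Otimes>\<^sub>M et Coarse p)) / ?g = (\<integral>z. H z \<partial>(et Fine (Suc p) \<Otimes>\<^sub>M et Coarse (Suc p)))"
    using tau_Suc[OF H, of p] g by (simp add: field_simps)
  finally show ?thesis .
qed

lemma pair_bound_all: "pair_bound p"
proof (induction p)
  case 0 show ?case by (rule pair_bound_0)
next
  case (Suc p)
  show ?case unfolding pair_bound_def
  proof (intro ballI impI)
    fix H assume H: "H \<in> bm Y" and nn: "\<forall>z\<in>space Y. 0 \<le> H z"
    obtain B where B: "0 \<le> B" "\<And>x. x \<in> space Y \<Longrightarrow> \<bar>H x\<bar> \<le> B" using bmE[OF H] by blast
    let ?I = "\<integral>z. H z \<partial>(et Fine (Suc p) \<Otimes>\<^sub>M et Coarse (Suc p))"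
    let ?R = "\<lambda>N u. \<integral>z. cross H z \<partial>(K N p u \<Otimes>\<^sub>M K N p u)"
    show "\<exists>E. (\<forall>N\<ge>1. (\<integral>u. avg2 N (cross H) u \<partial>\<pi> N (Suc p)) \<le> E N) \<and> E \<longlonglongrightarrow> ?I"
    proof (intro exI[of _ "\<lambda>N. (\<integral>u. ?R N u \<partial>\<pi> N p) + B / real N"] conjI allI impI)
      show "(\<lambda>N. (\<integral>u. ?R N u \<partial>\<pi> N p) + B / real N) \<longlonglongrightarrow> ?I"
        using tendsto_add[OF law.L1_conv_expectation[OF tensor_K_L1[OF Suc H]] lim_const_over_n[of B]] by simp
      fix N :: nat assume N: "N \<ge> 1"
      interpret P: prob_space "\<pi> N p" using law.prob[OF N] .
      have R: "?R N \<in> bm (conf N Y)" by (intro bm_kernel[OF tensor_K_kernel[OF N]] cross_bm H)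
      have c: "0 \<le> cross H x \<and> cross H x \<le> B" if "x \<in> space (Y \<Otimes>\<^sub>M Y)" for x
        using cross_space[OF that] nn B(2) unfolding cross_def by fastforce
      have "(\<integral>u. avg2 N (cross H) u \<partial>\<pi> N (Suc p)) = (\<integral>u. (\<integral>v. avg2 N (cross H) v \<partial>PiM {1..N} (\<lambda>_. K N p u)) \<partial>\<pi> N p)"
        by (rule pi_integral_Suc[OF N avg2_cross_bm[OF H]])
      also have "\<dots> \<le> (\<integral>u. ?R N u + B / N \<partial>\<pi> N p)"
      proof (rule integral_mono)
        show "integrable (\<pi> N p) (\<lambda>u. \<integral>v. avg2 N (cross H) v \<partial>PiM {1..N} (\<lambda>_. K N p u))"
          by (intro pi_int[OF N] bm_kernel[OF PiM_kernel[OF K_kernel[OF N]]] avg2_cross_bm H)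
        show "integrable (\<pi> N p) (\<lambda>u. ?R N u + B / N)" using pi_int[OF N R] by auto
        fix u assume "u \<in> space (\<pi> N p)"
        then have u: "u \<in> space (conf N Y)" using pi_space[OF N] by simp
        show "(\<integral>v. avg2 N (cross H) v \<partial>PiM {1..N} (\<lambda>_. K N p u)) \<le> ?R N u + B / N"
          by (rule iid_avg2_le[OF K_prob[OF N u] N cross_bm[OF H] c])
      qed
      also have "\<dots> = (\<integral>u. ?R N u \<partial>\<pi> N p) + B / N" using pi_int[OF N R] by (simp add: P.prob_space)
      finally show "(\<integral>u. avg2 N (cross H) u \<partial>\<pi> N (Suc p)) \<le> (\<integral>u. ?R N u \<partial>\<pi> N p) + B / real N" .
    qed
  qed
qed

lemmas product_L1 = pair_bound_L1[OF pair_bound_all]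

end

section \<open>Recursion for the characteristic functions\<close>

lemma iexp_lipschitz: "cmod (iexp x - iexp y) \<le> \<bar>x - y\<bar>"
proof -
  have "iexp x - iexp y = iexp y * (iexp (x - y) - 1)"
    by (simp add: algebra_simps exp_diff)
  also have "cmod \<dots> = cmod (iexp (x - y) - 1)" by (simp only: norm_mult norm_exp_i_times mult_1)
  also have "\<dots> \<le> \<bar>x - y\<bar>" using iexp_approx1[of "x - y" 0] by simp
  finally show ?thesis .
qed

lemma exp_minus_lipschitz:
  fixes x y :: real assumes "0 \<le> x" "0 \<le> y" shows "\<bar>exp (- x) - exp (- y)\<bar> \<le> \<bar>x - y\<bar>"
proof -
  have *: "exp (- x) - exp (- y) \<le> y - x \<and> 0 \<le> exp (-x) - exp (-y)" if "x \<le> y" "0 \<le> x" for x y :: real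
  proof -
    have "exp (- y) = exp (- x) * exp (- (y - x))" by (simp flip: exp_add)
    then have e: "exp (- x) - exp (- y) = exp (- x) * (1 - exp (- (y - x)))" by (simp add: right_diff_distrib)
    have "1 - exp (- (y - x)) \<le> y - x" using exp_ge_add_one_self[of "-(y - x)"] by linarith
    moreover have "0 \<le> 1 - exp (- (y - x))" using that by simp
    moreover have "exp (- x) \<le> 1" using that by simp
    ultimately have "exp (- x) * (1 - exp (- (y - x))) \<le> 1 * (y - x)" by (intro mult_mono) auto
    then show ?thesis using e that by simp
  qed
  show ?thesis using *[of x y] *[of y x] assms by (cases "x \<le> y") auto
qed

lemma exp_minus_quadratic:
  fixes x :: real assumes "0 \<le> x" shows "\<bar>exp (- x) - (1 - x)\<bar> \<le> x\<^sup>2 / 2"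
proof -
  have l: "1 - x \<le> exp (- x)" using exp_ge_add_one_self[of "- x"] by simp
  have q: "0 < 1 + x + x\<^sup>2 / 2" using assms by (intro add_pos_nonneg) auto
  have "1 + x + x\<^sup>2 / 2 \<le> exp x" using exp_lower_Taylor_quadratic[OF assms] by simp
  then have "exp (- x) \<le> 1 / (1 + x + x\<^sup>2 / 2)"
    using q by (simp add: exp_minus field_simps)
  also have "\<dots> \<le> 1 - x + x\<^sup>2 / 2"
  proof -
    have "(1 - x + x\<^sup>2 / 2) * (1 + x + x\<^sup>2 / 2) = 1 + (x\<^sup>2)\<^sup>2 / 4" by (simp add: power2_eq_square field_simps)
    then have "1 \<le> (1 - x + x\<^sup>2 / 2) * (1 + x + x\<^sup>2 / 2)" by simp
    then show ?thesis using q by (simp add: pos_divide_le_eq)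
  qed
  finally show ?thesis using l by simp
qed

lemma cintegral:
  assumes \<rho>: "\<rho> \<in> space (prob_algebra Z)" and F: "(\<lambda>u. Re (F u)) \<in> bm Z" "(\<lambda>u. Im (F u)) \<in> bm Z"
  shows cintegral_integrable: "integrable \<rho> F"
    and cintegral_eq: "(CLINT u|\<rho>. F u) = complex_of_real (\<integral>u. Re (F u) \<partial>\<rho>) + \<i> * complex_of_real (\<integral>u. Im (F u) \<partial>\<rho>)"
proof -
  have i: "integrable \<rho> (\<lambda>u. Re (F u))" "integrable \<rho> (\<lambda>u. Im (F u))" using bm_integrable[OF \<rho>] F by auto
  have "integrable \<rho> (\<lambda>u. complex_of_real (Re (F u)) + \<i> * complex_of_real (Im (F u)))"
    by (intro Bochner_Integration.integrable_add integrable_mult_right integrable_of_real i)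
  then show "integrable \<rho> F" by (simp add: complex_eq[symmetric])
  show "(CLINT u|\<rho>. F u) = complex_of_real (\<integral>u. Re (F u) \<partial>\<rho>) + \<i> * complex_of_real (\<integral>u. Im (F u) \<partial>\<rho>)"
  proof -
    have "(CLINT u|\<rho>. F u) = (CLINT u|\<rho>. complex_of_real (Re (F u)) + \<i> * complex_of_real (Im (F u)))"
      by (simp add: complex_eq[symmetric])
    also have "\<dots> = complex_of_real (\<integral>u. Re (F u) \<partial>\<rho>) + \<i> * complex_of_real (\<integral>u. Im (F u) \<partial>\<rho>)"
      using i by (subst Bochner_Integration.integral_add) auto
    finally show ?thesis .
  qed
qed

lemma iexp_bm:
  assumes g: "g \<in> bm Z"
  shows "(\<lambda>u. Re (iexp (g u))) \<in> bm Z" "(\<lambda>u. Im (iexp (g u))) \<in> bm Z"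
proof -
  note g[measurable]
  have "(\<lambda>u. cos (g u)) \<in> bm Z" "(\<lambda>u. sin (g u)) \<in> bm Z" by (rule bmI[where B=1]; simp)+
  then show "(\<lambda>u. Re (iexp (g u))) \<in> bm Z" "(\<lambda>u. Im (iexp (g u))) \<in> bm Z"
    by (simp_all add: Re_exp Im_exp)
qed

text \<open>Expansion of the characteristic function of one centred summand to second order, raised to the power
  \<open>N\<close>. The constants come from \<open>\<bar>h - m\<bar> \<le> 2B\<close>: the third order term is at most \<open>(2B)\<^sup>3/6 \<le> 2B\<^sup>3\<close>, and replacing
  \<open>1 - x\<close> by \<open>exp(-x)\<close> costs \<open>(4B\<^sup>2)\<^sup>2/8 = 2B\<^sup>4\<close>. The centring \<open>a\<close> is arbitrary, because the conditional mean
  \<open>m\<close> of the particles differs from its limit by a term of the same order as the fluctuations.\<close>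

lemma iid_char_expansion:
  assumes \<nu>: "\<nu> \<in> space (prob_algebra Y)" and N: "N \<ge> 1" and h: "h \<in> bm Y"
    and B: "\<And>x. x \<in> space Y \<Longrightarrow> \<bar>h x\<bar> \<le> B"
  defines "m \<equiv> (\<integral>z. h z \<partial>\<nu>)"
  defines "\<sigma>2 \<equiv> ((\<integral>z. (h z - m)\<^sup>2 \<partial>\<nu>) :: real)"
  shows "cmod ((CLINT v|PiM {1..N} (\<lambda>_. \<nu>). iexp (sqrt N * (avg N h v - a))) - iexp (sqrt N * (m - a)) * complex_of_real (exp (- \<sigma>2 / 2)))
    \<le> (2 * B ^ 3 + 2 * B ^ 4) / sqrt N"
proof -
  interpret prob_space \<nu> using prob_algebraD(1)[OF \<nu>] .
  have sp: "space \<nu> = space Y" using prob_algebraD(3)[OF \<nu>] .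
  define t where "t = 1 / sqrt N"
  have t: "0 < t" "t \<le> 1" "t\<^sup>2 = 1 / N" using N by (auto simp: t_def power_divide)
  define g where "g z = h z - m" for z
  have g: "g \<in> bm Y" unfolding g_def[abs_def] using h by auto
  have B0: "0 \<le> B" using not_empty sp B by (force intro: order_trans[OF abs_ge_zero])
  have "\<bar>m\<bar> \<le> B" unfolding m_def using B sp by (intro abs_integral_le) auto
  then have gB: "\<bar>g z\<bar> \<le> 2 * B" if "z \<in> space \<nu>" for z using B[of z] that sp by (auto simp: g_def)
  have gm: "g \<in> borel_measurable \<nu>" using prob_integrable_bm[OF \<nu> g] by (simp add: bm_iff)
  have gi: "integrable \<nu> g" "integrable \<nu> (\<lambda>z. (g z)\<^sup>2)" using bm_integrable[OF \<nu>] g by auto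
  have g0: "(\<integral>z. g z \<partial>\<nu>) = 0" unfolding g_def using bm_integrable[OF \<nu> h] by (simp add: m_def prob_space)
  have s0: "0 \<le> \<sigma>2" unfolding \<sigma>2_def by (intro integral_nonneg_AE) auto
  have sB: "\<sigma>2 \<le> 4 * B\<^sup>2"
  proof -
    have "\<bar>\<integral>z. (g z)\<^sup>2 \<partial>\<nu>\<bar> \<le> (2 * B)\<^sup>2"
    proof (rule abs_integral_le)
      fix z assume "z \<in> space \<nu>"
      from power_mono[OF gB[OF this], of 2] show "\<bar>(g z)\<^sup>2\<bar> \<le> (2 * B)\<^sup>2" by simp
    qed
    then show ?thesis by (simp add: \<sigma>2_def g_def power_mult_distrib)
  qed
  define \<psi> where "\<psi> = (CLINT z|\<nu>. iexp (t * g z))"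
  have c: "char (distr \<nu> borel g) t = \<psi>" unfolding char_def \<psi>_def using gm by (simp add: integral_distr)
  have "cmod (\<psi> - (1 - t\<^sup>2 * \<sigma>2 / 2)) \<le> t\<^sup>2 / 6 * (\<integral>z. min (6 * (g z)\<^sup>2) (\<bar>t\<bar> * \<bar>g z\<bar> ^ 3) \<partial>\<nu>)"
    unfolding c[symmetric] by (intro char_approx3'[OF _ _ _ _ _ refl] gi gm g0) (simp only: g0 diff_zero \<sigma>2_def g_def)
  also have "\<dots> \<le> t\<^sup>2 / 6 * (t * (2 * B) ^ 3)"
  proof (rule mult_left_mono)
    have "\<bar>\<integral>z. min (6 * (g z)\<^sup>2) (\<bar>t\<bar> * \<bar>g z\<bar> ^ 3) \<partial>\<nu>\<bar> \<le> t * (2 * B) ^ 3"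
    proof (rule abs_integral_le)
      fix z assume "z \<in> space \<nu>"
      from power_mono[OF gB[OF this], of 3] have "\<bar>t\<bar> * \<bar>g z\<bar> ^ 3 \<le> t * (2 * B) ^ 3"
        using t by (auto intro!: mult_mono)
      moreover have "0 \<le> min (6 * (g z)\<^sup>2) (\<bar>t\<bar> * \<bar>g z\<bar> ^ 3)" by simp
      ultimately show "\<bar>min (6 * (g z)\<^sup>2) (\<bar>t\<bar> * \<bar>g z\<bar> ^ 3)\<bar> \<le> t * (2 * B) ^ 3" by linarith
    qed
    then show "(\<integral>z. min (6 * (g z)\<^sup>2) (\<bar>t\<bar> * \<bar>g z\<bar> ^ 3) \<partial>\<nu>) \<le> t * (2 * B) ^ 3" by simp
  qed simp
  also have "\<dots> = t\<^sup>2 * t * (8 / 6 * B ^ 3)" by (simp add: power_mult_distrib)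
  also have "\<dots> \<le> t\<^sup>2 * t * (2 * B ^ 3)" using t B0 by (intro mult_left_mono mult_right_mono) auto
  finally have c1: "cmod (\<psi> - (1 - t\<^sup>2 * \<sigma>2 / 2)) \<le> t\<^sup>2 * t * (2 * B ^ 3)" .
  define w where "w = exp (- (t\<^sup>2 * \<sigma>2 / 2))"
  have "\<bar>w - (1 - t\<^sup>2 * \<sigma>2 / 2)\<bar> \<le> (t\<^sup>2 * \<sigma>2 / 2)\<^sup>2 / 2" unfolding w_def using s0 by (intro exp_minus_quadratic) auto
  also have "\<dots> = t\<^sup>2 * t\<^sup>2 * \<sigma>2\<^sup>2 / 8" by (simp add: power2_eq_square)
  also have "\<dots> \<le> t\<^sup>2 * t * (2 * B ^ 4)"
  proof -
    have "\<sigma>2\<^sup>2 \<le> (4 * B\<^sup>2)\<^sup>2" using s0 sB by (intro power_mono) auto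
    then have "\<sigma>2\<^sup>2 \<le> 16 * B ^ 4" by (simp add: power_mult_distrib flip: power_mult)
    moreover have "t\<^sup>2 \<le> t" using mult_left_le[of t t] t(1,2) by (simp add: power2_eq_square)
    ultimately have "t\<^sup>2 * \<sigma>2\<^sup>2 \<le> t * (16 * B ^ 4)" using t by (intro mult_mono) auto
    from mult_left_mono[OF this, of "t\<^sup>2"] show ?thesis by (simp add: mult.assoc)
  qed
  finally have c2: "\<bar>w - (1 - t\<^sup>2 * \<sigma>2 / 2)\<bar> \<le> t\<^sup>2 * t * (2 * B ^ 4)" .
  have "\<psi> - complex_of_real w = (\<psi> - (1 - t\<^sup>2 * \<sigma>2 / 2)) - complex_of_real (w - (1 - t\<^sup>2 * \<sigma>2 / 2))" by simp
  then have "cmod (\<psi> - complex_of_real w) \<le> cmod (\<psi> - (1 - t\<^sup>2 * \<sigma>2 / 2)) + cmod (complex_of_real (w - (1 - t\<^sup>2 * \<sigma>2 / 2)))"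
    by (metis norm_triangle_ineq4)
  also have "\<dots> \<le> t\<^sup>2 * t * (2 * B ^ 3) + t\<^sup>2 * t * (2 * B ^ 4)" using c1 c2 by (simp only: norm_of_real)
  also have "\<dots> = (1 / N) * t * (2 * B ^ 3 + 2 * B ^ 4)" by (simp add: t(3) algebra_simps)
  finally have d: "cmod (\<psi> - complex_of_real w) \<le> (1 / N) * t * (2 * B ^ 3 + 2 * B ^ 4)" .
  have "cmod \<psi> \<le> 1"
  proof -
    interpret rd: real_distribution "distr \<nu> borel g" using gm by (intro real_distribution_distr)
    show ?thesis using rd.cmod_char_le_1[of t] c by simp
  qed
  moreover have "cmod (complex_of_real w) \<le> 1" using s0 by (simp add: w_def)
  ultimately have "cmod (\<psi> ^ N - complex_of_real w ^ N) \<le> N * cmod (\<psi> - complex_of_real w)" by (rule norm_power_diff)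
  also have "\<dots> \<le> N * ((1 / N) * t * (2 * B ^ 3 + 2 * B ^ 4))" using d by (intro mult_left_mono) auto
  also have "\<dots> = (2 * B ^ 3 + 2 * B ^ 4) / sqrt N" using N by (simp add: t_def)
  finally have e: "cmod (\<psi> ^ N - complex_of_real w ^ N) \<le> (2 * B ^ 3 + 2 * B ^ 4) / sqrt N" .
  have wN: "w ^ N = exp (- \<sigma>2 / 2)"
    unfolding w_def exp_of_nat_mult[symmetric] using N by (simp add: t(3))
  have wN': "complex_of_real w ^ N = complex_of_real (exp (- \<sigma>2 / 2))" using wN by (metis of_real_power)
  have id: "sqrt N * (avg N h v - a) = (\<Sum>i\<in>{1..N}. t * g (v i)) + sqrt N * (m - a)" for v
  proof -
    have "(\<Sum>i\<in>{1..N}. t * g (v i)) = t * ((\<Sum>i\<in>{1..N}. h (v i)) - N * m)"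
      by (simp add: g_def sum_distrib_left[symmetric] sum_subtractf)
    also have "\<dots> = t * (N * (avg N h v - m))" using N by (simp add: avg_def field_simps)
    also have "t * (N * (avg N h v - m)) = sqrt N * (avg N h v - m)" using real_div_sqrt[of "real N"] by (simp add: t_def mult.assoc[symmetric])
    finally show ?thesis by (simp add: algebra_simps)
  qed
  have "(CLINT v|PiM {1..N} (\<lambda>_. \<nu>). iexp (sqrt N * (avg N h v - a)))
     = (CLINT v|PiM {1..N} (\<lambda>_. \<nu>). iexp (\<Sum>i\<in>{1..N}. t * g (v i)) * iexp (sqrt N * (m - a)))"
    unfolding id by (simp only: of_real_add distrib_left exp_add)
  also have "\<dots> = (CLINT v|PiM {1..N} (\<lambda>_. \<nu>). iexp (\<Sum>i\<in>{1..N}. t * g (v i))) * iexp (sqrt N * (m - a))" by simp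
  also have "(CLINT v|PiM {1..N} (\<lambda>_. \<nu>). iexp (\<Sum>i\<in>{1..N}. t * g (v i))) = \<psi> ^ N"
    unfolding \<psi>_def using g by (intro iid_char[OF \<nu> N] bm_mult) auto
  finally have "(CLINT v|PiM {1..N} (\<lambda>_. \<nu>). iexp (sqrt N * (avg N h v - a))) - iexp (sqrt N * (m - a)) * complex_of_real (exp (- \<sigma>2 / 2))
     = iexp (sqrt N * (m - a)) * (\<psi> ^ N - complex_of_real w ^ N)"
    by (simp only: wN'[symmetric] left_diff_distrib mult.commute)
  then have "cmod ((CLINT v|PiM {1..N} (\<lambda>_. \<nu>). iexp (sqrt N * (avg N h v - a))) - iexp (sqrt N * (m - a)) * complex_of_real (exp (- \<sigma>2 / 2)))
    = cmod (\<psi> ^ N - complex_of_real w ^ N)"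
    by (simp only: norm_mult norm_exp_i_times mult_1)
  with e show ?thesis by simp
qed

locale coupled_particle_scheme = particle_scheme +
  assumes cross_conv: "\<phi> \<in> bm X \<Longrightarrow> \<psi> \<in> bm X \<Longrightarrow>
    L1_conv (\<lambda>N. \<pi> N p) (\<lambda>N u. \<integral>z. \<phi> (fst z) * \<psi> (snd z) \<partial>K N p u) (\<integral>z. \<phi> (fst z) * \<psi> (snd z) \<partial>ell (Suc p))"
begin

text \<open>Two test functions are carried along: the one-step operators of the two levels differ, so that after
  one step backwards in time a single function has become two.\<close>

definition pair_diff :: "('a \<Rightarrow> real) \<Rightarrow> ('a \<Rightarrow> real) \<Rightarrow> 'a \<times> 'a \<Rightarrow> real" where
  "pair_diff \<phi> \<psi> z = \<phi> (proj Fine z) - \<psi> (proj Coarse z)"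

text \<open>The variance created by the sampling at time \<open>p\<close>.\<close>

definition time_var :: "nat \<Rightarrow> ('a \<Rightarrow> real) \<Rightarrow> ('a \<Rightarrow> real) \<Rightarrow> real" where
  "time_var p \<phi> \<psi> = (\<integral>z. (ctr Fine p \<phi> (fst z) - ctr Coarse p \<psi> (snd z))\<^sup>2 \<partial>ell p)"

primrec limit_var :: "nat \<Rightarrow> ('a \<Rightarrow> real) \<Rightarrow> ('a \<Rightarrow> real) \<Rightarrow> real" where
  "limit_var 0 \<phi> \<psi> = time_var 0 \<phi> \<psi>"
| "limit_var (Suc p) \<phi> \<psi> = time_var (Suc p) \<phi> \<psi> + limit_var p (Qt Fine p \<phi>) (Qt Coarse p \<psi>)"

definition mean_diff :: "nat \<Rightarrow> ('a \<Rightarrow> real) \<Rightarrow> ('a \<Rightarrow> real) \<Rightarrow> real" where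
  "mean_diff p \<phi> \<psi> = (\<integral>x. \<phi> x \<partial>et Fine p) - (\<integral>x. \<psi> x \<partial>et Coarse p)"

lemma pair_diff_bm: "\<phi> \<in> bm X \<Longrightarrow> \<psi> \<in> bm X \<Longrightarrow> pair_diff \<phi> \<psi> \<in> bm Y"
  unfolding pair_diff_def[abs_def] by (intro bm_diff bm_proj)

lemma ell_pair_diff:
  assumes "\<phi> \<in> bm X" "\<psi> \<in> bm X" shows "(\<integral>z. pair_diff \<phi> \<psi> z \<partial>ell p) = mean_diff p \<phi> \<psi>"
  unfolding pair_diff_def mean_diff_def
  using bm_integrable[OF ell_prob bm_proj[OF assms(1)], of p Fine] bm_integrable[OF ell_prob bm_proj[OF assms(2)], of p Coarse]
    ell_marg[OF assms(1), of p Fine] ell_marg[OF assms(2), of p Coarse]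
  by (simp del: proj.simps)

lemma K_pair_diff:
  assumes "N \<ge> 1" "u \<in> space (conf N Y)" "\<phi> \<in> bm X" "\<psi> \<in> bm X"
  shows "(\<integral>z. pair_diff \<phi> \<psi> z \<partial>K N p u) = (\<integral>z. \<phi> (proj Fine z) \<partial>K N p u) - (\<integral>z. \<psi> (proj Coarse z) \<partial>K N p u)"
  unfolding pair_diff_def
  using bm_integrable[OF K_prob[OF assms(1,2)] bm_proj[OF assms(3)], of p Fine] bm_integrable[OF K_prob[OF assms(1,2)] bm_proj[OF assms(4)], of p Coarse]
  by (simp del: proj.simps)

lemma time_var_eq: "time_var p \<phi> \<psi> = (\<integral>z. (pair_diff \<phi> \<psi> z - mean_diff p \<phi> \<psi>)\<^sup>2 \<partial>ell p)"
  unfolding time_var_def pair_diff_def mean_diff_def ctr_def by (simp add: algebra_simps)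

lemma time_var_nonneg: "0 \<le> time_var p \<phi> \<psi>"
  unfolding time_var_def by (intro integral_nonneg_AE) auto

text \<open>Only the mixed term depends on more than the two marginals of \<open>\<nu>\<close>.\<close>

lemma variance_expand:
  assumes \<nu>: "\<nu> \<in> space (prob_algebra Y)" and \<phi>: "\<phi> \<in> bm X" and \<psi>: "\<psi> \<in> bm X"
  shows "(\<integral>z. (pair_diff \<phi> \<psi> z - (\<integral>z. pair_diff \<phi> \<psi> z \<partial>\<nu>))\<^sup>2 \<partial>\<nu>) =
    (\<integral>z. (\<phi> (proj Fine z))\<^sup>2 \<partial>\<nu>) + (\<integral>z. (\<psi> (proj Coarse z))\<^sup>2 \<partial>\<nu>) - 2 * (\<integral>z. \<phi> (fst z) * \<psi> (snd z) \<partial>\<nu>)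
      - ((\<integral>z. \<phi> (proj Fine z) \<partial>\<nu>) - (\<integral>z. \<psi> (proj Coarse z) \<partial>\<nu>))\<^sup>2"
proof -
  interpret prob_space \<nu> using prob_algebraD(1)[OF \<nu>] .
  have i: "integrable \<nu> (\<lambda>z. (\<phi> (proj Fine z))\<^sup>2)" "integrable \<nu> (\<lambda>z. (\<psi> (proj Coarse z))\<^sup>2)"
    "integrable \<nu> (\<lambda>z. \<phi> (proj Fine z) * \<psi> (proj Coarse z))" "integrable \<nu> (\<lambda>z. \<phi> (proj Fine z))" "integrable \<nu> (\<lambda>z. \<psi> (proj Coarse z))"
    by (intro bm_integrable[OF \<nu>] bm_power bm_mult bm_proj \<phi> \<psi>)+
  have h: "integrable \<nu> (pair_diff \<phi> \<psi>)" "integrable \<nu> (\<lambda>z. (pair_diff \<phi> \<psi> z)\<^sup>2)"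
    by (intro bm_integrable[OF \<nu>] bm_power pair_diff_bm \<phi> \<psi>)+
  have "(\<integral>z. (pair_diff \<phi> \<psi> z)\<^sup>2 \<partial>\<nu>) = (\<integral>z. (\<phi> (proj Fine z))\<^sup>2 + (\<psi> (proj Coarse z))\<^sup>2 - 2 * (\<phi> (proj Fine z) * \<psi> (proj Coarse z)) \<partial>\<nu>)"
    by (intro Bochner_Integration.integral_cong) (auto simp: pair_diff_def power2_diff)
  also have "\<dots> = (\<integral>z. (\<phi> (proj Fine z))\<^sup>2 \<partial>\<nu>) + (\<integral>z. (\<psi> (proj Coarse z))\<^sup>2 \<partial>\<nu>) - 2 * (\<integral>z. \<phi> (proj Fine z) * \<psi> (proj Coarse z) \<partial>\<nu>)"
    using i by (simp del: proj.simps)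
  finally have s: "(\<integral>z. (pair_diff \<phi> \<psi> z)\<^sup>2 \<partial>\<nu>) = (\<integral>z. (\<phi> (proj Fine z))\<^sup>2 \<partial>\<nu>) + (\<integral>z. (\<psi> (proj Coarse z))\<^sup>2 \<partial>\<nu>) - 2 * (\<integral>z. \<phi> (fst z) * \<psi> (snd z) \<partial>\<nu>)"
    by simp
  have "(\<integral>z. pair_diff \<phi> \<psi> z \<partial>\<nu>) = (\<integral>z. \<phi> (proj Fine z) \<partial>\<nu>) - (\<integral>z. \<psi> (proj Coarse z) \<partial>\<nu>)"
    unfolding pair_diff_def using i by (simp del: proj.simps)
  then show ?thesis using variance_eq[OF h] s by simp
qed

lemma variance_L1:
  assumes \<phi>: "\<phi> \<in> bm X" and \<psi>: "\<psi> \<in> bm X"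
  shows "L1_conv (\<lambda>N. \<pi> N p) (\<lambda>N u. \<integral>z. (pair_diff \<phi> \<psi> z - (\<integral>z. pair_diff \<phi> \<psi> z \<partial>K N p u))\<^sup>2 \<partial>K N p u) (time_var (Suc p) \<phi> \<psi>)"
proof -
  let ?F = "\<lambda>N u. (\<integral>z. (\<phi> (proj Fine z))\<^sup>2 \<partial>K N p u) + (\<integral>z. (\<psi> (proj Coarse z))\<^sup>2 \<partial>K N p u) - 2 * (\<integral>z. \<phi> (fst z) * \<psi> (snd z) \<partial>K N p u)
      - ((\<integral>z. \<phi> (proj Fine z) \<partial>K N p u) - (\<integral>z. \<psi> (proj Coarse z) \<partial>K N p u)) * ((\<integral>z. \<phi> (proj Fine z) \<partial>K N p u) - (\<integral>z. \<psi> (proj Coarse z) \<partial>K N p u))"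
  have e1: "(\<integral>z. (pair_diff \<phi> \<psi> z - (\<integral>z. pair_diff \<phi> \<psi> z \<partial>K N p u))\<^sup>2 \<partial>K N p u) = ?F N u" if "N \<ge> 1" "u \<in> space (\<pi> N p)" for N u
    using variance_expand[OF K_prob \<phi> \<psi>, of N u p] that pi_space by (simp add: power2_eq_square)
  have e2: "time_var (Suc p) \<phi> \<psi> = (\<integral>x. (\<phi> x)\<^sup>2 \<partial>et Fine (Suc p)) + (\<integral>x. (\<psi> x)\<^sup>2 \<partial>et Coarse (Suc p)) - 2 * (\<integral>z. \<phi> (fst z) * \<psi> (snd z) \<partial>ell (Suc p))
    - mean_diff (Suc p) \<phi> \<psi> * mean_diff (Suc p) \<phi> \<psi>"
    using variance_expand[OF ell_prob \<phi> \<psi>, of "Suc p"] ell_marg[OF bm_power[OF \<phi>, of 2], of "Suc p" Fine] ell_marg[OF bm_power[OF \<psi>, of 2], of "Suc p" Coarse]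
      ell_marg[OF \<phi>, of "Suc p" Fine] ell_marg[OF \<psi>, of "Suc p" Coarse]
    by (simp add: time_var_eq ell_pair_diff[OF \<phi> \<psi>] mean_diff_def power2_eq_square del: proj.simps)
  have "L1_conv (\<lambda>N. \<pi> N p) ?F (time_var (Suc p) \<phi> \<psi>)"
    unfolding e2 mean_diff_def by (intro law.L1_conv_diff law.L1_conv_add law.L1_conv_cmult law.L1_conv_mult K_L1 cross_conv bm_power \<phi> \<psi>)
  then show ?thesis using law.L1_conv_cong[OF e1] by simp
qed

text \<open>With \<open>r\<close>, \<open>d\<close> and \<open>gb\<close> as in \<open>kernel_rate\<close>, the difference is \<open>- r d / gb\<close>, a product of two terms of
  order \<open>N\<^sup>-\<^sup>1\<^sup>/\<^sup>2\<close> in mean square; it stays negligible after multiplication by \<open>sqrt N\<close>.\<close>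

lemma linearisation_error:
  assumes \<phi>: "\<phi> \<in> bm X"
  shows "\<exists>C\<ge>0. \<forall>N\<ge>1. (\<integral>u. \<bar>(\<integral>z. \<phi> (proj s z) \<partial>K N p u) - (\<integral>x. \<phi> x \<partial>et s (Suc p)) - avg N (\<lambda>z. Qt s p \<phi> (proj s z)) u\<bar> \<partial>\<pi> N p) \<le> C / N"
proof -
  define gb where "gb = (\<integral>x. G p x \<partial>et s p)"
  have gb: "0 < gb" unfolding gb_def by (rule eta_G_pos)
  obtain C1 where C1: "C1 \<ge> 0" "\<And>N. N \<ge> 1 \<Longrightarrow> (\<integral>u. ((\<integral>z. \<phi> (proj s z) \<partial>K N p u) - (\<integral>x. \<phi> x \<partial>et s (Suc p)))\<^sup>2 \<partial>\<pi> N p) \<le> C1 / N"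
    using K_rate[OF \<phi>, of p s] unfolding rate_def by auto
  obtain C2 where C2: "C2 \<ge> 0" "\<And>N. N \<ge> 1 \<Longrightarrow> (\<integral>u. (Gavg N p s u - gb)\<^sup>2 \<partial>\<pi> N p) \<le> C2 / N"
    using avg_rate[OF G_bm[of p], of p s] unfolding rate_def gb_def by auto
  show ?thesis
  proof (intro exI[of _ "(C1 + C2) / (2 * gb)"] conjI allI impI)
    fix N :: nat assume N: "N \<ge> 1"
    define r where "r u = (\<integral>z. \<phi> (proj s z) \<partial>K N p u) - (\<integral>x. \<phi> x \<partial>et s (Suc p))" for u
    define d where "d u = Gavg N p s u - gb" for u
    define q where "q = avg N (\<lambda>z. Qt s p \<phi> (proj s z))"
    have r_bm: "r \<in> bm (conf N Y)" unfolding r_def[abs_def] by (intro bm_diff bm_const K_bm[OF N] bm_proj \<phi>)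
    have d_bm: "d \<in> bm (conf N Y)" unfolding d_def[abs_def] by (intro bm_diff bm_const avg_proj_bm G_bm)
    have q_bm: "q \<in> bm (conf N Y)" unfolding q_def by (intro avg_proj_bm Qt_bm \<phi>)
    have i: "integrable (\<pi> N p) (\<lambda>u. (r u)\<^sup>2)" "integrable (\<pi> N p) (\<lambda>u. (d u)\<^sup>2)" "integrable (\<pi> N p) (\<lambda>u. \<bar>r u - q u\<bar>)"
      by (intro pi_int[OF N] bm_abs bm_diff bm_power r_bm d_bm q_bm)+
    have ae: "AE u in \<pi> N p. \<bar>r u - q u\<bar> \<le> ((r u)\<^sup>2 + (d u)\<^sup>2) / (2 * gb)"
      using kernel_err[OF N \<phi>, of p s]
    proof eventually_elim
      case (elim u)
      then have "r u * (d u + gb) = avg N (\<lambda>z. GM s p \<phi> (proj s z)) u" by (simp add: r_def d_def)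
      moreover have "q u = avg N (\<lambda>z. GM s p \<phi> (proj s z)) u / gb" unfolding q_def Qt_def gb_def by (rule avg_divc)
      ultimately have "r u - q u = - (r u * d u) / gb" using gb by (simp add: field_simps)
      then have "\<bar>r u - q u\<bar> = \<bar>r u * d u\<bar> / gb" using gb by (simp add: abs_mult)
      also have "\<bar>r u * d u\<bar> \<le> ((r u)\<^sup>2 + (d u)\<^sup>2) / 2"
        using zero_le_power2[of "\<bar>r u\<bar> - \<bar>d u\<bar>"] by (simp add: power2_diff abs_mult)
      finally show ?case using gb by (simp add: field_simps)
    qed
    have "(\<integral>u. \<bar>r u - q u\<bar> \<partial>\<pi> N p) \<le> (\<integral>u. ((r u)\<^sup>2 + (d u)\<^sup>2) / (2 * gb) \<partial>\<pi> N p)"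
      by (rule integral_mono_AE[OF i(3) _ ae]) (use i in auto)
    also have "\<dots> = ((\<integral>u. (r u)\<^sup>2 \<partial>\<pi> N p) + (\<integral>u. (d u)\<^sup>2 \<partial>\<pi> N p)) / (2 * gb)" using i by simp
    also have "\<dots> \<le> (C1 / N + C2 / N) / (2 * gb)"
      using C1(2)[OF N] C2(2)[OF N] gb unfolding r_def d_def by (intro divide_right_mono add_mono) auto
    also have "\<dots> = (C1 + C2) / (2 * gb) / N" using gb N by (simp add: field_simps)
    finally show "(\<integral>u. \<bar>(\<integral>z. \<phi> (proj s z) \<partial>K N p u) - (\<integral>x. \<phi> x \<partial>et s (Suc p)) - avg N (\<lambda>z. Qt s p \<phi> (proj s z)) u\<bar> \<partial>\<pi> N p) \<le> (C1 + C2) / (2 * gb) / N"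
      by (simp add: r_def q_def)
  qed (use C1 C2 gb in simp)
qed

lemma pi_cintegral_Suc:
  assumes N: "N \<ge> 1" and F: "(\<lambda>u. Re (F u)) \<in> bm (conf N Y)" "(\<lambda>u. Im (F u)) \<in> bm (conf N Y)"
  shows "(CLINT u|\<pi> N (Suc p). F u) = (CLINT u|\<pi> N p. CLINT v|PiM {1..N} (\<lambda>_. K N p u). F v)"
    and "(\<lambda>u. Re (CLINT v|PiM {1..N} (\<lambda>_. K N p u). F v)) \<in> bm (conf N Y)"
    and "(\<lambda>u. Im (CLINT v|PiM {1..N} (\<lambda>_. K N p u). F v)) \<in> bm (conf N Y)"
proof -
  let ?I = "\<lambda>u. CLINT v|PiM {1..N} (\<lambda>_. K N p u). F v"
  have e: "Re (?I u) = (\<integral>v. Re (F v) \<partial>PiM {1..N} (\<lambda>_. K N p u))" "Im (?I u) = (\<integral>v. Im (F v) \<partial>PiM {1..N} (\<lambda>_. K N p u))"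
    if "u \<in> space (conf N Y)" for u
    using cintegral_eq[OF PiK_prob[OF N that] F] by simp_all
  note k = bm_kernel[OF PiM_kernel[OF K_kernel[OF N]]]
  show b: "(\<lambda>u. Re (?I u)) \<in> bm (conf N Y)" "(\<lambda>u. Im (?I u)) \<in> bm (conf N Y)"
    using k[OF F(1), of p] k[OF F(2), of p] by (simp_all only: bm_cong[OF e(1)] bm_cong[OF e(2)])
  have "(CLINT u|\<pi> N p. ?I u) = complex_of_real (\<integral>u. Re (?I u) \<partial>\<pi> N p) + \<i> * complex_of_real (\<integral>u. Im (?I u) \<partial>\<pi> N p)"
    by (rule cintegral_eq[OF pi_prob[OF N] b])
  also have "(\<integral>u. Re (?I u) \<partial>\<pi> N p) = (\<integral>u. Re (F u) \<partial>\<pi> N (Suc p))"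
    unfolding pi_integral_Suc[OF N F(1)] using e pi_space[OF N] by (intro Bochner_Integration.integral_cong) auto
  also have "(\<integral>u. Im (?I u) \<partial>\<pi> N p) = (\<integral>u. Im (F u) \<partial>\<pi> N (Suc p))"
    unfolding pi_integral_Suc[OF N F(2)] using e pi_space[OF N] by (intro Bochner_Integration.integral_cong) auto
  also have "complex_of_real (\<integral>u. Re (F u) \<partial>\<pi> N (Suc p)) + \<i> * complex_of_real (\<integral>u. Im (F u) \<partial>\<pi> N (Suc p)) = (CLINT u|\<pi> N (Suc p). F u)"
    by (rule cintegral_eq[OF pi_prob[OF N] F, symmetric])
  finally show "(CLINT u|\<pi> N (Suc p). F u) = (CLINT u|\<pi> N p. ?I u)" ..
qed

text \<open>Conditioning on time \<open>p\<close> leaves three errors: the expansion for i.i.d. draws, the conditional variance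
  against its limit, and the conditional mean against its linearisation.\<close>

lemma char_step:
  assumes \<phi>: "\<phi> \<in> bm X" and \<psi>: "\<psi> \<in> bm X"
  shows "(\<lambda>N. (CLINT u|\<pi> N (Suc p). iexp (sqrt N * (avg N (pair_diff \<phi> \<psi>) u - mean_diff (Suc p) \<phi> \<psi>)))
      - complex_of_real (exp (- time_var (Suc p) \<phi> \<psi> / 2)) * (CLINT u|\<pi> N p. iexp (sqrt N * (avg N (pair_diff (Qt Fine p \<phi>) (Qt Coarse p \<psi>)) u)))) \<longlonglongrightarrow> 0"
proof -
  define h where "h = pair_diff \<phi> \<psi>"
  define k where "k = pair_diff (Qt Fine p \<phi>) (Qt Coarse p \<psi>)"
  define a where "a = mean_diff (Suc p) \<phi> \<psi>"
  define \<sigma>2 where "\<sigma>2 = time_var (Suc p) \<phi> \<psi>"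
  define s where "s N u = (\<integral>z. (h z - (\<integral>z. h z \<partial>K N p u))\<^sup>2 \<partial>K N p u)" for N u
  have h: "h \<in> bm Y" and k: "k \<in> bm Y" unfolding h_def k_def by (intro pair_diff_bm Qt_bm \<phi> \<psi>)+
  obtain B where B: "0 \<le> B" "\<And>x. x \<in> space Y \<Longrightarrow> \<bar>h x\<bar> \<le> B" using bmE[OF h] by blast
  have \<sigma>2: "0 \<le> \<sigma>2" unfolding \<sigma>2_def by (rule time_var_nonneg)
  have s_conv: "L1_conv (\<lambda>N. \<pi> N p) s \<sigma>2"
    using variance_L1[OF \<phi> \<psi>, of p] unfolding s_def[abs_def] h_def \<sigma>2_def .
  obtain C1 where C1: "C1 \<ge> 0" "\<And>N. N \<ge> 1 \<Longrightarrow> (\<integral>u. \<bar>(\<integral>z. \<phi> (proj Fine z) \<partial>K N p u) - (\<integral>x. \<phi> x \<partial>et Fine (Suc p)) - avg N (\<lambda>z. Qt Fine p \<phi> (proj Fine z)) u\<bar> \<partial>\<pi> N p) \<le> C1 / N"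
    using linearisation_error[OF \<phi>, where s=Fine and p=p] by blast
  obtain C2 where C2: "C2 \<ge> 0" "\<And>N. N \<ge> 1 \<Longrightarrow> (\<integral>u. \<bar>(\<integral>z. \<psi> (proj Coarse z) \<partial>K N p u) - (\<integral>x. \<psi> x \<partial>et Coarse (Suc p)) - avg N (\<lambda>z. Qt Coarse p \<psi> (proj Coarse z)) u\<bar> \<partial>\<pi> N p) \<le> C2 / N"
    using linearisation_error[OF \<psi>, where s=Coarse and p=p] by blast
  define D where "D = 2 * B ^ 3 + 2 * B ^ 4"
  define E where "E N = D / sqrt N + (\<integral>u. \<bar>s N u - \<sigma>2\<bar> \<partial>\<pi> N p) + (C1 + C2) / sqrt N" for N :: nat
  show ?thesis
  proof (rule Lim_null_comparison)
    have "(\<lambda>N. D / sqrt (real N)) \<longlonglongrightarrow> 0" "(\<lambda>N. (C1 + C2) / sqrt (real N)) \<longlonglongrightarrow> 0"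
      by (intro real_tendsto_divide_at_top[OF tendsto_const] filterlim_compose[OF sqrt_at_top filterlim_real_sequentially])+
    then show "E \<longlonglongrightarrow> 0" unfolding E_def[abs_def]
      using tendsto_add[OF tendsto_add[OF _ L1_conv_LIMSEQ[OF s_conv]]] by fastforce
    show "\<forall>\<^sub>F N in sequentially. norm ((CLINT u|\<pi> N (Suc p). iexp (sqrt N * (avg N (pair_diff \<phi> \<psi>) u - mean_diff (Suc p) \<phi> \<psi>)))
      - complex_of_real (exp (- time_var (Suc p) \<phi> \<psi> / 2)) * (CLINT u|\<pi> N p. iexp (sqrt N * (avg N (pair_diff (Qt Fine p \<phi>) (Qt Coarse p \<psi>)) u)))) \<le> E N"
      unfolding h_def[symmetric] k_def[symmetric] a_def[symmetric] \<sigma>2_def[symmetric]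
    proof (rule eventually_sequentiallyI[of 1])
      fix N :: nat assume N: "1 \<le> N"
      interpret P: prob_space "\<pi> N p" using law.prob[OF N] .
      define F where "F v = iexp (sqrt N * (avg N h v - a))" for v
      define W where "W u = iexp (sqrt N * avg N k u)" for u
      define I where "I u = (CLINT v|PiM {1..N} (\<lambda>_. K N p u). F v)" for u
      define m where "m u = (\<integral>z. h z \<partial>K N p u)" for u
      define err where "err u = m u - a - avg N k u" for u
      have "(\<lambda>v. sqrt N * (avg N h v - a)) \<in> bm (conf N Y)" "(\<lambda>v. sqrt N * avg N k v) \<in> bm (conf N Y)"
        by (intro bm_mult bm_const bm_diff avg_bm h k)+
      note gg = this
      have F: "(\<lambda>u. Re (F u)) \<in> bm (conf N Y)" "(\<lambda>u. Im (F u)) \<in> bm (conf N Y)"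
        unfolding F_def by (rule iexp_bm[OF gg(1)])+
      have W: "(\<lambda>u. Re (W u)) \<in> bm (conf N Y)" "(\<lambda>u. Im (W u)) \<in> bm (conf N Y)"
        unfolding W_def by (rule iexp_bm[OF gg(2)])+
      note IF = pi_cintegral_Suc[OF N F, of p, folded I_def]
      have iI: "integrable (\<pi> N p) I" and iW: "integrable (\<pi> N p) W"
        using cintegral_integrable[OF pi_prob[OF N]] IF(2,3) W by blast+
      have isg: "integrable (\<pi> N p) (\<lambda>u. \<bar>s N u - \<sigma>2\<bar>)"
        by (intro law.bm_int[OF N] bm_abs bm_diff bm_const L1_conv_bm[OF s_conv N])
      have m_bm: "m \<in> bm (conf N Y)" unfolding m_def[abs_def] by (intro K_bm[OF N] h)
      have ie: "integrable (\<pi> N p) (\<lambda>u. \<bar>err u\<bar>)"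
        unfolding err_def using avg_bm[OF k, of N] m_bm by (intro pi_int[OF N] bm_abs bm_diff bm_const)
      have err: "(\<integral>u. \<bar>err u\<bar> \<partial>\<pi> N p) \<le> (C1 + C2) / N"
      proof -
        let ?e1 = "\<lambda>u. \<bar>(\<integral>z. \<phi> (proj Fine z) \<partial>K N p u) - (\<integral>x. \<phi> x \<partial>et Fine (Suc p)) - avg N (\<lambda>z. Qt Fine p \<phi> (proj Fine z)) u\<bar>"
        let ?e2 = "\<lambda>u. \<bar>(\<integral>z. \<psi> (proj Coarse z) \<partial>K N p u) - (\<integral>x. \<psi> x \<partial>et Coarse (Suc p)) - avg N (\<lambda>z. Qt Coarse p \<psi> (proj Coarse z)) u\<bar>"
        have i: "integrable (\<pi> N p) ?e1" "integrable (\<pi> N p) ?e2"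
          by (intro pi_int[OF N] bm_abs bm_diff bm_const avg_proj_bm Qt_bm K_bm[OF N] bm_proj \<phi> \<psi>)+
        have "(\<integral>u. \<bar>err u\<bar> \<partial>\<pi> N p) \<le> (\<integral>u. ?e1 u + ?e2 u \<partial>\<pi> N p)"
        proof (rule integral_mono[OF ie])
          fix u assume "u \<in> space (\<pi> N p)"
          then have u: "u \<in> space (conf N Y)" using pi_space[OF N] by simp
          have "err u = ((\<integral>z. \<phi> (proj Fine z) \<partial>K N p u) - (\<integral>x. \<phi> x \<partial>et Fine (Suc p)) - avg N (\<lambda>z. Qt Fine p \<phi> (proj Fine z)) u)
             - ((\<integral>z. \<psi> (proj Coarse z) \<partial>K N p u) - (\<integral>x. \<psi> x \<partial>et Coarse (Suc p)) - avg N (\<lambda>z. Qt Coarse p \<psi> (proj Coarse z)) u)"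
            unfolding err_def m_def h_def a_def k_def K_pair_diff[OF N u \<phi> \<psi>] mean_diff_def pair_diff_def[of "Qt Fine p \<phi>", abs_def] avg_diff by simp
          then show "\<bar>err u\<bar> \<le> ?e1 u + ?e2 u" by linarith
        qed (use i in auto)
        also have "\<dots> \<le> C1 / N + C2 / N" using i C1(2)[OF N] C2(2)[OF N] by (simp del: proj.simps)
        finally show ?thesis by (simp add: add_divide_distrib)
      qed
      have pt: "cmod (I u - complex_of_real (exp (- \<sigma>2 / 2)) * W u) \<le> D / sqrt N + \<bar>s N u - \<sigma>2\<bar> + sqrt N * \<bar>err u\<bar>" if "u \<in> space (\<pi> N p)" for u
      proof -
        have u: "u \<in> space (conf N Y)" using that pi_space[OF N] by simp
        have s0: "0 \<le> s N u" unfolding s_def by (intro integral_nonneg_AE) auto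
        let ?x = "sqrt N * (m u - a)"
        have 1: "cmod (I u - iexp ?x * complex_of_real (exp (- s N u / 2))) \<le> D / sqrt N"
          unfolding I_def F_def m_def s_def D_def by (rule iid_char_expansion[OF K_prob[OF N u] N h B(2)])
        have "\<bar>exp (- (s N u / 2)) - exp (- (\<sigma>2 / 2))\<bar> \<le> \<bar>s N u / 2 - \<sigma>2 / 2\<bar>" using s0 \<sigma>2 by (intro exp_minus_lipschitz) auto
        then have 2: "\<bar>exp (- s N u / 2) - exp (- \<sigma>2 / 2)\<bar> \<le> \<bar>s N u - \<sigma>2\<bar>" by simp
        have "cmod (iexp ?x - W u) \<le> \<bar>?x - sqrt N * avg N k u\<bar>" unfolding W_def by (rule iexp_lipschitz)
        also have "?x - sqrt N * avg N k u = sqrt N * err u" by (simp add: err_def algebra_simps)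
        finally have 3: "cmod (iexp ?x - W u) \<le> sqrt N * \<bar>err u\<bar>" by (simp add: abs_mult)
        (* The three brackets are the three errors; the factors in front of them have modulus at most one. *)
        have "I u - complex_of_real (exp (- \<sigma>2 / 2)) * W u = (I u - iexp ?x * complex_of_real (exp (- s N u / 2))) + iexp ?x * complex_of_real (exp (- s N u / 2) - exp (- \<sigma>2 / 2)) + complex_of_real (exp (- \<sigma>2 / 2)) * (iexp ?x - W u)"
          by (simp add: algebra_simps)
        also have "cmod \<dots> \<le> cmod (I u - iexp ?x * complex_of_real (exp (- s N u / 2))) + cmod (iexp ?x * complex_of_real (exp (- s N u / 2) - exp (- \<sigma>2 / 2))) + cmod (complex_of_real (exp (- \<sigma>2 / 2)) * (iexp ?x - W u))"
          by (intro order_trans[OF norm_triangle_ineq] add_right_mono norm_triangle_ineq)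
        also have "cmod (iexp ?x * complex_of_real (exp (- s N u / 2) - exp (- \<sigma>2 / 2))) = \<bar>exp (- s N u / 2) - exp (- \<sigma>2 / 2)\<bar>"
          by (simp only: norm_mult norm_exp_i_times mult_1 norm_of_real)
        also have "cmod (complex_of_real (exp (- \<sigma>2 / 2)) * (iexp ?x - W u)) \<le> 1 * cmod (iexp ?x - W u)"
          unfolding norm_mult using \<sigma>2 by (intro mult_right_mono) auto
        finally show ?thesis using 1 2 3 by simp
      qed
      have "(CLINT u|\<pi> N (Suc p). F u) - complex_of_real (exp (- \<sigma>2 / 2)) * (CLINT u|\<pi> N p. W u) = (CLINT u|\<pi> N p. I u - complex_of_real (exp (- \<sigma>2 / 2)) * W u)"
        using iI iW by (simp add: IF(1))
      then have "cmod ((CLINT u|\<pi> N (Suc p). F u) - complex_of_real (exp (- \<sigma>2 / 2)) * (CLINT u|\<pi> N p. W u)) \<le> (\<integral>u. cmod (I u - complex_of_real (exp (- \<sigma>2 / 2)) * W u) \<partial>\<pi> N p)"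
        by simp
      also have "\<dots> \<le> (\<integral>u. D / sqrt N + \<bar>s N u - \<sigma>2\<bar> + sqrt N * \<bar>err u\<bar> \<partial>\<pi> N p)"
        by (rule integral_mono) (use iI iW isg ie pt in auto)
      also have "\<dots> = D / sqrt N + (\<integral>u. \<bar>s N u - \<sigma>2\<bar> \<partial>\<pi> N p) + sqrt N * (\<integral>u. \<bar>err u\<bar> \<partial>\<pi> N p)"
        using isg ie by (simp add: P.prob_space)
      also have "sqrt N * (\<integral>u. \<bar>err u\<bar> \<partial>\<pi> N p) \<le> sqrt N * ((C1 + C2) / N)" using err by (intro mult_left_mono) auto
      also have "sqrt N * ((C1 + C2) / N) = (C1 + C2) / sqrt N" by (simp add: sqrt_divide_self_eq[symmetric] divide_inverse)
      finally show "cmod ((CLINT u|\<pi> N (Suc p). iexp (sqrt N * (avg N h u - a))) - complex_of_real (exp (- \<sigma>2 / 2)) * (CLINT u|\<pi> N p. iexp (sqrt N * avg N k u))) \<le> E N"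
        by (simp add: F_def W_def E_def)
    qed
  qed
qed

lemma char_limit:
  "\<phi> \<in> bm X \<Longrightarrow> \<psi> \<in> bm X \<Longrightarrow>
    (\<lambda>N. CLINT u|\<pi> N p. iexp (sqrt N * (avg N (pair_diff \<phi> \<psi>) u - mean_diff p \<phi> \<psi>))) \<longlonglongrightarrow> complex_of_real (exp (- limit_var p \<phi> \<psi> / 2))"
proof (induction p arbitrary: \<phi> \<psi>)
  case (0 \<phi> \<psi>)
  have h: "pair_diff \<phi> \<psi> \<in> bm Y" by (intro pair_diff_bm 0)
  obtain B where B: "0 \<le> B" "\<And>x. x \<in> space Y \<Longrightarrow> \<bar>pair_diff \<phi> \<psi> x\<bar> \<le> B" using bmE[OF h] by blast
  have "(\<lambda>N. (CLINT u|\<pi> N 0. iexp (sqrt N * (avg N (pair_diff \<phi> \<psi>) u - mean_diff 0 \<phi> \<psi>))) - complex_of_real (exp (- limit_var 0 \<phi> \<psi> / 2))) \<longlonglongrightarrow> 0"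
  proof (rule Lim_null_comparison)
    show "(\<lambda>N. (2 * B ^ 3 + 2 * B ^ 4) / sqrt (real N)) \<longlonglongrightarrow> 0"
      by (intro real_tendsto_divide_at_top[OF tendsto_const] filterlim_compose[OF sqrt_at_top filterlim_real_sequentially])
    show "\<forall>\<^sub>F N in sequentially. norm ((CLINT u|\<pi> N 0. iexp (sqrt N * (avg N (pair_diff \<phi> \<psi>) u - mean_diff 0 \<phi> \<psi>))) - complex_of_real (exp (- limit_var 0 \<phi> \<psi> / 2))) \<le> (2 * B ^ 3 + 2 * B ^ 4) / sqrt (real N)"
    proof (rule eventually_sequentiallyI[of 1])
      fix N :: nat assume N: "1 \<le> N"
      show "norm ((CLINT u|\<pi> N 0. iexp (sqrt N * (avg N (pair_diff \<phi> \<psi>) u - mean_diff 0 \<phi> \<psi>))) - complex_of_real (exp (- limit_var 0 \<phi> \<psi> / 2))) \<le> (2 * B ^ 3 + 2 * B ^ 4) / sqrt (real N)"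
        using iid_char_expansion[OF ell_prob N h B(2), of 0 "mean_diff 0 \<phi> \<psi>"] by (simp add: pi_0[OF N] ell_pair_diff 0 time_var_eq del: of_real_exp)
    qed
  qed
  then show ?case by (simp add: LIM_zero_iff)
next
  case (Suc p)
  have q: "Qt Fine p \<phi> \<in> bm X" "Qt Coarse p \<psi> \<in> bm X" by (intro Qt_bm Suc.prems)+
  have "mean_diff p (Qt Fine p \<phi>) (Qt Coarse p \<psi>) = 0" unfolding mean_diff_def by (simp add: Qt_integral Suc.prems)
  then have "(\<lambda>N. CLINT u|\<pi> N p. iexp (sqrt N * (avg N (pair_diff (Qt Fine p \<phi>) (Qt Coarse p \<psi>)) u))) \<longlonglongrightarrow> complex_of_real (exp (- limit_var p (Qt Fine p \<phi>) (Qt Coarse p \<psi>) / 2))"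
    using Suc.IH[OF q] by simp
  from tendsto_add[OF char_step[OF Suc.prems, of p] tendsto_mult_left[OF this, of "complex_of_real (exp (- time_var (Suc p) \<phi> \<psi> / 2))"]]
  have "(\<lambda>N. CLINT u|\<pi> N (Suc p). iexp (sqrt N * (avg N (pair_diff \<phi> \<psi>) u - mean_diff (Suc p) \<phi> \<psi>))) \<longlonglongrightarrow>
     complex_of_real (exp (- time_var (Suc p) \<phi> \<psi> / 2)) * complex_of_real (exp (- limit_var p (Qt Fine p \<phi>) (Qt Coarse p \<psi>) / 2))"
    by (simp del: of_real_exp)
  also have "complex_of_real (exp (- time_var (Suc p) \<phi> \<psi> / 2)) * complex_of_real (exp (- limit_var p (Qt Fine p \<phi>) (Qt Coarse p \<psi>) / 2)) = complex_of_real (exp (- limit_var (Suc p) \<phi> \<psi> / 2))"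
    by (simp only: of_real_mult[symmetric] exp_add[symmetric]) (simp add: field_simps)
  finally show ?case .
qed

end

section \<open>Law of the particle system\<close>

definition config :: "nat \<Rightarrow> (nat \<Rightarrow> nat \<Rightarrow> 'w \<Rightarrow> 'b) \<Rightarrow> nat \<Rightarrow> 'w \<Rightarrow> nat \<Rightarrow> 'b" where
  "config N U p \<omega> = (\<lambda>i\<in>{1..N}. U p i \<omega>)"

lemma empirical_cong:
  assumes "\<And>i. i \<in> {1..N} \<Longrightarrow> u i = v i" shows "empirical Y N u = empirical Y N v"
  unfolding empirical_def using assms by (intro distr_cong) (auto simp: uniform_count_measure_def space_point_measure)

context
  fixes Y :: "'b measure" and init step and \<Omega> :: "'w measure" and N :: nat and U
  assumes ps: "particle_system Y init step \<Omega> N U" and N: "N \<ge> 1"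
begin

lemma particle_rv: "i \<in> {1..N} \<Longrightarrow> U p i \<in> \<Omega> \<rightarrow>\<^sub>M Y"
  using ps unfolding particle_system_def by blast

lemma particle_prob: "prob_space \<Omega>"
  using ps unfolding particle_system_def by blast

lemma config_measurable: "config N U p \<in> \<Omega> \<rightarrow>\<^sub>M conf N Y"
  unfolding config_def[abs_def] conf_def using particle_rv by (rule measurable_restrict)

lemma config_law_0: "distr \<Omega> (conf N Y) (config N U 0) = PiM {1..N} (\<lambda>_. init)"
proof -
  interpret prob_space \<Omega> by (rule particle_prob)
  have "indep_vars (\<lambda>_. Y) (U 0) {1..N}" and d: "\<And>i. i \<in> {1..N} \<Longrightarrow> distr \<Omega> Y (U 0 i) = init"
    using ps unfolding particle_system_def by blast+
  then have "distr \<Omega> (PiM {1..N} (\<lambda>_. Y)) (\<lambda>x. \<lambda>i\<in>{1..N}. U 0 i x) = PiM {1..N} (\<lambda>i. distr \<Omega> Y (U 0 i))"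
    using indep_vars_iff_distr_eq_PiM'[where I="{1..N}" and M'="\<lambda>_. Y" and X="U 0"] particle_rv N by auto
  also have "\<dots> = PiM {1..N} (\<lambda>_. init)" using d by (intro PiM_cong) auto
  finally show ?thesis unfolding conf_def config_def[abs_def] .
qed

lemma past_subalgebra: "subalgebra \<Omega> (past Y \<Omega> N U p)"
proof -
  let ?G = "{U q i -` A \<inter> space \<Omega> | q i A. q \<le> p \<and> i \<in> {1..N} \<and> A \<in> sets Y}"
  have "?G \<subseteq> sets \<Omega>" using measurable_sets[OF particle_rv] by blast
  then have "sigma_sets (space \<Omega>) ?G \<subseteq> sets \<Omega>" by (rule sets.sigma_sets_subset)
  moreover have "?G \<subseteq> Pow (space \<Omega>)" by auto
  ultimately show ?thesis unfolding subalgebra_def past_def by simp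
qed

text \<open>The conditional expectation identity defining the system is integrated over the past; cylinder sets
  determine a law on configurations. The kernel \<open>K\<close> has to agree with the transition of the system only
  almost surely.\<close>

lemma config_law_Suc:
  assumes K: "K \<in> conf N Y \<rightarrow>\<^sub>M prob_algebra Y"
    and eq: "AE \<omega> in \<Omega>. step p (\<lambda>i. U p i \<omega>) = K (config N U p \<omega>)"
  shows "distr \<Omega> (conf N Y) (config N U (Suc p)) = distr \<Omega> (conf N Y) (config N U p) \<bind> (\<lambda>u. PiM {1..N} (\<lambda>_. K u))"
    (is "?L = ?R")
proof -
  interpret prob_space \<Omega> by (rule particle_prob)
  interpret finite_measure_subalgebra \<Omega> "past Y \<Omega> N U p"
    by unfold_locales (rule past_subalgebra)
  let ?\<pi> = "distr \<Omega> (conf N Y) (config N U p)"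
  have \<pi>: "?\<pi> \<in> space (prob_algebra (conf N Y))"
    using prob_space_distr[OF config_measurable] by (simp add: space_prob_algebra)
  have R: "?R \<in> space (prob_algebra (conf N Y))"
    using measurable_space[OF measurable_bind_prob_space[OF measurable_const[OF \<pi>] PiM_kernel[OF K]], of undefined "count_space UNIV"] by simp
  have L: "?L \<in> space (prob_algebra (conf N Y))"
    using prob_space_distr[OF config_measurable] by (simp add: space_prob_algebra)
  show ?thesis
  proof (rule measure_eqI_PiM_finite[where I="{1..N}" and M="\<lambda>_. Y" and A="\<lambda>_. space (conf N Y)"])
    show "sets ?L = sets (PiM {1..N} (\<lambda>_. Y))" "sets ?R = sets (PiM {1..N} (\<lambda>_. Y))"
      using prob_algebraD(2)[OF L] prob_algebraD(2)[OF R] by (simp_all add: conf_def)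
    show "range (\<lambda>_::nat. space (conf N Y)) \<subseteq> prod_algebra {1..N} (\<lambda>_. Y)"
      by (auto simp: conf_def space_PiM prod_algebra_eq_finite intro!: exI[of _ "\<lambda>_. space Y"])
    show "(\<Union>i::nat. space (conf N Y)) = space (PiM {1..N} (\<lambda>_. Y))" by (simp add: conf_def)
    show "emeasure ?L (space (conf N Y)) \<noteq> \<infinity>"
      using in_space_prob_algebra[OF L] by simp
  next
    fix A :: "nat \<Rightarrow> 'b set" assume "\<And>i. i \<in> {1..N} \<Longrightarrow> A i \<in> sets Y"
    then have A: "i \<in> {1..N} \<Longrightarrow> A i \<in> sets Y" for i .
    have PA: "Pi\<^sub>E {1..N} A \<in> sets (conf N Y)" unfolding conf_def using A by (intro sets_PiM_I_finite) auto
    define f where "f \<omega> = (\<Prod>i\<in>{1..N}. indicator (A i) (U (Suc p) i \<omega>) :: real)" for \<omega>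
    define k where "k u = (\<Prod>i\<in>{1..N}. measure (K u) (A i))" for u
    have k_bm: "k \<in> bm (conf N Y)"
    proof (rule bmI[where B=1])
      have "(\<lambda>u. measure (K u) (A i)) \<in> borel_measurable (conf N Y)" if "i \<in> {1..N}" for i
        using measurable_compose[OF K measurable_measure_prob_algebra[OF A[OF that]]] .
      then show "k \<in> borel_measurable (conf N Y)" unfolding k_def by (rule borel_measurable_prod)
      fix u assume u: "u \<in> space (conf N Y)"
      interpret Ku: prob_space "K u" using kernelD(1)[OF K u] .
      have "0 \<le> k u" unfolding k_def by (intro prod_nonneg) auto
      moreover have "k u \<le> 1" unfolding k_def by (intro prod_le_1) auto
      ultimately show "\<bar>k u\<bar> \<le> 1" by simp
    qed
    have f_ind: "f \<omega> = indicator (config N U (Suc p) -` Pi\<^sub>E {1..N} A \<inter> space \<Omega>) \<omega>" if "\<omega> \<in> space \<Omega>" for \<omega>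
    proof (cases "\<forall>i\<in>{1..N}. U (Suc p) i \<omega> \<in> A i")
      case True
      then show ?thesis using that by (auto simp: f_def config_def PiE_iff intro!: prod.neutral)
    next
      case False
      then have "f \<omega> = 0" unfolding f_def by (auto simp: indicator_def)
      then show ?thesis using that False by (auto simp: config_def PiE_iff split: split_indicator)
    qed
    have S: "config N U (Suc p) -` Pi\<^sub>E {1..N} A \<inter> space \<Omega> \<in> events"
      using measurable_sets[OF config_measurable PA] .
    have f_int: "integrable \<Omega> f"
      using S by (subst Bochner_Integration.integrable_cong[OF refl f_ind])
        (auto simp: emeasure_eq_measure intro!: integrable_real_indicator)
    have step: "AE \<omega> in \<Omega>. real_cond_exp \<Omega> (past Y \<Omega> N U p) f \<omega> = (\<Prod>i\<in>{1..N}. measure (step p (\<lambda>i. U p i \<omega>)) (A i))"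
      using ps A unfolding particle_system_def f_def[abs_def] by blast
    have "emeasure ?L (Pi\<^sub>E {1..N} A) = ennreal (\<integral>\<omega>. f \<omega> \<partial>\<Omega>)"
      using S by (simp add: emeasure_distr[OF config_measurable PA] emeasure_eq_measure Bochner_Integration.integral_cong[OF refl f_ind] del: One_nat_def)
    also have "(\<integral>\<omega>. f \<omega> \<partial>\<Omega>) = (\<integral>\<omega>. real_cond_exp \<Omega> (past Y \<Omega> N U p) f \<omega> \<partial>\<Omega>)"
      by (rule real_cond_exp_int(2)[OF f_int, symmetric])
    also have "\<dots> = (\<integral>\<omega>. k (config N U p \<omega>) \<partial>\<Omega>)"
    proof (rule integral_cong_AE)
      show "real_cond_exp \<Omega> (past Y \<Omega> N U p) f \<in> borel_measurable \<Omega>" by simp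
      show "(\<lambda>\<omega>. k (config N U p \<omega>)) \<in> borel_measurable \<Omega>"
        using measurable_compose[OF config_measurable bm_measurable[OF k_bm]] .
      show "AE \<omega> in \<Omega>. real_cond_exp \<Omega> (past Y \<Omega> N U p) f \<omega> = k (config N U p \<omega>)"
        using step eq by eventually_elim (simp add: k_def)
    qed
    also have "\<dots> = (\<integral>u. k u \<partial>?\<pi>)"
      by (rule integral_distr[OF config_measurable bm_measurable[OF k_bm], symmetric])
    also have "ennreal (\<integral>u. k u \<partial>?\<pi>) = (\<integral>\<^sup>+u. ennreal (k u) \<partial>?\<pi>)"
      by (rule nn_integral_eq_integral[symmetric, OF bm_integrable[OF \<pi> k_bm]]) (auto simp: k_def intro!: prod_nonneg)
    also have "\<dots> = (\<integral>\<^sup>+u. emeasure (PiM {1..N} (\<lambda>_. K u)) (Pi\<^sub>E {1..N} A) \<partial>?\<pi>)"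
    proof (rule nn_integral_cong)
      fix u assume "u \<in> space ?\<pi>"
      then have u: "u \<in> space (conf N Y)" by simp
      interpret Ku: prob_space "K u" using kernelD(1)[OF K u] .
      interpret product_sigma_finite "\<lambda>_. K u" ..
      have "emeasure (PiM {1..N} (\<lambda>_. K u)) (Pi\<^sub>E {1..N} A) = (\<Prod>i\<in>{1..N}. emeasure (K u) (A i))"
        using A kernelD(2)[OF K u] by (intro emeasure_PiM) auto
      also have "\<dots> = ennreal (k u)"
        unfolding k_def by (simp add: Ku.emeasure_eq_measure prod_ennreal)
      finally show "ennreal (k u) = emeasure (PiM {1..N} (\<lambda>_. K u)) (Pi\<^sub>E {1..N} A)" ..
    qed
    also have "\<dots> = emeasure ?R (Pi\<^sub>E {1..N} A)"
      by (rule emeasure_bind_prob_algebra[OF \<pi> PiM_kernel[OF K] PA, symmetric])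
    finally show "emeasure ?L (Pi\<^sub>E {1..N} A) = emeasure ?R (Pi\<^sub>E {1..N} A)" .
  qed simp
qed

end

section \<open>The asymptotic variance\<close>

context feynman_kac_pos
begin

lemma mass_pos: "0 < mass s p"
  using gamma_pos by (simp add: mass_def)

lemma Qsg_refl: "Qsg G M s n n f = f"
  by (simp add: Qsg_def)

lemma Qsg_Suc: "p \<le> n \<Longrightarrow> Qsg G M s p (Suc n) f = Qsg G M s p n (Qop G M s (Suc n) f)"
  by (simp add: Qsg_def)

lemma Qop_eq: "Qop G M s (Suc n) f = (\<lambda>x. G n x * Mop s n f x)"
  by (simp add: Qop_def[abs_def] Mop_def)

lemma Qsg_scale: "p \<le> n \<Longrightarrow> Qsg G M s p n (\<lambda>x. c * f x) = (\<lambda>x. c * Qsg G M s p n f x)"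
proof (induction n arbitrary: f)
  case 0 then show ?case by (simp add: Qsg_refl)
next
  case (Suc n)
  show ?case
  proof (cases "p = Suc n")
    case True then show ?thesis by (simp add: Qsg_refl)
  next
    case False
    then have le: "p \<le> n" using Suc.prems by simp
    have "Qop G M s (Suc n) (\<lambda>x. c * f x) = (\<lambda>x. c * Qop G M s (Suc n) f x)" by (simp add: Qop_def[abs_def] mult.left_commute)
    then show ?thesis using Suc.IH[OF le] by (simp add: Qsg_Suc[OF le])
  qed
qed

text \<open>The masses telescope, since \<open>\<eta>\<^bsub>n\<^esub>(G\<^bsub>n\<^esub>)\<close> is the ratio of two successive masses.\<close>

lemma Qsg_integral: "p \<le> n \<Longrightarrow> f \<in> bm X \<Longrightarrow> (\<integral>x. Qsg G M s p n f x \<partial>et s p) = (\<integral>x. f x \<partial>et s n) * (mass s n / mass s p)"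
proof (induction n arbitrary: f)
  case 0 then show ?case using mass_pos[of s 0] by (simp add: Qsg_refl)
next
  case (Suc n)
  show ?case
  proof (cases "p = Suc n")
    case True then show ?thesis using mass_pos[of s "Suc n"] by (simp add: Qsg_refl)
  next
    case False
    then have le: "p \<le> n" using Suc.prems by simp
    have "(\<integral>x. Qsg G M s p (Suc n) f x \<partial>et s p) = (\<integral>x. G n x * Mop s n f x \<partial>et s n) * (mass s n / mass s p)"
      unfolding Qsg_Suc[OF le] Qop_eq by (rule Suc.IH[OF le]) (intro bm_mult G_bm Mop_bm Suc.prems)
    also have "(\<integral>x. G n x * Mop s n f x \<partial>et s n) = (\<integral>x. f x \<partial>et s (Suc n)) * (mass s (Suc n) / mass s n)"
      using eta_Suc[OF Suc.prems(2), of s n] by (simp add: eta_G)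
    finally show ?thesis using mass_pos[of s n] by simp
  qed
qed

lemma Dop_eq:
  assumes "p \<le> n"
  shows "Dop X G eta0 M s p n \<phi> x = Qsg G M s p n (ctr s n \<phi>) x * (mass s p / mass s n)"
proof -
  have "(\<integral>u. Qsg G M s p n (\<lambda>_. 1) u \<partial>et s p) = mass s n / mass s p"
    using Qsg_integral[OF assms bm_const[of 1], of s] prob_space.prob_space[OF prob_algebraD(1)[OF eta_prob[of s n]]] by simp
  then show ?thesis using mass_pos[of s p]
    by (cases "p = n") (simp_all add: Dop_def Let_def ctr_def[abs_def] Qsg_refl)
qed

text \<open>Peel the last factor off the semigroup. Since \<open>Qt s n \<phi>\<close> is already centred under \<open>\<eta>\<^bsub>n\<^esub>\<close>, the centring
  inside \<open>D\<^bsub>p,n\<^esub>\<close> changes nothing.\<close>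

lemma Dop_Suc:
  assumes le: "p \<le> n" and \<phi>: "\<phi> \<in> bm X"
  shows "Dop X G eta0 M s p (Suc n) \<phi> = Dop X G eta0 M s p n (Qt s n \<phi>)"
proof
  fix x
  have 1: "Qop G M s (Suc n) (ctr s (Suc n) \<phi>) = GM s n \<phi>" by (simp add: Qop_eq GM_def[abs_def])
  have 2: "GM s n \<phi> = (\<lambda>x. (mass s (Suc n) / mass s n) * Qt s n \<phi> x)"
    using mass_pos[of s n] mass_pos[of s "Suc n"] by (auto simp: Qt_def eta_G)
  have 3: "ctr s n (Qt s n \<phi>) = Qt s n \<phi>" by (simp add: ctr_def[abs_def] Qt_integral[OF \<phi>])
  have "Dop X G eta0 M s p (Suc n) \<phi> x = (mass s (Suc n) / mass s n) * Qsg G M s p n (Qt s n \<phi>) x * (mass s p / mass s (Suc n))"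
    using le by (simp only: Dop_eq[OF le_SucI[OF le]] Qsg_Suc[OF le] 1 2 Qsg_scale[OF le])
  also have "\<dots> = Dop X G eta0 M s p n (Qt s n \<phi>) x"
    using mass_pos[of s "Suc n"] by (simp add: Dop_eq[OF le] 3)
  finally show "Dop X G eta0 M s p (Suc n) \<phi> x = Dop X G eta0 M s p n (Qt s n \<phi>) x" .
qed

lemma Dop_same: "Dop X G eta0 M s n n \<phi> = ctr s n \<phi>"
  using mass_pos[of s n] by (auto simp: Dop_eq Qsg_refl)

lemma Mop_scale: "Mop s p (\<lambda>x. c * f x) x = c * Mop s p f x"
  by (simp add: Mop_def)

lemma Qt_scale: "Qt s p (\<lambda>x. c * \<phi> x) = (\<lambda>x. c * Qt s p \<phi> x)"
proof -
  have "ctr s (Suc p) (\<lambda>x. c * \<phi> x) = (\<lambda>x. c * ctr s (Suc p) \<phi> x)" by (auto simp: ctr_def algebra_simps)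
  then show ?thesis by (auto simp: Qt_def GM_def Mop_scale)
qed

end

lemma char_centred_normal:
  assumes "0 \<le> v" shows "char (centred_normal v) t = complex_of_real (exp (- (t\<^sup>2 * v) / 2))"
    and "real_distribution (centred_normal v)"
proof -
  have "char (centred_normal v) t = complex_of_real (exp (- (t\<^sup>2 * v) / 2)) \<and> real_distribution (centred_normal v)"
  proof (cases "v = 0")
    case True
    interpret prob_space "return borel 0 :: real measure" by (rule prob_space_return) simp
    have "real_distribution (return borel (0::real))" by unfold_locales auto
    then show ?thesis using True by (simp add: centred_normal_def char_def integral_return)
  next
    case False
    then have v: "0 < sqrt v" using assms by simp
    interpret S: real_distribution std_normal_distribution by (rule real_dist_normal_dist)
    have "distr std_normal_distribution lborel (\<lambda>x. x) = std_normal_distribution"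
      by (rule distr_id2) simp
    then have "distributed std_normal_distribution lborel (\<lambda>x. x) (\<lambda>x. ennreal (std_normal_density x))"
      by (simp add: distributed_def)
    from S.normal_density_affine[OF this, of "sqrt v" 0] v
    have "distributed std_normal_distribution lborel (\<lambda>x. sqrt v * x) (\<lambda>x. ennreal (normal_density 0 (sqrt v) x))" by simp
    then have d: "distr std_normal_distribution lborel (\<lambda>x. sqrt v * x) = centred_normal v"
      using False by (simp add: distributed_def centred_normal_def)
    have d': "centred_normal v = distr std_normal_distribution borel (\<lambda>x. sqrt v * x)"
      unfolding d[symmetric] by (rule distr_cong) simp_all
    have "char (centred_normal v) t = char std_normal_distribution (t * sqrt v)"
      unfolding d' char_def by (subst integral_distr) (auto simp: mult.assoc)
    also have "\<dots> = complex_of_real (exp (- (t\<^sup>2 * v) / 2))"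
      using assms by (simp add: char_std_normal_distribution power_mult_distrib)
    finally show ?thesis using d' S.real_distribution_distr[of "\<lambda>x. sqrt v * x"] by simp
  qed
  then show "char (centred_normal v) t = complex_of_real (exp (- (t\<^sup>2 * v) / 2))" "real_distribution (centred_normal v)" by auto
qed

context coupled_particle_scheme
begin

lemma limit_var_eq:
  "\<phi> \<in> bm X \<Longrightarrow> \<psi> \<in> bm X \<Longrightarrow> limit_var n \<phi> \<psi> =
    (\<Sum>p=0..n. \<integral>z. (Dop X G eta0 M Fine p n \<phi> (fst z) - Dop X G eta0 M Coarse p n \<psi> (snd z))\<^sup>2 \<partial>ell p)"
proof (induction n arbitrary: \<phi> \<psi>)
  case 0
  then show ?case by (simp add: Dop_same time_var_def)
next
  case (Suc n)
  have "limit_var n (Qt Fine n \<phi>) (Qt Coarse n \<psi>) =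
    (\<Sum>p=0..n. \<integral>z. (Dop X G eta0 M Fine p n (Qt Fine n \<phi>) (fst z) - Dop X G eta0 M Coarse p n (Qt Coarse n \<psi>) (snd z))\<^sup>2 \<partial>ell p)"
    by (intro Suc.IH Qt_bm Suc.prems)
  also have "\<dots> = (\<Sum>p=0..n. \<integral>z. (Dop X G eta0 M Fine p (Suc n) \<phi> (fst z) - Dop X G eta0 M Coarse p (Suc n) \<psi> (snd z))\<^sup>2 \<partial>ell p)"
    by (intro sum.cong refl) (simp add: Dop_Suc Suc.prems)
  finally show ?case by (simp add: Dop_same time_var_def)
qed

text \<open>Linearity in the test functions: the characteristic function at \<open>t\<close> is the one at \<open>1\<close> for the test
  functions multiplied by \<open>t\<close>.\<close>

lemma limit_var_scale: "limit_var n (\<lambda>x. t * \<phi> x) (\<lambda>x. t * \<psi> x) = t\<^sup>2 * limit_var n \<phi> \<psi>"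
proof (induction n arbitrary: \<phi> \<psi>)
  case 0
  have "time_var 0 (\<lambda>x. t * \<phi> x) (\<lambda>x. t * \<psi> x) = (\<integral>z. t\<^sup>2 * (ctr Fine 0 \<phi> (fst z) - ctr Coarse 0 \<psi> (snd z))\<^sup>2 \<partial>ell 0)"
    unfolding time_var_def by (intro arg_cong[where f="integral\<^sup>L _"] ext) (simp add: ctr_def power2_eq_square algebra_simps)
  then show ?case by (simp add: time_var_def)
next
  case (Suc n)
  have "time_var (Suc n) (\<lambda>x. t * \<phi> x) (\<lambda>x. t * \<psi> x) = (\<integral>z. t\<^sup>2 * (ctr Fine (Suc n) \<phi> (fst z) - ctr Coarse (Suc n) \<psi> (snd z))\<^sup>2 \<partial>ell (Suc n))"
    unfolding time_var_def by (intro arg_cong[where f="integral\<^sup>L _"] ext) (simp add: ctr_def power2_eq_square algebra_simps)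
  then show ?case using Suc.IH by (simp add: Qt_scale time_var_def distrib_left)
qed

lemma scheme_weak_conv:
  fixes \<Omega> :: "nat \<Rightarrow> 'w measure" and U :: "nat \<Rightarrow> nat \<Rightarrow> nat \<Rightarrow> 'w \<Rightarrow> 'a \<times> 'a"
  assumes \<Omega>: "\<And>N. N \<ge> 1 \<Longrightarrow> prob_space (\<Omega> N)"
    and U: "\<And>N p. N \<ge> 1 \<Longrightarrow> config N (U N) p \<in> \<Omega> N \<rightarrow>\<^sub>M conf N Y"
    and \<pi>: "\<And>N p. N \<ge> 1 \<Longrightarrow> \<pi> N p = distr (\<Omega> N) (conf N Y) (config N (U N) p)"
    and \<phi>: "\<phi> \<in> bm X"
  shows "weak_conv_m (\<lambda>N. distr (\<Omega> N) borel (scaled_error X ell N (U N) n \<phi>)) (centred_normal (asymp_variance X G eta0 M ell n \<phi>))"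
proof -
  let ?v = "asymp_variance X G eta0 M ell n \<phi>"
  have v: "?v = limit_var n \<phi> \<phi>" unfolding asymp_variance_def by (rule limit_var_eq[OF \<phi> \<phi>, symmetric])
  have v0: "0 \<le> ?v" unfolding asymp_variance_def by (intro sum_nonneg integral_nonneg_AE) auto
  define err where "err N u = sqrt N * (avg N (pair_diff \<phi> \<phi>) u - mean_diff n \<phi> \<phi>)" for N :: nat and u
  have err_bm: "err N \<in> bm (conf N Y)" for N
    unfolding err_def[abs_def] by (intro bm_mult bm_const bm_diff avg_bm pair_diff_bm \<phi>)
  have se: "scaled_error X ell N (U N) n \<phi> \<omega> = err N (config N (U N) n \<omega>)" if "N \<ge> 1" "\<omega> \<in> space (\<Omega> N)" for N \<omega>
  proof -
    have u: "config N (U N) n \<omega> \<in> space (conf N Y)" using measurable_space[OF U[OF that(1)] that(2)] .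
    have "empirical Y N (\<lambda>i. U N n i \<omega>) = empirical Y N (config N (U N) n \<omega>)"
      by (rule empirical_cong) (simp add: config_def)
    then have "(\<integral>z. \<phi> (fst z) - \<phi> (snd z) \<partial>empirical Y N (\<lambda>i. U N n i \<omega>)) = (\<integral>z. pair_diff \<phi> \<phi> z \<partial>empirical Y N (config N (U N) n \<omega>))"
      by (simp add: pair_diff_def)
    also have "\<dots> = avg N (pair_diff \<phi> \<phi>) (config N (U N) n \<omega>)"
      by (rule integral_empirical[OF conf_space[OF u] bm_measurable[OF pair_diff_bm[OF \<phi> \<phi>]]])
    finally have 1: "(\<integral>z. \<phi> (fst z) - \<phi> (snd z) \<partial>empirical Y N (\<lambda>i. U N n i \<omega>)) = avg N (pair_diff \<phi> \<phi>) (config N (U N) n \<omega>)" .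
    have 2: "(\<integral>z. \<phi> (fst z) - \<phi> (snd z) \<partial>ell n) = mean_diff n \<phi> \<phi>"
      using ell_pair_diff[OF \<phi> \<phi>, of n] by (simp add: pair_diff_def)
    show ?thesis unfolding scaled_error_def err_def 1 2 ..
  qed
  have em: "(\<lambda>\<omega>. err N (config N (U N) n \<omega>)) \<in> borel_measurable (\<Omega> N)" if "N \<ge> 1" for N
    using measurable_compose[OF U[OF that] bm_measurable[OF err_bm]] .
  have sem: "scaled_error X ell N (U N) n \<phi> \<in> borel_measurable (\<Omega> N)" if "N \<ge> 1" for N
    using em[OF that] by (subst measurable_cong[OF se[OF that]])
  let ?D = "\<lambda>N. distr (\<Omega> N) borel (scaled_error X ell N (U N) n \<phi>)"
  have rd: "real_distribution (?D N)" if "N \<ge> 1" for N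
    using prob_space.real_distribution_distr[OF \<Omega>[OF that] sem[OF that]] .
  have ch: "char (?D N) t = (CLINT u|\<pi> N n. iexp (sqrt N * (avg N (pair_diff (\<lambda>x. t * \<phi> x) (\<lambda>x. t * \<phi> x)) u - mean_diff n (\<lambda>x. t * \<phi> x) (\<lambda>x. t * \<phi> x))))"
    if N: "N \<ge> 1" for N t
  proof -
    have "char (?D N) t = (CLINT \<omega>|\<Omega> N. iexp (t * scaled_error X ell N (U N) n \<phi> \<omega>))"
      unfolding char_def using sem[OF N] by (intro integral_distr) auto
    also have "\<dots> = (CLINT \<omega>|\<Omega> N. iexp (t * err N (config N (U N) n \<omega>)))"
      by (intro Bochner_Integration.integral_cong refl) (simp add: se[OF N])
    also have "\<dots> = (CLINT u|\<pi> N n. iexp (t * err N u))"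
      unfolding \<pi>[OF N] using bm_measurable[OF err_bm[of N]] by (intro integral_distr[symmetric] U[OF N]) auto
    also have "\<dots> = (CLINT u|\<pi> N n. iexp (sqrt N * (avg N (pair_diff (\<lambda>x. t * \<phi> x) (\<lambda>x. t * \<phi> x)) u - mean_diff n (\<lambda>x. t * \<phi> x) (\<lambda>x. t * \<phi> x))))"
    proof -
      have "t * err N u = sqrt N * (avg N (pair_diff (\<lambda>x. t * \<phi> x) (\<lambda>x. t * \<phi> x)) u - mean_diff n (\<lambda>x. t * \<phi> x) (\<lambda>x. t * \<phi> x))" for u
        unfolding err_def pair_diff_def[abs_def] mean_diff_def avg_diff avg_cmult by (simp add: algebra_simps)
      then show ?thesis by presburger
    qed
    finally show ?thesis .
  qed
  have lim: "(\<lambda>N. char (?D N) t) \<longlonglongrightarrow> char (centred_normal ?v) t" for t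
  proof -
    have t\<phi>: "(\<lambda>x. t * \<phi> x) \<in> bm X" using \<phi> by auto
    have "(\<lambda>N. CLINT u|\<pi> N n. iexp (sqrt N * (avg N (pair_diff (\<lambda>x. t * \<phi> x) (\<lambda>x. t * \<phi> x)) u - mean_diff n (\<lambda>x. t * \<phi> x) (\<lambda>x. t * \<phi> x))))
      \<longlonglongrightarrow> char (centred_normal ?v) t"
      using char_limit[OF t\<phi> t\<phi>, of n] unfolding v limit_var_scale char_centred_normal(1)[OF v0[unfolded v]] .
    then show ?thesis
      by (rule Lim_transform_eventually) (auto simp: ch intro!: eventually_sequentiallyI[of 1])
  qed
  (* The sequence is shifted by one, because nothing is known about index 0; weak convergence ignores the shift. *)
  have "weak_conv_m (\<lambda>N. ?D (Suc N)) (centred_normal ?v)"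
  proof (rule levy_continuity)
    show "real_distribution (?D (Suc N))" for N by (rule rd) simp
    show "real_distribution (centred_normal ?v)" by (rule char_centred_normal(2)[OF v0])
    show "(\<lambda>N. char (?D (Suc N)) t) \<longlonglongrightarrow> char (centred_normal ?v) t" for t
      using LIMSEQ_Suc[OF lim[of t]] .
  qed
  then have "(\<lambda>N. cdf (?D (Suc N)) x) \<longlonglongrightarrow> cdf (centred_normal ?v) x" if "isCont (cdf (centred_normal ?v)) x" for x
    using that unfolding weak_conv_m_def weak_conv_def by blast
  from LIMSEQ_imp_Suc[OF this] show ?thesis
    unfolding weak_conv_m_def weak_conv_def by (intro allI impI)
qed

end

section \<open>From particle systems to schemes\<close>

lemma emp_prob:
  "N \<ge> 1 \<Longrightarrow> u \<in> space (conf N (X \<Otimes>\<^sub>M X)) \<Longrightarrow> empirical X N (\<lambda>i. proj s (u i)) \<in> space (prob_algebra X)"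
  by (rule empirical_prob[OF _ proj_space[OF conf_space]])

lemma emp_int:
  assumes u: "u \<in> space (conf N (X \<Otimes>\<^sub>M X))" and f: "f \<in> bm X"
  shows "(\<integral>x. f x \<partial>empirical X N (\<lambda>i. proj s (u i))) = avg N (\<lambda>z. f (proj s z)) u"
proof -
  have "(\<integral>x. f x \<partial>empirical X N (\<lambda>i. proj s (u i))) = avg N f (\<lambda>i. proj s (u i))"
    by (rule integral_empirical[OF proj_space[OF conf_space[OF u]] bm_measurable[OF f]])
  then show ?thesis by (simp add: avg_def)
qed

text \<open>\<open>step N p u\<close> is the sampling law as the algorithm defines it. Its properties are available only where
  the normalising constants are positive; measurability in \<open>u\<close> is stated as agreement there with some
  measurable function.\<close>

locale particle_algorithm = feynman_kac_pos X G eta0 M etac0 Mc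
  for X :: "'a measure" and G eta0 M etac0 Mc +
  fixes step :: "nat \<Rightarrow> nat \<Rightarrow> (nat \<Rightarrow> 'a \<times> 'a) \<Rightarrow> ('a \<times> 'a) measure"
    and ell :: "nat \<Rightarrow> ('a \<times> 'a) measure" and \<Omega> :: "nat \<Rightarrow> 'w measure"
    and U :: "nat \<Rightarrow> nat \<Rightarrow> nat \<Rightarrow> 'w \<Rightarrow> 'a \<times> 'a"
  assumes lim_prob: "ell p \<in> space (prob_algebra (X \<Otimes>\<^sub>M X))"
    and lim_marg: "\<phi> \<in> bm X \<Longrightarrow> (\<integral>z. \<phi> (proj s z) \<partial>ell p) = (\<integral>x. \<phi> x \<partial>eta X G eta0 M s p)"
    and sys: "N \<ge> 1 \<Longrightarrow> particle_system (X \<Otimes>\<^sub>M X) (ell 0) (step N) (\<Omega> N) N (U N)"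
    and weights: "N \<ge> 1 \<Longrightarrow> positive_weights X G (\<Omega> N) N (U N)"
    and step_cong: "(\<And>i. i \<in> {1..N} \<Longrightarrow> u i = v i) \<Longrightarrow> step N p u = step N p v"
    and step_prob: "N \<ge> 1 \<Longrightarrow> u \<in> space (conf N (X \<Otimes>\<^sub>M X)) \<Longrightarrow> (\<And>s. 0 < avg N (\<lambda>z. G p (proj s z)) u) \<Longrightarrow>
        step N p u \<in> space (prob_algebra (X \<Otimes>\<^sub>M X))"
    and step_meas: "N \<ge> 1 \<Longrightarrow> S \<in> sets (X \<Otimes>\<^sub>M X) \<Longrightarrow> \<exists>R\<in>borel_measurable (conf N (X \<Otimes>\<^sub>M X)).
        \<forall>u\<in>space (conf N (X \<Otimes>\<^sub>M X)). (\<forall>s. 0 < avg N (\<lambda>z. G p (proj s z)) u) \<longrightarrow> measure (step N p u) S = R u"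
    and step_marg: "N \<ge> 1 \<Longrightarrow> u \<in> space (conf N (X \<Otimes>\<^sub>M X)) \<Longrightarrow> (\<And>s. 0 < avg N (\<lambda>z. G p (proj s z)) u) \<Longrightarrow> \<phi> \<in> bm X \<Longrightarrow>
      (\<integral>z. \<phi> (proj s z) \<partial>step N p u) * avg N (\<lambda>z. G p (proj s z)) u
        = avg N (\<lambda>z. G p (proj s z) * (\<integral>y. \<phi> y \<partial>M s (Suc p) (proj s z))) u"
begin

definition good :: "nat \<Rightarrow> nat \<Rightarrow> (nat \<Rightarrow> 'a \<times> 'a) \<Rightarrow> bool" where
  "good N p u \<longleftrightarrow> (\<forall>s. 0 < Gavg N p s u)"

text \<open>Where a normalising constant vanishes, an arbitrary fixed law makes \<open>ker\<close> a kernel. Such configurations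
  have probability zero.\<close>

definition ker :: "nat \<Rightarrow> nat \<Rightarrow> (nat \<Rightarrow> 'a \<times> 'a) \<Rightarrow> ('a \<times> 'a) measure" where
  "ker N p u = (if good N p u then step N p u else etac0)"

definition plaw :: "nat \<Rightarrow> nat \<Rightarrow> (nat \<Rightarrow> 'a \<times> 'a) measure" where
  "plaw N p = distr (\<Omega> N) (conf N Y) (config N (U N) p)"

lemma good_pred: "Measurable.pred (conf N Y) (good N p)"
proof -
  have eq: "good N p u \<longleftrightarrow> 0 < Gavg N p Fine u \<and> 0 < Gavg N p Coarse u" for u
    unfolding good_def by (metis level.exhaust)
  have m: "Gavg N p s \<in> borel_measurable (conf N Y)" for s
    by (rule bm_measurable[OF avg_bm[OF bm_proj[OF G_bm]]])
  note m[measurable]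
  show ?thesis unfolding eq by measurable
qed

lemma ker_kernel:
  assumes N: "N \<ge> 1" shows "ker N p \<in> conf N Y \<rightarrow>\<^sub>M prob_algebra Y"
proof (rule measurable_prob_algebra_generated[OF sets.sigma_sets_eq[symmetric] sets.Int_stable sets.space_closed])
  have k: "ker N p u \<in> space (prob_algebra Y)" if "u \<in> space (conf N Y)" for u
    using step_prob[OF N that, of p] etac0_prob by (auto simp: ker_def good_def)
  show "prob_space (ker N p u)" "sets (ker N p u) = sets Y" if "u \<in> space (conf N Y)" for u
    using prob_algebraD[OF k[OF that]] by auto
  fix S assume S: "S \<in> sets Y"
  obtain R where R: "R \<in> borel_measurable (conf N Y)" "\<And>u. u \<in> space (conf N Y) \<Longrightarrow> good N p u \<Longrightarrow> measure (step N p u) S = R u"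
    using step_meas[OF N S, of p] unfolding good_def by blast
  have "emeasure (ker N p u) S = ennreal (if good N p u then R u else measure etac0 S)" if "u \<in> space (conf N Y)" for u
  proof -
    interpret prob_space "ker N p u" using prob_algebraD[OF k[OF that]] by auto
    show ?thesis using R(2)[OF that] by (simp add: emeasure_eq_measure) (simp add: ker_def)
  qed
  moreover have "(\<lambda>u. ennreal (if good N p u then R u else measure etac0 S)) \<in> borel_measurable (conf N Y)"
    using R(1) good_pred[of N p] by measurable
  ultimately show "(\<lambda>u. emeasure (ker N p u) S) \<in> borel_measurable (conf N Y)"
    by (simp cong: measurable_cong)
qed

lemma config_m: "N \<ge> 1 \<Longrightarrow> config N (U N) p \<in> \<Omega> N \<rightarrow>\<^sub>M conf N Y"
  by (rule config_measurable[OF sys])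

lemma AE_good: assumes N: "N \<ge> 1" shows "AE \<omega> in \<Omega> N. good N p (config N (U N) p \<omega>)"
proof -
  have e: "(\<integral>x. G p x \<partial>empirical X N (\<lambda>i. proj s (U N p i \<omega>))) = Gavg N p s (config N (U N) p \<omega>)"
    if "\<omega> \<in> space (\<Omega> N)" for \<omega> s
  proof -
    have "empirical X N (\<lambda>i. proj s (U N p i \<omega>)) = empirical X N (\<lambda>i. proj s (config N (U N) p \<omega> i))"
      by (rule empirical_cong) (simp add: config_def)
    then show ?thesis using emp_int[OF measurable_space[OF config_m[OF N] that] G_bm] by metis
  qed
  have "AE \<omega> in \<Omega> N. 0 < (\<integral>x. G p x \<partial>empirical X N (\<lambda>i. proj s (U N p i \<omega>)))" for s
    using weights[OF N] unfolding positive_weights_def by blast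
  from this[of Fine] this[of Coarse] AE_space show ?thesis
  proof eventually_elim
    case (elim \<omega>)
    show ?case unfolding good_def
    proof
      fix s show "0 < Gavg N p s (config N (U N) p \<omega>)"
        using elim e[OF elim(3), of s] by (cases s) (auto simp del: proj.simps)
    qed
  qed
qed

sublocale particle_scheme X G eta0 M etac0 Mc ell plaw ker
proof unfold_locales
  show "ell p \<in> space (prob_algebra Y)" for p by (rule lim_prob)
  show "\<phi> \<in> bm X \<Longrightarrow> (\<integral>z. \<phi> (proj s z) \<partial>ell p) = (\<integral>x. \<phi> x \<partial>et s p)" for \<phi> s p by (rule lim_marg)
  show "plaw N 0 = PiM {1..N} (\<lambda>_. ell 0)" if "N \<ge> 1" for N
    unfolding plaw_def by (rule config_law_0[OF sys[OF that] that])
  show "plaw N (Suc p) = plaw N p \<bind> (\<lambda>u. PiM {1..N} (\<lambda>_. ker N p u))" if N: "N \<ge> 1" for N p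
    unfolding plaw_def
  proof (rule config_law_Suc[OF sys[OF N] N ker_kernel[OF N]])
    show "AE \<omega> in \<Omega> N. step N p (\<lambda>i. U N p i \<omega>) = ker N p (config N (U N) p \<omega>)"
      using AE_good[OF N, of p]
    proof eventually_elim
      case (elim \<omega>)
      have "step N p (\<lambda>i. U N p i \<omega>) = step N p (config N (U N) p \<omega>)" by (rule step_cong) (simp add: config_def)
      with elim show ?case by (simp add: ker_def)
    qed
  qed
  show "ker N p \<in> conf N Y \<rightarrow>\<^sub>M prob_algebra Y" if "N \<ge> 1" for N p using that by (rule ker_kernel)
  show "AE u in plaw N p. 0 < Gavg N p s u" if N: "N \<ge> 1" for N p s
  proof -
    have "AE u in plaw N p. good N p u"
      unfolding plaw_def using AE_good[OF N, of p] good_pred[of N p]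
      by (subst AE_distr_iff[OF config_m[OF N]]) (auto simp: pred_def)
    then show ?thesis by eventually_elim (simp add: good_def)
  qed
  show "(\<integral>z. \<phi> (proj s z) \<partial>ker N p u) * Gavg N p s u
        = avg N (\<lambda>z. G p (proj s z) * (\<integral>y. \<phi> y \<partial>M s (Suc p) (proj s z))) u"
    if "N \<ge> 1" "u \<in> space (conf N Y)" "\<And>s. 0 < Gavg N p s u" "\<phi> \<in> bm X" for N u p \<phi> s
    using step_marg[OF that] that(3) by (simp add: ker_def good_def del: proj.simps)
qed

lemma AE_ker: assumes N: "N \<ge> 1"
  shows "AE u in plaw N p. u \<in> space (conf N Y) \<and> (\<forall>s. 0 < Gavg N p s u) \<and> ker N p u = step N p u"
  using pos_all[OF N, of p] by eventually_elim (simp add: ker_def good_def)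

lemma weak_conv_of_cross:
  assumes cross: "\<And>\<phi> \<psi> p. \<phi> \<in> bm X \<Longrightarrow> \<psi> \<in> bm X \<Longrightarrow>
    L1_conv (\<lambda>N. plaw N p) (\<lambda>N u. \<integral>z. \<phi> (fst z) * \<psi> (snd z) \<partial>ker N p u) (\<integral>z. \<phi> (fst z) * \<psi> (snd z) \<partial>ell (Suc p))"
    and \<phi>: "\<phi> \<in> bm X"
  shows "weak_conv_m (\<lambda>N. distr (\<Omega> N) borel (scaled_error X ell N (U N) n \<phi>)) (centred_normal (asymp_variance X G eta0 M ell n \<phi>))"
proof -
  interpret C: coupled_particle_scheme X G eta0 M etac0 Mc ell plaw ker
    by unfold_locales (rule cross)
  show ?thesis
    by (rule C.scheme_weak_conv[OF particle_prob[OF sys] config_m plaw_def \<phi>])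
qed

end

section \<open>Independent resampling\<close>

text \<open>For a product measure the normalising constant of the coupled update factorises, so that one factor
  cancels in each marginal.\<close>

lemma Phi_I_product:
  assumes K: "K \<in> X \<Otimes>\<^sub>M X \<rightarrow>\<^sub>M prob_algebra (X \<Otimes>\<^sub>M X)"
    and \<mu>: "\<And>s. \<mu> s \<in> space (prob_algebra X)"
    and g: "g \<in> bm X" "\<And>x. x \<in> space X \<Longrightarrow> 0 \<le> g x" and D: "\<And>s. 0 < (\<integral>x. g x \<partial>\<mu> s)"
  shows Phi_I_product_prob: "Phi_I X g K (\<mu> Fine \<Otimes>\<^sub>M \<mu> Coarse) \<in> space (prob_algebra (X \<Otimes>\<^sub>M X))"
    and Phi_I_product_integral: "f \<in> bm (X \<Otimes>\<^sub>M X) \<Longrightarrow> (\<integral>z. f z \<partial>Phi_I X g K (\<mu> Fine \<Otimes>\<^sub>M \<mu> Coarse)) * ((\<integral>x. g x \<partial>\<mu> Fine) * (\<integral>x. g x \<partial>\<mu> Coarse))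
      = (\<integral>z. g (fst z) * g (snd z) * (\<integral>x. f x \<partial>K z) \<partial>(\<mu> Fine \<Otimes>\<^sub>M \<mu> Coarse))"
    and Phi_I_product_marginal: "\<phi> \<in> bm X \<Longrightarrow> \<psi> \<in> bm X \<Longrightarrow> (\<And>z. z \<in> space (X \<Otimes>\<^sub>M X) \<Longrightarrow> (\<integral>x. \<phi> (proj s x) \<partial>K z) = \<psi> (proj s z)) \<Longrightarrow>
      (\<integral>z. \<phi> (proj s z) \<partial>Phi_I X g K (\<mu> Fine \<Otimes>\<^sub>M \<mu> Coarse)) * (\<integral>x. g x \<partial>\<mu> s) = (\<integral>x. g x * \<psi> x \<partial>\<mu> s)"
proof -
  let ?m = "\<mu> Fine \<Otimes>\<^sub>M \<mu> Coarse"
  note m = pa_pair[OF \<mu>[of Fine] \<mu>[of Coarse]]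
  note sf = pa_sigma_finite[OF \<mu>]
  have gi: "integrable (\<mu> s) g" for s using bm_integrable[OF \<mu> g(1)] .
  have gg: "(\<integral>z. g (fst z) * g (snd z) \<partial>?m) = (\<integral>x. g x \<partial>\<mu> Fine) * (\<integral>x. g x \<partial>\<mu> Coarse)"
    by (rule tensor_integral_eq[OF sf sf gi gi])
  then have D': "0 < (\<integral>z. g (fst z) * g (snd z) \<partial>?m)" using D by simp
  show "Phi_I X g K ?m \<in> space (prob_algebra (X \<Otimes>\<^sub>M X))" by (rule Phi_I_prob[OF K m g D'])
  show F: "(\<integral>z. f z \<partial>Phi_I X g K ?m) * ((\<integral>x. g x \<partial>\<mu> Fine) * (\<integral>x. g x \<partial>\<mu> Coarse))
      = (\<integral>z. g (fst z) * g (snd z) * (\<integral>x. f x \<partial>K z) \<partial>?m)" if "f \<in> bm (X \<Otimes>\<^sub>M X)" for f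
    using Phi_I_integral[OF K m g D' that] D[of Fine] D[of Coarse] gg by simp
  assume \<phi>: "\<phi> \<in> bm X" and \<psi>: "\<psi> \<in> bm X"
    and Km: "\<And>z. z \<in> space (X \<Otimes>\<^sub>M X) \<Longrightarrow> (\<integral>x. \<phi> (proj s x) \<partial>K z) = \<psi> (proj s z)"
  have g\<psi>i: "integrable (\<mu> s) (\<lambda>x. g x * \<psi> x)" for s using bm_integrable[OF \<mu> bm_mult[OF g(1) \<psi>]] .
  have "(\<integral>z. g (fst z) * g (snd z) * (\<integral>x. \<phi> (proj s x) \<partial>K z) \<partial>?m) = (\<integral>z. g (fst z) * g (snd z) * \<psi> (proj s z) \<partial>?m)"
    using prob_algebraD(3)[OF m] by (intro Bochner_Integration.integral_cong refl) (simp add: Km)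
  also have "\<dots> = (\<integral>x. g x * \<psi> x \<partial>\<mu> s) * (\<integral>x. g x \<partial>\<mu> (case s of Fine \<Rightarrow> Coarse | Coarse \<Rightarrow> Fine))"
  proof (cases s)
    case Fine
    have "(\<integral>z. g (fst z) * g (snd z) * \<psi> (proj s z) \<partial>?m) = (\<integral>z. (g (fst z) * \<psi> (fst z)) * g (snd z) \<partial>?m)"
      using Fine by (intro Bochner_Integration.integral_cong refl) simp
    then show ?thesis using tensor_integral_eq[OF sf sf g\<psi>i gi, of Fine Coarse] Fine by simp
  next
    case Coarse
    have "(\<integral>z. g (fst z) * g (snd z) * \<psi> (proj s z) \<partial>?m) = (\<integral>z. g (fst z) * (g (snd z) * \<psi> (snd z)) \<partial>?m)"
      using Coarse by (intro Bochner_Integration.integral_cong refl) simp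
    then show ?thesis using tensor_integral_eq[OF sf sf gi g\<psi>i, of Fine Coarse] Coarse by simp
  qed
  finally have "(\<integral>z. \<phi> (proj s z) \<partial>Phi_I X g K ?m) * ((\<integral>x. g x \<partial>\<mu> Fine) * (\<integral>x. g x \<partial>\<mu> Coarse))
    = (\<integral>x. g x * \<psi> x \<partial>\<mu> s) * (\<integral>x. g x \<partial>\<mu> (case s of Fine \<Rightarrow> Coarse | Coarse \<Rightarrow> Fine))"
    using F[OF bm_proj[OF \<phi>]] by simp
  then show "(\<integral>z. \<phi> (proj s z) \<partial>Phi_I X g K ?m) * (\<integral>x. g x \<partial>\<mu> s) = (\<integral>x. g x * \<psi> x \<partial>\<mu> s)"
    using D[of Fine] D[of Coarse] by (cases s) (auto simp: mult.assoc[symmetric])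
qed

context feynman_kac_pos
begin

lemma marg_ratio:
  assumes "a * (\<integral>x. G p x \<partial>et s p) = (\<integral>x. G p x * Mop s p \<phi> x \<partial>et s p)" and "\<phi> \<in> bm X"
  shows "a = (\<integral>x. \<phi> x \<partial>et s (Suc p))"
  using assms eta_Suc[OF assms(2), of s p] eta_G_pos[of s p] by (metis less_irrefl mult_right_cancel)

lemma etac0_marg:
  assumes "\<phi> \<in> bm X" shows "(\<integral>z. \<phi> (proj s z) \<partial>etac0) = (\<integral>x. \<phi> x \<partial>et s 0)"
  using integral_distr_proj[OF etac0_prob assms, of s] eta_zero[OF assms, of s] etac0_marginal[of s] by simp

lemma limit_I_prob: "limit_I X G eta0 M etac0 Mc p \<in> space (prob_algebra Y)"
proof (cases p)
  case 0 then show ?thesis using etac0_prob by simp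
next
  case (Suc q)
  then show ?thesis using Phi_I_product_prob[OF Mc_k eta_prob G_bm G_nonneg eta_G_pos, of q q] by simp
qed

lemma limit_I_marg:
  assumes \<phi>: "\<phi> \<in> bm X" shows "(\<integral>z. \<phi> (proj s z) \<partial>limit_I X G eta0 M etac0 Mc p) = (\<integral>x. \<phi> x \<partial>et s p)"
proof (cases p)
  case 0 then show ?thesis using etac0_marg[OF \<phi>] by simp
next
  case (Suc q)
  have "(\<integral>z. \<phi> (proj s z) \<partial>Phi_I X (G q) (Mc (Suc q)) (et Fine q \<Otimes>\<^sub>M et Coarse q)) * (\<integral>x. G q x \<partial>et s q) = (\<integral>x. G q x * Mop s q \<phi> x \<partial>et s q)"
    by (rule Phi_I_product_marginal[OF Mc_k eta_prob G_bm G_nonneg eta_G_pos \<phi> Mop_bm[OF \<phi>] Mc_Mop[OF _ \<phi>]])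
  from marg_ratio[OF this \<phi>] Suc show ?thesis by simp
qed

definition step_I :: "nat \<Rightarrow> nat \<Rightarrow> (nat \<Rightarrow> 'a \<times> 'a) \<Rightarrow> ('a \<times> 'a) measure" where
  "step_I N p u = Phi_I X (G p) (Mc (Suc p)) (empirical X N (\<lambda>i. proj Fine (u i)) \<Otimes>\<^sub>M empirical X N (\<lambda>i. proj Coarse (u i)))"

text \<open>The unnormalised one-step operator of independent resampling on functions of pairs.\<close>

definition coupled_Q :: "nat \<Rightarrow> ('a \<times> 'a \<Rightarrow> real) \<Rightarrow> 'a \<times> 'a \<Rightarrow> real" where
  "coupled_Q p f z = G p (fst z) * G p (snd z) * (\<integral>w. f w \<partial>Mc (Suc p) z)"

lemma coupled_Q_bm: "f \<in> bm Y \<Longrightarrow> coupled_Q p f \<in> bm Y"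
  unfolding coupled_Q_def[abs_def]
  by (intro bm_mult bm_compose[OF measurable_fst G_bm] bm_compose[OF measurable_snd G_bm] bm_kernel[OF Mc_k])

lemma step_I_formula:
  assumes N: "N \<ge> 1" and u: "u \<in> space (conf N Y)" and ps: "\<And>s. 0 < Gavg N p s u"
  shows "step_I N p u \<in> space (prob_algebra Y)"
    and "f \<in> bm Y \<Longrightarrow> (\<integral>z. f z \<partial>step_I N p u) * (Gavg N p Fine u * Gavg N p Coarse u) = avg2 N (cross (coupled_Q p f)) u"
    and "\<phi> \<in> bm X \<Longrightarrow> (\<integral>z. \<phi> (proj s z) \<partial>step_I N p u) * Gavg N p s u
        = avg N (\<lambda>z. G p (proj s z) * (\<integral>y. \<phi> y \<partial>M s (Suc p) (proj s z))) u"
proof -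
  let ?e = "\<lambda>s. empirical X N (\<lambda>i. proj s (u i))"
  have e: "?e s \<in> space (prob_algebra X)" for s by (rule emp_prob[OF N u])
  have D: "0 < (\<integral>x. G p x \<partial>?e s)" for s using ps by (simp add: emp_int[OF u G_bm])
  show "step_I N p u \<in> space (prob_algebra Y)"
    unfolding step_I_def by (rule Phi_I_product_prob[OF Mc_k e G_bm G_nonneg D])
  show "(\<integral>z. f z \<partial>step_I N p u) * (Gavg N p Fine u * Gavg N p Coarse u) = avg2 N (cross (coupled_Q p f)) u"
    if f: "f \<in> bm Y"
  proof -
    have "(\<integral>z. f z \<partial>step_I N p u) * ((\<integral>x. G p x \<partial>?e Fine) * (\<integral>x. G p x \<partial>?e Coarse)) = (\<integral>z. coupled_Q p f z \<partial>(?e Fine \<Otimes>\<^sub>M ?e Coarse))"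
      unfolding step_I_def coupled_Q_def by (rule Phi_I_product_integral[OF Mc_k e G_bm G_nonneg D f])
    then show ?thesis unfolding avg2_cross_empirical[OF N u coupled_Q_bm[OF f]] emp_int[OF u G_bm] .
  qed
  assume \<phi>: "\<phi> \<in> bm X"
  have "(\<integral>z. \<phi> (proj s z) \<partial>step_I N p u) * (\<integral>x. G p x \<partial>?e s) = (\<integral>x. G p x * Mop s p \<phi> x \<partial>?e s)"
    unfolding step_I_def
    by (rule Phi_I_product_marginal[OF Mc_k e G_bm G_nonneg D \<phi> Mop_bm[OF \<phi>] Mc_Mop[OF _ \<phi>]])
  then show "(\<integral>z. \<phi> (proj s z) \<partial>step_I N p u) * Gavg N p s u
        = avg N (\<lambda>z. G p (proj s z) * (\<integral>y. \<phi> y \<partial>M s (Suc p) (proj s z))) u"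
    unfolding emp_int[OF u G_bm] emp_int[OF u bm_mult[OF G_bm Mop_bm[OF \<phi>]]] unfolding Mop_def .
qed

end

locale algorithm_I = feynman_kac_pos X G eta0 M etac0 Mc
  for X :: "'a measure" and G eta0 M etac0 Mc +
  fixes \<Omega> :: "nat \<Rightarrow> 'w measure" and U :: "nat \<Rightarrow> nat \<Rightarrow> nat \<Rightarrow> 'w \<Rightarrow> 'a \<times> 'a"
  assumes particles: "N \<ge> 1 \<Longrightarrow> particles_I X G etac0 Mc (\<Omega> N) N (U N)"
    and weights: "N \<ge> 1 \<Longrightarrow> positive_weights X G (\<Omega> N) N (U N)"
begin

sublocale particle_algorithm X G eta0 M etac0 Mc step_I "limit_I X G eta0 M etac0 Mc" \<Omega> U
proof unfold_locales
  show "limit_I X G eta0 M etac0 Mc p \<in> space (prob_algebra Y)" for p by (rule limit_I_prob)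
  show "\<phi> \<in> bm X \<Longrightarrow> (\<integral>z. \<phi> (proj s z) \<partial>limit_I X G eta0 M etac0 Mc p) = (\<integral>x. \<phi> x \<partial>et s p)" for \<phi> s p
    by (rule limit_I_marg)
  show "particle_system Y (limit_I X G eta0 M etac0 Mc 0) (step_I N) (\<Omega> N) N (U N)" if "N \<ge> 1" for N
    using particles[OF that] by (simp add: particles_I_def step_I_def[abs_def])
  show "positive_weights X G (\<Omega> N) N (U N)" if "N \<ge> 1" for N using that by (rule weights)
  show "step_I N p u = step_I N p v" if "\<And>i. i \<in> {1..N} \<Longrightarrow> u i = v i" for N p u v
  proof -
    have "empirical X N (\<lambda>i. proj s (u i)) = empirical X N (\<lambda>i. proj s (v i))" for s
      using that by (intro empirical_cong) auto
    then show ?thesis by (simp add: step_I_def del: proj.simps)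
  qed
  show "step_I N p u \<in> space (prob_algebra Y)" if "N \<ge> 1" "u \<in> space (conf N Y)" "\<And>s. 0 < Gavg N p s u" for N p u
    using that by (rule step_I_formula)
  show "(\<integral>z. \<phi> (proj s z) \<partial>step_I N p u) * Gavg N p s u
        = avg N (\<lambda>z. G p (proj s z) * (\<integral>y. \<phi> y \<partial>M s (Suc p) (proj s z))) u"
    if "N \<ge> 1" "u \<in> space (conf N Y)" "\<And>s. 0 < Gavg N p s u" "\<phi> \<in> bm X" for N p u \<phi> s
    using that by (rule step_I_formula)
  show "\<exists>R\<in>borel_measurable (conf N Y). \<forall>u\<in>space (conf N Y). (\<forall>s. 0 < Gavg N p s u) \<longrightarrow> measure (step_I N p u) S = R u"
    if N: "N \<ge> 1" and S: "S \<in> sets Y" for N p S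
  proof (intro bexI ballI impI)
    let ?a = "\<lambda>s. Gavg N p s"
    let ?R = "\<lambda>u. avg2 N (cross (coupled_Q p (indicator S))) u / (?a Fine u * ?a Coarse u)"
    show "?R \<in> borel_measurable (conf N Y)"
      using bm_measurable[OF avg2_bm[OF cross_bm[OF coupled_Q_bm[OF bm_indicator[OF S]]]], of N p]
        bm_measurable[OF avg_bm[OF bm_proj[OF G_bm]], of N p] by (intro borel_measurable_divide borel_measurable_times)
    fix u assume u: "u \<in> space (conf N Y)" and "\<forall>s. 0 < ?a s u"
    then have ps: "\<And>s. 0 < ?a s u" by blast
    have "(\<integral>z. indicator S z \<partial>step_I N p u) = measure (step_I N p u) S"
      using prob_algebraD(2,3)[OF step_I_formula(1)[OF N u ps]] S sets.sets_into_space[OF S] by (simp add: Int_absorb2)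
    then show "measure (step_I N p u) S = ?R u"
      using step_I_formula(2)[OF N u ps bm_indicator[OF S]] ps[of Fine] ps[of Coarse] by (simp add: field_simps)
  qed
qed

lemma clt:
  assumes \<phi>: "\<phi> \<in> bm X"
  shows "weak_conv_m (\<lambda>N. distr (\<Omega> N) borel (scaled_error X (limit_I X G eta0 M etac0 Mc) N (U N) n \<phi>))
    (centred_normal (asymp_variance X G eta0 M (limit_I X G eta0 M etac0 Mc) n \<phi>))"
proof (rule weak_conv_of_cross[OF _ \<phi>])
  fix \<phi> \<psi> p assume \<phi>: "\<phi> \<in> bm X" and \<psi>: "\<psi> \<in> bm X"
  let ?f = "\<lambda>z. \<phi> (fst z) * \<psi> (snd z)"
  have f: "?f \<in> bm Y" by (intro bm_mult bm_compose[OF measurable_fst \<phi>] bm_compose[OF measurable_snd \<psi>])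
  obtain B where B: "0 \<le> B" "\<And>z. z \<in> space Y \<Longrightarrow> \<bar>?f z\<bar> \<le> B" using bmE[OF f] by blast
  let ?g = "(\<integral>x. G p x \<partial>et Fine p) * (\<integral>x. G p x \<partial>et Coarse p)"
  have g: "?g \<noteq> 0" using eta_G_pos[of Fine p] eta_G_pos[of Coarse p] by simp
  have "L1_conv (\<lambda>N. plaw N p) (\<lambda>N u. \<integral>z. ?f z \<partial>ker N p u) ((\<integral>z. coupled_Q p ?f z \<partial>(et Fine p \<Otimes>\<^sub>M et Coarse p)) / ?g)"
  proof (rule law.L1_conv_ratio[OF product_L1[OF coupled_Q_bm[OF f]] law.L1_conv_mult[OF avg_L1[OF G_bm] avg_L1[OF G_bm]] g, where B=B])
    fix N :: nat assume N: "N \<ge> 1"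
    show "(\<lambda>u. \<integral>z. ?f z \<partial>ker N p u) \<in> borel_measurable (plaw N p)" by (intro pi_meas N K_bm f)
    show "\<bar>\<integral>z. ?f z \<partial>ker N p u\<bar> \<le> B" if "u \<in> space (plaw N p)" for u
      using that pi_space[OF N] by (intro K_abs_le[OF N] B) auto
    show "AE u in plaw N p. (\<integral>z. ?f z \<partial>ker N p u) * (Gavg N p Fine u * Gavg N p Coarse u) = avg2 N (cross (coupled_Q p ?f)) u"
      using AE_ker[OF N, of p]
    proof eventually_elim
      case (elim u)
      then have ps: "\<And>s. 0 < Gavg N p s u" by blast
      show ?case using step_I_formula(2)[OF N _ ps f] elim by (simp del: proj.simps)
    qed
  qed
  also have "(\<integral>z. coupled_Q p ?f z \<partial>(et Fine p \<Otimes>\<^sub>M et Coarse p)) / ?g = (\<integral>z. ?f z \<partial>limit_I X G eta0 M etac0 Mc (Suc p))"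
  proof -
    have "(\<integral>z. ?f z \<partial>limit_I X G eta0 M etac0 Mc (Suc p)) * ?g = (\<integral>z. coupled_Q p ?f z \<partial>(et Fine p \<Otimes>\<^sub>M et Coarse p))"
      unfolding coupled_Q_def limit_I.simps by (rule Phi_I_product_integral[OF Mc_k eta_prob G_bm G_nonneg eta_G_pos f])
    then show ?thesis using g by (simp add: field_simps)
  qed
  finally show "L1_conv (\<lambda>N. plaw N p) (\<lambda>N u. \<integral>z. ?f z \<partial>ker N p u) (\<integral>z. ?f z \<partial>limit_I X G eta0 M etac0 Mc (Suc p))" .
qed

end

section \<open>Maximally coupled resampling\<close>

lemma emp_pair_prob: "N \<ge> 1 \<Longrightarrow> u \<in> space (conf N Y) \<Longrightarrow> empirical Y N u \<in> space (prob_algebra Y)"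
  by (rule empirical_prob[OF _ conf_space])

lemma emp_pair_int: "u \<in> space (conf N Y) \<Longrightarrow> f \<in> bm Y \<Longrightarrow> (\<integral>x. f x \<partial>empirical Y N u) = avg N f u"
  by (rule integral_empirical[OF conf_space bm_measurable])

lemma avg2_empirical:
  assumes N: "N \<ge> 1" and u: "u \<in> space (conf N Y)" and W: "W \<in> bm (Y \<Otimes>\<^sub>M Y)"
  shows "(\<integral>z. W z \<partial>(empirical Y N u \<Otimes>\<^sub>M empirical Y N u)) = avg2 N W u"
proof -
  note e = emp_pair_prob[OF N u]
  have "(\<integral>z. W z \<partial>(empirical Y N u \<Otimes>\<^sub>M empirical Y N u)) = (\<integral>x. \<integral>y. W (x, y) \<partial>empirical Y N u \<partial>empirical Y N u)"
    by (rule bm_pair_integral_fst(1)[OF e e W, symmetric])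
  also have "\<dots> = avg N (\<lambda>x. \<integral>y. W (x, y) \<partial>empirical Y N u) u"
    by (rule emp_pair_int[OF u bm_integral_snd[OF e W]])
  also have "\<dots> = avg2 N W u"
    unfolding avg2_def by (rule avg_cong[OF u]) (rule emp_pair_int[OF u bm_section(1)[OF W]])
  finally show ?thesis .
qed

lemma avg_joint_measurable:
  assumes h: "(\<lambda>x. h (fst x) (snd x)) \<in> borel_measurable (conf N Y \<Otimes>\<^sub>M Y)"
  shows "(\<lambda>u. avg N (h u) u) \<in> borel_measurable (conf N Y)"
proof -
  have "(\<lambda>u. h u (u i)) \<in> borel_measurable (conf N Y)" if "i \<in> {1..N}" for i
    using measurable_compose[OF measurable_Pair[OF measurable_ident conf_component[OF that]] h] by simp
  then show ?thesis unfolding avg_def by (intro borel_measurable_divide borel_measurable_sum borel_measurable_const) auto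
qed

lemma avg2_joint_measurable:
  assumes h: "(\<lambda>x. h (fst x) (snd x)) \<in> borel_measurable (conf N Y \<Otimes>\<^sub>M (Y \<Otimes>\<^sub>M Y))"
  shows "(\<lambda>u. avg2 N (h u) u) \<in> borel_measurable (conf N Y)"
proof -
  have "(\<lambda>u. h u (u i, u j)) \<in> borel_measurable (conf N Y)" if "i \<in> {1..N}" "j \<in> {1..N}" for i j
    using measurable_compose[OF measurable_Pair[OF measurable_ident measurable_Pair[OF conf_component[OF that(1)] conf_component[OF that(2)]]] h] by simp
  then show ?thesis unfolding avg2_def avg_def by (intro borel_measurable_divide borel_measurable_sum borel_measurable_const) auto
qed

context particle_scheme
begin

text \<open>As for \<open>product_L1\<close>, but with a weight on each of the two particles. A weight may depend on both
  coordinates of its particle, so the joint law of the coordinates has to converge; the error of the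
  approximation by rectangles is still an average over pairs without weights.\<close>

lemma weighted_product_L1:
  assumes J: "\<And>f. f \<in> bm Y \<Longrightarrow> L1_conv (\<lambda>N. \<pi> N p) (\<lambda>N. avg N f) (\<integral>z. f z \<partial>ell p)"
    and a: "a \<in> bm Y" and b: "b \<in> bm Y" and H: "H \<in> bm Y"
  shows "L1_conv (\<lambda>N. \<pi> N p) (\<lambda>N. avg2 N (\<lambda>q. a (fst q) * b (snd q) * cross H q))
    (\<integral>q. a (fst q) * b (snd q) * cross H q \<partial>(ell p \<Otimes>\<^sub>M ell p))"
proof -
  let ?\<tau> = "et Fine p \<Otimes>\<^sub>M et Coarse p" and ?ll = "ell p \<Otimes>\<^sub>M ell p"
  have ll: "?ll \<in> space (prob_algebra (Y \<Otimes>\<^sub>M Y))" by (intro pa_pair ell_prob)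
  have ab: "(\<lambda>q. a (fst q) * b (snd q)) \<in> bm (Y \<Otimes>\<^sub>M Y)"
    by (intro bm_mult bm_compose[OF measurable_fst a] bm_compose[OF measurable_snd b])
  have abH: "(\<lambda>q. a (fst q) * b (snd q) * cross H q) \<in> bm (Y \<Otimes>\<^sub>M Y)" if "H \<in> bm Y" for H
    by (intro bm_mult[OF ab] cross_bm that)
  obtain C where C: "0 \<le> C" "\<And>q. q \<in> space (Y \<Otimes>\<^sub>M Y) \<Longrightarrow> \<bar>a (fst q) * b (snd q)\<bar> \<le> C" using bmE[OF ab] by blast
  obtain B where B: "0 \<le> B" "\<And>q. q \<in> space (Y \<Otimes>\<^sub>M Y) \<Longrightarrow> \<bar>a (fst q) * b (snd q) * cross H q\<bar> \<le> B" using bmE[OF abH[OF H]] by blast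
  let ?L = "\<lambda>H. \<integral>q. a (fst q) * b (snd q) * cross H q \<partial>?ll"
  let ?A = "\<lambda>H N. avg2 N (\<lambda>q. a (fst q) * b (snd q) * cross H q)"
  have span: "L1_conv (\<lambda>N. \<pi> N p) (?A T) (?L T)" if "T \<in> rect_span X" for T
    using that
  proof (induction rule: rect_span.induct)
    case (rect A B c)
    let ?a = "\<lambda>z. a z * indicator A (proj Fine z)" and ?b = "\<lambda>z. b z * indicator B (proj Coarse z)"
    have a': "?a \<in> bm Y" and b': "?b \<in> bm Y" by (intro bm_mult a b bm_proj bm_indicator rect)+
    have e: "a (fst q) * b (snd q) * cross (\<lambda>z. c * (indicator A (fst z) * indicator B (snd z))) q = c * (?a (fst q) * ?b (snd q))" for q
      by (simp add: cross_def)
    have e2: "(\<integral>q. c * (?a (fst q) * ?b (snd q)) \<partial>?ll) = c * ((\<integral>z. ?a z \<partial>ell p) * (\<integral>z. ?b z \<partial>ell p))"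
      using tensor_integral_eq[OF pa_sigma_finite[OF ell_prob] pa_sigma_finite[OF ell_prob] bm_integrable[OF ell_prob a', of p] bm_integrable[OF ell_prob b', of p]]
      by (simp only: integral_mult_right_zero)
    have e3: "avg2 N (\<lambda>q. c * (?a (fst q) * ?b (snd q))) u = c * (avg N ?a u * avg N ?b u)" for N u
      unfolding avg2_cmult by (subst avg2_tensor[of N ?a ?b]) (rule refl)
    show ?case unfolding e e2 e3
      by (intro law.L1_conv_cmult law.L1_conv_mult J a' b')
  next
    case (add S T)
    have i: "integrable ?ll (\<lambda>q. a (fst q) * b (snd q) * cross T q)" if "T \<in> rect_span X" for T
      using bm_integrable[OF ll abH[OF rect_span_bm[OF that]]] .
    have "(\<lambda>q. a (fst q) * b (snd q) * cross (\<lambda>z. S z + T z) q) = (\<lambda>q. a (fst q) * b (snd q) * cross S q + a (fst q) * b (snd q) * cross T q)"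
      by (simp add: cross_def[abs_def] distrib_left)
    then show ?case using law.L1_conv_add[OF add.IH] i[OF add.hyps(1)] i[OF add.hyps(2)]
      by (simp add: avg2_add)
  qed
  show ?thesis
  proof (rule law.L1_conv_approx[where B=B])
    show "?A H N \<in> borel_measurable (\<pi> N p)" if "N \<ge> 1" for N by (intro pi_meas that avg2_bm abH H)
    show "\<bar>?A H N u\<bar> \<le> B" if "N \<ge> 1" "u \<in> space (\<pi> N p)" for N u
      using that pi_space[OF that(1)] by (intro avg2_abs_le[of u N Y] B) auto
    fix e :: real assume e: "e > 0"
    then have e': "e / (C + 1) > 0" using C by simp
    obtain T where T: "T \<in> rect_span X" "(\<integral>z. \<bar>H z - T z\<bar> \<partial>?\<tau>) < e / (C + 1)"
      using rect_span_dense[OF _ prob_algebraD(2)[OF tau_prob] bm_integrable[OF tau_prob H] e'] prob_algebraD(1)[OF tau_prob] prob_space.finite_measure by blast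
    have Ce: "C * (\<integral>z. \<bar>H z - T z\<bar> \<partial>?\<tau>) \<le> e"
    proof -
      have "C * (\<integral>z. \<bar>H z - T z\<bar> \<partial>?\<tau>) \<le> C * (e / (C + 1))" using T C by (intro mult_left_mono) auto
      also have "\<dots> \<le> e" using C e by (simp add: field_simps)
      finally show ?thesis .
    qed
    have Tb: "T \<in> bm Y" by (rule rect_span_bm[OF T(1)])
    have HT: "(\<lambda>z. \<bar>H z - T z\<bar>) \<in> bm Y" by (intro bm_abs bm_diff H Tb)
    have d: "\<bar>a (fst q) * b (snd q) * cross H q - a (fst q) * b (snd q) * cross T q\<bar> \<le> C * cross (\<lambda>z. \<bar>H z - T z\<bar>) q"
      if "q \<in> space (Y \<Otimes>\<^sub>M Y)" for q
      using mult_right_mono[OF C(2)[OF that], of "\<bar>cross H q - cross T q\<bar>"]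
      by (simp add: cross_def abs_mult[symmetric] right_diff_distrib)
    let ?H = "\<lambda>N u. C * avg2 N (cross (\<lambda>z. \<bar>H z - T z\<bar>)) u"
    have HL: "L1_conv (\<lambda>N. \<pi> N p) ?H (C * (\<integral>z. \<bar>H z - T z\<bar> \<partial>?\<tau>))"
      by (intro law.L1_conv_cmult product_L1 HT)
    show "\<exists>F' c' H' E h. L1_conv (\<lambda>N. \<pi> N p) F' c' \<and> \<bar>c' - ?L H\<bar> \<le> e \<and>
       (\<forall>N\<ge>1. H' N \<in> bm (\<pi> N p) \<and> (\<integral>u. H' N u \<partial>\<pi> N p) \<le> E N \<and> (\<forall>u\<in>space (\<pi> N p). \<bar>?A H N u - F' N u\<bar> \<le> H' N u))
       \<and> E \<longlonglongrightarrow> h \<and> h \<le> e"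
    proof (intro exI conjI allI impI ballI)
      show "L1_conv (\<lambda>N. \<pi> N p) (?A T) (?L T)" by (rule span[OF T(1)])
      show "\<bar>?L T - ?L H\<bar> \<le> e"
      proof -
        have i: "integrable ?ll (\<lambda>q. a (fst q) * b (snd q) * cross H q)" "integrable ?ll (\<lambda>q. a (fst q) * b (snd q) * cross T q)"
          by (intro bm_integrable[OF ll] abH H Tb)+
        have "\<bar>?L T - ?L H\<bar> = \<bar>\<integral>q. a (fst q) * b (snd q) * cross H q - a (fst q) * b (snd q) * cross T q \<partial>?ll\<bar>" using i by simp
        also have "\<dots> \<le> (\<integral>q. \<bar>a (fst q) * b (snd q) * cross H q - a (fst q) * b (snd q) * cross T q\<bar> \<partial>?ll)" by (rule integral_abs_bound)
        also have "\<dots> \<le> (\<integral>q. C * cross (\<lambda>z. \<bar>H z - T z\<bar>) q \<partial>?ll)"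
        proof (rule integral_mono)
          show "integrable ?ll (\<lambda>q. \<bar>a (fst q) * b (snd q) * cross H q - a (fst q) * b (snd q) * cross T q\<bar>)" using i by auto
          show "integrable ?ll (\<lambda>q. C * cross (\<lambda>z. \<bar>H z - T z\<bar>) q)" by (intro bm_integrable[OF ll] bm_mult bm_const cross_bm HT)
        qed (use d prob_algebraD(3)[OF ll] in auto)
        also have "\<dots> = C * (\<integral>z. \<bar>H z - T z\<bar> \<partial>?\<tau>)" by (simp add: cross_integral[OF ell_prob HT] ell_distr del: proj.simps)
        finally show ?thesis using Ce by simp
      qed
      show "(\<lambda>N. \<integral>u. ?H N u \<partial>\<pi> N p) \<longlonglongrightarrow> C * (\<integral>z. \<bar>H z - T z\<bar> \<partial>?\<tau>)" by (rule law.L1_conv_expectation[OF HL])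
      show "C * (\<integral>z. \<bar>H z - T z\<bar> \<partial>?\<tau>) \<le> e" by (rule Ce)
      fix N :: nat assume N: "1 \<le> N"
      show "?H N \<in> bm (\<pi> N p)" by (rule L1_conv_bm[OF HL N])
      show "(\<integral>u. ?H N u \<partial>\<pi> N p) \<le> (\<integral>u. ?H N u \<partial>\<pi> N p)" by simp
      fix u assume "u \<in> space (\<pi> N p)"
      then have u: "u \<in> space (conf N Y)" using pi_space[OF N] by simp
      have "\<bar>?A H N u - ?A T N u\<bar> \<le> avg2 N (\<lambda>q. \<bar>a (fst q) * b (snd q) * cross H q - a (fst q) * b (snd q) * cross T q\<bar>) u"
        unfolding avg2_diff[symmetric] by (rule avg2_abs)
      also have "\<dots> \<le> avg2 N (\<lambda>q. C * cross (\<lambda>z. \<bar>H z - T z\<bar>) q) u" by (rule avg2_mono[OF u d])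
      finally show "\<bar>?A H N u - ?A T N u\<bar> \<le> ?H N u" by (simp add: avg2_cmult)
    qed
  qed
qed

end

context feynman_kac_pos
begin

lemma limit_M_both:
  "limit_M X G etac0 Mc p \<in> space (prob_algebra Y) \<and> (\<forall>s. \<forall>\<phi>\<in>bm X. (\<integral>z. \<phi> (proj s z) \<partial>limit_M X G etac0 Mc p) = (\<integral>x. \<phi> x \<partial>et s p))"
proof (induction p)
  case 0 then show ?case using etac0_prob etac0_marg by simp
next
  case (Suc p)
  let ?l = "limit_M X G etac0 Mc p"
  have l: "?l \<in> space (prob_algebra Y)" using Suc by blast
  have m: "(\<integral>z. \<phi> (proj s z) \<partial>?l) = (\<integral>x. \<phi> x \<partial>et s p)" if "\<phi> \<in> bm X" for s \<phi> using Suc that by blast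
  have D: "0 < (\<integral>z. G p (proj s z) \<partial>?l)" for s unfolding m[OF G_bm] by (rule eta_G_pos)
  have "(\<integral>z. \<phi> (proj s z) \<partial>limit_M X G etac0 Mc (Suc p)) = (\<integral>x. \<phi> x \<partial>et s (Suc p))" if \<phi>: "\<phi> \<in> bm X" for s \<phi>
  proof (rule marg_ratio[OF _ \<phi>])
    have "(\<integral>z. \<phi> (proj s z) \<partial>Phi_M X (G p) (Mc (Suc p)) ?l) * (\<integral>z. G p (proj s z) \<partial>?l) = (\<integral>z. G p (proj s z) * Mop s p \<phi> (proj s z) \<partial>?l)"
      by (rule Phi_M_marginal[OF Mc_k l G_bm G_nonneg D \<phi> Mop_bm[OF \<phi>] Mc_Mop[OF _ \<phi>]])
    then show "(\<integral>z. \<phi> (proj s z) \<partial>limit_M X G etac0 Mc (Suc p)) * (\<integral>x. G p x \<partial>et s p) = (\<integral>x. G p x * Mop s p \<phi> x \<partial>et s p)"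
      unfolding m[OF G_bm] m[OF bm_mult[OF G_bm Mop_bm[OF \<phi>]]] by simp
  qed
  moreover have "Phi_M X (G p) (Mc (Suc p)) ?l \<in> space (prob_algebra Y)"
    by (rule Phi_M_prob[OF Mc_k l G_bm G_nonneg D])
  ultimately show ?case by simp
qed

lemma limit_M_prob: "limit_M X G etac0 Mc p \<in> space (prob_algebra Y)"
  and limit_M_marg: "\<phi> \<in> bm X \<Longrightarrow> (\<integral>z. \<phi> (proj s z) \<partial>limit_M X G etac0 Mc p) = (\<integral>x. \<phi> x \<partial>et s p)"
  using limit_M_both[of p] by blast+

definition step_M :: "nat \<Rightarrow> nat \<Rightarrow> (nat \<Rightarrow> 'a \<times> 'a) \<Rightarrow> ('a \<times> 'a) measure" where
  "step_M N p u = Phi_M X (G p) (Mc (Suc p)) (empirical Y N u)"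

text \<open>The common part and the residual parts of the resampling weights of a configuration.\<close>

abbreviation cmin where "cmin N p u \<equiv> FM_min (G p) (empirical Y N u)"
abbreviation cres where "cres N p u \<equiv> FM_res (G p) (empirical Y N u)"
abbreviation cres2 where
  "cres2 N p u H \<equiv> avg2 N (\<lambda>q. cres N p u Fine (fst q) * cres N p u Coarse (snd q) * cross H q) u"

definition coupled_M :: "nat \<Rightarrow> ('a \<times> 'a \<Rightarrow> real) \<Rightarrow> 'a \<times> 'a \<Rightarrow> real" where
  "coupled_M p f z = (\<integral>w. f w \<partial>Mc (Suc p) z)"

lemma coupled_M_bm: "f \<in> bm Y \<Longrightarrow> coupled_M p f \<in> bm Y"
  unfolding coupled_M_def[abs_def] by (rule bm_kernel[OF Mc_k])

lemma emp_D: "u \<in> space (conf N Y) \<Longrightarrow> (\<integral>z. G p (proj s z) \<partial>empirical Y N u) = Gavg N p s u"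
  by (rule emp_pair_int[OF _ bm_proj[OF G_bm]])

lemma FM_emp: "u \<in> space (conf N Y) \<Longrightarrow> FM (G p) (empirical Y N u) s z = G p (proj s z) / Gavg N p s u"
  by (simp add: FM_def emp_D del: proj.simps)

context
  fixes N :: nat and p u
  assumes N: "N \<ge> 1" and u: "u \<in> space (conf N Y)" and ps: "\<And>s. 0 < Gavg N p s u"
begin

lemma emp_D_pos: "0 < (\<integral>z. G p (proj s z) \<partial>empirical Y N u)"
  using ps by (simp add: emp_D[OF u] del: proj.simps)

lemma cmin_bm: "cmin N p u \<in> bm Y"
  and cres_bm: "cres N p u s \<in> bm Y"
  and cres_nonneg: "0 \<le> cres N p u s z"
proof -
  note A = Mc_k[of p] emp_pair_prob[OF N u] G_bm[of p]
  show "cmin N p u \<in> bm Y" by (rule FM_min_bm[OF A G_nonneg emp_D_pos])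
  show "cres N p u s \<in> bm Y" by (rule FM_res_bm[OF A G_nonneg emp_D_pos])
  show "0 \<le> cres N p u s z" by (rule FM_res_nonneg[OF A G_nonneg emp_D_pos])
qed

lemma cFM_avg: "avg N (FM (G p) (empirical Y N u) s) u = 1"
proof -
  have "FM (G p) (empirical Y N u) s = (\<lambda>z. G p (proj s z) / Gavg N p s u)"
    by (rule ext) (rule FM_emp[OF u])
  then show ?thesis using ps[of s] by (simp add: avg_divc del: proj.simps)
qed

lemma cres_avg: "avg N (cres N p u s) u = 1 - avg N (cmin N p u) u"
  unfolding FM_res_def[abs_def] by (simp add: avg_diff cFM_avg)

lemma cmin_le: "avg N (cmin N p u) u \<le> 1"
  using avg_nonneg[OF u, of "cres N p u Fine"] cres_nonneg cres_avg[of Fine] by simp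

lemma step_M_prob: "step_M N p u \<in> space (prob_algebra Y)"
  unfolding step_M_def by (rule Phi_M_prob[OF Mc_k emp_pair_prob[OF N u] G_bm G_nonneg emp_D_pos])

lemma step_M_integral:
  assumes f: "f \<in> bm Y"
  shows "(\<integral>z. f z \<partial>step_M N p u) = avg N (\<lambda>z. cmin N p u z * coupled_M p f z) u +
    (if avg N (cmin N p u) u = 1 then 0 else
      cres2 N p u (coupled_M p f) / (1 - avg N (cmin N p u) u))"
proof -
  have c: "(\<integral>z. cmin N p u z \<partial>empirical Y N u) = avg N (cmin N p u) u" by (rule emp_pair_int[OF u cmin_bm])
  have 1: "(\<integral>z. cmin N p u z * coupled_M p f z \<partial>empirical Y N u) = avg N (\<lambda>z. cmin N p u z * coupled_M p f z) u"
    by (rule emp_pair_int[OF u bm_mult[OF cmin_bm coupled_M_bm[OF f]]])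
  have 2: "(\<integral>q. cres N p u Fine (fst q) * cres N p u Coarse (snd q) * cross (coupled_M p f) q \<partial>(empirical Y N u \<Otimes>\<^sub>M empirical Y N u))
    = cres2 N p u (coupled_M p f)"
    by (rule avg2_empirical[OF N u]) (intro bm_mult bm_compose[OF measurable_fst cres_bm] bm_compose[OF measurable_snd cres_bm] cross_bm coupled_M_bm f)
  have "(\<integral>z. f z \<partial>step_M N p u) = (\<integral>z. cmin N p u z * coupled_M p f z \<partial>empirical Y N u) +
    (if (\<integral>z. cmin N p u z \<partial>empirical Y N u) = 1 then 0 else
      (\<integral>q. cres N p u Fine (fst q) * cres N p u Coarse (snd q) * cross (coupled_M p f) q \<partial>(empirical Y N u \<Otimes>\<^sub>M empirical Y N u)) / (1 - (\<integral>z. cmin N p u z \<partial>empirical Y N u)))"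
    unfolding step_M_def coupled_M_def cross_def
    by (rule Phi_M_integral[OF Mc_k emp_pair_prob[OF N u] G_bm G_nonneg emp_D_pos f])
  then show ?thesis unfolding c 1 2 .
qed

lemma step_M_marg:
  assumes \<phi>: "\<phi> \<in> bm X"
  shows "(\<integral>z. \<phi> (proj s z) \<partial>step_M N p u) * Gavg N p s u
        = avg N (\<lambda>z. G p (proj s z) * (\<integral>y. \<phi> y \<partial>M s (Suc p) (proj s z))) u"
proof -
  have "(\<integral>z. \<phi> (proj s z) \<partial>step_M N p u) * (\<integral>z. G p (proj s z) \<partial>empirical Y N u) = (\<integral>z. G p (proj s z) * Mop s p \<phi> (proj s z) \<partial>empirical Y N u)"
    unfolding step_M_def
    by (rule Phi_M_marginal[OF Mc_k emp_pair_prob[OF N u] G_bm G_nonneg emp_D_pos \<phi> Mop_bm[OF \<phi>] Mc_Mop[OF _ \<phi>]])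
  then show ?thesis
    unfolding emp_D[OF u] emp_pair_int[OF u bm_mult[OF bm_proj[OF G_bm] bm_proj[OF Mop_bm[OF \<phi>]]]] unfolding Mop_def .
qed

text \<open>Each residual weight has average \<open>1 - c\<close>.\<close>

lemma rem_bound:
  assumes H: "\<And>z. z \<in> space Y \<Longrightarrow> \<bar>H z\<bar> \<le> B" and B: "0 \<le> B"
  shows "\<bar>cres2 N p u H\<bar> \<le> B * (1 - avg N (cmin N p u) u)\<^sup>2"
proof -
  have "\<bar>cres2 N p u H\<bar> \<le> avg2 N (\<lambda>q. \<bar>cres N p u Fine (fst q) * cres N p u Coarse (snd q) * cross H q\<bar>) u"
    by (rule avg2_abs)
  also have "\<dots> \<le> avg2 N (\<lambda>q. B * (cres N p u Fine (fst q) * cres N p u Coarse (snd q))) u"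
  proof (rule avg2_mono[OF u])
    fix q assume q: "q \<in> space (Y \<Otimes>\<^sub>M Y)"
    have "0 \<le> cres N p u Fine (fst q) * cres N p u Coarse (snd q)" by (intro mult_nonneg_nonneg cres_nonneg)
    from mult_left_mono[OF H[OF cross_space[OF q]] this]
    show "\<bar>cres N p u Fine (fst q) * cres N p u Coarse (snd q) * cross H q\<bar> \<le> B * (cres N p u Fine (fst q) * cres N p u Coarse (snd q))"
      using cres_nonneg by (simp add: abs_mult cross_def mult.commute)
  qed
  also have "\<dots> = B * (1 - avg N (cmin N p u) u)\<^sup>2"
    by (simp add: avg2_cmult avg2_tensor cres_avg power2_eq_square)
  finally show ?thesis .
qed

end

lemma FM_emp_joint: "N \<ge> 1 \<Longrightarrow> (\<lambda>x. FM (G p) (empirical Y N (fst x)) s (snd x)) \<in> borel_measurable (conf N Y \<Otimes>\<^sub>M Y)"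
proof -
  have a: "(\<lambda>x. Gavg N p s (fst x)) \<in> borel_measurable (conf N Y \<Otimes>\<^sub>M Y)"
    by (rule measurable_compose[OF measurable_fst bm_measurable[OF avg_bm[OF bm_proj[OF G_bm]]]])
  have b: "(\<lambda>x. G p (proj s (snd x))) \<in> borel_measurable (conf N Y \<Otimes>\<^sub>M Y)"
    by (rule measurable_compose[OF measurable_snd bm_measurable[OF bm_proj[OF G_bm]]])
  have "(\<lambda>x. G p (proj s (snd x)) / Gavg N p s (fst x)) \<in> borel_measurable (conf N Y \<Otimes>\<^sub>M Y)"
    by (rule borel_measurable_divide[OF b a])
  moreover have "FM (G p) (empirical Y N (fst x)) s (snd x) = G p (proj s (snd x)) / Gavg N p s (fst x)"
    if "x \<in> space (conf N Y \<Otimes>\<^sub>M Y)" for x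
    using that by (intro FM_emp) (auto simp: space_pair_measure)
  ultimately show ?thesis by (subst measurable_cong)
qed

lemma cmin_joint: "N \<ge> 1 \<Longrightarrow> (\<lambda>x. cmin N p (fst x) (snd x)) \<in> borel_measurable (conf N Y \<Otimes>\<^sub>M Y)"
  unfolding FM_min_def by (intro borel_measurable_min FM_emp_joint)

lemma cres_joint: "N \<ge> 1 \<Longrightarrow> (\<lambda>x. cres N p (fst x) s (snd x)) \<in> borel_measurable (conf N Y \<Otimes>\<^sub>M Y)"
  unfolding FM_res_def by (intro borel_measurable_diff FM_emp_joint cmin_joint)

lemma W_measurable:
  assumes N: "N \<ge> 1" and b: "b \<in> bm Y"
  shows "(\<lambda>u. avg N (\<lambda>z. cmin N p u z * b z) u) \<in> borel_measurable (conf N Y)"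
  by (rule avg_joint_measurable) (intro borel_measurable_times cmin_joint N measurable_compose[OF measurable_snd bm_measurable[OF b]])

lemma V_measurable:
  assumes N: "N \<ge> 1" and H: "H \<in> bm Y"
  shows "(\<lambda>u. cres2 N p u H) \<in> borel_measurable (conf N Y)"
proof (rule avg2_joint_measurable, intro borel_measurable_times)
  show "(\<lambda>x. cres N p (fst x) Fine (fst (snd x))) \<in> borel_measurable (conf N Y \<Otimes>\<^sub>M (Y \<Otimes>\<^sub>M Y))"
    using measurable_compose[OF measurable_Pair[OF measurable_fst measurable_compose[OF measurable_snd measurable_fst]] cres_joint[OF N, of p Fine]] by simp
  show "(\<lambda>x. cres N p (fst x) Coarse (snd (snd x))) \<in> borel_measurable (conf N Y \<Otimes>\<^sub>M (Y \<Otimes>\<^sub>M Y))"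
    using measurable_compose[OF measurable_Pair[OF measurable_fst measurable_compose[OF measurable_snd measurable_snd]] cres_joint[OF N, of p Coarse]] by simp
  show "(\<lambda>x. cross H (snd x)) \<in> borel_measurable (conf N Y \<Otimes>\<^sub>M (Y \<Otimes>\<^sub>M Y))"
    by (rule measurable_compose[OF measurable_snd bm_measurable[OF cross_bm[OF H]]])
qed

lemma avgG_nonneg: "u \<in> space (conf N Y) \<Longrightarrow> 0 \<le> Gavg N p s u"
  by (rule avg_nonneg) (auto intro: G_nonneg proj_space simp del: proj.simps)

lemma cFM_nonneg: "u \<in> space (conf N Y) \<Longrightarrow> z \<in> space Y \<Longrightarrow> 0 \<le> FM (G p) (empirical Y N u) s z"
  unfolding FM_emp using avgG_nonneg[of u N p s] G_nonneg[OF proj_space[of z X s], of p] by (simp add: FM_emp del: proj.simps)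

lemma cFM_avg_le:
  assumes u: "u \<in> space (conf N Y)" shows "avg N (FM (G p) (empirical Y N u) s) u \<le> 1"
proof -
  have "FM (G p) (empirical Y N u) s = (\<lambda>z. G p (proj s z) / Gavg N p s u)"
    by (rule ext) (rule FM_emp[OF u])
  then show ?thesis by (simp add: avg_divc del: proj.simps)
qed

lemma W_bound:
  assumes u: "u \<in> space (conf N Y)" and b: "\<And>z. z \<in> space Y \<Longrightarrow> \<bar>b z\<bar> \<le> B" and B: "0 \<le> B"
  shows "\<bar>avg N (\<lambda>z. cmin N p u z * b z) u\<bar> \<le> B"
proof -
  have "\<bar>avg N (\<lambda>z. cmin N p u z * b z) u\<bar> \<le> avg N (\<lambda>z. \<bar>cmin N p u z * b z\<bar>) u" by (rule avg_abs)
  also have "\<dots> \<le> avg N (\<lambda>z. B * FM (G p) (empirical Y N u) Fine z) u"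
  proof (rule avg_mono[OF u])
    fix z assume z: "z \<in> space Y"
    have "0 \<le> cmin N p u z" "cmin N p u z \<le> FM (G p) (empirical Y N u) Fine z"
      using cFM_nonneg[OF u z] by (auto simp: FM_min_def)
    then have "cmin N p u z * \<bar>b z\<bar> \<le> FM (G p) (empirical Y N u) Fine z * B" using b[OF z] cFM_nonneg[OF u z] by (intro mult_mono) auto
    then show "\<bar>cmin N p u z * b z\<bar> \<le> B * FM (G p) (empirical Y N u) Fine z" using \<open>0 \<le> cmin N p u z\<close> by (simp add: abs_mult mult.commute)
  qed
  also have "\<dots> \<le> B * 1" unfolding avg_cmult using B cFM_avg_le[OF u] by (intro mult_left_mono)
  finally show ?thesis by simp
qed

lemma cres_bounds:
  assumes u: "u \<in> space (conf N Y)" and z: "z \<in> space Y"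
  shows "0 \<le> cres N p u s z" "cres N p u s z \<le> FM (G p) (empirical Y N u) s z"
  using cFM_nonneg[OF u z] by (cases s; auto simp: FM_res_def FM_min_def)+

lemma cres_avg_le: "u \<in> space (conf N Y) \<Longrightarrow> avg N (cres N p u s) u \<le> 1"
  using avg_mono[of u N Y "cres N p u s" "FM (G p) (empirical Y N u) s"] cres_bounds(2)[of u N] cFM_avg_le[of u N p s] by force

lemma V_bound:
  assumes u: "u \<in> space (conf N Y)" and H: "\<And>z. z \<in> space Y \<Longrightarrow> \<bar>H z\<bar> \<le> B" and B: "0 \<le> B"
  shows "\<bar>cres2 N p u H\<bar> \<le> B"
proof -
  have "\<bar>cres2 N p u H\<bar> \<le> avg2 N (\<lambda>q. \<bar>cres N p u Fine (fst q) * cres N p u Coarse (snd q) * cross H q\<bar>) u"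
    by (rule avg2_abs)
  also have "\<dots> \<le> avg2 N (\<lambda>q. B * (cres N p u Fine (fst q) * cres N p u Coarse (snd q))) u"
  proof (rule avg2_mono[OF u])
    fix q assume q: "q \<in> space (Y \<Otimes>\<^sub>M Y)"
    then have q': "fst q \<in> space Y" "snd q \<in> space Y" by (auto simp: space_pair_measure)
    have n: "0 \<le> cres N p u Fine (fst q)" "0 \<le> cres N p u Coarse (snd q)" using cres_bounds(1)[OF u] q' by auto
    from mult_left_mono[OF H[OF cross_space[OF q]] mult_nonneg_nonneg[OF n]] n
    show "\<bar>cres N p u Fine (fst q) * cres N p u Coarse (snd q) * cross H q\<bar> \<le> B * (cres N p u Fine (fst q) * cres N p u Coarse (snd q))"
      by (simp add: abs_mult cross_def mult.commute)
  qed
  also have "\<dots> = B * (avg N (cres N p u Fine) u * avg N (cres N p u Coarse) u)" by (simp add: avg2_cmult avg2_tensor)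
  also have "\<dots> \<le> B * (1 * 1)"
    using B cres_avg_le[OF u] by (intro mult_left_mono mult_mono avg_nonneg[OF u] cres_bounds(1)[OF u]) auto
  finally show ?thesis by simp
qed

end

locale algorithm_M = feynman_kac_pos X G eta0 M etac0 Mc
  for X :: "'a measure" and G eta0 M etac0 Mc +
  fixes \<Omega> :: "nat \<Rightarrow> 'w measure" and U :: "nat \<Rightarrow> nat \<Rightarrow> nat \<Rightarrow> 'w \<Rightarrow> 'a \<times> 'a"
  assumes particles: "N \<ge> 1 \<Longrightarrow> particles_M X G etac0 Mc (\<Omega> N) N (U N)"
    and weights: "N \<ge> 1 \<Longrightarrow> positive_weights X G (\<Omega> N) N (U N)"
begin

abbreviation lM where "lM \<equiv> limit_M X G etac0 Mc"

sublocale particle_algorithm X G eta0 M etac0 Mc step_M "limit_M X G etac0 Mc" \<Omega> U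
proof unfold_locales
  show "lM p \<in> space (prob_algebra Y)" for p by (rule limit_M_prob)
  show "\<phi> \<in> bm X \<Longrightarrow> (\<integral>z. \<phi> (proj s z) \<partial>lM p) = (\<integral>x. \<phi> x \<partial>et s p)" for \<phi> s p by (rule limit_M_marg)
  show "particle_system Y (lM 0) (step_M N) (\<Omega> N) N (U N)" if "N \<ge> 1" for N
    using particles[OF that] by (simp add: particles_M_def step_M_def[abs_def])
  show "positive_weights X G (\<Omega> N) N (U N)" if "N \<ge> 1" for N using that by (rule weights)
  show "step_M N p u = step_M N p v" if "\<And>i. i \<in> {1..N} \<Longrightarrow> u i = v i" for N p u v
    using empirical_cong[OF that] by (simp add: step_M_def)
  show "step_M N p u \<in> space (prob_algebra Y)" if "N \<ge> 1" "u \<in> space (conf N Y)" "\<And>s. 0 < Gavg N p s u" for N p u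
    using that by (rule step_M_prob)
  show "(\<integral>z. \<phi> (proj s z) \<partial>step_M N p u) * Gavg N p s u
        = avg N (\<lambda>z. G p (proj s z) * (\<integral>y. \<phi> y \<partial>M s (Suc p) (proj s z))) u"
    if "N \<ge> 1" "u \<in> space (conf N Y)" "\<And>s. 0 < Gavg N p s u" "\<phi> \<in> bm X" for N p u \<phi> s
    using that by (rule step_M_marg)
  show "\<exists>R\<in>borel_measurable (conf N Y). \<forall>u\<in>space (conf N Y). (\<forall>s. 0 < Gavg N p s u) \<longrightarrow> measure (step_M N p u) S = R u"
    if N: "N \<ge> 1" and S: "S \<in> sets Y" for N p S
  proof (intro bexI ballI impI)
    let ?i = "indicator S :: 'a \<times> 'a \<Rightarrow> real"
    let ?c = "\<lambda>u. avg N (cmin N p u) u"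
    let ?V = "\<lambda>u. cres2 N p u (coupled_M p ?i)"
    let ?R = "\<lambda>u. avg N (\<lambda>z. cmin N p u z * coupled_M p ?i z) u + (if ?c u = 1 then 0 else ?V u / (1 - ?c u))"
    have cm: "?c \<in> borel_measurable (conf N Y)" using W_measurable[OF N bm_const[of 1], of p] by simp
    have Wm: "(\<lambda>u. avg N (\<lambda>z. cmin N p u z * coupled_M p ?i z) u) \<in> borel_measurable (conf N Y)"
      by (rule W_measurable[OF N coupled_M_bm[OF bm_indicator[OF S]]])
    have Vm: "?V \<in> borel_measurable (conf N Y)" by (rule V_measurable[OF N coupled_M_bm[OF bm_indicator[OF S]]])
    note cm[measurable] Wm[measurable] Vm[measurable]
    show "?R \<in> borel_measurable (conf N Y)" by measurable
    fix u assume u: "u \<in> space (conf N Y)" and "\<forall>s. 0 < Gavg N p s u"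
    then have ps: "\<And>s. 0 < Gavg N p s u" by blast
    have "(\<integral>z. ?i z \<partial>step_M N p u) = measure (step_M N p u) S"
      using prob_algebraD(2,3)[OF step_M_prob[OF N u ps]] S sets.sets_into_space[OF S] by (simp add: Int_absorb2)
    then show "measure (step_M N p u) S = ?R u"
      using step_M_integral[OF N u ps bm_indicator[OF S]] by simp
  qed
qed

context
  fixes p :: nat
  assumes J: "\<And>f. f \<in> bm Y \<Longrightarrow> L1_conv (\<lambda>N. plaw N p) (\<lambda>N. avg N f) (\<integral>z. f z \<partial>lM p)"
begin

definition gbar :: "level \<Rightarrow> real" where "gbar s = (\<integral>x. G p x \<partial>et s p)"

text \<open>A bound for the average distance between the random and the limiting weights; it is small because it only involves the normalising constants.\<close>

definition \<delta> :: "nat \<Rightarrow> (nat \<Rightarrow> 'a \<times> 'a) \<Rightarrow> real" where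
  "\<delta> N u = 1 / gbar Fine * \<bar>Gavg N p Fine u - gbar Fine\<bar> + 1 / gbar Coarse * \<bar>Gavg N p Coarse u - gbar Coarse\<bar>"

lemma \<delta>_L1: "L1_conv (\<lambda>N. plaw N p) \<delta> 0"
  unfolding \<delta>_def[abs_def] gbar_def by (intro law.L1_conv_abs_cmult0_add avg_L1 G_bm)

lemma gbar_pos: "0 < gbar s" unfolding gbar_def by (rule eta_G_pos)

abbreviation "lmin \<equiv> FM_min (G p) (lM p)"
abbreviation "lres \<equiv> FM_res (G p) (lM p)"

lemma lM_D: "0 < (\<integral>z. G p (proj s z) \<partial>lM p)"
  unfolding limit_M_marg[OF G_bm] by (rule eta_G_pos)

lemma FM_lM: "FM (G p) (lM p) s z = G p (proj s z) / gbar s"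
  unfolding FM_def limit_M_marg[OF G_bm] gbar_def ..

lemma lmin_bm: "lmin \<in> bm Y" by (rule FM_min_bm[OF Mc_k limit_M_prob G_bm G_nonneg lM_D])
lemma lres_bm: "lres s \<in> bm Y" by (rule FM_res_bm[OF Mc_k limit_M_prob G_bm G_nonneg lM_D])
lemma lres_nonneg: "0 \<le> lres s z" by (rule FM_res_nonneg[OF Mc_k limit_M_prob G_bm G_nonneg lM_D])

context
  fixes N :: nat and u
  assumes N: "N \<ge> 1" and u: "u \<in> space (conf N Y)" and ps: "\<And>s. 0 < Gavg N p s u"
begin

abbreviation "dF s z \<equiv> \<bar>FM (G p) (empirical Y N u) s z - FM (G p) (lM p) s z\<bar>"

text \<open>The two weights are multiples of the same potential: with \<open>a\<close> and \<open>g\<close> the random and the limiting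
  normalising constant, \<open>G/a - G/g = (1 - a/g) G/a\<close>, and \<open>G/a\<close> has average one.\<close>

lemma dF_avg: "avg N (dF s) u = 1 / gbar s * \<bar>Gavg N p s u - gbar s\<bar>"
proof -
  let ?a = "Gavg N p s u"
  have "dF s z = \<bar>1 - ?a / gbar s\<bar> * (G p (proj s z) / ?a)" if "z \<in> space Y" for z
  proof -
    have "FM (G p) (empirical Y N u) s z - FM (G p) (lM p) s z = (1 - ?a / gbar s) * (G p (proj s z) / ?a)"
      unfolding FM_emp[OF u] FM_lM using ps[of s] gbar_pos[of s] by (simp add: field_simps del: proj.simps)
    moreover have "0 \<le> G p (proj s z) / ?a" using G_nonneg[OF proj_space[OF that]] ps[of s] by (simp del: proj.simps)
    ultimately show ?thesis by (simp only: abs_mult abs_of_nonneg)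
  qed
  then have "avg N (dF s) u = avg N (\<lambda>z. \<bar>1 - ?a / gbar s\<bar> * (G p (proj s z) / ?a)) u" by (rule avg_cong[OF u])
  also have "\<dots> = \<bar>1 - ?a / gbar s\<bar>" unfolding avg_cmult avg_divc using ps[of s] by simp
  also have "1 - ?a / gbar s = (gbar s - ?a) / gbar s" using gbar_pos[of s] by (simp add: diff_divide_distrib)
  finally show ?thesis using gbar_pos[of s] by (simp add: abs_minus_commute)
qed

lemma dF_sum: "avg N (\<lambda>z. dF Fine z + dF Coarse z) u = \<delta> N u"
  unfolding avg_add dF_avg \<delta>_def ..

lemma \<delta>_nonneg: "0 \<le> \<delta> N u"
  unfolding \<delta>_def using gbar_pos by (intro add_nonneg_nonneg mult_nonneg_nonneg) (auto simp: less_imp_le)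

lemma dmin_le: "\<bar>cmin N p u z - lmin z\<bar> \<le> dF Fine z + dF Coarse z"
  unfolding FM_min_def by (auto simp: min_def)

lemma dres_avg: "avg N (\<lambda>z. \<bar>cres N p u s z - lres s z\<bar>) u \<le> 2 * \<delta> N u"
proof -
  have "\<bar>cres N p u s z - lres s z\<bar> \<le> 2 * (dF Fine z + dF Coarse z)" for z
  proof -
    have "\<bar>cres N p u s z - lres s z\<bar> \<le> dF s z + \<bar>cmin N p u z - lmin z\<bar>" unfolding FM_res_def by linarith
    moreover have "dF s z \<le> dF Fine z + dF Coarse z" by (cases s) auto
    ultimately have "\<bar>cres N p u s z - lres s z\<bar> \<le> (dF Fine z + dF Coarse z) + (dF Fine z + dF Coarse z)"
      using dmin_le[of z] by (meson add_mono order_trans)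
    then show ?thesis by (simp only: mult_2)
  qed
  then have "avg N (\<lambda>z. \<bar>cres N p u s z - lres s z\<bar>) u \<le> avg N (\<lambda>z. 2 * (dF Fine z + dF Coarse z)) u" by (intro avg_mono[OF u])
  then show ?thesis by (simp only: avg_cmult dF_sum)
qed

lemma W_diff:
  assumes b: "\<And>z. z \<in> space Y \<Longrightarrow> \<bar>b z\<bar> \<le> B" and B: "0 \<le> B"
  shows "\<bar>avg N (\<lambda>z. cmin N p u z * b z) u - avg N (\<lambda>z. lmin z * b z) u\<bar> \<le> B * \<delta> N u"
proof -
  have "\<bar>avg N (\<lambda>z. cmin N p u z * b z) u - avg N (\<lambda>z. lmin z * b z) u\<bar> \<le> avg N (\<lambda>z. \<bar>cmin N p u z * b z - lmin z * b z\<bar>) u"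
    unfolding avg_diff[symmetric] by (rule avg_abs)
  also have "\<dots> \<le> avg N (\<lambda>z. B * (dF Fine z + dF Coarse z)) u"
  proof (rule avg_mono[OF u])
    fix z assume z: "z \<in> space Y"
    have "\<bar>cmin N p u z * b z - lmin z * b z\<bar> = \<bar>cmin N p u z - lmin z\<bar> * \<bar>b z\<bar>" by (simp add: left_diff_distrib flip: abs_mult)
    also have "\<dots> \<le> (dF Fine z + dF Coarse z) * B" using dmin_le b[OF z] by (intro mult_mono) auto
    finally show "\<bar>cmin N p u z * b z - lmin z * b z\<bar> \<le> B * (dF Fine z + dF Coarse z)" by (simp only: mult.commute)
  qed
  finally show ?thesis by (simp only: avg_cmult dF_sum)
qed

text \<open>Change one residual weight at a time. The random weight that stays has average at most one, and the
  limiting one is bounded.\<close>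

lemma V_diff:
  assumes H: "\<And>z. z \<in> space Y \<Longrightarrow> \<bar>H z\<bar> \<le> B" and B: "0 \<le> B" and R: "\<And>z. z \<in> space Y \<Longrightarrow> lres Fine z \<le> R" and R0: "0 \<le> R"
  shows "\<bar>cres2 N p u H
     - avg2 N (\<lambda>q. lres Fine (fst q) * lres Coarse (snd q) * cross H q) u\<bar> \<le> B * ((2 + 2 * R) * \<delta> N u)"
proof -
  let ?d = "\<lambda>s z. \<bar>cres N p u s z - lres s z\<bar>"
  let ?m = "\<lambda>q. ?d Fine (fst q) * cres N p u Coarse (snd q) + lres Fine (fst q) * ?d Coarse (snd q)"
  have "\<bar>cres2 N p u H
     - avg2 N (\<lambda>q. lres Fine (fst q) * lres Coarse (snd q) * cross H q) u\<bar>
    \<le> avg2 N (\<lambda>q. \<bar>cres N p u Fine (fst q) * cres N p u Coarse (snd q) * cross H q - lres Fine (fst q) * lres Coarse (snd q) * cross H q\<bar>) u"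
    unfolding avg2_diff[symmetric] by (rule avg2_abs)
  also have "\<dots> \<le> avg2 N (\<lambda>q. B * ?m q) u"
  proof (rule avg2_mono[OF u])
    fix q assume q: "q \<in> space (Y \<Otimes>\<^sub>M Y)"
    let ?r1 = "cres N p u Fine (fst q)" and ?r2 = "cres N p u Coarse (snd q)" and ?l1 = "lres Fine (fst q)" and ?l2 = "lres Coarse (snd q)"
    have n: "0 \<le> ?r2" "0 \<le> ?l1" by (rule cres_nonneg[OF N u ps], rule lres_nonneg)
    have "?r1 * ?r2 - ?l1 * ?l2 = (?r1 - ?l1) * ?r2 + ?l1 * (?r2 - ?l2)" by (simp add: algebra_simps)
    then have "\<bar>?r1 * ?r2 - ?l1 * ?l2\<bar> \<le> \<bar>(?r1 - ?l1) * ?r2\<bar> + \<bar>?l1 * (?r2 - ?l2)\<bar>" by (metis abs_triangle_ineq)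
    also have "\<dots> = ?m q" using n by (simp add: abs_mult)
    finally have m: "\<bar>?r1 * ?r2 - ?l1 * ?l2\<bar> \<le> ?m q" .
    have "\<bar>?r1 * ?r2 * cross H q - ?l1 * ?l2 * cross H q\<bar> = \<bar>?r1 * ?r2 - ?l1 * ?l2\<bar> * \<bar>cross H q\<bar>"
      by (simp add: left_diff_distrib flip: abs_mult)
    also have "\<dots> \<le> ?m q * B" using m H[OF cross_space[OF q]] n by (intro mult_mono) (auto simp: cross_def)
    finally show "\<bar>?r1 * ?r2 * cross H q - ?l1 * ?l2 * cross H q\<bar> \<le> B * ?m q" by (simp only: mult.commute)
  qed
  also have "\<dots> = B * (avg N (?d Fine) u * avg N (cres N p u Coarse) u + avg N (lres Fine) u * avg N (?d Coarse) u)"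
    unfolding avg2_cmult avg2_add avg2_tensor[of N "?d Fine" "cres N p u Coarse"] avg2_tensor[of N "lres Fine" "?d Coarse"] ..
  also have "\<dots> \<le> B * ((2 * \<delta> N u) * 1 + R * (2 * \<delta> N u))"
  proof (intro mult_left_mono add_mono mult_mono B)
    show "avg N (?d Fine) u \<le> 2 * \<delta> N u" "avg N (?d Coarse) u \<le> 2 * \<delta> N u" by (rule dres_avg)+
    show "avg N (cres N p u Coarse) u \<le> 1" by (rule cres_avg_le[OF u])
    show "avg N (lres Fine) u \<le> R" using avg_mono[OF u R] avg_const[OF N, of R u] by simp
    show "0 \<le> avg N (cres N p u Coarse) u" by (intro avg_nonneg[OF u] cres_nonneg[OF N u ps])
    show "0 \<le> avg N (?d Coarse) u" by (intro avg_nonneg[OF u]) simp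
  qed (use \<delta>_nonneg R0 in auto)
  also have "\<dots> = B * ((2 + 2 * R) * \<delta> N u)" by (simp add: algebra_simps)
  finally show ?thesis .
qed

end

lemma W_L1:
  assumes b: "b \<in> bm Y"
  shows "L1_conv (\<lambda>N. plaw N p) (\<lambda>N u. avg N (\<lambda>z. cmin N p u z * b z) u) (\<integral>z. lmin z * b z \<partial>lM p)"
proof -
  obtain B where B: "0 \<le> B" "\<And>z. z \<in> space Y \<Longrightarrow> \<bar>b z\<bar> \<le> B" using bmE[OF b] by blast
  have j: "L1_conv (\<lambda>N. plaw N p) (\<lambda>N. avg N (\<lambda>z. lmin z * b z)) (\<integral>z. lmin z * b z \<partial>lM p)"
    by (intro J bm_mult lmin_bm b)
  have d: "L1_conv (\<lambda>N. plaw N p) (\<lambda>N u. B * \<delta> N u + \<bar>avg N (\<lambda>z. lmin z * b z) u - (\<integral>z. lmin z * b z \<partial>lM p)\<bar>) 0"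
    using law.L1_conv_add[OF law.L1_conv_cmult[OF \<delta>_L1, of B] law.L1_conv_abs0[OF j]] by simp
  show ?thesis
  proof (rule law.L1_conv_dominated[OF _ _ d, where B=B])
    fix N :: nat assume N: "1 \<le> N"
    have cs: "borel_measurable (plaw N p) = (borel_measurable (conf N Y) :: ((nat \<Rightarrow> 'a \<times> 'a) \<Rightarrow> real) set)"
      by (rule measurable_cong_sets[OF prob_algebraD(2)[OF pi_prob[OF N]] refl])
    show "(\<lambda>u. avg N (\<lambda>z. cmin N p u z * b z) u) \<in> borel_measurable (plaw N p)" unfolding cs by (rule W_measurable[OF N b])
    show "\<bar>avg N (\<lambda>z. cmin N p u z * b z) u\<bar> \<le> B" if "u \<in> space (plaw N p)" for u
      using that pi_space[OF N] by (intro W_bound B) auto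
    show "AE u in plaw N p. \<bar>avg N (\<lambda>z. cmin N p u z * b z) u - (\<integral>z. lmin z * b z \<partial>lM p)\<bar>
        \<le> B * \<delta> N u + \<bar>avg N (\<lambda>z. lmin z * b z) u - (\<integral>z. lmin z * b z \<partial>lM p)\<bar>"
      using AE_ker[OF N, of p]
    proof eventually_elim
      case (elim u)
      then have u: "u \<in> space (conf N Y)" and ps: "\<And>s. 0 < Gavg N p s u" by blast+
      have "\<bar>avg N (\<lambda>z. cmin N p u z * b z) u - avg N (\<lambda>z. lmin z * b z) u\<bar> \<le> B * \<delta> N u"
        by (rule W_diff[OF N u ps B(2) B(1)])
      then show ?case by linarith
    qed
  qed
qed

lemma V_L1:
  assumes H: "H \<in> bm Y"
  shows "L1_conv (\<lambda>N. plaw N p) (\<lambda>N u. cres2 N p u H)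
    (\<integral>q. lres Fine (fst q) * lres Coarse (snd q) * cross H q \<partial>(lM p \<Otimes>\<^sub>M lM p))" (is "L1_conv _ ?V ?v")
proof -
  obtain B where B: "0 \<le> B" "\<And>z. z \<in> space Y \<Longrightarrow> \<bar>H z\<bar> \<le> B" using bmE[OF H] by blast
  obtain R where R: "0 \<le> R" "\<And>z. z \<in> space Y \<Longrightarrow> \<bar>lres Fine z\<bar> \<le> R" using bmE[OF lres_bm[of Fine]] by blast
  let ?V' = "\<lambda>N. avg2 N (\<lambda>q. lres Fine (fst q) * lres Coarse (snd q) * cross H q)"
  have j: "L1_conv (\<lambda>N. plaw N p) ?V' ?v"
    by (rule weighted_product_L1[OF J lres_bm lres_bm H])
  have d: "L1_conv (\<lambda>N. plaw N p) (\<lambda>N u. B * ((2 + 2 * R) * \<delta> N u) + \<bar>?V' N u - ?v\<bar>) 0"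
    using law.L1_conv_add[OF law.L1_conv_cmult[OF law.L1_conv_cmult[OF \<delta>_L1, of "2 + 2 * R"], of B] law.L1_conv_abs0[OF j]] by simp
  show ?thesis
  proof (rule law.L1_conv_dominated[OF _ _ d, where B=B])
    fix N :: nat assume N: "1 \<le> N"
    have cs: "borel_measurable (plaw N p) = (borel_measurable (conf N Y) :: ((nat \<Rightarrow> 'a \<times> 'a) \<Rightarrow> real) set)"
      by (rule measurable_cong_sets[OF prob_algebraD(2)[OF pi_prob[OF N]] refl])
    show "?V N \<in> borel_measurable (plaw N p)" unfolding cs by (rule V_measurable[OF N H])
    show "\<bar>?V N u\<bar> \<le> B" if "u \<in> space (plaw N p)" for u
      using that pi_space[OF N] by (intro V_bound B) auto
    show "AE u in plaw N p. \<bar>?V N u - ?v\<bar> \<le> B * ((2 + 2 * R) * \<delta> N u) + \<bar>?V' N u - ?v\<bar>"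
      using AE_ker[OF N, of p]
    proof eventually_elim
      case (elim u)
      then have u: "u \<in> space (conf N Y)" and ps: "\<And>s. 0 < Gavg N p s u" by blast+
      have R': "lres Fine z \<le> R" if "z \<in> space Y" for z using R(2)[OF that] by linarith
      have "\<bar>?V N u - ?V' N u\<bar> \<le> B * ((2 + 2 * R) * \<delta> N u)"
        by (rule V_diff[OF N u ps B(2) B(1) R' R(1)])
      then show ?case by linarith
    qed
  qed
qed

text \<open>The diagonal part of the update converges by \<open>W_L1\<close>; the rest is a quotient of the form treated by
  \<open>L1_conv_remainder\<close>.\<close>

lemma ker_L1:
  assumes f: "f \<in> bm Y"
  shows "L1_conv (\<lambda>N. plaw N p) (\<lambda>N u. \<integral>z. f z \<partial>ker N p u) (\<integral>z. f z \<partial>lM (Suc p))"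
proof -
  let ?H = "coupled_M p f"
  let ?W = "\<lambda>N u. avg N (\<lambda>z. cmin N p u z * ?H z) u"
  let ?c = "\<lambda>N u. avg N (cmin N p u) u"
  let ?V = "\<lambda>N u. cres2 N p u ?H"
  let ?T = "\<lambda>N u. (\<integral>z. f z \<partial>ker N p u) - ?W N u"
  let ?cl = "\<integral>z. lmin z \<partial>lM p" and ?vl = "\<integral>q. lres Fine (fst q) * lres Coarse (snd q) * cross ?H q \<partial>(lM p \<Otimes>\<^sub>M lM p)"
  have H: "?H \<in> bm Y" by (rule coupled_M_bm[OF f])
  obtain B where B: "0 \<le> B" "\<And>z. z \<in> space Y \<Longrightarrow> \<bar>f z\<bar> \<le> B" using bmE[OF f] by blast
  obtain B' where B': "0 \<le> B'" "\<And>z. z \<in> space Y \<Longrightarrow> \<bar>?H z\<bar> \<le> B'" using bmE[OF H] by blast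
  have c: "L1_conv (\<lambda>N. plaw N p) ?c ?cl" using W_L1[OF bm_const[of 1]] by simp
  have "L1_conv (\<lambda>N. plaw N p) ?T (if ?cl = 1 then 0 else ?vl / (1 - ?cl))"
  proof (rule law.L1_conv_remainder[OF V_L1[OF H] c, where B="B + B'" and B'=B'])
    fix N :: nat assume N: "1 \<le> N"
    have cs: "borel_measurable (plaw N p) = (borel_measurable (conf N Y) :: ((nat \<Rightarrow> 'a \<times> 'a) \<Rightarrow> real) set)"
      by (rule measurable_cong_sets[OF prob_algebraD(2)[OF pi_prob[OF N]] refl])
    show "?T N \<in> borel_measurable (plaw N p)" unfolding cs
      by (intro borel_measurable_diff W_measurable[OF N H] bm_measurable[OF K_bm[OF N f]])
    show "\<bar>?T N u\<bar> \<le> B + B'" if "u \<in> space (plaw N p)" for u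
    proof -
      have u: "u \<in> space (conf N Y)" using that pi_space[OF N] by simp
      have "\<bar>\<integral>z. f z \<partial>ker N p u\<bar> \<le> B" by (rule K_abs_le[OF N u B(2)])
      moreover have "\<bar>?W N u\<bar> \<le> B'" by (rule W_bound[OF u B'(2) B'(1)])
      ultimately show ?thesis by linarith
    qed
    show "AE u in plaw N p. ?T N u * (1 - ?c N u) = ?V N u \<and> \<bar>?T N u\<bar> \<le> B' * \<bar>1 - ?c N u\<bar>"
      using AE_ker[OF N, of p]
    proof eventually_elim
      case (elim u)
      then have u: "u \<in> space (conf N Y)" and ps: "\<And>s. 0 < Gavg N p s u" and k: "ker N p u = step_M N p u" by blast+
      have T: "?T N u = (if ?c N u = 1 then 0 else ?V N u / (1 - ?c N u))"
        unfolding k step_M_integral[OF N u ps f] by simp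
      have V: "\<bar>?V N u\<bar> \<le> B' * (1 - ?c N u)\<^sup>2" by (rule rem_bound[OF N u ps B'(2) B'(1)])
      have c1: "?c N u \<le> 1" by (rule cmin_le[OF N u ps])
      show ?case unfolding T by (rule remainder_quotient[OF c1 V])
    qed
  qed
  from law.L1_conv_add[OF this W_L1[OF H]]
  have "L1_conv (\<lambda>N. plaw N p) (\<lambda>N u. \<integral>z. f z \<partial>ker N p u) ((if ?cl = 1 then 0 else ?vl / (1 - ?cl)) + (\<integral>z. lmin z * ?H z \<partial>lM p))"
    by simp
  also have "(if ?cl = 1 then 0 else ?vl / (1 - ?cl)) + (\<integral>z. lmin z * ?H z \<partial>lM p) = (\<integral>z. f z \<partial>lM (Suc p))"
  proof -
    have "(\<integral>z. f z \<partial>Phi_M X (G p) (Mc (Suc p)) (lM p)) = (\<integral>z. lmin z * ?H z \<partial>lM p) + (if ?cl = 1 then 0 else ?vl / (1 - ?cl))"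
      unfolding coupled_M_def cross_def by (rule Phi_M_integral[OF Mc_k limit_M_prob G_bm G_nonneg lM_D f])
    then show ?thesis by simp
  qed
  finally show ?thesis .
qed

end

text \<open>If the empirical measure on pairs converges at time \<open>p\<close>, the sampling law converges by \<open>ker_L1\<close>, and the
  independent draws at time \<open>p + 1\<close> add a variance of order \<open>1/N\<close>.\<close>

lemma joint_L1: "f \<in> bm Y \<Longrightarrow> L1_conv (\<lambda>N. plaw N p) (\<lambda>N. avg N f) (\<integral>z. f z \<partial>lM p)"
proof (induction p arbitrary: f)
  case (0 f)
  obtain B where B: "0 \<le> B" "\<And>z. z \<in> space Y \<Longrightarrow> \<bar>f z\<bar> \<le> B" using bmE[OF 0] by blast
  show ?case
  proof (rule law.L1_conv_L2[where B=B, OF _ _ _ lim_const_over_n])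
    fix N :: nat assume N: "N \<ge> 1"
    show "avg N f \<in> borel_measurable (plaw N 0)" by (intro pi_meas N avg_bm 0)
    show "\<bar>avg N f u\<bar> \<le> B" if "u \<in> space (plaw N 0)" for u
      using that pi_space[OF N] by (intro avg_abs_le[of u N Y] B) auto
    show "(\<integral>u. (avg N f u - (\<integral>z. f z \<partial>lM 0))\<^sup>2 \<partial>plaw N 0) \<le> B\<^sup>2 / N"
      unfolding pi_0[OF N] using iid_square[OF ell_prob N 0 B(2), of 0 "\<integral>z. f z \<partial>lM 0"] by simp
  qed
next
  case (Suc p f)
  obtain B where B: "0 \<le> B" "\<And>z. z \<in> space Y \<Longrightarrow> \<bar>f z\<bar> \<le> B" using bmE[OF Suc.prems] by blast
  let ?a = "\<integral>z. f z \<partial>lM (Suc p)"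
  let ?k = "\<lambda>N u. ((\<integral>z. f z \<partial>ker N p u) - ?a) * ((\<integral>z. f z \<partial>ker N p u) - ?a)"
  have k: "L1_conv (\<lambda>N. plaw N p) ?k 0"
  proof -
    have "L1_conv (\<lambda>N. plaw N p) (\<lambda>N u. (\<integral>z. f z \<partial>ker N p u) - ?a) (?a - ?a)"
      by (intro law.L1_conv_diff law.L1_conv_const ker_L1 Suc)
    from law.L1_conv_mult[OF this this] show ?thesis by simp
  qed
  show ?case
  proof (rule law.L1_conv_L2[where B=B and e="\<lambda>N. B\<^sup>2 / real N + (\<integral>u. ?k N u \<partial>plaw N p)"])
    show "(\<lambda>N. B\<^sup>2 / real N + (\<integral>u. ?k N u \<partial>plaw N p)) \<longlonglongrightarrow> 0"
      using tendsto_add[OF lim_const_over_n[of "B\<^sup>2"] law.L1_conv_expectation[OF k]] by simp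
    fix N :: nat assume N: "N \<ge> 1"
    interpret P: prob_space "plaw N p" using law.prob[OF N] .
    show "avg N f \<in> borel_measurable (plaw N (Suc p))" by (intro pi_meas N avg_bm Suc.prems)
    show "\<bar>avg N f u\<bar> \<le> B" if "u \<in> space (plaw N (Suc p))" for u
      using that pi_space[OF N] by (intro avg_abs_le[of u N Y] B) auto
    let ?F = "\<lambda>v. (avg N f v - ?a)\<^sup>2"
    have F: "?F \<in> bm (conf N Y)" by (intro bm_power bm_diff bm_const avg_bm Suc.prems)
    have i: "integrable (plaw N p) (?k N)" by (intro law.bm_int[OF N] L1_conv_bm[OF k N])
    have "(\<integral>u. ?F u \<partial>plaw N (Suc p)) = (\<integral>u. (\<integral>v. ?F v \<partial>PiM {1..N} (\<lambda>_. ker N p u)) \<partial>plaw N p)"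
      by (rule pi_integral_Suc[OF N F])
    also have "\<dots> \<le> (\<integral>u. B\<^sup>2 / N + ?k N u \<partial>plaw N p)"
    proof (rule integral_mono)
      show "integrable (plaw N p) (\<lambda>u. \<integral>v. ?F v \<partial>PiM {1..N} (\<lambda>_. ker N p u))"
        by (intro pi_int[OF N] bm_kernel[OF PiM_kernel[OF K_kernel[OF N]] F])
      show "integrable (plaw N p) (\<lambda>u. B\<^sup>2 / N + ?k N u)" using i by auto
      fix u assume "u \<in> space (plaw N p)"
      then have u: "u \<in> space (conf N Y)" using pi_space[OF N] by simp
      show "(\<integral>v. ?F v \<partial>PiM {1..N} (\<lambda>_. ker N p u)) \<le> B\<^sup>2 / N + ?k N u"
        using iid_square[OF K_prob[OF N u] N Suc.prems B(2), of p ?a] by (simp add: power2_eq_square)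
    qed
    also have "\<dots> = B\<^sup>2 / N + (\<integral>u. ?k N u \<partial>plaw N p)" using i by (simp add: P.prob_space)
    finally show "(\<integral>u. ?F u \<partial>plaw N (Suc p)) \<le> B\<^sup>2 / real N + (\<integral>u. ?k N u \<partial>plaw N p)" .
  qed
qed

lemma clt:
  assumes \<phi>: "\<phi> \<in> bm X"
  shows "weak_conv_m (\<lambda>N. distr (\<Omega> N) borel (scaled_error X lM N (U N) n \<phi>)) (centred_normal (asymp_variance X G eta0 M lM n \<phi>))"
proof (rule weak_conv_of_cross[OF _ \<phi>])
  fix \<phi> \<psi> p assume "\<phi> \<in> bm X" "\<psi> \<in> bm X"
  then show "L1_conv (\<lambda>N. plaw N p) (\<lambda>N u. \<integral>z. \<phi> (fst z) * \<psi> (snd z) \<partial>ker N p u) (\<integral>z. \<phi> (fst z) * \<psi> (snd z) \<partial>lM (Suc p))"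
    by (intro ker_L1 joint_L1 bm_mult bm_compose[OF measurable_fst] bm_compose[OF measurable_snd])
qed

end

section \<open>Maximal coupling of densities\<close>

lemma density_probability:
  assumes \<kappa>: "density L (\<lambda>x. ennreal (f x)) \<in> space (prob_algebra X)"
    and f: "f \<in> borel_measurable L" "\<And>x. x \<in> space L \<Longrightarrow> 0 \<le> f x"
  shows density_integrable: "\<phi> \<in> bm X \<Longrightarrow> integrable L (\<lambda>x. f x * \<phi> x)"
    and density_integral: "\<phi> \<in> bm X \<Longrightarrow> (\<integral>x. \<phi> x \<partial>density L (\<lambda>x. ennreal (f x))) = (\<integral>x. f x * \<phi> x \<partial>L)"
proof -
  have s: "sets L = sets X" using prob_algebraD(2)[OF \<kappa>] by simp
  have AE: "AE x in L. 0 \<le> f x" using f(2) by auto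
  have m: "\<phi> \<in> borel_measurable L" if "\<phi> \<in> bm X" for \<phi>
    using that bm_measurable bm_cong_sets[OF s] by blast
  show "integrable L (\<lambda>x. f x * \<phi> x)" if "\<phi> \<in> bm X"
    using bm_integrable[OF \<kappa> that] integrable_density[OF m[OF that] f(1) AE] by simp
  show "(\<integral>x. \<phi> x \<partial>density L (\<lambda>x. ennreal (f x))) = (\<integral>x. f x * \<phi> x \<partial>L)" if "\<phi> \<in> bm X"
    using integral_density[OF m[OF that] f(1) AE] by simp
qed

context
  fixes X L \<mu> :: "'a measure" and g :: "'a \<Rightarrow> real" and \<delta> :: "'a \<Rightarrow> 'a \<Rightarrow> real" and K :: "'a \<Rightarrow> 'a measure"
  assumes L: "sigma_finite_measure L" and LX: "sets L = sets X"
    and \<mu>: "\<mu> \<in> space (prob_algebra X)" and K: "K \<in> X \<rightarrow>\<^sub>M prob_algebra X"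
    and \<delta>: "(\<lambda>(x, y). \<delta> x y) \<in> borel_measurable (X \<Otimes>\<^sub>M X)" "\<And>x y. x \<in> space X \<Longrightarrow> y \<in> space X \<Longrightarrow> 0 \<le> \<delta> x y"
    and K\<delta>: "\<And>x. x \<in> space X \<Longrightarrow> K x = density L (\<lambda>y. ennreal (\<delta> x y))"
    and g: "g \<in> bm X" "\<And>x. x \<in> space X \<Longrightarrow> 0 \<le> g x" and D: "0 < (\<integral>x. g x \<partial>\<mu>)"
begin

text \<open>The space of the potential is integrated first in the definition of \<open>FC\<close>, the dominating measure first
  in the Boltzmann--Gibbs update; Fubini's theorem makes \<open>FC\<close> the density of the update.\<close>

lemma FC_fubini_integrable:
  assumes \<phi>: "\<phi> \<in> bm X"
  shows "integrable (\<mu> \<Otimes>\<^sub>M L) (\<lambda>(y, x). g y * \<delta> y x * \<phi> x)"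
    and "x \<in> space X \<Longrightarrow> (\<integral>y. g x * \<delta> x y * \<phi> y \<partial>L) = g x * (\<integral>y. \<phi> y \<partial>K x)"
proof -
  interpret sigma_finite_measure L by (rule L)
  interpret M1: sigma_finite_measure \<mu> by (rule pa_sigma_finite[OF \<mu>])
  interpret P: pair_sigma_finite \<mu> L ..
  have sL: "space L = space X" by (rule sets_eq_imp_space_eq[OF LX])
  have cs: "borel_measurable (\<mu> \<Otimes>\<^sub>M L) = (borel_measurable (X \<Otimes>\<^sub>M X) :: ('a \<times> 'a \<Rightarrow> real) set)"
    by (intro measurable_cong_sets sets_pair_measure_cong prob_algebraD(2)[OF \<mu>] LX refl)
  have dm: "\<delta> x \<in> borel_measurable L" if "x \<in> space X" for x
  proof -
    have "(\<lambda>y. \<delta> x y) \<in> borel_measurable X"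
      using measurable_compose[OF measurable_Pair1'[OF that] \<delta>(1)] by simp
    then show ?thesis using measurable_cong_sets[OF LX refl] by blast
  qed
  have Kx: "density L (\<lambda>y. ennreal (\<delta> x y)) \<in> space (prob_algebra X)" if "x \<in> space X" for x
    using measurable_space[OF K that] K\<delta>[OF that] by simp
  have ki: "integrable L (\<lambda>y. \<delta> x y * f y)" "(\<integral>y. \<delta> x y * f y \<partial>L) = (\<integral>y. f y \<partial>K x)"
    if x: "x \<in> space X" and f: "f \<in> bm X" for x f
    using density_integrable[OF Kx[OF x] dm[OF x] _ f] density_integral[OF Kx[OF x] dm[OF x] _ f] \<delta>(2)[OF x] K\<delta>[OF x]
    by (auto simp: sL)
  show "(\<integral>y. g x * \<delta> x y * \<phi> y \<partial>L) = g x * (\<integral>y. \<phi> y \<partial>K x)" if x: "x \<in> space X" for x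
    using ki(2)[OF x \<phi>] by (simp add: mult.assoc)
  show "integrable (\<mu> \<Otimes>\<^sub>M L) (\<lambda>(y, x). g y * \<delta> y x * \<phi> x)"
  proof (rule P.Fubini_integrable)
    have a: "(\<lambda>z. g (fst z)) \<in> borel_measurable (X \<Otimes>\<^sub>M X)" "(\<lambda>z. \<phi> (snd z)) \<in> borel_measurable (X \<Otimes>\<^sub>M X)"
      by (intro measurable_compose[OF measurable_fst bm_measurable[OF g(1)]] measurable_compose[OF measurable_snd bm_measurable[OF \<phi>]])+
    have "(\<lambda>z. g (fst z) * (case z of (x, y) \<Rightarrow> \<delta> x y) * \<phi> (snd z)) \<in> borel_measurable (X \<Otimes>\<^sub>M X)"
      by (intro borel_measurable_times a \<delta>(1))
    then show "(\<lambda>(y, x). g y * \<delta> y x * \<phi> x) \<in> borel_measurable (\<mu> \<Otimes>\<^sub>M L)"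
      unfolding cs by (simp add: split_beta')
    have e: "(\<integral>x. norm (case (y, x) of (y, x) \<Rightarrow> g y * \<delta> y x * \<phi> x) \<partial>L) = g y * (\<integral>x. \<bar>\<phi> x\<bar> \<partial>K y)" if y: "y \<in> space X" for y
    proof -
      have "(\<integral>x. norm (case (y, x) of (y, x) \<Rightarrow> g y * \<delta> y x * \<phi> x) \<partial>L) = (\<integral>x. g y * (\<delta> y x * \<bar>\<phi> x\<bar>) \<partial>L)"
        using \<delta>(2)[OF y] g(2)[OF y] by (intro Bochner_Integration.integral_cong refl) (auto simp: abs_mult sL)
      then show ?thesis using ki(2)[OF y bm_abs[OF \<phi>]] by simp
    qed
    have "integrable \<mu> (\<lambda>y. g y * (\<integral>x. \<bar>\<phi> x\<bar> \<partial>K y))"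
      by (intro bm_integrable[OF \<mu>] bm_mult g(1) bm_kernel[OF K] bm_abs \<phi>)
    then show "integrable \<mu> (\<lambda>y. \<integral>x. norm (case (y, x) of (y, x) \<Rightarrow> g y * \<delta> y x * \<phi> x) \<partial>L)"
      using e prob_algebraD(3)[OF \<mu>] by (subst Bochner_Integration.integrable_cong[OF refl]) auto
    show "AE y in \<mu>. integrable L (\<lambda>x. case (y, x) of (y, x) \<Rightarrow> g y * \<delta> y x * \<phi> x)"
      using ki(1)[OF _ \<phi>] prob_algebraD(3)[OF \<mu>] by (intro AE_I2) (auto simp: mult.assoc intro!: integrable_mult_right)
  qed
qed

lemma FC_integral:
  assumes \<phi>: "\<phi> \<in> bm X"
  shows FC_integrable_mult: "integrable L (\<lambda>x. FC g \<delta> \<mu> x * \<phi> x)"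
    and FC_integral_mult: "(\<integral>x. FC g \<delta> \<mu> x * \<phi> x \<partial>L) * (\<integral>x. g x \<partial>\<mu>) = (\<integral>x. g x * (\<integral>y. \<phi> y \<partial>K x) \<partial>\<mu>)"
proof -
  interpret sigma_finite_measure L by (rule L)
  interpret M1: sigma_finite_measure \<mu> by (rule pa_sigma_finite[OF \<mu>])
  interpret P: pair_sigma_finite \<mu> L ..
  note I = FC_fubini_integrable[OF \<phi>]
  have e: "(\<integral>y. g y * \<delta> y x * \<phi> x \<partial>\<mu>) = (\<integral>x. g x \<partial>\<mu>) * (FC g \<delta> \<mu> x * \<phi> x)" for x
    using D by (simp add: FC_def)
  have "integrable L (\<lambda>x. (\<integral>x. g x \<partial>\<mu>) * (FC g \<delta> \<mu> x * \<phi> x))"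
    using P.integrable_snd[OF I(1)] unfolding e .
  then show "integrable L (\<lambda>x. FC g \<delta> \<mu> x * \<phi> x)"
    using D by (simp del: times_divide_eq_left)
  have "(\<integral>x. FC g \<delta> \<mu> x * \<phi> x \<partial>L) * (\<integral>x. g x \<partial>\<mu>) = (\<integral>x. (\<integral>y. g y * \<delta> y x * \<phi> x \<partial>\<mu>) \<partial>L)"
    unfolding e by simp
  also have "\<dots> = (\<integral>x. (\<integral>y. g x * \<delta> x y * \<phi> y \<partial>L) \<partial>\<mu>)"
    by (rule P.Fubini_integral[OF I(1)])
  also have "\<dots> = (\<integral>x. g x * (\<integral>y. \<phi> y \<partial>K x) \<partial>\<mu>)"
    using prob_algebraD(3)[OF \<mu>] by (intro Bochner_Integration.integral_cong refl I(2)) simp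
  finally show "(\<integral>x. FC g \<delta> \<mu> x * \<phi> x \<partial>L) * (\<integral>x. g x \<partial>\<mu>) = (\<integral>x. g x * (\<integral>y. \<phi> y \<partial>K x) \<partial>\<mu>)" .
qed

lemma FC_density:
  shows FC_integrable: "integrable L (FC g \<delta> \<mu>)"
    and FC_nonneg: "x \<in> space L \<Longrightarrow> 0 \<le> FC g \<delta> \<mu> x"
    and FC_total: "(\<integral>x. FC g \<delta> \<mu> x \<partial>L) = 1"
proof -
  show "integrable L (FC g \<delta> \<mu>)" using FC_integral(1)[OF bm_const[of 1]] by simp
  have "(\<integral>x. g x * (\<integral>y. 1 \<partial>K x) \<partial>\<mu>) = (\<integral>x. g x \<partial>\<mu>)"
  proof (intro Bochner_Integration.integral_cong refl)
    fix x assume "x \<in> space \<mu>"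
    then have "x \<in> space X" using prob_algebraD(3)[OF \<mu>] by simp
    from prob_space.prob_space[OF kernelD(1)[OF K this]] show "g x * (\<integral>y. 1 \<partial>K x) = g x" by simp
  qed
  then show "(\<integral>x. FC g \<delta> \<mu> x \<partial>L) = 1" using FC_integral(2)[OF bm_const[of 1]] D by simp
  assume "x \<in> space L"
  then have "x \<in> space X" using sets_eq_imp_space_eq[OF LX] by simp
  then show "0 \<le> FC g \<delta> \<mu> x"
    unfolding FC_def using D prob_algebraD(3)[OF \<mu>] \<delta>(2) g(2)
    by (intro divide_nonneg_pos Bochner_Integration.integral_nonneg mult_nonneg_nonneg) auto
qed

end

locale algorithm_C = feynman_kac_pos X G eta0 M etac0 Mc
  for X :: "'a measure" and G eta0 M etac0 Mc +
  fixes L :: "'a measure" and d0 :: "level \<Rightarrow> 'a \<Rightarrow> real" and d :: "level \<Rightarrow> nat \<Rightarrow> 'a \<Rightarrow> 'a \<Rightarrow> real"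
    and \<Omega> :: "nat \<Rightarrow> 'w measure" and U :: "nat \<Rightarrow> nat \<Rightarrow> nat \<Rightarrow> 'w \<Rightarrow> 'a \<times> 'a"
  assumes dens: "densities X eta0 M L d0 d"
    and d_bm: "k \<ge> 1 \<Longrightarrow> (\<lambda>(x, y). d s k x y) \<in> bm (X \<Otimes>\<^sub>M X)"
    and particles: "N \<ge> 1 \<Longrightarrow> particles_C X G L d0 d (\<Omega> N) N (U N)"
    and weights: "N \<ge> 1 \<Longrightarrow> positive_weights X G (\<Omega> N) N (U N)"
begin

lemma L_sf: "sigma_finite_measure L" and LX: "sets L = sets X"
  using dens by (auto simp: densities_def)

sublocale L: sigma_finite_measure L by (rule L_sf)

lemma sL: "space L = space X" by (rule sets_eq_imp_space_eq[OF LX])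
lemma bmL: "bm L = bm X" by (rule bm_cong_sets[OF LX])
lemma LL: "sets (L \<Otimes>\<^sub>M L) = sets Y" by (intro sets_pair_measure_cong LX)
lemma paLL: "prob_algebra (L \<Otimes>\<^sub>M L) = prob_algebra Y" by (simp only: prob_algebra_def subprob_algebra_cong[OF LL])
lemma bmLL: "bm (L \<Otimes>\<^sub>M L) = bm Y" by (rule bm_cong_sets[OF LL])

lemma d_meas: "(\<lambda>(x, y). d s (Suc p) x y) \<in> borel_measurable (X \<Otimes>\<^sub>M X)"
  by (rule bm_measurable[OF d_bm]) simp

lemma d_nonneg: "x \<in> space X \<Longrightarrow> y \<in> space X \<Longrightarrow> 0 \<le> d s (Suc p) x y"
  and M_density: "x \<in> space X \<Longrightarrow> M s (Suc p) x = density L (\<lambda>y. ennreal (d s (Suc p) x y))"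
  using dens by (auto simp: densities_def)

lemma Gd_bm:
  assumes x: "x \<in> space X" shows "(\<lambda>y. G p y * d s (Suc p) y x) \<in> bm X"
  using bm_compose[OF measurable_Pair2'[OF x] d_bm[of "Suc p" s]] by (intro bm_mult G_bm) simp

lemma d0_density:
  shows "integrable L (d0 s)" "\<And>x. x \<in> space L \<Longrightarrow> 0 \<le> d0 s x" "(\<integral>x. d0 s x \<partial>L) = 1"
    and d0_integral: "\<phi> \<in> bm X \<Longrightarrow> (\<integral>x. d0 s x * \<phi> x \<partial>L) = (\<integral>x. \<phi> x \<partial>et s 0)"
proof -
  have e: "eta0 s = density L (\<lambda>x. ennreal (d0 s x))" and m: "d0 s \<in> borel_measurable L" and nn: "\<And>x. x \<in> space L \<Longrightarrow> 0 \<le> d0 s x"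
    using dens measurable_cong_sets[OF LX refl, of borel] by (auto simp: densities_def sL)
  have p: "density L (\<lambda>x. ennreal (d0 s x)) \<in> space (prob_algebra X)" using eta0_prob[of s] e by simp
  show "0 \<le> d0 s x" if "x \<in> space L" for x using that by (rule nn)
  show i: "(\<integral>x. d0 s x * \<phi> x \<partial>L) = (\<integral>x. \<phi> x \<partial>et s 0)" if "\<phi> \<in> bm X" for \<phi>
    using density_integral[OF p m nn that] eta_zero[OF that, of s] e by simp
  show "integrable L (d0 s)" using density_integrable[OF p m nn bm_const[of 1]] by simp
  show "(\<integral>x. d0 s x \<partial>L) = 1"
    using i[OF bm_const[of 1]] prob_space.prob_space[OF prob_algebraD(1)[OF eta_prob[of s 0]]] by simp
qed

text \<open>The limiting density at time \<open>p + 1\<close>.\<close>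

definition lden :: "nat \<Rightarrow> level \<Rightarrow> 'a \<Rightarrow> real" where
  "lden p s = FC (G p) (d s (Suc p)) (et s p)"

lemma lden_density:
  shows "integrable L (lden p s)" "\<And>x. x \<in> space L \<Longrightarrow> 0 \<le> lden p s x" "(\<integral>x. lden p s x \<partial>L) = 1"
    and lden_integral: "\<phi> \<in> bm X \<Longrightarrow> (\<integral>x. lden p s x * \<phi> x \<partial>L) = (\<integral>x. \<phi> x \<partial>et s (Suc p))"
proof -
  note A = L_sf LX eta_prob M_k d_meas d_nonneg M_density G_bm G_nonneg eta_G_pos
  show "integrable L (lden p s)" unfolding lden_def by (rule FC_integrable[OF A])
  show "0 \<le> lden p s x" if "x \<in> space L" for x unfolding lden_def by (rule FC_nonneg[OF A]) (simp_all add: that)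
  show "(\<integral>x. lden p s x \<partial>L) = 1" unfolding lden_def by (rule FC_total[OF A])
  show "(\<integral>x. lden p s x * \<phi> x \<partial>L) = (\<integral>x. \<phi> x \<partial>et s (Suc p))" if \<phi>: "\<phi> \<in> bm X"
  proof (rule marg_ratio[OF _ \<phi>])
    show "(\<integral>x. lden p s x * \<phi> x \<partial>L) * (\<integral>x. G p x \<partial>et s p) = (\<integral>x. G p x * Mop s p \<phi> x \<partial>et s p)"
      unfolding lden_def Mop_def by (rule FC_integral_mult[OF A \<phi>])
  qed
qed

lemma limit_C_prob: "limit_C X G eta0 M L d0 d p \<in> space (prob_algebra Y)"
proof (cases p)
  case 0 then show ?thesis using max_coupling_prob[OF L_sf d0_density(1,2,3) d0_density(1,2,3), of Fine Coarse] by (simp add: paLL)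
next
  case (Suc q)
  then show ?thesis using max_coupling_prob[OF L_sf lden_density(1,2,3) lden_density(1,2,3), of q Fine q Coarse]
    by (simp add: paLL Phi_C_def lden_def)
qed

lemma limit_C_marg:
  assumes \<phi>: "\<phi> \<in> bm X"
  shows "(\<integral>z. \<phi> (proj s z) \<partial>limit_C X G eta0 M L d0 d p) = (\<integral>x. \<phi> x \<partial>et s p)"
proof (cases p)
  case 0
  have "\<phi> \<in> bm L" using \<phi> bmL by simp
  from max_coupling_marginal[OF L_sf d0_density(1,2,3) d0_density(1,2,3) this, of Fine Coarse s] d0_integral[OF \<phi>, of s] 0
  show ?thesis by (cases s) simp_all
next
  case (Suc q)
  have "\<phi> \<in> bm L" using \<phi> bmL by simp
  from max_coupling_marginal[OF L_sf lden_density(1,2,3) lden_density(1,2,3) this, of q Fine q Coarse s] lden_integral[OF \<phi>, of q s] Suc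
  show ?thesis by (cases s) (simp_all add: Phi_C_def lden_def)
qed

definition step_C :: "nat \<Rightarrow> nat \<Rightarrow> (nat \<Rightarrow> 'a \<times> 'a) \<Rightarrow> ('a \<times> 'a) measure" where
  "step_C N p u = Phi_C L (G p) (\<lambda>s. d s (Suc p)) (\<lambda>s. empirical X N (\<lambda>i. proj s (u i)))"

text \<open>The random density at time \<open>p + 1\<close>. The limiting density in place of a quotient by zero makes it a
  probability density for every configuration, so that all bounds below hold without exception.\<close>

definition den :: "nat \<Rightarrow> nat \<Rightarrow> (nat \<Rightarrow> 'a \<times> 'a) \<Rightarrow> level \<Rightarrow> 'a \<Rightarrow> real" where
  "den N p u s = (if 0 < Gavg N p s u
     then FC (G p) (d s (Suc p)) (empirical X N (\<lambda>i. proj s (u i))) else lden p s)"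

lemma step_C_den: "(\<And>s. 0 < Gavg N p s u) \<Longrightarrow> step_C N p u = max_coupling L (den N p u Fine) (den N p u Coarse)"
  by (simp add: step_C_def Phi_C_def den_def del: proj.simps)

lemma den_formula:
  assumes u: "u \<in> space (conf N Y)" and ps: "0 < Gavg N p s u" and x: "x \<in> space X"
  shows "den N p u s x = avg N (\<lambda>z. G p (proj s z) * d s (Suc p) (proj s z) x) u / Gavg N p s u"
  using ps by (simp add: den_def FC_def emp_int[OF u G_bm] emp_int[OF u Gd_bm[OF x]] del: proj.simps)

lemma den_density:
  assumes N: "N \<ge> 1" and u: "u \<in> space (conf N Y)"
  shows "integrable L (den N p u s)" "\<And>x. x \<in> space L \<Longrightarrow> 0 \<le> den N p u s x" "(\<integral>x. den N p u s x \<partial>L) = 1"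
    and den_integral: "0 < Gavg N p s u \<Longrightarrow> \<phi> \<in> bm X \<Longrightarrow>
      (\<integral>x. den N p u s x * \<phi> x \<partial>L) * Gavg N p s u = avg N (\<lambda>z. G p (proj s z) * (\<integral>y. \<phi> y \<partial>M s (Suc p) (proj s z))) u"
proof -
  let ?e = "empirical X N (\<lambda>i. proj s (u i))"
  have D: "0 < (\<integral>x. G p x \<partial>?e)" if "0 < Gavg N p s u" using that by (simp add: emp_int[OF u G_bm])
  note A = L_sf LX emp_prob[OF N u] M_k d_meas d_nonneg M_density G_bm G_nonneg D
  let ?g = "0 < Gavg N p s u"
  have e: "den N p u s = (if ?g then FC (G p) (d s (Suc p)) ?e else lden p s)" by (rule ext) (simp add: den_def del: proj.simps)
  have 1: "integrable L (FC (G p) (d s (Suc p)) ?e)" if ?g by (rule FC_integrable[OF A]) (simp_all add: that del: proj.simps)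
  have 2: "0 \<le> FC (G p) (d s (Suc p)) ?e x" if ?g "x \<in> space L" for x by (rule FC_nonneg[OF A]) (simp_all add: that del: proj.simps)
  have 3: "(\<integral>x. FC (G p) (d s (Suc p)) ?e x \<partial>L) = 1" if ?g by (rule FC_total[OF A]) (simp_all add: that del: proj.simps)
  show "integrable L (den N p u s)" using lden_density(1) 1 by (simp add: e del: proj.simps)
  show "0 \<le> den N p u s x" if "x \<in> space L" for x using lden_density(2)[OF that] 2[OF _ that] by (simp add: e del: proj.simps)
  show "(\<integral>x. den N p u s x \<partial>L) = 1" using lden_density(3) 3 by (simp add: e del: proj.simps)
  assume ps: ?g and \<phi>: "\<phi> \<in> bm X"
  have "(\<integral>x. FC (G p) (d s (Suc p)) ?e x * \<phi> x \<partial>L) * (\<integral>x. G p x \<partial>?e) = (\<integral>x. G p x * Mop s p \<phi> x \<partial>?e)"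
    unfolding Mop_def by (rule FC_integral_mult[OF A]) (simp_all add: ps \<phi> del: proj.simps)
  then have "(\<integral>x. den N p u s x * \<phi> x \<partial>L) * (\<integral>x. G p x \<partial>?e) = (\<integral>x. G p x * Mop s p \<phi> x \<partial>?e)"
    using ps by (simp add: e del: proj.simps)
  then show "(\<integral>x. den N p u s x * \<phi> x \<partial>L) * Gavg N p s u = avg N (\<lambda>z. G p (proj s z) * (\<integral>y. \<phi> y \<partial>M s (Suc p) (proj s z))) u"
    unfolding emp_int[OF u G_bm] emp_int[OF u bm_mult[OF G_bm Mop_bm[OF \<phi>]]] unfolding Mop_def .
qed

lemma den_joint:
  assumes P: "sets P = sets (conf N Y)"
  shows "(\<lambda>q. den N p (fst q) s (snd q)) \<in> borel_measurable (P \<Otimes>\<^sub>M L)"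
proof -
  have eq: "borel_measurable (P \<Otimes>\<^sub>M L) = (borel_measurable (conf N Y \<Otimes>\<^sub>M X) :: ((nat \<Rightarrow> 'a \<times> 'a) \<times> 'a \<Rightarrow> real) set)"
    by (intro measurable_cong_sets sets_pair_measure_cong P LX refl)
  let ?D = "\<lambda>u. Gavg N p s u"
  let ?A = "\<lambda>q. avg N (\<lambda>z. G p (proj s z) * d s (Suc p) (proj s z) (snd q)) (fst q)"
  have D: "(\<lambda>q. ?D (fst q)) \<in> borel_measurable (conf N Y \<Otimes>\<^sub>M X)"
    by (rule measurable_compose[OF measurable_fst bm_measurable[OF avg_bm[OF bm_proj[OF G_bm]]]])
  have A: "?A \<in> borel_measurable (conf N Y \<Otimes>\<^sub>M X)"
  proof -
    have "(\<lambda>q. G p (proj s (fst q i)) * d s (Suc p) (proj s (fst q i)) (snd q)) \<in> borel_measurable (conf N Y \<Otimes>\<^sub>M X)"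
      if i: "i \<in> {1..N}" for i
    proof (rule borel_measurable_times)
      have m: "(\<lambda>q. proj s (fst q i)) \<in> conf N Y \<Otimes>\<^sub>M X \<rightarrow>\<^sub>M X"
        by (rule measurable_compose[OF measurable_compose[OF measurable_fst conf_component[OF i]] proj_measurable])
      show "(\<lambda>q. G p (proj s (fst q i))) \<in> borel_measurable (conf N Y \<Otimes>\<^sub>M X)" by (rule measurable_compose[OF m G_measurable])
      show "(\<lambda>q. d s (Suc p) (proj s (fst q i)) (snd q)) \<in> borel_measurable (conf N Y \<Otimes>\<^sub>M X)"
        using measurable_compose[OF measurable_Pair[OF m measurable_snd] d_meas] by simp
    qed
    then show ?thesis unfolding avg_def by (intro borel_measurable_divide borel_measurable_sum borel_measurable_const)
  qed
  have l: "(\<lambda>q. lden p s (snd q)) \<in> borel_measurable (conf N Y \<Otimes>\<^sub>M X)"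
  proof (rule measurable_compose[OF measurable_snd])
    show "lden p s \<in> borel_measurable X"
      using borel_measurable_integrable[OF lden_density(1)] measurable_cong_sets[OF LX refl] by blast
  qed
  note D[measurable] A[measurable] l[measurable]
  have m: "(\<lambda>q. if 0 < ?D (fst q) then ?A q / ?D (fst q) else lden p s (snd q)) \<in> borel_measurable (conf N Y \<Otimes>\<^sub>M X)"
    by measurable
  have e: "den N p (fst q) s (snd q) = (if 0 < ?D (fst q) then ?A q / ?D (fst q) else lden p s (snd q))" if "q \<in> space (conf N Y \<Otimes>\<^sub>M X)" for q
  proof (cases "0 < ?D (fst q)")
    case True
    then show ?thesis using den_formula[OF _ True, of "snd q"] that by (simp add: space_pair_measure mem_Times_iff del: proj.simps)
  next
    case False then show ?thesis by (simp add: den_def del: proj.simps)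
  qed
  show ?thesis unfolding eq by (subst measurable_cong[OF e]) (assumption, rule m)
qed

end

context algorithm_C
begin

lemma min_den_joint:
  assumes P: "sets P = sets (conf N Y)"
  shows "(\<lambda>q. min (den N p (fst q) Fine (snd q)) (den N p (fst q) Coarse (snd q))) \<in> borel_measurable (P \<Otimes>\<^sub>M L)"
  by (intro borel_measurable_min den_joint P)

lemma L_integral_measurable:
  fixes h :: "_ \<Rightarrow> _ \<Rightarrow> real" shows
  "(\<lambda>q. h (fst q) (snd q)) \<in> borel_measurable (P \<Otimes>\<^sub>M L) \<Longrightarrow> (\<lambda>u. \<integral>x. h u x \<partial>L) \<in> borel_measurable P"
  using L.borel_measurable_lebesgue_integral[of h P] by (simp add: case_prod_beta')

sublocale LL: pair_sigma_finite L L ..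

lemma LL_integral_measurable:
  fixes h :: "_ \<Rightarrow> _ \<Rightarrow> real" shows
  "(\<lambda>q. h (fst q) (snd q)) \<in> borel_measurable (P \<Otimes>\<^sub>M (L \<Otimes>\<^sub>M L)) \<Longrightarrow> (\<lambda>u. \<integral>x. h u x \<partial>(L \<Otimes>\<^sub>M L)) \<in> borel_measurable P"
  using LL.P.borel_measurable_lebesgue_integral[of h P] by (simp add: case_prod_beta')

lemma step_C_measurable:
  assumes N: "N \<ge> 1" and S: "S \<in> sets Y"
  shows "\<exists>R\<in>borel_measurable (conf N Y). \<forall>u\<in>space (conf N Y). (\<forall>s. 0 < Gavg N p s u) \<longrightarrow> measure (step_C N p u) S = R u"
proof (intro bexI ballI impI)
  let ?i = "indicator S :: 'a \<times> 'a \<Rightarrow> real"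
  let ?m = "\<lambda>u x. min (den N p u Fine x) (den N p u Coarse x)"
  let ?c = "\<lambda>u. \<integral>x. ?m u x \<partial>L"
  let ?V = "\<lambda>u. \<integral>q. (den N p u Fine (fst q) - ?m u (fst q)) * (den N p u Coarse (snd q) - ?m u (snd q)) * ?i q \<partial>(L \<Otimes>\<^sub>M L)"
  let ?W = "\<lambda>u. \<integral>x. ?m u x * ?i (x, x) \<partial>L"
  let ?R = "\<lambda>u. ?W u + (if ?c u = 1 then 0 else ?V u / (1 - ?c u))"
  note j = den_joint[OF refl, of N] min_den_joint[OF refl, of N p]
  have iS: "?i \<in> borel_measurable (L \<Otimes>\<^sub>M L)" using bm_measurable[OF bm_indicator[OF S]] measurable_cong_sets[OF LL refl] by blast
  have c: "?c \<in> borel_measurable (conf N Y)" by (rule L_integral_measurable[OF j(2)])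
  have W: "?W \<in> borel_measurable (conf N Y)"
  proof (rule L_integral_measurable, rule borel_measurable_times[OF j(2)])
    show "(\<lambda>q. ?i (snd q, snd q)) \<in> borel_measurable (conf N Y \<Otimes>\<^sub>M L)"
      by (rule measurable_compose[OF measurable_Pair[OF measurable_snd measurable_snd] iS])
  qed
  have V: "?V \<in> borel_measurable (conf N Y)"
  proof (rule LL_integral_measurable, intro borel_measurable_times borel_measurable_diff)
    have f: "(\<lambda>q. (fst q, fst (snd q))) \<in> conf N Y \<Otimes>\<^sub>M (L \<Otimes>\<^sub>M L) \<rightarrow>\<^sub>M conf N Y \<Otimes>\<^sub>M L"
      and g: "(\<lambda>q. (fst q, snd (snd q))) \<in> conf N Y \<Otimes>\<^sub>M (L \<Otimes>\<^sub>M L) \<rightarrow>\<^sub>M conf N Y \<Otimes>\<^sub>M L"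
      by measurable
    show "(\<lambda>q. den N p (fst q) Fine (fst (snd q))) \<in> borel_measurable (conf N Y \<Otimes>\<^sub>M (L \<Otimes>\<^sub>M L))"
      using measurable_compose[OF f j(1)] by simp
    show "(\<lambda>q. ?m (fst q) (fst (snd q))) \<in> borel_measurable (conf N Y \<Otimes>\<^sub>M (L \<Otimes>\<^sub>M L))"
      using measurable_compose[OF f j(2)] by simp
    show "(\<lambda>q. den N p (fst q) Coarse (snd (snd q))) \<in> borel_measurable (conf N Y \<Otimes>\<^sub>M (L \<Otimes>\<^sub>M L))"
      using measurable_compose[OF g j(1)] by simp
    show "(\<lambda>q. ?m (fst q) (snd (snd q))) \<in> borel_measurable (conf N Y \<Otimes>\<^sub>M (L \<Otimes>\<^sub>M L))"
      using measurable_compose[OF g j(2)] by simp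
    show "(\<lambda>q. ?i (snd q)) \<in> borel_measurable (conf N Y \<Otimes>\<^sub>M (L \<Otimes>\<^sub>M L))"
      by (rule measurable_compose[OF measurable_snd iS])
  qed
  note c[measurable] W[measurable] V[measurable]
  show "?R \<in> borel_measurable (conf N Y)" by measurable
  fix u assume u: "u \<in> space (conf N Y)" and ps: "\<forall>s. 0 < Gavg N p s u"
  have mc: "step_C N p u = max_coupling L (den N p u Fine) (den N p u Coarse)" using ps by (intro step_C_den) blast
  note dd = den_density(1,2,3)[OF N u]
  have p: "step_C N p u \<in> space (prob_algebra Y)" using max_coupling_prob[OF L_sf dd dd, of p Fine p Coarse] unfolding mc paLL .
  have "(\<integral>z. ?i z \<partial>step_C N p u) = measure (step_C N p u) S"
    using prob_algebraD(2,3)[OF p] S sets.sets_into_space[OF S] by (simp add: Int_absorb2)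
  moreover have "?i \<in> bm (L \<Otimes>\<^sub>M L)" using bm_indicator[OF S] bmLL by blast
  ultimately show "measure (step_C N p u) S = ?R u"
    using max_coupling_integral[OF L_sf dd dd, of ?i p Fine p Coarse] unfolding mc by simp
qed

sublocale particle_algorithm X G eta0 M etac0 Mc step_C "limit_C X G eta0 M L d0 d" \<Omega> U
proof unfold_locales
  show "limit_C X G eta0 M L d0 d p \<in> space (prob_algebra Y)" for p by (rule limit_C_prob)
  show "\<phi> \<in> bm X \<Longrightarrow> (\<integral>z. \<phi> (proj s z) \<partial>limit_C X G eta0 M L d0 d p) = (\<integral>x. \<phi> x \<partial>et s p)" for \<phi> s p
    by (rule limit_C_marg)
  show "particle_system Y (limit_C X G eta0 M L d0 d 0) (step_C N) (\<Omega> N) N (U N)" if "N \<ge> 1" for N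
    using particles[OF that] by (simp add: particles_C_def step_C_def[abs_def])
  show "positive_weights X G (\<Omega> N) N (U N)" if "N \<ge> 1" for N using that by (rule weights)
  show "step_C N p u = step_C N p v" if "\<And>i. i \<in> {1..N} \<Longrightarrow> u i = v i" for N p u v
  proof -
    have "empirical X N (\<lambda>i. proj s (u i)) = empirical X N (\<lambda>i. proj s (v i))" for s
      using that by (intro empirical_cong) auto
    then show ?thesis by (simp add: step_C_def del: proj.simps)
  qed
  show "step_C N p u \<in> space (prob_algebra Y)" if "N \<ge> 1" "u \<in> space (conf N Y)" "\<And>s. 0 < Gavg N p s u" for N p u
    using max_coupling_prob[OF L_sf den_density(1,2,3)[OF that(1,2)] den_density(1,2,3)[OF that(1,2)], of p Fine p Coarse]
    unfolding step_C_den[OF that(3)] paLL .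
  show "(\<integral>z. \<phi> (proj s z) \<partial>step_C N p u) * Gavg N p s u
        = avg N (\<lambda>z. G p (proj s z) * (\<integral>y. \<phi> y \<partial>M s (Suc p) (proj s z))) u"
    if "N \<ge> 1" "u \<in> space (conf N Y)" "\<And>s. 0 < Gavg N p s u" "\<phi> \<in> bm X" for N p u \<phi> s
  proof -
    note dd = den_density(1,2,3)[OF that(1,2)]
    have "\<phi> \<in> bm L" using that(4) bmL by simp
    from max_coupling_marginal[OF L_sf dd dd this, of p Fine p Coarse s]
    have "(\<integral>z. \<phi> (proj s z) \<partial>step_C N p u) = (\<integral>x. den N p u s x * \<phi> x \<partial>L)"
      unfolding step_C_den[OF that(3)] by (cases s) simp_all
    then show ?thesis using den_integral[OF that(1,2,3,4)] by (simp only:)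
  qed
  show "\<exists>R\<in>borel_measurable (conf N Y). \<forall>u\<in>space (conf N Y). (\<forall>s. 0 < Gavg N p s u) \<longrightarrow> measure (step_C N p u) S = R u"
    if "N \<ge> 1" "S \<in> sets Y" for N p S
    using that by (rule step_C_measurable)
qed

lemma plaw_sets: "N \<ge> 1 \<Longrightarrow> sets (plaw N p) = sets (conf N Y)"
  by (rule prob_algebraD(2)[OF pi_prob])

definition ldist :: "nat \<Rightarrow> level \<Rightarrow> nat \<Rightarrow> (nat \<Rightarrow> 'a \<times> 'a) \<Rightarrow> real" where
  "ldist p s N u = (\<integral>x. \<bar>den N p u s x - lden p s x\<bar> \<partial>L)"

text \<open>Scheffe's lemma: for probability densities, the distance in \<open>L\<^sup>1\<close> is twice the integral of the positive
  part of limit minus approximation, and this part is dominated by the limit.\<close>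

definition shortfall :: "nat \<Rightarrow> level \<Rightarrow> nat \<Rightarrow> (nat \<Rightarrow> 'a \<times> 'a) \<Rightarrow> 'a \<Rightarrow> real" where
  "shortfall p s N u x = max 0 (lden p s x - den N p u s x)"

lemma shortfall_joint:
  assumes P: "sets P = sets (conf N Y)"
  shows "(\<lambda>q. shortfall p s N (fst q) (snd q)) \<in> borel_measurable (P \<Otimes>\<^sub>M L)"
  unfolding shortfall_def
  by (intro borel_measurable_max borel_measurable_const borel_measurable_diff den_joint[OF P]
    measurable_compose[OF measurable_snd borel_measurable_integrable[OF lden_density(1)]])

lemma shortfall_bounds:
  assumes "N \<ge> 1" "u \<in> space (conf N Y)" "x \<in> space L"
  shows "0 \<le> shortfall p s N u x" "shortfall p s N u x \<le> lden p s x"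
  using den_density(2)[OF assms, of p s] lden_density(2)[OF assms(3), of p s] by (auto simp: shortfall_def)

lemma shortfall_integrable:
  assumes "N \<ge> 1" "u \<in> space (conf N Y)" shows "integrable L (shortfall p s N u)"
  unfolding shortfall_def[abs_def] using den_density(1)[OF assms] lden_density(1) by (intro integrable_max integrable_zero Bochner_Integration.integrable_diff)

lemma ldist_shortfall:
  assumes N: "N \<ge> 1" and u: "u \<in> space (conf N Y)"
  shows "ldist p s N u = 2 * (\<integral>x. shortfall p s N u x \<partial>L)"
proof -
  note i = den_density(1)[OF N u, of p s] lden_density(1)[of p s] shortfall_integrable[OF N u, of p s]
  have "\<bar>den N p u s x - lden p s x\<bar> = 2 * shortfall p s N u x + (den N p u s x - lden p s x)" for x
    by (simp add: shortfall_def max_def abs_if)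
  then have "ldist p s N u = (\<integral>x. 2 * shortfall p s N u x + (den N p u s x - lden p s x) \<partial>L)" by (simp add: ldist_def)
  also have "\<dots> = 2 * (\<integral>x. shortfall p s N u x \<partial>L)" using i den_density(3)[OF N u, of p s] lden_density(3)[of p s] by simp
  finally show ?thesis .
qed

text \<open>With \<open>f\<close> the limiting density at \<open>x\<close>, \<open>aN / DN\<close> the random one and \<open>r = f - aN / DN \<le> f\<close>, the identity
  \<open>r D = r (D - DN) + f (DN - D) - (aN - a)\<close> bounds \<open>r\<close> by the errors of two averages over particles.\<close>

lemma shortfall_L1:
  assumes x: "x \<in> space L"
  shows "L1_conv (\<lambda>N. plaw N p) (\<lambda>N u. shortfall p s N u x) 0"
proof -
  have xX: "x \<in> space X" using x sL by simp
  let ?a = "\<integral>y. G p y * d s (Suc p) y x \<partial>et s p" and ?D = "\<integral>y. G p y \<partial>et s p"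
  let ?f = "lden p s x"
  let ?aN = "\<lambda>N. avg N (\<lambda>z. G p (proj s z) * d s (Suc p) (proj s z) x)" and ?DN = "\<lambda>N. Gavg N p s"
  have D: "0 < ?D" by (rule eta_G_pos)
  have f: "?f * ?D = ?a" using D by (simp add: lden_def FC_def)
  have f0: "0 \<le> ?f" by (rule lden_density(2)[OF x])
  have H: "L1_conv (\<lambda>N. plaw N p) (\<lambda>N u. 2 * ?f / ?D * \<bar>?DN N u - ?D\<bar> + 1 / ?D * \<bar>?aN N u - ?a\<bar>) 0"
    by (intro law.L1_conv_abs_cmult0_add avg_L1 G_bm Gd_bm xX)
  show ?thesis
  proof (rule law.L1_conv_dominated[OF _ _ H, where B="?f"])
    fix N :: nat assume N: "N \<ge> 1"
    show "(\<lambda>u. shortfall p s N u x) \<in> borel_measurable (plaw N p)"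
      using measurable_compose[OF measurable_Pair2'[OF x] shortfall_joint[OF plaw_sets[OF N]]] by simp
    show "\<bar>shortfall p s N u x\<bar> \<le> ?f" if "u \<in> space (plaw N p)" for u
      using shortfall_bounds[OF N _ x, of u p s] that pi_space[OF N] by simp
    show "AE u in plaw N p. \<bar>shortfall p s N u x - 0\<bar> \<le> 2 * ?f / ?D * \<bar>?DN N u - ?D\<bar> + 1 / ?D * \<bar>?aN N u - ?a\<bar>"
      using AE_ker[OF N, of p]
    proof eventually_elim
      case (elim u)
      then have u: "u \<in> space (conf N Y)" and ps: "0 < ?DN N u" by blast+
      let ?r = "shortfall p s N u x"
      have den: "den N p u s x * ?DN N u = ?aN N u" using den_formula[OF u ps xX] ps by simp
      have r: "0 \<le> ?r" "?r \<le> ?f" by (rule shortfall_bounds[OF N u x])+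
      have "?r * ?D \<le> 2 * ?f * \<bar>?DN N u - ?D\<bar> + \<bar>?aN N u - ?a\<bar>"
      proof (cases "?r = 0")
        case False
        then have "?r = ?f - den N p u s x" by (auto simp: shortfall_def max_def split: if_splits)
        then have "?r * ?DN N u = ?f * ?DN N u - ?aN N u" using den by (simp only: left_diff_distrib)
        then have "?r * ?D = ?r * (?D - ?DN N u) + (?f * (?DN N u - ?D) - (?aN N u - ?a))"
          using f by (simp only: right_diff_distrib)
        moreover have "?r * (?D - ?DN N u) \<le> ?r * \<bar>?DN N u - ?D\<bar>" using r by (intro mult_left_mono) auto
        moreover have "?r * \<bar>?DN N u - ?D\<bar> \<le> ?f * \<bar>?DN N u - ?D\<bar>" using r by (intro mult_right_mono) auto
        moreover have "?f * (?DN N u - ?D) \<le> ?f * \<bar>?DN N u - ?D\<bar>" using f0 by (intro mult_left_mono) auto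
        ultimately show ?thesis by linarith
      qed (use f0 in auto)
      then have "?r \<le> (2 * ?f * \<bar>?DN N u - ?D\<bar> + \<bar>?aN N u - ?a\<bar>) / ?D" using D by (simp only: pos_le_divide_eq)
      then show ?case using r by (simp add: add_divide_distrib)
    qed
  qed
qed

lemma ldist_measurable: "N \<ge> 1 \<Longrightarrow> ldist p s N \<in> borel_measurable (plaw N p)"
  unfolding ldist_def[abs_def]
  by (rule L_integral_measurable)
     (intro borel_measurable_abs borel_measurable_diff den_joint plaw_sets measurable_compose[OF measurable_snd borel_measurable_integrable[OF lden_density(1)]])

lemma ldist_bounds:
  assumes N: "N \<ge> 1" and u: "u \<in> space (conf N Y)"
  shows "0 \<le> ldist p s N u" "ldist p s N u \<le> 2"
proof -
  show "0 \<le> ldist p s N u" by (simp add: ldist_def)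
  have "(\<integral>x. shortfall p s N u x \<partial>L) \<le> (\<integral>x. lden p s x \<partial>L)"
    by (rule integral_mono[OF shortfall_integrable[OF N u] lden_density(1) shortfall_bounds(2)[OF N u]])
  then show "ldist p s N u \<le> 2" using ldist_shortfall[OF N u] lden_density(3) by simp
qed

text \<open>Exchange the expectation with the integral over the state space and use dominated convergence there.\<close>

lemma ldist_L1: "L1_conv (\<lambda>N. plaw N p) (ldist p s) 0"
proof (rule law.L1_convI[where B=2 and e="\<lambda>N. 2 * (\<integral>x. (\<integral>u. shortfall p s N u x \<partial>plaw N p) \<partial>L)"])
  fix N :: nat assume N: "N \<ge> 1"
  have su: "u \<in> space (plaw N p) \<Longrightarrow> u \<in> space (conf N Y)" for u using pi_space[OF N] by simp
  show "ldist p s N \<in> borel_measurable (plaw N p)" by (rule ldist_measurable[OF N])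
  show "\<bar>ldist p s N u\<bar> \<le> 2" if "u \<in> space (plaw N p)" for u using ldist_bounds[OF N su[OF that]] by simp
  interpret PN: prob_space "plaw N p" using law.prob[OF N] .
  interpret Q: pair_sigma_finite "plaw N p" L ..
  have "integrable (plaw N p \<Otimes>\<^sub>M L) (\<lambda>(u, x). shortfall p s N u x)"
  proof (rule Bochner_Integration.integrable_bound)
    show "integrable (plaw N p \<Otimes>\<^sub>M L) (\<lambda>(u, x). 1 * lden p s x)"
      using tensor_integrable[OF PN.sigma_finite_measure_axioms L_sf, of "\<lambda>_. 1" "lden p s"] lden_density(1) by (simp add: split_beta')
    show "(\<lambda>(u, x). shortfall p s N u x) \<in> borel_measurable (plaw N p \<Otimes>\<^sub>M L)"
      using shortfall_joint[OF plaw_sets[OF N]] by (simp add: split_beta')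
    show "AE q in plaw N p \<Otimes>\<^sub>M L. norm (case q of (u, x) \<Rightarrow> shortfall p s N u x) \<le> norm (case q of (u, x) \<Rightarrow> 1 * lden p s x)"
      using shortfall_bounds[OF N su] lden_density(2) by (intro AE_I2) (auto simp: space_pair_measure)
  qed
  from Q.Fubini_integral[OF this]
  have F: "(\<integral>x. (\<integral>u. shortfall p s N u x \<partial>plaw N p) \<partial>L) = (\<integral>u. (\<integral>x. shortfall p s N u x \<partial>L) \<partial>plaw N p)" .
  have "(\<integral>u. \<bar>ldist p s N u - 0\<bar> \<partial>plaw N p) = (\<integral>u. 2 * (\<integral>x. shortfall p s N u x \<partial>L) \<partial>plaw N p)"
    using ldist_bounds(1)[OF N su] ldist_shortfall[OF N su] by (intro Bochner_Integration.integral_cong refl) simp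
  then show "(\<integral>u. \<bar>ldist p s N u - 0\<bar> \<partial>plaw N p) \<le> 2 * (\<integral>x. (\<integral>u. shortfall p s N u x \<partial>plaw N p) \<partial>L)"
    unfolding F by simp
next
  (* The majorant is valid from N = 1 on, hence the shift. *)
  have "(\<lambda>N. \<integral>x. (\<integral>u. shortfall p s (Suc N) u x \<partial>plaw (Suc N) p) \<partial>L) \<longlonglongrightarrow> (\<integral>x. 0 \<partial>L)"
  proof (rule integral_dominated_convergence[where w="lden p s"])
    show "integrable L (lden p s)" by (rule lden_density(1))
    show "AE x in L. (\<lambda>N. \<integral>u. shortfall p s (Suc N) u x \<partial>plaw (Suc N) p) \<longlonglongrightarrow> 0"
      using LIMSEQ_Suc[OF law.L1_conv_expectation[OF shortfall_L1]] by (intro AE_I2)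
    fix N
    have N: "Suc N \<ge> 1" by simp
    interpret PN: prob_space "plaw (Suc N) p" using law.prob[OF N] .
    show "(\<lambda>x. \<integral>u. shortfall p s (Suc N) u x \<partial>plaw (Suc N) p) \<in> borel_measurable L"
    proof (rule PN.borel_measurable_lebesgue_integral)
      show "(\<lambda>(x, u). shortfall p s (Suc N) u x) \<in> borel_measurable (L \<Otimes>\<^sub>M plaw (Suc N) p)"
        using measurable_compose[OF measurable_Pair[OF measurable_snd measurable_fst] shortfall_joint[OF plaw_sets[OF N]]] by (simp add: split_beta')
    qed
    show "AE x in L. norm (\<integral>u. shortfall p s (Suc N) u x \<partial>plaw (Suc N) p) \<le> lden p s x"
    proof (rule AE_I2)
      fix x assume x: "x \<in> space L"
      have "\<bar>\<integral>u. shortfall p s (Suc N) u x \<partial>plaw (Suc N) p\<bar> \<le> lden p s x"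
      proof (rule PN.abs_integral_le)
        fix u assume "u \<in> space (plaw (Suc N) p)"
        then have u: "u \<in> space (conf (Suc N) Y)" using pi_space[OF N] by simp
        show "\<bar>shortfall p s (Suc N) u x\<bar> \<le> lden p s x" using shortfall_bounds[OF N u x, of p s] by simp
      qed
      then show "norm (\<integral>u. shortfall p s (Suc N) u x \<partial>plaw (Suc N) p) \<le> lden p s x" by simp
    qed
  qed auto
  from LIMSEQ_imp_Suc[OF this[unfolded Bochner_Integration.integral_zero]]
  have "(\<lambda>N. \<integral>x. (\<integral>u. shortfall p s N u x \<partial>plaw N p) \<partial>L) \<longlonglongrightarrow> 0" .
  from tendsto_mult_right_zero[OF this, of 2]
  show "(\<lambda>N. 2 * (\<integral>x. (\<integral>u. shortfall p s N u x \<partial>plaw N p) \<partial>L)) \<longlonglongrightarrow> 0" .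
qed

text \<open>Functionals of the two densities that are Lipschitz at each point inherit the convergence.\<close>

lemma functional_L1:
  assumes joint: "\<And>N. N \<ge> 1 \<Longrightarrow> (\<lambda>q. h N (fst q) (snd q)) \<in> borel_measurable (plaw N p \<Otimes>\<^sub>M L)"
    and hi: "\<And>N u. N \<ge> 1 \<Longrightarrow> u \<in> space (conf N Y) \<Longrightarrow> integrable L (h N u)" and li: "integrable L l"
    and k: "0 \<le> k" and le: "\<And>N u x. N \<ge> 1 \<Longrightarrow> u \<in> space (conf N Y) \<Longrightarrow> x \<in> space L \<Longrightarrow>
      \<bar>h N u x - l x\<bar> \<le> k * (\<bar>den N p u Fine x - lden p Fine x\<bar> + \<bar>den N p u Coarse x - lden p Coarse x\<bar>)"
    and b: "b \<in> bm X"
  shows "L1_conv (\<lambda>N. plaw N p) (\<lambda>N u. \<integral>x. h N u x * b x \<partial>L) (\<integral>x. l x * b x \<partial>L)"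
proof -
  obtain B where B: "0 \<le> B" "\<And>x. x \<in> space X \<Longrightarrow> \<bar>b x\<bar> \<le> B" using bmE[OF b] by blast
  have bL: "b \<in> bm L" using b bmL by simp
  let ?H = "\<lambda>N u. (B * k) * (ldist p Fine N u + ldist p Coarse N u)"
  have H: "L1_conv (\<lambda>N. plaw N p) ?H 0"
    using law.L1_conv_cmult[OF law.L1_conv_add[OF ldist_L1[of p Fine] ldist_L1[of p Coarse]], of "B * k"] by simp
  have li': "integrable L (\<lambda>x. l x * b x)" by (rule integrable_mult_bm[OF li bL])
  have main: "\<bar>(\<integral>x. h N u x * b x \<partial>L) - (\<integral>x. l x * b x \<partial>L)\<bar> \<le> ?H N u" if N: "N \<ge> 1" and u: "u \<in> space (conf N Y)" for N u
  proof -
    let ?e = "\<lambda>s x. \<bar>den N p u s x - lden p s x\<bar>"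
    have ei: "integrable L (?e s)" for s using den_density(1)[OF N u] lden_density(1) by (intro integrable_abs Bochner_Integration.integrable_diff)
    have hi': "integrable L (\<lambda>x. h N u x * b x)" by (rule integrable_mult_bm[OF hi[OF N u] bL])
    have "\<bar>(\<integral>x. h N u x * b x \<partial>L) - (\<integral>x. l x * b x \<partial>L)\<bar> = \<bar>\<integral>x. h N u x * b x - l x * b x \<partial>L\<bar>" using hi' li' by simp
    also have "\<dots> \<le> (\<integral>x. \<bar>h N u x * b x - l x * b x\<bar> \<partial>L)" by (rule integral_abs_bound)
    also have "\<dots> \<le> (\<integral>x. (B * k) * (?e Fine x + ?e Coarse x) \<partial>L)"
    proof (rule integral_mono)
      show "integrable L (\<lambda>x. \<bar>h N u x * b x - l x * b x\<bar>)" using hi' li' by (intro integrable_abs Bochner_Integration.integrable_diff)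
      show "integrable L (\<lambda>x. (B * k) * (?e Fine x + ?e Coarse x))" using ei by (intro integrable_mult_right Bochner_Integration.integrable_add)
      fix x assume x: "x \<in> space L"
      have "\<bar>h N u x * b x - l x * b x\<bar> = \<bar>b x\<bar> * \<bar>h N u x - l x\<bar>" by (metis abs_mult left_diff_distrib mult.commute)
      also have "\<dots> \<le> B * (k * (?e Fine x + ?e Coarse x))" using B x sL le[OF N u x] by (intro mult_mono) auto
      finally show "\<bar>h N u x * b x - l x * b x\<bar> \<le> (B * k) * (?e Fine x + ?e Coarse x)" by (simp only: mult.assoc)
    qed
    also have "\<dots> = ?H N u" using ei by (simp add: ldist_def)
    finally show ?thesis .
  qed
  show ?thesis
  proof (rule law.L1_conv_dominated[OF _ _ H, where B="\<bar>\<integral>x. l x * b x \<partial>L\<bar> + (B * k) * 4"])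
    fix N :: nat assume N: "N \<ge> 1"
    show "(\<lambda>u. \<integral>x. h N u x * b x \<partial>L) \<in> borel_measurable (plaw N p)"
      by (rule L_integral_measurable) (intro borel_measurable_times joint N measurable_compose[OF measurable_snd bm_measurable[OF bL]])
    show "\<bar>\<integral>x. h N u x * b x \<partial>L\<bar> \<le> \<bar>\<integral>x. l x * b x \<partial>L\<bar> + (B * k) * 4" if "u \<in> space (plaw N p)" for u
    proof -
      have u: "u \<in> space (conf N Y)" using that pi_space[OF N] by simp
      have "?H N u \<le> (B * k) * 4"
        using ldist_bounds(2)[OF N u, of p Fine] ldist_bounds(2)[OF N u, of p Coarse] B(1) k by (intro mult_left_mono) auto
      then show ?thesis using main[OF N u] by linarith
    qed
    show "AE u in plaw N p. \<bar>(\<integral>x. h N u x * b x \<partial>L) - (\<integral>x. l x * b x \<partial>L)\<bar> \<le> ?H N u"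
      using main[OF N] pi_space[OF N] by (intro AE_I2) simp
  qed
qed

abbreviation "dmin N p u x \<equiv> min (den N p u Fine x) (den N p u Coarse x)"
abbreviation "ldmin p x \<equiv> min (lden p Fine x) (lden p Coarse x)"

lemma dmin_L1:
  assumes b: "b \<in> bm X"
  shows "L1_conv (\<lambda>N. plaw N p) (\<lambda>N u. \<integral>x. dmin N p u x * b x \<partial>L) (\<integral>x. ldmin p x * b x \<partial>L)"
proof (rule functional_L1[where k=1, OF _ _ _ _ _ b])
  fix N :: nat assume N: "N \<ge> 1"
  show "(\<lambda>q. dmin N p (fst q) (snd q)) \<in> borel_measurable (plaw N p \<Otimes>\<^sub>M L)" by (rule min_den_joint[OF plaw_sets[OF N]])
  fix u assume u: "u \<in> space (conf N Y)"
  show "integrable L (dmin N p u)" by (intro integrable_min den_density(1)[OF N u])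
  show "\<bar>dmin N p u x - ldmin p x\<bar> \<le> 1 * (\<bar>den N p u Fine x - lden p Fine x\<bar> + \<bar>den N p u Coarse x - lden p Coarse x\<bar>)" for x
    by (auto simp: min_def)
qed (auto intro!: integrable_min lden_density(1))

lemma dres_L1:
  assumes b: "b \<in> bm X"
  shows "L1_conv (\<lambda>N. plaw N p) (\<lambda>N u. \<integral>x. (den N p u s x - dmin N p u x) * b x \<partial>L) (\<integral>x. (lden p s x - ldmin p x) * b x \<partial>L)"
proof (rule functional_L1[where k=2, OF _ _ _ _ _ b])
  fix N :: nat assume N: "N \<ge> 1"
  show "(\<lambda>q. den N p (fst q) s (snd q) - dmin N p (fst q) (snd q)) \<in> borel_measurable (plaw N p \<Otimes>\<^sub>M L)"
    by (rule borel_measurable_diff[OF den_joint[OF plaw_sets[OF N]] min_den_joint[OF plaw_sets[OF N]]])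
  fix u assume u: "u \<in> space (conf N Y)"
  show "integrable L (\<lambda>x. den N p u s x - dmin N p u x)" by (intro Bochner_Integration.integrable_diff integrable_min den_density(1)[OF N u])
  show "\<bar>den N p u s x - dmin N p u x - (lden p s x - ldmin p x)\<bar> \<le> 2 * (\<bar>den N p u Fine x - lden p Fine x\<bar> + \<bar>den N p u Coarse x - lden p Coarse x\<bar>)" for x
  proof -
    let ?e = "\<lambda>s. \<bar>den N p u s x - lden p s x\<bar>"
    have "\<bar>den N p u s x - dmin N p u x - (lden p s x - ldmin p x)\<bar> \<le> ?e s + \<bar>dmin N p u x - ldmin p x\<bar>" by linarith
    also have "\<dots> \<le> (?e Fine + ?e Coarse) + (?e Fine + ?e Coarse)"
    proof (rule add_mono)
      show "?e s \<le> ?e Fine + ?e Coarse" by (cases s) auto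
      show "\<bar>dmin N p u x - ldmin p x\<bar> \<le> ?e Fine + ?e Coarse" by (auto simp: min_def)
    qed
    finally show ?thesis by (simp only: mult_2)
  qed
qed (auto intro!: integrable_min lden_density(1) Bochner_Integration.integrable_diff)

lemma tensor_L1:
  assumes \<phi>: "\<phi> \<in> bm X" and \<psi>: "\<psi> \<in> bm X"
  shows "L1_conv (\<lambda>N. plaw N p) (\<lambda>N u. \<integral>z. \<phi> (fst z) * \<psi> (snd z) \<partial>ker N p u) (\<integral>z. \<phi> (fst z) * \<psi> (snd z) \<partial>limit_C X G eta0 M L d0 d (Suc p))"
proof -
  let ?f = "\<lambda>z. \<phi> (fst z) * \<psi> (snd z)"
  let ?W = "\<lambda>N u. \<integral>x. dmin N p u x * (\<phi> x * \<psi> x) \<partial>L"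
  let ?c = "\<lambda>N u. \<integral>x. dmin N p u x \<partial>L"
  let ?a = "\<lambda>N u. \<integral>x. (den N p u Fine x - dmin N p u x) * \<phi> x \<partial>L"
  let ?b = "\<lambda>N u. \<integral>x. (den N p u Coarse x - dmin N p u x) * \<psi> x \<partial>L"
  let ?T = "\<lambda>N u. (\<integral>z. ?f z \<partial>ker N p u) - ?W N u"
  let ?cl = "\<integral>x. ldmin p x \<partial>L"
  let ?vl = "(\<integral>x. (lden p Fine x - ldmin p x) * \<phi> x \<partial>L) * (\<integral>x. (lden p Coarse x - ldmin p x) * \<psi> x \<partial>L)"
  have f: "?f \<in> bm Y" by (intro bm_mult bm_compose[OF measurable_fst \<phi>] bm_compose[OF measurable_snd \<psi>])
  obtain B1 where B1: "0 \<le> B1" "\<And>x. x \<in> space X \<Longrightarrow> \<bar>\<phi> x\<bar> \<le> B1" using bmE[OF \<phi>] by blast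
  obtain B2 where B2: "0 \<le> B2" "\<And>x. x \<in> space X \<Longrightarrow> \<bar>\<psi> x\<bar> \<le> B2" using bmE[OF \<psi>] by blast
  obtain B where B: "0 \<le> B" "\<And>z. z \<in> space Y \<Longrightarrow> \<bar>?f z\<bar> \<le> B" using bmE[OF f] by blast
  have W: "L1_conv (\<lambda>N. plaw N p) ?W (\<integral>x. ldmin p x * (\<phi> x * \<psi> x) \<partial>L)" by (rule dmin_L1[OF bm_mult[OF \<phi> \<psi>]])
  obtain B' where B': "\<And>N u. N \<ge> 1 \<Longrightarrow> u \<in> space (plaw N p) \<Longrightarrow> \<bar>?W N u\<bar> \<le> B'" using L1_conv_bounded[OF W] by blast
  have c: "L1_conv (\<lambda>N. plaw N p) ?c ?cl" using dmin_L1[OF bm_const[of 1]] by simp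
  have \<phi>L: "\<phi> \<in> bm L" "\<psi> \<in> bm L" using \<phi> \<psi> bmL by auto
  have res: "\<bar>\<integral>x. (den N p u s x - dmin N p u x) * b x \<partial>L\<bar> \<le> K * (1 - ?c N u)"
    if N: "N \<ge> 1" and u: "u \<in> space (conf N Y)" and b: "b \<in> bm X" and K: "0 \<le> K" "\<And>x. x \<in> space X \<Longrightarrow> \<bar>b x\<bar> \<le> K" for N u s b K
  proof -
    have i: "integrable L (\<lambda>x. den N p u s x - dmin N p u x)" by (intro Bochner_Integration.integrable_diff integrable_min den_density(1)[OF N u])
    have bL: "b \<in> bm L" using b bmL by simp
    have "\<bar>\<integral>x. (den N p u s x - dmin N p u x) * b x \<partial>L\<bar> \<le> (\<integral>x. \<bar>(den N p u s x - dmin N p u x) * b x\<bar> \<partial>L)" by (rule integral_abs_bound)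
    also have "\<dots> \<le> (\<integral>x. K * (den N p u s x - dmin N p u x) \<partial>L)"
    proof (rule integral_mono)
      show "integrable L (\<lambda>x. \<bar>(den N p u s x - dmin N p u x) * b x\<bar>)" by (intro integrable_abs integrable_mult_bm[OF i bL])
      show "integrable L (\<lambda>x. K * (den N p u s x - dmin N p u x))" using i by simp
      fix x assume "x \<in> space L"
      then have "\<bar>b x\<bar> \<le> K" using K sL by simp
      moreover have "0 \<le> den N p u s x - dmin N p u x" by (cases s) auto
      ultimately show "\<bar>(den N p u s x - dmin N p u x) * b x\<bar> \<le> K * (den N p u s x - dmin N p u x)"
        using mult_right_mono[of "\<bar>b x\<bar>" K "den N p u s x - dmin N p u x"] by (simp add: abs_mult mult.commute)
    qed
    also have "\<dots> = K * (1 - ?c N u)"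
    proof -
      have "(\<integral>x. den N p u s x - dmin N p u x \<partial>L) = 1 - ?c N u"
        using den_density(1,3)[OF N u] by (subst Bochner_Integration.integral_diff) (auto intro!: integrable_min)
      then show ?thesis by simp
    qed
    finally show ?thesis .
  qed
  have "L1_conv (\<lambda>N. plaw N p) ?T (if ?cl = 1 then 0 else ?vl / (1 - ?cl))"
  proof (rule law.L1_conv_remainder[OF law.L1_conv_mult[OF dres_L1[OF \<phi>] dres_L1[OF \<psi>]] c, where B="B + B'" and B'="B1 * B2"])
    fix N :: nat assume N: "1 \<le> N"
    show "?T N \<in> borel_measurable (plaw N p)"
      by (intro borel_measurable_diff bm_measurable[OF L1_conv_bm[OF W N]] pi_meas N K_bm f)
    show "\<bar>?T N u\<bar> \<le> B + B'" if "u \<in> space (plaw N p)" for u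
    proof -
      have u: "u \<in> space (conf N Y)" using that pi_space[OF N] by simp
      have "\<bar>\<integral>z. ?f z \<partial>ker N p u\<bar> \<le> B" by (rule K_abs_le[OF N u B(2)])
      then show ?thesis using B'[OF N that] by linarith
    qed
    show "AE u in plaw N p. ?T N u * (1 - ?c N u) = ?a N u * ?b N u \<and> \<bar>?T N u\<bar> \<le> B1 * B2 * \<bar>1 - ?c N u\<bar>"
      using AE_ker[OF N, of p]
    proof eventually_elim
      case (elim u)
      then have u: "u \<in> space (conf N Y)" and ps: "\<And>s. 0 < Gavg N p s u" and k: "ker N p u = step_C N p u" by blast+
      note dd = den_density(1,2,3)[OF N u]
      have e: "(\<integral>z. ?f z \<partial>max_coupling L (den N p u Fine) (den N p u Coarse)) = ?W N u + (if ?c N u = 1 then 0 else ?a N u * ?b N u / (1 - ?c N u))"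
        by (rule max_coupling_tensor[OF L_sf dd dd \<phi>L])
      have T: "?T N u = (if ?c N u = 1 then 0 else ?a N u * ?b N u / (1 - ?c N u))"
        unfolding k step_C_den[OF ps] e by (rule add_diff_cancel_left')
      have c1: "?c N u \<le> 1" using min_integral_le[OF L_sf dd dd, of p Fine p Coarse] .
      have "\<bar>?a N u * ?b N u\<bar> \<le> (B1 * (1 - ?c N u)) * (B2 * (1 - ?c N u))"
        unfolding abs_mult by (intro mult_mono res[OF N u \<phi> B1] res[OF N u \<psi> B2]) (use c1 B1(1) in simp_all)
      then have V: "\<bar>?a N u * ?b N u\<bar> \<le> (B1 * B2) * (1 - ?c N u)\<^sup>2" by (simp add: power2_eq_square mult_ac)
      show ?case unfolding T by (rule remainder_quotient[OF c1 V])
    qed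
  qed
  from law.L1_conv_add[OF this W]
  have "L1_conv (\<lambda>N. plaw N p) (\<lambda>N u. \<integral>z. ?f z \<partial>ker N p u) ((if ?cl = 1 then 0 else ?vl / (1 - ?cl)) + (\<integral>x. ldmin p x * (\<phi> x * \<psi> x) \<partial>L))"
    by simp
  also have "(if ?cl = 1 then 0 else ?vl / (1 - ?cl)) + (\<integral>x. ldmin p x * (\<phi> x * \<psi> x) \<partial>L) = (\<integral>z. ?f z \<partial>limit_C X G eta0 M L d0 d (Suc p))"
    using max_coupling_tensor[OF L_sf lden_density(1,2,3) lden_density(1,2,3) \<phi>L, of p Fine p Coarse] by (simp add: Phi_C_def lden_def)
  finally show ?thesis .
qed

lemma clt:
  assumes \<phi>: "\<phi> \<in> bm X"
  shows "weak_conv_m (\<lambda>N. distr (\<Omega> N) borel (scaled_error X (limit_C X G eta0 M L d0 d) N (U N) n \<phi>))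
    (centred_normal (asymp_variance X G eta0 M (limit_C X G eta0 M L d0 d) n \<phi>))"
  by (rule weak_conv_of_cross[OF tensor_L1 \<phi>])

end

section \<open>The three central limit theorems\<close>

theorem theorem4p1:
  fixes X :: "'a measure"
    and G :: "nat \<Rightarrow> 'a \<Rightarrow> real"
    and eta0 :: "level \<Rightarrow> 'a measure"
    and M :: "level \<Rightarrow> nat \<Rightarrow> 'a \<Rightarrow> 'a measure"
    and etac0 :: "('a \<times> 'a) measure"
    and Mc :: "nat \<Rightarrow> 'a \<times> 'a \<Rightarrow> ('a \<times> 'a) measure"
    and T :: "'a topology"
    and L :: "'a measure"
    and d0 :: "level \<Rightarrow> 'a \<Rightarrow> real"
    and d :: "level \<Rightarrow> nat \<Rightarrow> 'a \<Rightarrow> 'a \<Rightarrow> real"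
    and \<Omega> :: "nat \<Rightarrow> 'w measure"
    and U :: "nat \<Rightarrow> nat \<Rightarrow> nat \<Rightarrow> 'w \<Rightarrow> 'a \<times> 'a"
    and n :: nat
  assumes model: "coupled_feynman_kac X G eta0 M etac0 Mc"
    and gamma_pos: "\<And>s p. 0 < measure (gamma X G eta0 M s p) (space X)"
    and weights_pos: "\<And>N. N \<ge> 1 \<Longrightarrow> positive_weights X G (\<Omega> N) N (U N)"
  shows
    "((\<forall>N\<ge>1. particles_I X G etac0 Mc (\<Omega> N) N (U N)) \<longrightarrow>
      (\<forall>\<phi>. \<phi> \<in> borel_measurable X \<and> bounded (\<phi> ` space X) \<longrightarrow>
        weak_conv_m
          (\<lambda>N. distr (\<Omega> N) borel (scaled_error X (limit_I X G eta0 M etac0 Mc) N (U N) n \<phi>))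
          (centred_normal (asymp_variance X G eta0 M (limit_I X G eta0 M etac0 Mc) n \<phi>))))
    \<and>
     ((\<forall>N\<ge>1. particles_M X G etac0 Mc (\<Omega> N) N (U N)) \<and>
      space X = topspace T \<and> sets X = sigma_sets (topspace T) {V. openin T V} \<and>
      metrizable_space (prod_topology T T) \<and>
      locally_compact_space (prod_topology T T) \<and>
      separable_space (prod_topology T T) \<and>
      (\<forall>k. continuous_map T euclideanreal (G k)) \<and>
      (\<forall>k\<ge>1. feller (prod_topology T T) (Mc k)) \<longrightarrow>
      (\<forall>\<phi>. continuous_map T euclideanreal \<phi> \<and> bounded (\<phi> ` space X) \<longrightarrow>
        weak_conv_m
          (\<lambda>N. distr (\<Omega> N) borel (scaled_error X (limit_M X G etac0 Mc) N (U N) n \<phi>))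
          (centred_normal (asymp_variance X G eta0 M (limit_M X G etac0 Mc) n \<phi>))))
    \<and>
     ((\<forall>N\<ge>1. particles_C X G L d0 d (\<Omega> N) N (U N)) \<and>
      densities X eta0 M L d0 d \<and>
      (\<forall>s. \<forall>k\<ge>1. (\<lambda>(x, y). d s k x y) \<in> borel_measurable (X \<Otimes>\<^sub>M X) \<and>
        bounded ((\<lambda>(x, y). d s k x y) ` space (X \<Otimes>\<^sub>M X))) \<longrightarrow>
      (\<forall>\<phi>. \<phi> \<in> borel_measurable X \<and> bounded (\<phi> ` space X) \<longrightarrow>
        weak_conv_m
          (\<lambda>N. distr (\<Omega> N) borel (scaled_error X (limit_C X G eta0 M L d0 d) N (U N) n \<phi>))
          (centred_normal (asymp_variance X G eta0 M (limit_C X G eta0 M L d0 d) n \<phi>))))"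
proof -
  interpret FK: feynman_kac_pos X G eta0 M etac0 Mc
    by (intro feynman_kac_pos.intro feynman_kac_pos_axioms.intro model gamma_pos)
  show ?thesis
  proof (intro conjI impI allI; (elim conjE)?)
    fix \<phi> :: "'a \<Rightarrow> real"
    assume particles: "\<forall>N\<ge>1. particles_I X G etac0 Mc (\<Omega> N) N (U N)"
      and \<phi>: "\<phi> \<in> borel_measurable X" "bounded (\<phi> ` space X)"
    interpret algorithm_I X G eta0 M etac0 Mc \<Omega> U
    proof unfold_locales
      show "particles_I X G etac0 Mc (\<Omega> N) N (U N)" if "N \<ge> 1" for N using particles that by blast
      show "positive_weights X G (\<Omega> N) N (U N)" if "N \<ge> 1" for N using that by (rule weights_pos)
    qed
    have \<phi>bm: "\<phi> \<in> bm X" using \<phi> by (simp only: bm_def mem_Collect_eq)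
    show "weak_conv_m (\<lambda>N. distr (\<Omega> N) borel (scaled_error X (limit_I X G eta0 M etac0 Mc) N (U N) n \<phi>))
      (centred_normal (asymp_variance X G eta0 M (limit_I X G eta0 M etac0 Mc) n \<phi>))"
      by (rule clt[OF \<phi>bm])
  next
    fix \<phi> :: "'a \<Rightarrow> real"
    assume particles: "\<forall>N\<ge>1. particles_M X G etac0 Mc (\<Omega> N) N (U N)"
      and X: "space X = topspace T" "sets X = sigma_sets (topspace T) {V. openin T V}"
      and \<phi>: "continuous_map T euclideanreal \<phi>" "bounded (\<phi> ` space X)"
    interpret algorithm_M X G eta0 M etac0 Mc \<Omega> U
    proof unfold_locales
      show "particles_M X G etac0 Mc (\<Omega> N) N (U N)" if "N \<ge> 1" for N using particles that by blast
      show "positive_weights X G (\<Omega> N) N (U N)" if "N \<ge> 1" for N using that by (rule weights_pos)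
    qed
    have "\<phi> \<in> borel_measurable X"
    proof (rule borel_measurableI)
      fix S :: "real set" assume "open S"
      then have "openin T {x \<in> topspace T. \<phi> x \<in> S}"
        using \<phi>(1) by (simp add: continuous_map_def)
      moreover have "\<phi> -` S \<inter> space X = {x \<in> topspace T. \<phi> x \<in> S}" using X(1) by auto
      ultimately show "\<phi> -` S \<inter> space X \<in> sets X" unfolding X(2) by (intro sigma_sets.Basic) simp
    qed
    then have \<phi>bm: "\<phi> \<in> bm X" using \<phi>(2) by (simp only: bm_def mem_Collect_eq)
    show "weak_conv_m (\<lambda>N. distr (\<Omega> N) borel (scaled_error X (limit_M X G etac0 Mc) N (U N) n \<phi>))
      (centred_normal (asymp_variance X G eta0 M (limit_M X G etac0 Mc) n \<phi>))"
      by (rule clt[OF \<phi>bm])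
  next
    fix \<phi> :: "'a \<Rightarrow> real"
    assume particles: "\<forall>N\<ge>1. particles_C X G L d0 d (\<Omega> N) N (U N)"
      and dens: "densities X eta0 M L d0 d"
      and bounded_densities: "\<forall>s. \<forall>k\<ge>1. (\<lambda>(x, y). d s k x y) \<in> borel_measurable (X \<Otimes>\<^sub>M X) \<and>
        bounded ((\<lambda>(x, y). d s k x y) ` space (X \<Otimes>\<^sub>M X))"
      and \<phi>: "\<phi> \<in> borel_measurable X" "bounded (\<phi> ` space X)"
    interpret algorithm_C X G eta0 M etac0 Mc L d0 d \<Omega> U
    proof unfold_locales
      show "densities X eta0 M L d0 d" by (rule dens)
      show "(\<lambda>(x, y). d s k x y) \<in> bm (X \<Otimes>\<^sub>M X)" if "k \<ge> 1" for s k
        unfolding bm_def mem_Collect_eq using bounded_densities that by blast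
      show "particles_C X G L d0 d (\<Omega> N) N (U N)" if "N \<ge> 1" for N using particles that by blast
      show "positive_weights X G (\<Omega> N) N (U N)" if "N \<ge> 1" for N using that by (rule weights_pos)
    qed
    have \<phi>bm: "\<phi> \<in> bm X" using \<phi> by (simp only: bm_def mem_Collect_eq)
    show "weak_conv_m (\<lambda>N. distr (\<Omega> N) borel (scaled_error X (limit_C X G eta0 M L d0 d) N (U N) n \<phi>))
      (centred_normal (asymp_variance X G eta0 M (limit_C X G eta0 M L d0 d) n \<phi>))"
      by (rule clt[OF \<phi>bm])
  qed
qed

end
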